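(* Let $K\subset\overline{\mathbb{Q}}$ be a quadratic imaginary field and let $E,E'\subset\overline{\mathbb{Q}}$ be number fields. Let $M$ (resp. $M'$) be a regular motive over $K$ with coefficients in $E$ (resp. $E'$), of rank $n$ (resp. $n'$), pure of weight $\omega(M)$ (resp. $\omega(M')$), with Hodge type $\{(p_i,\omega(M)-p_i)\}_{1\le i\le n}$, $p_1>\dots>p_n$ (resp. $\{(r_j,\omega(M')-r_j)\}_{1\le j\le n'}$, $r_1>\dots>r_{n'}$). Put $\omega=\omega(M)+\omega(M')$ and assume that $M\otimes M'$ has no $(\omega/2,\omega/2)$-class. Let $$A=\{(a,b)\mid p_a+r_b>\tfrac{\omega}{2}\},\qquad T=\{(t,u)\mid p_{n+1-t}+r_{n'+1-u}<\tfrac{\omega}{2}\},$$ subsets of $\{1,\dots,n\}\times\{1,\dots,n'\}$. Then $$c^{+}(R(M\otimes M'))\sim_{EE'}\Big(\prod_{(t,u)\notin T}Q_{n+1-t}(M)Q_{n'+1-u}(M')\Big)\delta(M\otimes M')\sim_{EE'}\Big(\prod_{(t,u)\in A}Q_{t}(M)Q_{u}(M')\Big)\delta(M\otimes M').$$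
   Context: **Relation.** Fix $\overline{\mathbb{Q}}\subset\mathbb{C}$. For a number field $E$ and $A,B\in E\otimes_{\mathbb{Q}}\mathbb{C}$, $A\sim_E B$ means: $A=0$, or $B=0$, or $B\in(E\otimes\mathbb{C})^\times$ and $A/B\in E^\times\subset(E\otimes\mathbb{C})^\times$. $EE'$ is the compositum; elements of $E\otimes\mathbb{C}$ and $E'\otimes\mathbb{C}$ are viewed in $EE'\otimes\mathbb{C}$. **Motives over $K$.** Motives are pure motives for absolute Hodge cycles. A motive $M$ over $K$ with coefficients in $E$ has realizations for each of the two complex embeddings of $K$; those for the fixed embedding are denoted by $M$, those for its complex conjugate by $M^c$. The data used are: $n$-dimensional $E$-vector spaces $M_B,M_{DR}$ and $M^c_B,M^c_{DR}$ ($n$ is the rank); comparison isomorphisms of $E\otimes\mathbb{C}$-modules $I_\infty:M_B\otimes\mathbb{C}\to M_{DR}\otimes\mathbb{C}$ and $I_\infty:M^c_B\otimes\mathbb{C}\to M^c_{DR}\otimes\mathbb{C}$; an $E$-linear isomorphism (infinite Frobenius) $F_\infty:M_B\to M_B^c$, whose inverse $M_B^c\to M_B$ is also written $F_\infty$, extended $\mathbb{C}$-linearly; Hodge decompositions of $M_B\otimes\mathbb{C}$ and $M_B^c\otimes\mathbb{C}$ into free $E\otimes\mathbb{C}$-modules $M^{p,q}$, $(M^c)^{p,q}$ with $F_\infty(M^{p,q})=(M^c)^{q,p}$; decreasing $E$-rational Hodge filtrations on $M_{DR}$, $M_{DR}^c$ (with steps $M^{i}$, etc.) such that $I_\infty(\bigoplus_{p\ge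 i}M^{p,q})=M^i\otimes\mathbb{C}$, and likewise for $M^c$. $M$ is pure of weight $\omega(M)$ if $M^{p,q}=0$ for $p+q\ne\omega(M)$, and regular if each $M^{p,q}$ has rank $\le 1$ over $E\otimes\mathbb{C}$. If $M$ is regular and pure with Hodge type (set of $(p,q)$ with $M^{p,q}\neq 0$) $\{(p_i,\omega(M)-p_i)\}$, $p_1>\dots>p_n$, then $M^c$ has Hodge type $\{(p_i^c,\omega(M)-p_i^c)\}$ with $p^c_i=\omega(M)-p_{n+1-i}$; similarly for $M'$ with $r^c_j=\omega(M')-r_{n'+1-j}$. (So $T=\{(t,u)\mid p_t^c+r_u^c>\omega/2\}$.) **Periods.** The determinant period $\delta(M)\in(E\otimes\mathbb{C})^\times$ is the determinant of $I_\infty:M_B\otimes\mathbb{C}\to M_{DR}\otimes\mathbb{C}$ with respect to $E$-bases of $M_B$ and $M_{DR}$ (well defined modulo $E^\times$); $\delta(M\otimes M')$ is defined in the same way with coefficient field $EE'$. For each $i$, $I_\infty$ induces $M^{p_i,q_i}\cong (M^{p_i}\otimes\mathbb{C})/(M^{p_{i-1}}\otimes\mathbb{C})$ (with $q_i=\omega(M)-p_i$, $M^{p_0}:=0$); let $\omega_i\in M^{p_i,q_i}$ be a nonzero element whose image lies in the image of $M^{p_i}$. Define $\omega_i^c\in(M^c)^{p_i^c,q_i^c}$ similarly for $M^c$. The motivic periods $Q_i(M)\in(E\otimes\mathbb{C})^\times$, $1\le i\le n$ (well defined modulo $E^\times$), are defined by $F_\infty\omega_i=Q_i(M)\,\omega^c_{n+1-i}$.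 The periods $Q_j(M')$, $1\le j\le n'$, are defined in the same way for $M'$. **Tensor product.** $M\otimes M'$ has coefficients in $EE'$ (all tensor products of realizations are taken after extending coefficients to $EE'$, over $EE'$). $M^{\#}=R(M\otimes M')$, the restriction of $M\otimes M'$ from $K$ to $\mathbb{Q}$, is the motive over $\mathbb{Q}$ with coefficients in $EE'$, pure of weight $\omega$, with Betti realization $M_B\otimes M'_B\oplus M^c_B\otimes M'^c_B$, de Rham realization $M_{DR}\otimes M'_{DR}\oplus M^c_{DR}\otimes M'^c_{DR}$, direct-sum comparison isomorphism, Hodge decomposition and filtration, and involution $F_\infty$ on $M^{\#}_B$ exchanging the two summands via $F_\infty\otimes F_\infty$. "No $(\omega/2,\omega/2)$-class" means $p_a+r_b\ne\omega/2$ for all $a,b$. **Deligne period.** Let $(M^{\#}_B)^+$ be the subspace fixed by $F_\infty$, and $F^+(M^{\#})\subset M^{\#}_{DR}$ the step of the Hodge filtration with $I_\infty^{-1}(F^+(M^{\#})\otimes\mathbb{C})=\bigoplus_{p>q}(M^{\#})^{p,q}$. Then $c^+(M^{\#})\in(EE'\otimes\mathbb{C})^\times$ is the determinant of the isomorphism $(M^{\#}_B)^+\otimes\mathbb{C}\hookrightarrow M^{\#}_B\otimes\mathbb{C}\xrightarrow{I_\infty}M^{\#}_{DR}\otimes\mathbb{C}\to(M^{\#}_{DR}/F^+(M^{\#}))\otimes\mathbb{C}$ with respect to $EE'$-bases of $(M^{\#}_B)^+$ and $M^{\#}_{DR}/F^+(M^{\#})$ (well defined modulo $(EE')^\times$).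 *)

theory Defs
  imports
    Complex_Main
    "HOL-Combinatorics.Permutations"
    "HOL-Algebra.Free_Abelian_Groups"
    "HOL-Algebra.Embedded_Algebras"
    "HOL-Algebra.Generated_Fields"
begin

section \<open>Fields inside the complex numbers\<close>

text \<open>
  A subring of \<open>\<complex>\<close> as a HOL-Algebra structure.  The extra \<open>smult\<close> field makes the same record
  usable as a module over any of its subrings.
\<close>

definition scalars :: "complex set \<Rightarrow> (complex, complex) module" where
  "scalars S = \<lparr>carrier = S, mult = (*), one = 1, zero = 0, add = (+), smult = (*)\<rparr>"

abbreviation CC :: "(complex, complex) module" where
  "CC \<equiv> scalars UNIV"

text \<open>Being finite over \<open>\<rat>\<close>, a number field automatically consists of algebraic numbers.\<close>

definition number_field :: "complex set \<Rightarrow> bool" where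
  "number_field E \<longleftrightarrow> subfield E CC \<and> ring.finite_dimension CC \<rat> E"

definition imaginary_quadratic_field :: "complex set \<Rightarrow> bool" where
  "imaginary_quadratic_field K \<longleftrightarrow>
     number_field K \<and> ring.dimension CC 2 \<rat> K \<and> \<not> K \<subseteq> \<real>"

definition compositum :: "complex set \<Rightarrow> complex set \<Rightarrow> complex set" where
  "compositum E E' = generate_field CC (E \<union> E')"


section \<open>Linear algebra over commutative rings\<close>

definition is_basis :: "('r, 'm) ring_scheme \<Rightarrow> ('r, 'a, 'n) module_scheme \<Rightarrow> 'a list \<Rightarrow> bool" where
  "is_basis R M bs \<longleftrightarrow>
     set bs \<subseteq> carrier M \<and>
     (\<forall>x\<in>carrier M. \<exists>!c. c \<in> {..<length bs} \<rightarrow>\<^sub>E carrier R \<and>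
        x = (\<Oplus>\<^bsub>M\<^esub>i\<in>{..<length bs}. c i \<odot>\<^bsub>M\<^esub> bs ! i))"

definition free_of_rank :: "('r, 'm) ring_scheme \<Rightarrow> ('r, 'a, 'n) module_scheme \<Rightarrow> nat \<Rightarrow> bool" where
  "free_of_rank R M n \<longleftrightarrow> (\<exists>bs. is_basis R M bs \<and> length bs = n)"

definition linear_iso ::
  "('r, 'm) ring_scheme \<Rightarrow> ('r, 'a, 'n) module_scheme \<Rightarrow> ('r, 'b, 'k) module_scheme \<Rightarrow>
     ('a \<Rightarrow> 'b) \<Rightarrow> bool" where
  "linear_iso R M N f \<longleftrightarrow>
     bij_betw f (carrier M) (carrier N) \<and>
     (\<forall>x\<in>carrier M. \<forall>y\<in>carrier M. f (x \<oplus>\<^bsub>M\<^esub> y) = f x \<oplus>\<^bsub>N\<^esub> f y) \<and>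
     (\<forall>r\<in>carrier R. \<forall>x\<in>carrier M. f (r \<odot>\<^bsub>M\<^esub> x) = r \<odot>\<^bsub>N\<^esub> f x)"

definition mod_span :: "('r, 'm) ring_scheme \<Rightarrow> ('r, 'a, 'n) module_scheme \<Rightarrow> 'a set \<Rightarrow> 'a set" where
  "mod_span R M X = (\<lambda>H. submodule H R M) hull X"

text \<open>Internal direct sum \<open>M = \<Oplus>\<^sub>i H i\<close> with only finitely many nonzero summands.\<close>

definition direct_sum_decomposition ::
  "('r, 'm) ring_scheme \<Rightarrow> ('r, 'a, 'n) module_scheme \<Rightarrow> ('i \<Rightarrow> 'a set) \<Rightarrow> bool" where
  "direct_sum_decomposition R M H \<longleftrightarrow>
     (\<forall>i. submodule (H i) R M) \<and>
     finite {i. H i \<noteq> {\<zero>\<^bsub>M\<^esub>}} \<and>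
     (\<forall>x\<in>carrier M. \<exists>!f. (\<forall>i. f i \<in> H i) \<and> x = (\<Oplus>\<^bsub>M\<^esub>i\<in>{i. H i \<noteq> {\<zero>\<^bsub>M\<^esub>}}. f i))"

definition quotient_module :: "('r, 'a) module \<Rightarrow> 'a set \<Rightarrow> ('r, 'a set) module" where
  "quotient_module M U =
     \<lparr>carrier = a_rcosets\<^bsub>M\<^esub> U, mult = undefined, one = undefined,
      zero = U, add = set_add M,
      smult = (\<lambda>r X. \<Union>x\<in>X. U +>\<^bsub>M\<^esub> (r \<odot>\<^bsub>M\<^esub> x))\<rparr>"

definition direct_sum_module :: "('r, 'a) module \<Rightarrow> ('r, 'b) module \<Rightarrow> ('r, 'a \<times> 'b) module" where
  "direct_sum_module M N =
     \<lparr>carrier = carrier M \<times> carrier N, mult = undefined, one = undefined,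
      zero = (\<zero>\<^bsub>M\<^esub>, \<zero>\<^bsub>N\<^esub>),
      add = (\<lambda>x y. (fst x \<oplus>\<^bsub>M\<^esub> fst y, snd x \<oplus>\<^bsub>N\<^esub> snd y)),
      smult = (\<lambda>r x. (r \<odot>\<^bsub>M\<^esub> fst x, r \<odot>\<^bsub>N\<^esub> snd x))\<rparr>"

definition ring_det :: "('r, 'm) ring_scheme \<Rightarrow> nat \<Rightarrow> (nat \<Rightarrow> nat \<Rightarrow> 'r) \<Rightarrow> 'r" where
  "ring_det R n A =
     (\<Oplus>\<^bsub>R\<^esub>\<sigma>\<in>{\<sigma>. \<sigma> permutes {..<n}}. [sign \<sigma>] \<cdot>\<^bsub>R\<^esub> (\<Otimes>\<^bsub>R\<^esub>i\<in>{..<n}. A i (\<sigma> i)))"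


section \<open>Tensor products\<close>

text \<open>
  \<open>V \<otimes>\<^sub>K W\<close> is the free abelian group on \<open>V \<times> W\<close> modulo the subgroup generated by the usual relations;
  its elements are cosets.  Here \<open>K\<close> is only a set of scalars: \<open>V\<close> and \<open>W\<close> may carry actions of larger
  rings.
\<close>

type_synonym ('a, 'b) tensor = "('a \<times> 'b \<Rightarrow>\<^sub>0 int) set"

definition tensor_relations ::
  "'k set \<Rightarrow> ('k, 'a) module \<Rightarrow> ('k, 'b) module \<Rightarrow> ('a \<times> 'b \<Rightarrow>\<^sub>0 int) set" where
  "tensor_relations K V W =
     generate (free_Abelian_group (carrier V \<times> carrier W))
       ({frag_of (v \<oplus>\<^bsub>V\<^esub> v', w) - frag_of (v, w) - frag_of (v', w) |v v' w.
           v \<in> carrier V \<and> v' \<in> carrier V \<and> w \<in> carrier W} \<union>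
        {frag_of (v, w \<oplus>\<^bsub>W\<^esub> w') - frag_of (v, w) - frag_of (v, w') |v w w'.
           v \<in> carrier V \<and> w \<in> carrier W \<and> w' \<in> carrier W} \<union>
        {frag_of (k \<odot>\<^bsub>V\<^esub> v, w) - frag_of (v, k \<odot>\<^bsub>W\<^esub> w) |k v w.
           k \<in> K \<and> v \<in> carrier V \<and> w \<in> carrier W})"

definition tensor_group ::
  "'k set \<Rightarrow> ('k, 'a) module \<Rightarrow> ('k, 'b) module \<Rightarrow> ('a, 'b) tensor ring" where
  "tensor_group K V W =
     (let G = free_Abelian_group (carrier V \<times> carrier W) Mod tensor_relations K V W
      in \<lparr>carrier = carrier G, mult = undefined, one = undefined,
          zero = \<one>\<^bsub>G\<^esub>, add = mult G\<rparr>)"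

definition pure_tensor ::
  "'k set \<Rightarrow> ('k, 'a) module \<Rightarrow> ('k, 'b) module \<Rightarrow> 'a \<Rightarrow> 'b \<Rightarrow> ('a, 'b) tensor" where
  "pure_tensor K V W v w =
     tensor_relations K V W #>\<^bsub>free_Abelian_group (carrier V \<times> carrier W)\<^esub> frag_of (v, w)"

text \<open>
  The additive map \<open>V \<otimes>\<^sub>K W \<rightarrow> P\<close> with \<open>v \<otimes> w \<mapsto> f v w\<close>.  It is computed on a representative of the
  coset, and does not depend on it when \<open>f\<close> is biadditive and \<open>K\<close>-balanced.
\<close>

definition tensor_lift ::
  "('p, 'm) ring_scheme \<Rightarrow> ('a \<Rightarrow> 'b \<Rightarrow> 'p) \<Rightarrow> ('a, 'b) tensor \<Rightarrow> 'p" where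
  "tensor_lift P f X =
     (let x = (SOME x. x \<in> X)
      in \<Oplus>\<^bsub>P\<^esub>k\<in>Poly_Mapping.keys x. [Poly_Mapping.lookup x k] \<cdot>\<^bsub>P\<^esub> f (fst k) (snd k))"

text \<open>
  \<open>V \<otimes>\<^sub>K W\<close> with scalars acting on the left factor, so that \<open>tensor_module E (scalars L) V\<close> below is
  used in the form \<open>L \<otimes>\<^sub>E V\<close> as an \<open>L\<close>-module.
\<close>

definition tensor_module ::
  "'k set \<Rightarrow> ('k, 'a) module \<Rightarrow> ('k, 'b) module \<Rightarrow> ('k, ('a, 'b) tensor) module" where
  "tensor_module K V W =
     (let G = tensor_group K V W
      in \<lparr>carrier = carrier G, mult = undefined, one = undefined, zero = \<zero>\<^bsub>G\<^esub>, add = add G,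
          smult = (\<lambda>k. tensor_lift G (\<lambda>v w. pure_tensor K V W (k \<odot>\<^bsub>V\<^esub> v) w))\<rparr>)"


section \<open>Complexification\<close>

text \<open>
  For an \<open>E\<close>-vector space \<open>V\<close>, \<open>complexify V\<close> is \<open>V \<otimes>\<^sub>\<rat> \<complex>\<close> with the action
  \<open>(e \<otimes> z) (v \<otimes> z') = e v \<otimes> z z'\<close> of \<open>E \<otimes>\<^sub>\<rat> \<complex>\<close>, and \<open>coeff_ring E\<close> is the ring \<open>E \<otimes>\<^sub>\<rat> \<complex>\<close> itself.
\<close>

definition ctensor :: "(complex, 'v) module \<Rightarrow> 'v \<Rightarrow> complex \<Rightarrow> ('v, complex) tensor" where
  "ctensor V v z = pure_tensor \<rat> V CC v z"

definition complexify ::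
  "(complex, 'v) module \<Rightarrow> ((complex, complex) tensor, ('v, complex) tensor) module" where
  "complexify V =
     (let G = tensor_group \<rat> V CC
      in \<lparr>carrier = carrier G, mult = undefined, one = undefined, zero = \<zero>\<^bsub>G\<^esub>, add = add G,
          smult = (\<lambda>r x.
            tensor_lift G (\<lambda>e z.
              tensor_lift G (\<lambda>v z'. ctensor V (e \<odot>\<^bsub>V\<^esub> v) (z * z')) x) r)\<rparr>)"

definition coeff_ring :: "complex set \<Rightarrow> (complex, complex) tensor ring" where
  "coeff_ring E =
     (let C = complexify (scalars E)
      in \<lparr>carrier = carrier C, mult = smult C, one = ctensor (scalars E) 1 1,
          zero = \<zero>\<^bsub>C\<^esub>, add = add C\<rparr>)"

text \<open>\<open>f \<otimes> id : V \<otimes> \<complex> \<rightarrow> W \<otimes> \<complex>\<close> for an additive map \<open>f : V \<rightarrow> W\<close>.\<close>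

definition complexify_map ::
  "(complex, 'w) module \<Rightarrow> ('v \<Rightarrow> 'w) \<Rightarrow> ('v, complex) tensor \<Rightarrow> ('w, complex) tensor" where
  "complexify_map W f = tensor_lift (complexify W) (\<lambda>v z. ctensor W (f v) z)"

text \<open>\<open>U \<otimes> \<complex>\<close> as a submodule of \<open>V \<otimes> \<complex>\<close>, for a subspace \<open>U\<close> of \<open>V\<close>.\<close>

definition complexify_sub :: "(complex, 'v) module \<Rightarrow> 'v set \<Rightarrow> ('v, complex) tensor set" where
  "complexify_sub V U =
     complexify_map V id ` carrier (complexify (V\<lparr>carrier := U\<rparr>))"

text \<open>
  The canonical map from \<open>E \<otimes> \<complex>\<close> to \<open>L \<otimes> \<complex>\<close> for \<open>E \<subseteq> L\<close>; it is injective because \<open>\<rat>\<close> is a field.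
\<close>

definition extend_coeff :: "complex set \<Rightarrow> (complex, complex) tensor \<Rightarrow> (complex, complex) tensor" where
  "extend_coeff L = complexify_map (scalars L) id"

text \<open>The multiplication \<open>(V \<otimes> \<complex>) \<times> (W \<otimes> \<complex>) \<rightarrow> (V \<otimes>\<^sub>L W) \<otimes> \<complex>\<close>.\<close>

definition complexify_mult ::
  "complex set \<Rightarrow> (complex, 'v) module \<Rightarrow> (complex, 'w) module \<Rightarrow>
     ('v, complex) tensor \<Rightarrow> ('w, complex) tensor \<Rightarrow> (('v, 'w) tensor, complex) tensor" where
  "complexify_mult L V W x y =
     (let T = tensor_module L V W
      in tensor_lift (complexify T) (\<lambda>v z.
           tensor_lift (complexify T) (\<lambda>w z'.
             ctensor T (pure_tensor L V W v w) (z * z')) y) x)"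

definition period_equiv ::
  "complex set \<Rightarrow> (complex, complex) tensor \<Rightarrow> (complex, complex) tensor \<Rightarrow> bool" where
  "period_equiv E A B \<longleftrightarrow>
     A = \<zero>\<^bsub>coeff_ring E\<^esub> \<or> B = \<zero>\<^bsub>coeff_ring E\<^esub> \<or>
     (B \<in> Units (coeff_ring E) \<and>
      (\<exists>e\<in>E - {0}. A \<otimes>\<^bsub>coeff_ring E\<^esub> inv\<^bsub>coeff_ring E\<^esub> B = ctensor (scalars E) e 1))"

text \<open>
  \<open>d\<close> is the determinant of the map \<open>\<phi> : V \<otimes> \<complex> \<rightarrow> W \<otimes> \<complex>\<close> with respect to some pair of
  \<open>L\<close>-bases of \<open>V\<close> and \<open>W\<close>.
\<close>

definition is_determinant ::
  "complex set \<Rightarrow> (complex, 'v) module \<Rightarrow> (complex, 'w) module \<Rightarrow>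
     (('v, complex) tensor \<Rightarrow> ('w, complex) tensor) \<Rightarrow> (complex, complex) tensor \<Rightarrow> bool" where
  "is_determinant L V W \<phi> d \<longleftrightarrow>
     (\<exists>bs cs A.
        is_basis (scalars L) V bs \<and> is_basis (scalars L) W cs \<and> length bs = length cs \<and>
        (\<forall>i<length cs. \<forall>j<length bs. A i j \<in> carrier (coeff_ring L)) \<and>
        (\<forall>j<length bs. \<phi> (ctensor V (bs ! j) 1) =
           (\<Oplus>\<^bsub>complexify W\<^esub>i\<in>{..<length cs}. A i j \<odot>\<^bsub>complexify W\<^esub> ctensor W (cs ! i) 1)) \<and>
        d = ring_det (coeff_ring L) (length bs) A)"


section \<open>Realizations of motives\<close>

text \<open>
  The data attached to a motive and one complex embedding of its base field: \<open>M\<^sub>B\<close>, \<open>M\<^sub>D\<^sub>R\<close>, the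
  comparison isomorphism \<open>I\<^sub>\<infinity>\<close>, the Hodge components \<open>M\<^sup>p\<^sup>,\<^sup>q\<close> of \<open>M\<^sub>B \<otimes> \<complex>\<close> and the Hodge filtration
  on \<open>M\<^sub>D\<^sub>R\<close>.
\<close>

record ('b, 'd) realization =
  betti :: "(complex, 'b) module"
  derham :: "(complex, 'd) module"
  compar :: "('b, complex) tensor \<Rightarrow> ('d, complex) tensor"
  hodge :: "int \<Rightarrow> int \<Rightarrow> ('b, complex) tensor set"
  hodge_filt :: "int \<Rightarrow> 'd set"

definition hodge_sum ::
  "complex set \<Rightarrow> ('b, 'd, 'm) realization_scheme \<Rightarrow> (int \<times> int) set \<Rightarrow> ('b, complex) tensor set" where
  "hodge_sum E N P =
     mod_span (coeff_ring E) (complexify (betti N)) (\<Union>(p, q)\<in>P. hodge N p q)"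

definition realization_with_coeffs ::
  "complex set \<Rightarrow> nat \<Rightarrow> ('b, 'd, 'm) realization_scheme \<Rightarrow> bool" where
  "realization_with_coeffs E n N \<longleftrightarrow>
     module (scalars E) (betti N) \<and> free_of_rank (scalars E) (betti N) n \<and>
     module (scalars E) (derham N) \<and> free_of_rank (scalars E) (derham N) n \<and>
     linear_iso (coeff_ring E) (complexify (betti N)) (complexify (derham N)) (compar N) \<and>
     direct_sum_decomposition (coeff_ring E) (complexify (betti N)) (\<lambda>(p, q). hodge N p q) \<and>
     (\<forall>p q. \<exists>r. free_of_rank (coeff_ring E) ((complexify (betti N))\<lparr>carrier := hodge N p q\<rparr>) r) \<and>
     (\<forall>i. submodule (hodge_filt N i) (scalars E) (derham N)) \<and>
     antimono (hodge_filt N) \<and>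
     (\<forall>i. compar N ` hodge_sum E N {(p, q). p \<ge> i} =
          complexify_sub (derham N) (hodge_filt N i))"

text \<open>
  A motive over an imaginary quadratic field: its realizations for the fixed embedding and for the
  complex conjugate one, and \<open>F\<^sub>\<infinity> : M\<^sub>B \<rightarrow> M\<^sup>c\<^sub>B\<close>.
\<close>

record ('b, 'd) motive =
  at_id :: "('b, 'd) realization"
  at_conj :: "('b, 'd) realization"
  frob :: "'b \<Rightarrow> 'b"

definition motive_with_coeffs :: "complex set \<Rightarrow> nat \<Rightarrow> ('b, 'd) motive \<Rightarrow> bool" where
  "motive_with_coeffs E n M \<longleftrightarrow>
     realization_with_coeffs E n (at_id M) \<and> realization_with_coeffs E n (at_conj M) \<and>
     linear_iso (scalars E) (betti (at_id M)) (betti (at_conj M)) (frob M) \<and>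
     (\<forall>p q. complexify_map (betti (at_conj M)) (frob M) ` hodge (at_id M) p q =
            hodge (at_conj M) q p)"

definition pure_of_weight :: "('b, 'd) motive \<Rightarrow> int \<Rightarrow> bool" where
  "pure_of_weight M w \<longleftrightarrow>
     (\<forall>p q. p + q \<noteq> w \<longrightarrow> hodge (at_id M) p q = {\<zero>\<^bsub>complexify (betti (at_id M))\<^esub>})"

definition regular :: "complex set \<Rightarrow> ('b, 'd) motive \<Rightarrow> bool" where
  "regular E M \<longleftrightarrow>
     (\<forall>p q. \<exists>r\<le>1. free_of_rank (coeff_ring E)
        ((complexify (betti (at_id M)))\<lparr>carrier := hodge (at_id M) p q\<rparr>) r)"

definition hodge_type :: "('b, 'd) motive \<Rightarrow> (int \<times> int) set" where
  "hodge_type M =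
     {(p, q). hodge (at_id M) p q \<noteq> {\<zero>\<^bsub>complexify (betti (at_id M))\<^esub>}}"


section \<open>Periods of a regular motive\<close>

definition is_determinant_period ::
  "complex set \<Rightarrow> ('b, 'd, 'm) realization_scheme \<Rightarrow> (complex, complex) tensor \<Rightarrow> bool" where
  "is_determinant_period E N d \<longleftrightarrow> is_determinant E (betti N) (derham N) (compar N) d"

text \<open>
  \<open>\<omega>\<close> is a nonzero element of \<open>N\<^sup>p\<^sup>,\<^sup>w\<^sup>-\<^sup>p\<close>, \<open>p = p i\<close>, whose class in
  \<open>(N\<^sup>p\<^sup>(\<^sup>i\<^sup>) \<otimes> \<complex>) / (N\<^sup>p\<^sup>(\<^sup>i\<^sup>-\<^sup>1\<^sup>) \<otimes> \<complex>)\<close> is the class of an element of \<open>N\<^sup>p\<^sup>(\<^sup>i\<^sup>)\<close>; the step before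
  the first one is \<open>0\<close>.
\<close>

definition rational_hodge_class ::
  "('b, 'd) realization \<Rightarrow> int \<Rightarrow> (nat \<Rightarrow> int) \<Rightarrow> nat \<Rightarrow> ('b, complex) tensor \<Rightarrow> bool" where
  "rational_hodge_class N w p i \<omega> \<longleftrightarrow>
     \<omega> \<in> hodge N (p i) (w - p i) \<and> \<omega> \<noteq> \<zero>\<^bsub>complexify (betti N)\<^esub> \<and>
     (\<exists>x\<in>hodge_filt N (p i).
        compar N \<omega> \<ominus>\<^bsub>complexify (derham N)\<^esub> ctensor (derham N) x 1 \<in>
          complexify_sub (derham N)
            (if i = 1 then {\<zero>\<^bsub>derham N\<^esub>} else hodge_filt N (p (i - 1))))"

text \<open>
  \<open>Q\<close> is a value of the period \<open>Q\<^sub>i(M)\<close>, for \<open>M\<close> of weight \<open>w\<close> and Hodge type \<open>(p i, w - p i)\<close>.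
  The Hodge type of \<open>M\<^sup>c\<close> is enumerated in decreasing order by \<open>p\<^sup>c j = w - p (n + 1 - j)\<close>.
\<close>

definition is_motivic_period ::
  "complex set \<Rightarrow> ('b, 'd) motive \<Rightarrow> nat \<Rightarrow> int \<Rightarrow> (nat \<Rightarrow> int) \<Rightarrow> nat \<Rightarrow>
     (complex, complex) tensor \<Rightarrow> bool" where
  "is_motivic_period E M n w p i Q \<longleftrightarrow>
     Q \<in> Units (coeff_ring E) \<and>
     (\<exists>\<omega> \<omega>c.
        rational_hodge_class (at_id M) w p i \<omega> \<and>
        rational_hodge_class (at_conj M) w (\<lambda>j. w - p (n + 1 - j)) (n + 1 - i) \<omega>c \<and>
        complexify_map (betti (at_conj M)) (frob M) \<omega> =
          Q \<odot>\<^bsub>complexify (betti (at_conj M))\<^esub> \<omega>c)"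


section \<open>Extension of coefficients and tensor product\<close>

definition extend_module ::
  "complex set \<Rightarrow> complex set \<Rightarrow> (complex, 'v) module \<Rightarrow> (complex, (complex, 'v) tensor) module" where
  "extend_module E L V = tensor_module E (scalars L) V"

definition extend_vector ::
  "complex set \<Rightarrow> complex set \<Rightarrow> (complex, 'v) module \<Rightarrow> 'v \<Rightarrow> (complex, 'v) tensor" where
  "extend_vector E L V v = pure_tensor E (scalars L) V 1 v"

text \<open>The canonical map \<open>V \<otimes> \<complex> \<rightarrow> (L \<otimes>\<^sub>E V) \<otimes> \<complex>\<close>.\<close>

definition extend_complexified ::
  "complex set \<Rightarrow> complex set \<Rightarrow> (complex, 'v) module \<Rightarrow>
     ('v, complex) tensor \<Rightarrow> ((complex, 'v) tensor, complex) tensor" where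
  "extend_complexified E L V = complexify_map (extend_module E L V) (extend_vector E L V)"

text \<open>
  The comparison map of the extended realization is the \<open>L \<otimes> \<complex>\<close>-linear extension of \<open>I\<^sub>\<infinity>\<close>:
  \<open>(l \<otimes> v) \<otimes> z \<mapsto> (l \<otimes> z) I\<^sub>\<infinity>(v \<otimes> 1)\<close>.
\<close>

definition extend_realization ::
  "complex set \<Rightarrow> complex set \<Rightarrow> ('b, 'd) realization \<Rightarrow>
     ((complex, 'b) tensor, (complex, 'd) tensor) realization" where
  "extend_realization E L N =
     (let B = extend_module E L (betti N);
          D = extend_module E L (derham N)
      in \<lparr>betti = B, derham = D,
          compar =
            tensor_lift (complexify D) (\<lambda>x z.
              tensor_lift (complexify D) (\<lambda>l v.
                ctensor (scalars L) l z \<odot>\<^bsub>complexify D\<^esub>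
                  extend_complexified E L (derham N) (compar N (ctensor (betti N) v 1))) x),
          hodge = (\<lambda>p q. mod_span (coeff_ring L) (complexify B)
                     (extend_complexified E L (betti N) ` hodge N p q)),
          hodge_filt = (\<lambda>i. mod_span (scalars L) D
                     (extend_vector E L (derham N) ` hodge_filt N i))\<rparr>)"

definition extend_motive ::
  "complex set \<Rightarrow> complex set \<Rightarrow> ('b, 'd) motive \<Rightarrow>
     ((complex, 'b) tensor, (complex, 'd) tensor) motive" where
  "extend_motive E L M =
     \<lparr>at_id = extend_realization E L (at_id M),
      at_conj = extend_realization E L (at_conj M),
      frob = tensor_lift (extend_module E L (betti (at_conj M)))
               (\<lambda>l v. pure_tensor E (scalars L) (betti (at_conj M)) l (frob M v))\<rparr>"

text \<open>
  Tensor product over a common coefficient field \<open>L\<close>; its comparison map is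
  \<open>(v \<otimes> v') \<otimes> z \<mapsto> z I\<^sub>\<infinity>(v \<otimes> 1) I\<^sub>\<infinity>(v' \<otimes> 1)\<close>, and the Hodge components and filtration steps
  are the sums of the tensor products of those of the factors whose indices add up correctly.
\<close>

definition tensor_realization ::
  "complex set \<Rightarrow> ('b, 'd) realization \<Rightarrow> ('b2, 'd2) realization \<Rightarrow>
     (('b, 'b2) tensor, ('d, 'd2) tensor) realization" where
  "tensor_realization L N N' =
     (let B = tensor_module L (betti N) (betti N');
          D = tensor_module L (derham N) (derham N')
      in \<lparr>betti = B, derham = D,
          compar =
            tensor_lift (complexify D) (\<lambda>x z.
              tensor_lift (complexify D) (\<lambda>v v'.
                ctensor (scalars L) 1 z \<odot>\<^bsub>complexify D\<^esub>
                  complexify_mult L (derham N) (derham N')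
                    (compar N (ctensor (betti N) v 1))
                    (compar N' (ctensor (betti N') v' 1))) x),
          hodge = (\<lambda>p q. mod_span (coeff_ring L) (complexify B)
                     {complexify_mult L (betti N) (betti N') x y |x y.
                        \<exists>a b c d. a + c = p \<and> b + d = q \<and> x \<in> hodge N a b \<and> y \<in> hodge N' c d}),
          hodge_filt = (\<lambda>k. mod_span (scalars L) D
                     {pure_tensor L (derham N) (derham N') x y |x y.
                        \<exists>i j. i + j = k \<and> x \<in> hodge_filt N i \<and> y \<in> hodge_filt N' j})\<rparr>)"

definition tensor_motive_over ::
  "complex set \<Rightarrow> ('b, 'd) motive \<Rightarrow> ('b2, 'd2) motive \<Rightarrow>
     (('b, 'b2) tensor, ('d, 'd2) tensor) motive" where
  "tensor_motive_over L M M' =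
     \<lparr>at_id = tensor_realization L (at_id M) (at_id M'),
      at_conj = tensor_realization L (at_conj M) (at_conj M'),
      frob = tensor_lift (tensor_module L (betti (at_conj M)) (betti (at_conj M')))
               (\<lambda>v v'. pure_tensor L (betti (at_conj M)) (betti (at_conj M')) (frob M v) (frob M' v'))\<rparr>"

definition tensor_motive ::
  "complex set \<Rightarrow> complex set \<Rightarrow> ('b, 'd) motive \<Rightarrow> ('b2, 'd2) motive \<Rightarrow>
     (((complex, 'b) tensor, (complex, 'b2) tensor) tensor,
      ((complex, 'd) tensor, (complex, 'd2) tensor) tensor) motive" where
  "tensor_motive E E' M M' =
     (let L = compositum E E'
      in tensor_motive_over L (extend_motive E L M) (extend_motive E' L M'))"


section \<open>Restriction to the rationals and the Deligne period\<close>

record ('b, 'd) rat_motive = "('b, 'd) realization" +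
  involution :: "'b \<Rightarrow> 'b"

definition restrict_to_rat :: "('b, 'd) motive \<Rightarrow> ('b \<times> 'b, 'd \<times> 'd) rat_motive" where
  "restrict_to_rat M =
     (let N = at_id M; N' = at_conj M;
          B = direct_sum_module (betti N) (betti N');
          D = direct_sum_module (derham N) (derham N')
      in \<lparr>betti = B, derham = D,
          compar = (\<lambda>X.
            complexify_map D (\<lambda>x. (x, \<zero>\<^bsub>derham N'\<^esub>)) (compar N (complexify_map (betti N) fst X))
              \<oplus>\<^bsub>complexify D\<^esub>
            complexify_map D (\<lambda>y. (\<zero>\<^bsub>derham N\<^esub>, y)) (compar N' (complexify_map (betti N') snd X))),
          hodge = (\<lambda>p q.
            {complexify_map B (\<lambda>x. (x, \<zero>\<^bsub>betti N'\<^esub>)) x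
               \<oplus>\<^bsub>complexify B\<^esub>
             complexify_map B (\<lambda>y. (\<zero>\<^bsub>betti N\<^esub>, y)) y |x y. x \<in> hodge N p q \<and> y \<in> hodge N' p q}),
          hodge_filt = (\<lambda>i. hodge_filt N i \<times> hodge_filt N' i),
          involution = (\<lambda>(x, y). (inv_into (carrier (betti N)) (frob M) y, frob M x))\<rparr>)"

definition betti_plus :: "('b, 'd) rat_motive \<Rightarrow> (complex, 'b) module" where
  "betti_plus N = (betti N)\<lparr>carrier := {x \<in> carrier (betti N). involution N x = x}\<rparr>"

definition is_F_plus :: "complex set \<Rightarrow> ('b, 'd) rat_motive \<Rightarrow> 'd set \<Rightarrow> bool" where
  "is_F_plus E N F \<longleftrightarrow>
     (\<exists>k. F = hodge_filt N k) \<and>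
     {x \<in> carrier (complexify (betti N)). compar N x \<in> complexify_sub (derham N) F} =
       hodge_sum E N {(p, q). p > q}"

definition is_deligne_period ::
  "complex set \<Rightarrow> ('b, 'd) rat_motive \<Rightarrow> (complex, complex) tensor \<Rightarrow> bool" where
  "is_deligne_period E N c \<longleftrightarrow>
     (\<exists>F. is_F_plus E N F \<and>
        is_determinant E (betti_plus N) (quotient_module (derham N) F)
          (\<lambda>X. complexify_map (quotient_module (derham N) F) (\<lambda>x. F +>\<^bsub>derham N\<^esub> x)
                 (compar N (complexify_map (betti N) id X)))
          c)"

end

theory Submission
  imports Defs
begin

text \<open>
  Let \<open>V\<close> and \<open>D\<close> be the Betti and de Rham spaces of \<open>M \<otimes> M'\<close> over \<open>L = EE'\<close>, and \<open>V'\<close>, \<open>D'\<close> those of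
  the conjugate realization. Everything is computed in one system of classes.

  For one factor \<open>M\<close>, let \<open>\<omega> i\<close> be the classes that define the periods and \<open>x i\<close> de Rham vectors in
  the corresponding filtration steps that represent them. The comparison map sends \<open>\<omega> j\<close> to \<open>x j\<close>
  plus a combination of the \<open>x i\<close> with \<open>i < j\<close>; the \<open>x i\<close> generate the de Rham space, the \<open>\<omega> i\<close> the
  complexified Betti space, and the comparison matrix is unitriangular
  (\<open>frame_of_rational_classes\<close>). Such a frame survives extension of coefficients and tensor products
  (\<open>extend_frame\<close>, \<open>tensor_frame\<close>): indices become pairs \<open>(a, b)\<close>, classes and vectors are multiplied,
  and the matrix stays triangular for the height \<open>a + b\<close>. Frobenius sends the class at \<open>(a, b)\<close> to
  the product of the periods \<open>Q a\<close> and \<open>Q' b\<close> times the conjugate class at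
  \<open>(n + 1 - a, n' + 1 - b)\<close> (\<open>tensor_motive_frob\<close>).

  Let \<open>P\<close> be the matrix of an \<open>L\<close>-basis of \<open>V\<close> in these classes. As the comparison matrix has
  determinant one, \<open>\<delta>\<close> is \<open>det P\<close> up to a nonzero factor in \<open>L\<close>. The invariants of the involution are the pairs \<open>(v, F v)\<close>
  with \<open>F\<close> the Frobenius map, so \<open>c\<close> is the determinant of the map that sends \<open>v\<close> to the comparison
  images of \<open>v\<close> and \<open>F v\<close>, modulo the filtration step of the classes with \<open>p > q\<close>. For \<open>(a, b) \<notin> A\<close>
  the conjugate class at the mirror image of \<open>(a, b)\<close> has \<open>p > q\<close>, since there is no middle class,
  and the second component dies; for \<open>(a, b) \<in> A\<close> the first one does, and the second one carries the
  periods. Thus the matrix of the map in the surviving vectors consists of two triangular blocks,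
  one with diagonal entries one and one with diagonal entries \<open>Q a\<close> times \<open>Q' b\<close> for \<open>(a, b) \<in> A\<close>.
  Hence \<open>c\<close> is the product over \<open>A\<close> times \<open>det P\<close>, up to such a factor (\<open>deligne_determinant_ratio\<close>).

  The filtration step is given only through its complexification. That it contains the de Rham
  vectors at the pairs in \<open>A\<close>, and their counterparts on the conjugate side, follows by induction on
  the height from the triangular shape (\<open>triangular_kernel\<close>).

  Finally, \<open>(t, u) \<mapsto> (n + 1 - t, n' + 1 - u)\<close> maps the complement of \<open>T\<close> onto \<open>A\<close>, so the two
  products of periods in the statement are equal.
\<close>

section \<open>Determinants over commutative rings\<close>

lemma (in comm_monoid) finprod_Times:
  assumes "finite A" "finite B" "\<And>a b. a \<in> A \<Longrightarrow> b \<in> B \<Longrightarrow> f a b \<in> carrier G"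
  shows "finprod G (\<lambda>(a, b). f a b) (A \<times> B) = finprod G (\<lambda>a. finprod G (f a) B) A"
  using assms(1,3)
proof (induction A)
  case empty
  then show ?case by simp
next
  case (insert x F)
  have eq: "insert x F \<times> B = Pair x ` B \<union> F \<times> B" by auto
  have "finprod G (\<lambda>(a, b). f a b) (insert x F \<times> B)
      = finprod G (\<lambda>(a, b). f a b) (Pair x ` B) \<otimes> finprod G (\<lambda>(a, b). f a b) (F \<times> B)"
    unfolding eq using insert assms by (intro finprod_Un_disjoint) auto
  also have "finprod G (\<lambda>(a, b). f a b) (Pair x ` B) = finprod G (f x) B"
    using insert by (subst finprod_reindex) (auto simp: inj_on_def)
  finally show ?case using insert by (subst finprod_insert) auto
qed

lemma (in comm_monoid) finprod_swap:
  assumes "finite A" "finite B" "\<And>a b. a \<in> A \<Longrightarrow> b \<in> B \<Longrightarrow> f a b \<in> carrier G"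
  shows "finprod G (\<lambda>a. finprod G (\<lambda>b. f a b) B) A = finprod G (\<lambda>b. finprod G (\<lambda>a. f a b) A) B"
  using assms(1,3)
proof (induction A)
  case empty
  then show ?case by simp
next
  case (insert x F)
  have "finprod G (\<lambda>a. finprod G (\<lambda>b. f a b) B) (insert x F)
      = finprod G (\<lambda>b. f x b) B \<otimes> finprod G (\<lambda>b. finprod G (\<lambda>a. f a b) F) B"
    using insert by (subst finprod_insert) auto
  also have "\<dots> = finprod G (\<lambda>b. f x b \<otimes> finprod G (\<lambda>a. f a b) F) B"
    using insert by (subst finprod_multf) auto
  also have "\<dots> = finprod G (\<lambda>b. finprod G (\<lambda>a. f a b) (insert x F)) B"
    using insert by (intro finprod_cong') (auto simp: Pi_def)
  finally show ?case .
qed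

lemmas (in abelian_monoid) finsum_Times = add.finprod_Times
lemmas (in abelian_monoid) finsum_swap = add.finprod_swap

lemma (in cring) finprod_finsum_distrib:
  assumes "finite I" "finite K" "\<And>i k. i \<in> I \<Longrightarrow> k \<in> K \<Longrightarrow> F i k \<in> carrier R"
  shows "(\<Otimes>i\<in>I. \<Oplus>k\<in>K. F i k) = (\<Oplus>f\<in>I \<rightarrow>\<^sub>E K. \<Otimes>i\<in>I. F i (f i))"
  using assms(1,3)
proof (induction I)
  case empty
  then show ?case by simp
next
  case (insert x I)
  have finE: "finite (I \<rightarrow>\<^sub>E K)" using insert assms by (intro finite_PiE) auto
  have cl: "(\<Otimes>i\<in>I. F i (f i)) \<in> carrier R" if "f \<in> I \<rightarrow>\<^sub>E K" for f
    using insert that by (intro finprod_closed) (auto simp: PiE_def Pi_def)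
  have inj: "inj_on (\<lambda>(y, g). g(x := y)) (K \<times> (I \<rightarrow>\<^sub>E K))"
    using insert by (intro inj_combinator) auto
  have "(\<Otimes>i\<in>insert x I. \<Oplus>k\<in>K. F i k) = (\<Oplus>k\<in>K. F x k) \<otimes> (\<Oplus>f\<in>I \<rightarrow>\<^sub>E K. \<Otimes>i\<in>I. F i (f i))"
    using insert by (subst finprod_insert) (auto intro!: finsum_closed)
  also have "\<dots> = (\<Oplus>k\<in>K. \<Oplus>f\<in>I \<rightarrow>\<^sub>E K. F x k \<otimes> (\<Otimes>i\<in>I. F i (f i)))"
  proof -
    have "(\<Oplus>k\<in>K. F x k) \<otimes> (\<Oplus>f\<in>I \<rightarrow>\<^sub>E K. \<Otimes>i\<in>I. F i (f i))
        = (\<Oplus>k\<in>K. F x k \<otimes> (\<Oplus>f\<in>I \<rightarrow>\<^sub>E K. \<Otimes>i\<in>I. F i (f i)))"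
      using insert assms cl by (intro finsum_ldistr) auto
    also have "\<dots> = (\<Oplus>k\<in>K. \<Oplus>f\<in>I \<rightarrow>\<^sub>E K. F x k \<otimes> (\<Otimes>i\<in>I. F i (f i)))"
      using insert finE cl by (intro finsum_cong' finsum_rdistr) (auto intro!: finsum_closed)
    finally show ?thesis .
  qed
  also have "\<dots> = finsum R (\<lambda>(k, f). F x k \<otimes> (\<Otimes>i\<in>I. F i (f i))) (K \<times> (I \<rightarrow>\<^sub>E K))"
    using insert assms finE cl by (subst finsum_Times) auto
  also have "\<dots> = finsum R (\<lambda>(k, f). \<Otimes>i\<in>insert x I. F i ((f(x := k)) i)) (K \<times> (I \<rightarrow>\<^sub>E K))"
  proof (intro finsum_cong', goal_cases)
    case 2
    then show ?case using insert
      by (auto intro!: finprod_closed simp: PiE_def Pi_def)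
  next
    case (3 p)
    obtain k f where p: "p = (k, f)" "k \<in> K" "f \<in> I \<rightarrow>\<^sub>E K" using 3 by auto
    have "(\<Otimes>i\<in>insert x I. F i ((f(x := k)) i)) = F x k \<otimes> (\<Otimes>i\<in>I. F i ((f(x := k)) i))"
      using insert p by (subst finprod_insert) (auto simp: PiE_def Pi_def)
    also have "(\<Otimes>i\<in>I. F i ((f(x := k)) i)) = (\<Otimes>i\<in>I. F i (f i))"
      using insert p by (intro finprod_cong') (auto simp: PiE_def Pi_def)
    finally show ?case by (simp add: p)
  qed simp
  also have "\<dots> = (\<Oplus>f\<in>(\<lambda>(y, g). g(x := y)) ` (K \<times> (I \<rightarrow>\<^sub>E K)). \<Otimes>i\<in>insert x I. F i (f i))"
    using insert inj
    by (subst finsum_reindex)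
      (auto intro!: finprod_closed finsum_cong' simp: PiE_def Pi_def split_def)
  also have "(\<lambda>(y, g). g(x := y)) ` (K \<times> (I \<rightarrow>\<^sub>E K)) = insert x I \<rightarrow>\<^sub>E K"
    by (simp add: PiE_insert_eq)
  finally show ?case .
qed

lemma permutes_less: "\<sigma> permutes {..<n} \<Longrightarrow> i < n \<Longrightarrow> \<sigma> i < n"
  using permutes_in_image[of \<sigma> "{..<n}" i] by simp

lemma (in cring) ring_det_closed:
  assumes "\<And>i j. i < n \<Longrightarrow> j < n \<Longrightarrow> A i j \<in> carrier R"
  shows "ring_det R n A \<in> carrier R"
  unfolding ring_det_def using assms permutes_in_image
  by (intro finsum_closed funcsetI add.int_pow_closed finprod_closed) fastforce

lemma (in cring) prod_perm_closed:
  assumes "\<And>i j. i < n \<Longrightarrow> j < n \<Longrightarrow> A i j \<in> carrier R" "\<sigma> permutes {..<n}" 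
  shows "(\<Otimes>i\<in>{..<n}. A i (\<sigma> i)) \<in> carrier R"
  using assms permutes_in_image by (intro finprod_closed) fastforce

lemma (in cring) ring_det_cong:
  assumes "\<And>i j. i < n \<Longrightarrow> j < n \<Longrightarrow> A i j \<in> carrier R"
    "\<And>i j. i < n \<Longrightarrow> j < n \<Longrightarrow> A i j = B i j"
  shows "ring_det R n A = ring_det R n B"
  unfolding ring_det_def
proof (intro finsum_cong', goal_cases)
  case 2
  then show ?case using assms by (auto intro!: add.int_pow_closed prod_perm_closed)
next
  case (3 \<sigma>)
  then show ?case using assms permutes_in_image[of \<sigma> "{..<n}"]
    by (intro arg_cong[where f = "add_pow R _"] finprod_cong') auto
qed simp

lemma (in cring) finprod_permute:
  assumes "\<tau> permutes {..<n}" "\<And>i. i < n \<Longrightarrow> f i \<in> carrier R"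
  shows "(\<Otimes>i\<in>{..<n}. f (\<tau> i)) = (\<Otimes>i\<in>{..<n}. f i)"
proof -
  have "(\<Otimes>i\<in>{..<n}. f i) = (\<Otimes>i\<in>\<tau> ` {..<n}. f i)"
    using assms by (simp add: permutes_image)
  also have "\<dots> = (\<Otimes>i\<in>{..<n}. f (\<tau> i))"
    using assms permutes_image[OF assms(1)]
    by (intro finprod_reindex) (auto simp: permutes_inj_on)
  finally show ?thesis by simp
qed

lemma inj_on_comp_permutes: "\<tau> permutes S \<Longrightarrow> inj_on (\<lambda>\<sigma>. \<sigma> \<circ> \<tau>) X"
  by (rule inj_onI) (metis comp_assoc comp_id permutes_inv_o(1))

lemma (in abelian_group) finsum_neg:
  assumes "f \<in> S \<rightarrow> carrier G"
  shows "(\<Oplus>s\<in>S. \<ominus> f s) = \<ominus> finsum G f S"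
  using assms
proof (induction S rule: infinite_finite_induct)
  case (insert x F)
  then show ?case by (simp add: Pi_def minus_add)
qed (use add.inv_one in \<open>simp_all add: a_inv_def\<close>)

lemma (in abelian_group) int_pow_sign:
  assumes "x \<in> carrier G"
  shows "[(1::int)] \<cdot> x = x" "[(-1::int)] \<cdot> x = \<ominus> x"
  using assms add.int_pow_1[of x] add.int_pow_neg[of x 1] by simp_all

lemma (in cring) ring_det_permute_rows:
  assumes B: "\<And>i j. i < n \<Longrightarrow> j < n \<Longrightarrow> B i j \<in> carrier R" and t: "\<tau> permutes {..<n}"
  shows "ring_det R n (\<lambda>i. B (\<tau> i)) = [sign \<tau>] \<cdot> ring_det R n B"
proof -
  let ?P = "{\<sigma>. \<sigma> permutes {..<n}}"
  have tin: "\<tau> i < n" if "i < n" for i using permutes_in_image[OF t] that by auto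
  have "ring_det R n (\<lambda>i. B (\<tau> i)) = (\<Oplus>\<sigma>\<in>(\<lambda>\<sigma>. \<sigma> \<circ> \<tau>) ` ?P. [sign \<sigma>] \<cdot> (\<Otimes>i\<in>{..<n}. B (\<tau> i) (\<sigma> i)))"
    unfolding ring_det_def image_compose_permutations_right[OF t, folded image_Collect] image_Collect ..
  also have "\<dots> = (\<Oplus>\<sigma>\<in>?P. [sign (\<sigma> \<circ> \<tau>)] \<cdot> (\<Otimes>i\<in>{..<n}. B (\<tau> i) ((\<sigma> \<circ> \<tau>) i)))"
  proof (intro finsum_reindex)
    show "inj_on (\<lambda>\<sigma>. \<sigma> \<circ> \<tau>) ?P"
      using t by (rule inj_on_comp_permutes)
    show "(\<lambda>\<sigma>. [sign \<sigma>] \<cdot> (\<Otimes>i\<in>{..<n}. B (\<tau> i) (\<sigma> i))) \<in> (\<lambda>\<sigma>. \<sigma> \<circ> \<tau>) ` ?P \<rightarrow> carrier R"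
      using B tin permutes_compose[OF t]
      by (auto intro!: add.int_pow_closed prod_perm_closed[where A = "\<lambda>i. B (\<tau> i)"] simp del: comp_apply)
  qed
  also have "\<dots> = (\<Oplus>\<sigma>\<in>?P. [sign \<tau>] \<cdot> ([sign \<sigma>] \<cdot> (\<Otimes>i\<in>{..<n}. B i (\<sigma> i))))"
  proof (intro finsum_cong', goal_cases)
    case 2
    then show ?case using B by (auto intro!: add.int_pow_closed prod_perm_closed)
  next
    case (3 \<sigma>)
    then have s: "\<sigma> permutes {..<n}" by simp
    have "(\<Otimes>i\<in>{..<n}. B (\<tau> i) ((\<sigma> \<circ> \<tau>) i)) = (\<Otimes>i\<in>{..<n}. B i (\<sigma> i))"
      using finprod_permute[OF t, of "\<lambda>i. B i (\<sigma> i)"] B permutes_in_image[OF s] by fastforce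
    moreover have "sign (\<sigma> \<circ> \<tau>) = sign \<sigma> * sign \<tau>"
      using s t by (intro sign_compose) (auto simp: permutation_permutes)
    ultimately show ?case
      using add.int_pow_pow[OF prod_perm_closed[of n B, OF B s]] by simp
  qed simp
  also have "\<dots> = [sign \<tau>] \<cdot> ring_det R n B"
  proof -
    have 1: "(\<lambda>\<sigma>. [sign \<sigma>] \<cdot> (\<Otimes>i\<in>{..<n}. B i (\<sigma> i))) \<in> ?P \<rightarrow> carrier R"
      using B by (auto intro!: add.int_pow_closed prod_perm_closed)
    have "sign \<tau> = 1 \<or> sign \<tau> = -1" by (simp add: sign_def)
    then show ?thesis
    proof
      assume "sign \<tau> = 1"
      with 1 show ?thesis unfolding ring_det_def
        by (auto simp: int_pow_sign finsum_closed Pi_def intro!: finsum_cong')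
    next
      assume s: "sign \<tau> = -1"
      note m = int_pow_sign(2)
      have "(\<Oplus>\<sigma>\<in>?P. \<ominus> ([sign \<sigma>] \<cdot> (\<Otimes>i\<in>{..<n}. B i (\<sigma> i)))) = \<ominus> ring_det R n B"
        unfolding ring_det_def using 1 by (rule finsum_neg)
      moreover have "(\<Oplus>\<sigma>\<in>?P. [sign \<tau>] \<cdot> ([sign \<sigma>] \<cdot> (\<Otimes>i\<in>{..<n}. B i (\<sigma> i))))
          = (\<Oplus>\<sigma>\<in>?P. \<ominus> ([sign \<sigma>] \<cdot> (\<Otimes>i\<in>{..<n}. B i (\<sigma> i))))"
        unfolding s using 1 m by (intro finsum_cong') auto
      ultimately show ?thesis using B by (simp add: s m ring_det_closed)
    qed
  qed
  finally show ?thesis .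
qed

text \<open>
  Composition with the transposition of the two rows matches the even permutations with the odd ones,
  and matched terms cancel. Alternation under row permutations alone would only give twice the
  determinant.
\<close>

lemma (in cring) ring_det_equal_rows:
  assumes B: "\<And>i j. i < n \<Longrightarrow> j < n \<Longrightarrow> B i j \<in> carrier R"
    and ab: "a < n" "b < n" "a \<noteq> b" "\<And>j. j < n \<Longrightarrow> B a j = B b j"
  shows "ring_det R n B = \<zero>"
proof -
  let ?P = "{\<sigma>. \<sigma> permutes {..<n}}"
  let ?E = "{\<sigma>. \<sigma> permutes {..<n} \<and> evenperm \<sigma>}"
  let ?O = "{\<sigma>. \<sigma> permutes {..<n} \<and> \<not> evenperm \<sigma>}"
  let ?t = "Transposition.transpose a b"
  define g where "g \<sigma> = [sign \<sigma>] \<cdot> (\<Otimes>i\<in>{..<n}. B i (\<sigma> i))" for \<sigma>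
  have t: "?t permutes {..<n}" using ab by (intro permutes_swap_id) auto
  have g: "g \<sigma> \<in> carrier R" if "\<sigma> permutes {..<n}" for \<sigma>
    unfolding g_def using B that by (auto intro!: add.int_pow_closed prod_perm_closed)
  have evt: "evenperm (\<sigma> \<circ> ?t) \<longleftrightarrow> \<not> evenperm \<sigma>" if "\<sigma> permutes {..<n}" for \<sigma>
    using that t ab evenperm_comp[of \<sigma> ?t]
    by (auto simp: permutation_permutes evenperm_swap)
  have O: "?O = (\<lambda>\<sigma>. \<sigma> \<circ> ?t) ` ?E"
  proof (intro equalityI subsetI)
    fix \<sigma> assume s: "\<sigma> \<in> ?O"
    have "\<sigma> = (\<sigma> \<circ> ?t) \<circ> ?t" by (simp add: comp_assoc)
    moreover have "\<sigma> \<circ> ?t \<in> ?E" using s evt t by (auto intro: permutes_compose)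
    ultimately show "\<sigma> \<in> (\<lambda>\<sigma>. \<sigma> \<circ> ?t) ` ?E" by (rule image_eqI)
  qed (use evt t in \<open>auto intro: permutes_compose\<close>)
  have gt: "g (\<sigma> \<circ> ?t) = \<ominus> g \<sigma>" if "\<sigma> \<in> ?E" for \<sigma>
  proof -
    have s: "\<sigma> permutes {..<n}" using that by simp
    have "(\<Otimes>i\<in>{..<n}. B i ((\<sigma> \<circ> ?t) i)) = (\<Otimes>i\<in>{..<n}. B (?t i) (\<sigma> (?t i)))"
      using B ab permutes_in_image[OF s] permutes_in_image[OF t]
      by (intro finprod_cong') (auto simp: Transposition.transpose_def)
    also have "\<dots> = (\<Otimes>i\<in>{..<n}. B i (\<sigma> i))"
      using finprod_permute[OF t, of "\<lambda>i. B i (\<sigma> i)"] B permutes_in_image[OF s] by fastforce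
    finally have "g (\<sigma> \<circ> ?t) = [sign (\<sigma> \<circ> ?t)] \<cdot> (\<Otimes>i\<in>{..<n}. B i (\<sigma> i))" by (simp add: g_def)
    moreover have "sign (\<sigma> \<circ> ?t) = -1" "sign \<sigma> = 1"
      using that evt[OF s] by (auto simp: sign_def)
    ultimately show ?thesis
      using prod_perm_closed[of n B, OF B s] add.int_pow_neg[of _ 1]
      by (simp add: g_def add.int_pow_1)
  qed
  have fin: "finite ?P" by (rule finite_permutations) simp
  have "ring_det R n B = finsum R g (?E \<union> ?O)"
    unfolding ring_det_def g_def by (rule arg_cong[where f = "finsum R _"]) auto
  also have "\<dots> = finsum R g ?E \<oplus> finsum R g ?O"
    using fin g by (intro finsum_Un_disjoint) (auto intro: finite_subset[OF _ fin])
  also have "finsum R g ?O = (\<Oplus>\<sigma>\<in>?E. g (\<sigma> \<circ> ?t))"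
    unfolding O
  proof (intro finsum_reindex)
    show "inj_on (\<lambda>\<sigma>. \<sigma> \<circ> ?t) ?E"
      using t by (rule inj_on_comp_permutes)
    show "g \<in> (\<lambda>\<sigma>. \<sigma> \<circ> ?t) ` ?E \<rightarrow> carrier R"
      using g t by (auto intro: permutes_compose)
  qed
  also have "\<dots> = (\<Oplus>\<sigma>\<in>?E. \<ominus> g \<sigma>)" using gt g by (intro finsum_cong') auto
  also have "\<dots> = \<ominus> finsum R g ?E" using g by (intro finsum_neg) auto
  finally show ?thesis using g by (simp add: r_neg finsum_closed Pi_def)
qed

definition mat_mult :: "('r, 'm) ring_scheme \<Rightarrow> nat \<Rightarrow> (nat \<Rightarrow> nat \<Rightarrow> 'r) \<Rightarrow> (nat \<Rightarrow> nat \<Rightarrow> 'r) \<Rightarrow> nat \<Rightarrow> nat \<Rightarrow> 'r" where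
  "mat_mult R n A B i j = (\<Oplus>\<^bsub>R\<^esub>k\<in>{..<n}. A i k \<otimes>\<^bsub>R\<^esub> B k j)"

lemma (in cring) mat_mult_closed:
  assumes "\<And>i j. i < n \<Longrightarrow> j < n \<Longrightarrow> A i j \<in> carrier R" "\<And>i j. i < n \<Longrightarrow> j < n \<Longrightarrow> B i j \<in> carrier R"
    "i < n" "j < n"
  shows "mat_mult R n A B i j \<in> carrier R"
  unfolding mat_mult_def using assms by (intro finsum_closed) auto

lemma (in cring) add_pow_sign_rdistr:
  assumes "finite S" "x \<in> S \<rightarrow> carrier R"
  shows "[(k::int)] \<cdot> finsum R x S = (\<Oplus>s\<in>S. [k] \<cdot> x s)"
  using assms
proof (induction S)
  case (insert s S)
  then show ?case by (simp add: add.int_pow_distrib Pi_def finsum_closed)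
qed simp

text \<open>
  Expanding all entries of the product matrix turns its determinant into a sum over the maps \<open>f\<close> from
  rows to rows, with the determinant of the rows \<open>f i\<close> of \<open>B\<close> as a factor. That factor vanishes unless
  \<open>f\<close> is a permutation, and then it is the determinant of \<open>B\<close> up to the sign.
\<close>

theorem (in cring) ring_det_mult:
  assumes A: "\<And>i j. i < n \<Longrightarrow> j < n \<Longrightarrow> A i j \<in> carrier R"
    and B: "\<And>i j. i < n \<Longrightarrow> j < n \<Longrightarrow> B i j \<in> carrier R"
  shows "ring_det R n (mat_mult R n A B) = ring_det R n A \<otimes> ring_det R n B"
proof -
  let ?I = "{..<n}"
  let ?P = "{\<sigma>. \<sigma> permutes ?I}"
  let ?F = "?I \<rightarrow>\<^sub>E ?I"
  have fin: "finite ?P" "finite ?F" by (auto intro: finite_permutations finite_PiE)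
  have Fin: "f i < n" if "f \<in> ?F" "i < n" for f i using that by (auto simp: PiE_def Pi_def)
  have cA: "(\<Otimes>i\<in>?I. A i (f i)) \<in> carrier R" if "f \<in> ?F" for f
    using that A Fin by (intro finprod_closed) auto
  have cB: "(\<Otimes>i\<in>?I. B (f i) (\<sigma> i)) \<in> carrier R" if "f \<in> ?F" "\<sigma> permutes ?I" for f \<sigma>
    using that B Fin permutes_in_image[OF that(2)] by (intro finprod_closed) auto
  have "ring_det R n (mat_mult R n A B)
      = (\<Oplus>\<sigma>\<in>?P. \<Oplus>f\<in>?F. (\<Otimes>i\<in>?I. A i (f i)) \<otimes> ([sign \<sigma>] \<cdot> (\<Otimes>i\<in>?I. B (f i) (\<sigma> i))))"
    unfolding ring_det_def
  proof (intro finsum_cong', goal_cases)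
    case 2
    then show ?case using cA cB by (auto intro!: finsum_closed add.int_pow_closed)
  next
    case (3 \<sigma>)
    then have s: "\<sigma> permutes ?I" by simp
    have "(\<Otimes>i\<in>?I. mat_mult R n A B i (\<sigma> i)) = (\<Oplus>f\<in>?F. \<Otimes>i\<in>?I. A i (f i) \<otimes> B (f i) (\<sigma> i))"
      unfolding mat_mult_def using A B permutes_in_image[OF s] by (intro finprod_finsum_distrib) auto
    also have "\<dots> = (\<Oplus>f\<in>?F. (\<Otimes>i\<in>?I. A i (f i)) \<otimes> (\<Otimes>i\<in>?I. B (f i) (\<sigma> i)))"
      using A B Fin permutes_in_image[OF s] cA cB[OF _ s]
      by (intro finsum_cong' finprod_multf) auto
    finally show ?case using cA cB[OF _ s] fin
      by (simp add: add_pow_sign_rdistr Pi_def add_pow_rdistr_int cong: finsum_cong)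
  qed simp
  also have "\<dots> = (\<Oplus>f\<in>?F. \<Oplus>\<sigma>\<in>?P. (\<Otimes>i\<in>?I. A i (f i)) \<otimes> ([sign \<sigma>] \<cdot> (\<Otimes>i\<in>?I. B (f i) (\<sigma> i))))"
    using fin cA cB by (intro finsum_swap) auto
  also have "\<dots> = (\<Oplus>f\<in>?F. (\<Otimes>i\<in>?I. A i (f i)) \<otimes> ring_det R n (\<lambda>i. B (f i)))"
    unfolding ring_det_def using fin cA cB
    by (intro finsum_cong' finsum_rdistr[symmetric])
      (auto intro!: finsum_closed add.int_pow_closed)
  also have "\<dots> = (\<Oplus>f\<in>(\<lambda>\<pi>. restrict \<pi> ?I) ` ?P. (\<Otimes>i\<in>?I. A i (f i)) \<otimes> ring_det R n (\<lambda>i. B (f i)))"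
  proof (rule add.finprod_mono_neutral_cong_right[OF fin(2)])
    show "(\<lambda>\<pi>. restrict \<pi> ?I) ` ?P \<subseteq> ?F"
      by (auto simp: PiE_def Pi_def permutes_less)
    show "(\<lambda>f. (\<Otimes>i\<in>?I. A i (f i)) \<otimes> ring_det R n (\<lambda>i. B (f i))) \<in> ?F \<rightarrow> carrier R"
      using cA B Fin by (auto intro!: ring_det_closed)
  next
    fix f assume f: "f \<in> ?F - (\<lambda>\<pi>. restrict \<pi> ?I) ` ?P"
    have "\<not> inj_on f ?I"
    proof
      assume inj: "inj_on f ?I"
      define \<pi> where "\<pi> i = (if i \<in> ?I then f i else i)" for i
      have "bij_betw f ?I ?I"
        using f inj endo_inj_surj[of ?I f] by (auto simp: bij_betw_def)
      then have "bij_betw \<pi> ?I ?I" by (rule bij_betw_cong[THEN iffD1, rotated]) (simp add: \<pi>_def)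
      then have "\<pi> permutes ?I" by (rule bij_imp_permutes) (auto simp: \<pi>_def)
      moreover have "f = restrict \<pi> ?I" using f by (auto simp: \<pi>_def fun_eq_iff PiE_def extensional_def)
      ultimately show False using f by auto
    qed
    then obtain a b where ab: "a < n" "b < n" "a \<noteq> b" "f a = f b" by (auto simp: inj_on_def)
    have "ring_det R n (\<lambda>i. B (f i)) = \<zero>"
      using ab f Fin B by (intro ring_det_equal_rows[of n _ a b]) auto
    then show "(\<Otimes>i\<in>?I. A i (f i)) \<otimes> ring_det R n (\<lambda>i. B (f i)) = \<zero>"
      using cA f by auto
  qed simp
  also have "\<dots> = (\<Oplus>\<pi>\<in>?P. (\<Otimes>i\<in>?I. A i (restrict \<pi> ?I i)) \<otimes> ring_det R n (\<lambda>i. B (restrict \<pi> ?I i)))"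
  proof (rule finsum_reindex)
    show "(\<lambda>f. (\<Otimes>i\<in>?I. A i (f i)) \<otimes> ring_det R n (\<lambda>i. B (f i))) \<in> (\<lambda>\<pi>. restrict \<pi> ?I) ` ?P \<rightarrow> carrier R"
      using A B by (auto intro!: ring_det_closed finprod_closed simp: permutes_less)
    show "inj_on (\<lambda>\<pi>. restrict \<pi> ?I) ?P"
    proof (rule inj_onI)
      fix x y assume xy: "x \<in> ?P" "y \<in> ?P" "restrict x ?I = restrict y ?I"
      show "x = y"
      proof
        fix i show "x i = y i"
          using xy(1,2) fun_cong[OF xy(3), of i] permutes_not_in[of x ?I i] permutes_not_in[of y ?I i]
          by (cases "i \<in> ?I") auto
      qed
    qed
  qed
  also have "\<dots> = (\<Oplus>\<pi>\<in>?P. ([sign \<pi>] \<cdot> (\<Otimes>i\<in>?I. A i (\<pi> i))) \<otimes> ring_det R n B)"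
  proof (intro finsum_cong', goal_cases)
    case 2
    then show ?case using A B by (auto intro!: ring_det_closed add.int_pow_closed prod_perm_closed)
  next
    case (3 \<pi>)
    then have p: "\<pi> permutes ?I" by simp
    have "(\<Otimes>i\<in>?I. A i (restrict \<pi> ?I i)) = (\<Otimes>i\<in>?I. A i (\<pi> i))"
      using A permutes_in_image[OF p] by (intro finprod_cong') auto
    moreover have "ring_det R n (\<lambda>i. B (restrict \<pi> ?I i)) = ring_det R n (\<lambda>i. B (\<pi> i))"
      using B permutes_less[OF p] by (intro ring_det_cong) auto
    moreover have "ring_det R n (\<lambda>i. B (\<pi> i)) = [sign \<pi>] \<cdot> ring_det R n B"
      using B p by (rule ring_det_permute_rows)
    ultimately show ?case
      using ring_det_closed[of n B, OF B] prod_perm_closed[of n A, OF A p]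
      by (simp add: add_pow_rdistr_int add_pow_ldistr_int)
  qed simp
  also have "\<dots> = ring_det R n A \<otimes> ring_det R n B"
    unfolding ring_det_def[of R n A]
    using A B fin by (intro finsum_ldistr[symmetric]) (auto intro!: ring_det_closed add.int_pow_closed prod_perm_closed)
  finally show ?thesis .
qed

text \<open>
  Triangular means that nonzero entries off the diagonal raise a height \<open>\<rho>\<close>; the matrices below are
  indexed by numbered pairs, whose numbering has no relation to the triangular shape. A permutation
  contributing to the determinant raises \<open>\<rho>\<close> wherever it moves an index, while it preserves the sum of
  \<open>\<rho>\<close>, so it is the identity.
\<close>

lemma (in cring) ring_det_triangular:
  fixes \<rho> :: "nat \<Rightarrow> int"
  assumes A: "\<And>i j. i < n \<Longrightarrow> j < n \<Longrightarrow> A i j \<in> carrier R"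
    and tri: "\<And>i j. i < n \<Longrightarrow> j < n \<Longrightarrow> i \<noteq> j \<Longrightarrow> \<not> \<rho> i < \<rho> j \<Longrightarrow> A i j = \<zero>"
  shows "ring_det R n A = (\<Otimes>i\<in>{..<n}. A i i)"
proof -
  let ?P = "{\<sigma>. \<sigma> permutes {..<n}}"
  have fin: "finite ?P" by (rule finite_permutations) simp
  have z: "(\<Otimes>i\<in>{..<n}. A i (\<sigma> i)) = \<zero>" if s: "\<sigma> permutes {..<n}" "\<sigma> \<noteq> id" for \<sigma>
  proof -
    have "\<exists>i<n. \<sigma> i \<noteq> i \<and> \<not> \<rho> i < \<rho> (\<sigma> i)"
    proof (rule ccontr)
      assume neg: "\<not> ?thesis"
      have le: "\<rho> i \<le> \<rho> (\<sigma> i)" if "i < n" for i using neg that by (cases "\<sigma> i = i") auto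
      obtain i where i: "\<sigma> i \<noteq> i" using s(2) by (auto simp: fun_eq_iff)
      then have "i < n" using s(1) by (auto simp: permutes_def)
      then have "(\<Sum>i<n. \<rho> i) < (\<Sum>i<n. \<rho> (\<sigma> i))"
        using le neg i by (intro sum_strict_mono_ex1) auto
      also have "(\<Sum>i<n. \<rho> (\<sigma> i)) = (\<Sum>i<n. \<rho> i)"
        using sum.permute[OF s(1), of \<rho>] by (simp add: comp_def)
      finally show False by simp
    qed
    then obtain i where i: "i < n" "\<sigma> i \<noteq> i" "\<not> \<rho> i < \<rho> (\<sigma> i)" by auto
    have si: "\<sigma> j < n" if "j < n" for j using permutes_in_image[OF s(1)] that by auto
    have "(\<Otimes>j\<in>{..<n}. A j (\<sigma> j)) = (\<Otimes>j\<in>insert i ({..<n} - {i}). A j (\<sigma> j))"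
      using i by (simp add: insert_absorb)
    also have "\<dots> = A i (\<sigma> i) \<otimes> (\<Otimes>j\<in>{..<n} - {i}. A j (\<sigma> j))"
      using i si A by (subst finprod_insert) auto
    also have "A i (\<sigma> i) = \<zero>" using i si[of i] tri[of i "\<sigma> i"] by auto
    finally show ?thesis using si A by (simp add: finprod_closed Pi_def)
  qed
  have "ring_det R n A = (\<Oplus>\<sigma>\<in>{id}. [sign \<sigma>] \<cdot> (\<Otimes>i\<in>{..<n}. A i (\<sigma> i)))"
    unfolding ring_det_def using z A
    by (intro add.finprod_mono_neutral_cong_right[OF fin])
      (auto intro!: add.int_pow_closed prod_perm_closed simp: permutes_id)
  also have "\<dots> = (\<Otimes>i\<in>{..<n}. A i i)"
    using A by (simp add: finprod_closed Pi_def add.int_pow_1 sign_id)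
  finally show ?thesis .
qed

lemma (in cring) ring_det_inverse:
  assumes A: "\<And>i j. i < n \<Longrightarrow> j < n \<Longrightarrow> A i j \<in> carrier R"
    and B: "\<And>i j. i < n \<Longrightarrow> j < n \<Longrightarrow> B i j \<in> carrier R"
    and AB: "\<And>i j. i < n \<Longrightarrow> j < n \<Longrightarrow> mat_mult R n A B i j = (if i = j then \<one> else \<zero>)"
  shows "ring_det R n A \<otimes> ring_det R n B = \<one>"
proof -
  have "ring_det R n A \<otimes> ring_det R n B = ring_det R n (mat_mult R n A B)"
    using A B by (simp add: ring_det_mult)
  also have "\<dots> = ring_det R n (\<lambda>i j. if i = j then \<one> else \<zero>)"
    using A B AB by (intro ring_det_cong) (auto intro: mat_mult_closed)
  also have "\<dots> = (\<Otimes>i\<in>{..<n}. (if i = i then \<one> else \<zero>))"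
    by (intro ring_det_triangular[where \<rho> = "\<lambda>_. 0"]) auto
  finally show ?thesis by simp
qed

lemma (in ring_hom_cring) hom_int_pow:
  assumes "x \<in> carrier R"
  shows "h ([(k::int)] \<cdot>\<^bsub>R\<^esub> x) = [k] \<cdot>\<^bsub>S\<^esub> h x"
proof -
  have "group_hom (add_monoid R) (add_monoid S) h"
    by (rule group_hom.intro[OF R.a_group S.a_group])
      (auto simp: group_hom_axioms_def hom_def)
  then show ?thesis using group_hom.hom_int_pow[of "add_monoid R" "add_monoid S" h x k] assms
    by (simp add: add_pow_def)
qed

lemma (in ring_hom_cring) hom_ring_det:
  assumes A: "\<And>i j. i < n \<Longrightarrow> j < n \<Longrightarrow> A i j \<in> carrier R"
  shows "h (ring_det R n A) = ring_det S n (\<lambda>i j. h (A i j))"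
  unfolding ring_det_def
  using A R.prod_perm_closed[of n A, OF A]
proof (subst hom_finsum, goal_cases)
  case 1
  then show ?case by (auto intro: R.add.int_pow_closed)
next
  case 2
  show ?case
  proof (intro S.finsum_cong', goal_cases)
    case 2
    then show ?case using A by (auto intro!: S.add.int_pow_closed S.prod_perm_closed)
  next
    case (3 \<sigma>)
    then show ?case using A R.prod_perm_closed[of n A, OF A] permutes_in_image[of \<sigma> "{..<n}"]
      by (auto simp: hom_int_pow comp_def intro!: arg_cong[where f = "add_pow S _"] S.finprod_cong'
          simp: hom_finprod)
  qed simp
qed


section \<open>Tensor products\<close>

definition additive_map :: "('a, 'm) ring_scheme \<Rightarrow> ('b, 'n) ring_scheme \<Rightarrow> ('a \<Rightarrow> 'b) \<Rightarrow> bool" where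
  "additive_map G H f \<longleftrightarrow> f \<in> carrier G \<rightarrow> carrier H \<and>
     (\<forall>x\<in>carrier G. \<forall>y\<in>carrier G. f (x \<oplus>\<^bsub>G\<^esub> y) = f x \<oplus>\<^bsub>H\<^esub> f y)"

lemma additive_mapI:
  assumes "\<And>x. x \<in> carrier G \<Longrightarrow> f x \<in> carrier H"
    "\<And>x y. x \<in> carrier G \<Longrightarrow> y \<in> carrier G \<Longrightarrow> f (x \<oplus>\<^bsub>G\<^esub> y) = f x \<oplus>\<^bsub>H\<^esub> f y"
  shows "additive_map G H f"
  using assms by (auto simp: additive_map_def)

lemma additive_mapD:
  assumes "additive_map G H f"
  shows "x \<in> carrier G \<Longrightarrow> f x \<in> carrier H"
    "x \<in> carrier G \<Longrightarrow> y \<in> carrier G \<Longrightarrow> f (x \<oplus>\<^bsub>G\<^esub> y) = f x \<oplus>\<^bsub>H\<^esub> f y"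
  using assms by (auto simp: additive_map_def)

lemma additive_map_zero:
  assumes "additive_map G H f" "abelian_group G" "abelian_group H"
  shows "f \<zero>\<^bsub>G\<^esub> = \<zero>\<^bsub>H\<^esub>"
proof -
  interpret G: abelian_group G by fact
  interpret H: abelian_group H by fact
  have "f \<zero>\<^bsub>G\<^esub> \<oplus>\<^bsub>H\<^esub> f \<zero>\<^bsub>G\<^esub> = f \<zero>\<^bsub>G\<^esub>"
    using additive_mapD(2)[OF assms(1), of "\<zero>\<^bsub>G\<^esub>" "\<zero>\<^bsub>G\<^esub>"] by simp
  then show ?thesis using additive_mapD(1)[OF assms(1), of "\<zero>\<^bsub>G\<^esub>"]
    by (simp add: H.add.l_cancel_one)
qed

lemma additive_map_minus:
  assumes "additive_map G H f" "abelian_group G" "abelian_group H" "x \<in> carrier G"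
  shows "f (\<ominus>\<^bsub>G\<^esub> x) = \<ominus>\<^bsub>H\<^esub> f x"
proof -
  interpret G: abelian_group G by fact
  interpret H: abelian_group H by fact
  have "f (\<ominus>\<^bsub>G\<^esub> x) \<oplus>\<^bsub>H\<^esub> f x = \<zero>\<^bsub>H\<^esub>"
    using additive_mapD(2)[OF assms(1), of "\<ominus>\<^bsub>G\<^esub> x" x] additive_map_zero[OF assms(1-3)] assms(4)
    by (simp add: G.l_neg)
  then show ?thesis using additive_mapD(1)[OF assms(1)] assms(4)
    by (simp add: H.minus_equality)
qed

lemma additive_map_finsum:
  assumes "additive_map G H f" "abelian_group G" "abelian_group H" "\<And>i. i \<in> I \<Longrightarrow> g i \<in> carrier G"
  shows "f (finsum G g I) = finsum H (\<lambda>i. f (g i)) I"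
proof -
  interpret G: abelian_group G by fact
  interpret H: abelian_group H by fact
  show ?thesis using assms(4)
  proof (induction I rule: infinite_finite_induct)
    case (insert i I)
    then show ?case using additive_mapD[OF assms(1)]
      by (simp add: G.finsum_closed Pi_def)
  qed (use additive_map_zero[OF assms(1-3)] in auto)
qed

lemma additive_map_comp:
  assumes "additive_map G H f" "additive_map H P g"
  shows "additive_map G P (\<lambda>x. g (f x))"
  using assms by (auto intro!: additive_mapI simp: additive_mapD)

lemma (in abelian_group) minus_eq_zero_iff:
  assumes "x \<in> carrier G" "y \<in> carrier G"
  shows "x \<ominus> y = \<zero> \<longleftrightarrow> x = y"
  using assms by (metis add.inv_closed add.inv_inv add.inv_equality minus_eq r_neg a_inv_def)

lemma (in abelian_group) a_inv_zero: "\<ominus> \<zero> = \<zero>"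
  using add.inv_one by (simp add: a_inv_def)

lemma (in abelian_group) int_mult_closed:
  assumes "x \<in> carrier G"
  shows "[(k::int)] \<cdot> x \<in> carrier G"
  using assms by (rule add.int_pow_closed)

lemma (in abelian_group) int_mult_zero: "[(0::int)] \<cdot> x = \<zero>"
  by (simp add: add_pow_def)

definition balanced ::
  "'k set \<Rightarrow> ('k, 'a) module \<Rightarrow> ('k, 'b) module \<Rightarrow> ('p, 'm) ring_scheme \<Rightarrow> ('a \<Rightarrow> 'b \<Rightarrow> 'p) \<Rightarrow> bool" where
  "balanced K V W P f \<longleftrightarrow>
     (\<forall>w\<in>carrier W. additive_map V P (\<lambda>v. f v w)) \<and> (\<forall>v\<in>carrier V. additive_map W P (f v)) \<and>
     (\<forall>k\<in>K. \<forall>v\<in>carrier V. \<forall>w\<in>carrier W. f (k \<odot>\<^bsub>V\<^esub> v) w = f v (k \<odot>\<^bsub>W\<^esub> w))"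

lemma balancedI:
  assumes "\<And>v w. v \<in> carrier V \<Longrightarrow> w \<in> carrier W \<Longrightarrow> f v w \<in> carrier P"
    "\<And>v v' w. v \<in> carrier V \<Longrightarrow> v' \<in> carrier V \<Longrightarrow> w \<in> carrier W \<Longrightarrow> f (v \<oplus>\<^bsub>V\<^esub> v') w = f v w \<oplus>\<^bsub>P\<^esub> f v' w"
    "\<And>v w w'. v \<in> carrier V \<Longrightarrow> w \<in> carrier W \<Longrightarrow> w' \<in> carrier W \<Longrightarrow> f v (w \<oplus>\<^bsub>W\<^esub> w') = f v w \<oplus>\<^bsub>P\<^esub> f v w'"
    "\<And>k v w. k \<in> K \<Longrightarrow> v \<in> carrier V \<Longrightarrow> w \<in> carrier W \<Longrightarrow> f (k \<odot>\<^bsub>V\<^esub> v) w = f v (k \<odot>\<^bsub>W\<^esub> w)"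
  shows "balanced K V W P f"
  using assms by (auto simp: balanced_def additive_map_def)

lemma balancedD:
  assumes "balanced K V W P f"
  shows "v \<in> carrier V \<Longrightarrow> w \<in> carrier W \<Longrightarrow> f v w \<in> carrier P"
    "v \<in> carrier V \<Longrightarrow> v' \<in> carrier V \<Longrightarrow> w \<in> carrier W \<Longrightarrow> f (v \<oplus>\<^bsub>V\<^esub> v') w = f v w \<oplus>\<^bsub>P\<^esub> f v' w"
    "v \<in> carrier V \<Longrightarrow> w \<in> carrier W \<Longrightarrow> w' \<in> carrier W \<Longrightarrow> f v (w \<oplus>\<^bsub>W\<^esub> w') = f v w \<oplus>\<^bsub>P\<^esub> f v w'"
    "k \<in> K \<Longrightarrow> v \<in> carrier V \<Longrightarrow> w \<in> carrier W \<Longrightarrow> f (k \<odot>\<^bsub>V\<^esub> v) w = f v (k \<odot>\<^bsub>W\<^esub> w)"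
  using assms by (auto simp: balanced_def additive_map_def)

text \<open>
  Only the action of \<open>K\<close> is recorded, so that the universal property obtained here serves the
  complexifications over \<open>\<rat>\<close> as well as the tensor products over number fields.
\<close>

locale tensor_pair =
  fixes K :: "'k set" and V :: "('k, 'a) module" and W :: "('k, 'b) module"
  assumes V: "abelian_group V" and W: "abelian_group W"
    and smultV: "\<And>k v. k \<in> K \<Longrightarrow> v \<in> carrier V \<Longrightarrow> k \<odot>\<^bsub>V\<^esub> v \<in> carrier V"
    and smultW: "\<And>k w. k \<in> K \<Longrightarrow> w \<in> carrier W \<Longrightarrow> k \<odot>\<^bsub>W\<^esub> w \<in> carrier W"
begin

interpretation V: abelian_group V by (rule V)
interpretation W: abelian_group W by (rule W)

abbreviation "S \<equiv> carrier V \<times> carrier W"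
abbreviation "F \<equiv> free_Abelian_group S"
abbreviation "N \<equiv> tensor_relations K V W"
abbreviation "G \<equiv> tensor_group K V W"

definition gens where
  "gens = {frag_of (v \<oplus>\<^bsub>V\<^esub> v', w) - frag_of (v, w) - frag_of (v', w) |v v' w.
           v \<in> carrier V \<and> v' \<in> carrier V \<and> w \<in> carrier W} \<union>
        {frag_of (v, w \<oplus>\<^bsub>W\<^esub> w') - frag_of (v, w) - frag_of (v, w') |v w w'.
           v \<in> carrier V \<and> w \<in> carrier W \<and> w' \<in> carrier W} \<union>
        {frag_of (k \<odot>\<^bsub>V\<^esub> v, w) - frag_of (v, k \<odot>\<^bsub>W\<^esub> w) |k v w.
           k \<in> K \<and> v \<in> carrier V \<and> w \<in> carrier W}"

lemma N_eq: "N = generate F gens"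
  unfolding tensor_relations_def gens_def ..

lemma keys_diff_le: "Poly_Mapping.keys a \<subseteq> S \<Longrightarrow> Poly_Mapping.keys b \<subseteq> S \<Longrightarrow> Poly_Mapping.keys (a - b) \<subseteq> S"
  using keys_diff[of a b] by auto

lemma gens_carrier: "gens \<subseteq> carrier F"
proof
  fix x assume "x \<in> gens"
  then have "Poly_Mapping.keys x \<subseteq> S"
    unfolding gens_def
    by (elim UnE CollectE exE conjE; simp only:; intro keys_diff_le) (simp_all add: smultV smultW)
  then show "x \<in> carrier F" by simp
qed

lemma N_subgroup: "subgroup N F"
  unfolding N_eq by (intro group.generate_is_subgroup group_free_Abelian_group gens_carrier)

lemma N_normal: "N \<lhd> F"
  by (rule comm_group.normal_iff_subgroup[OF abelian_free_Abelian_group, THEN iffD2, OF N_subgroup])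

lemma G_simps: "carrier G = carrier (F Mod N)" "add G = mult (F Mod N)" "zero G = one (F Mod N)"
  by (simp_all add: tensor_group_def Let_def)

lemma G_abelian: "abelian_group G"
proof -
  have c: "comm_group (F Mod N)" by (rule comm_group.abelian_FactGroup[OF abelian_free_Abelian_group N_subgroup])
  interpret Q: comm_group "F Mod N" by (rule c)
  show ?thesis
    using Q.m_closed Q.one_closed Q.m_assoc Q.m_comm Q.l_one Q.l_inv_ex
    by (intro abelian_groupI) (simp_all only: G_simps)
qed

interpretation G: abelian_group G by (rule G_abelian)

abbreviation "proj x \<equiv> N #>\<^bsub>F\<^esub> x"

lemma proj_add: "x \<in> carrier F \<Longrightarrow> y \<in> carrier F \<Longrightarrow> proj (x + y) = proj x \<oplus>\<^bsub>G\<^esub> proj y"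
  using normal.rcos_sum[OF N_normal, of x y] by (simp add: G_simps)

lemma proj_closed: "x \<in> carrier F \<Longrightarrow> proj x \<in> carrier G"
  by (auto simp: G_simps carrier_FactGroup)

lemma proj_zero: "proj 0 = \<zero>\<^bsub>G\<^esub>"
  using group.coset_mult_one[OF group_free_Abelian_group subgroup.subset[OF N_subgroup]] by (simp add: G_simps)

lemma proj_diff:
  assumes "x \<in> carrier F" "y \<in> carrier F"
  shows "proj (x - y) = proj x \<ominus>\<^bsub>G\<^esub> proj y"
proof -
  have c: "x - y \<in> carrier F" using keys_diff_le[of x y] assms by simp
  have "proj (x - y) \<oplus>\<^bsub>G\<^esub> proj y = proj x"
    using proj_add[of "x - y" y] assms c by simp
  then show ?thesis using proj_closed[OF c] proj_closed[OF assms(1)] proj_closed[OF assms(2)]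
    by (metis G.add.inv_solve_right G.minus_eq)
qed

lemma proj_eq_zero: "x \<in> N \<Longrightarrow> proj x = \<zero>\<^bsub>G\<^esub>"
  using group.coset_join2[OF group_free_Abelian_group _ N_subgroup] subgroup.subset[OF N_subgroup]
  by (auto simp: G_simps)

lemma pure_tensor_proj: "pure_tensor K V W v w = proj (frag_of (v, w))"
  by (simp add: pure_tensor_def)

lemma pure_closed: "v \<in> carrier V \<Longrightarrow> w \<in> carrier W \<Longrightarrow> pure_tensor K V W v w \<in> carrier G"
  unfolding pure_tensor_proj by (intro proj_closed) simp

lemma balanced_pure: "balanced K V W G (pure_tensor K V W)"
proof (rule balancedI, goal_cases)
  case (1 v w)
  then show ?case by (rule pure_closed)
next
  case (2 v v' w)
  have m: "frag_of (v \<oplus>\<^bsub>V\<^esub> v', w) - frag_of (v, w) - frag_of (v', w) \<in> N"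
    unfolding N_eq using 2 by (intro generate.incl) (auto simp: gens_def)
  have c: "frag_of (v \<oplus>\<^bsub>V\<^esub> v', w) - frag_of (v, w) \<in> carrier F"
    using 2 keys_diff_le[of "frag_of (v \<oplus>\<^bsub>V\<^esub> v', w)" "frag_of (v, w)"] by simp
  have "proj (frag_of (v \<oplus>\<^bsub>V\<^esub> v', w)) \<ominus>\<^bsub>G\<^esub> proj (frag_of (v, w)) \<ominus>\<^bsub>G\<^esub> proj (frag_of (v', w)) = \<zero>\<^bsub>G\<^esub>"
    using proj_eq_zero[OF m] proj_diff[OF c, of "frag_of (v', w)"]
      proj_diff[of "frag_of (v \<oplus>\<^bsub>V\<^esub> v', w)" "frag_of (v, w)"] 2 by simp
  then show ?case
    using pure_closed[of "v \<oplus>\<^bsub>V\<^esub> v'" w] pure_closed[of v w] pure_closed[of v' w] 2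
    unfolding pure_tensor_proj
    by (simp add: G.minus_eq_zero_iff)
      (metis G.add.inv_solve_right G.a_comm G.minus_eq)
next
  case (3 v w w')
  have m: "frag_of (v, w \<oplus>\<^bsub>W\<^esub> w') - frag_of (v, w) - frag_of (v, w') \<in> N"
    unfolding N_eq using 3 by (intro generate.incl) (auto simp: gens_def)
  have c: "frag_of (v, w \<oplus>\<^bsub>W\<^esub> w') - frag_of (v, w) \<in> carrier F"
    using 3 keys_diff_le[of "frag_of (v, w \<oplus>\<^bsub>W\<^esub> w')" "frag_of (v, w)"] by simp
  have "proj (frag_of (v, w \<oplus>\<^bsub>W\<^esub> w')) \<ominus>\<^bsub>G\<^esub> proj (frag_of (v, w)) \<ominus>\<^bsub>G\<^esub> proj (frag_of (v, w')) = \<zero>\<^bsub>G\<^esub>"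
    using proj_eq_zero[OF m] proj_diff[OF c, of "frag_of (v, w')"]
      proj_diff[of "frag_of (v, w \<oplus>\<^bsub>W\<^esub> w')" "frag_of (v, w)"] 3 by simp
  then show ?case
    using pure_closed[of v "w \<oplus>\<^bsub>W\<^esub> w'"] pure_closed[of v w] pure_closed[of v w'] 3
    unfolding pure_tensor_proj
    by (simp add: G.minus_eq_zero_iff)
      (metis G.add.inv_solve_right G.a_comm G.minus_eq)
next
  case (4 k v w)
  have m: "frag_of (k \<odot>\<^bsub>V\<^esub> v, w) - frag_of (v, k \<odot>\<^bsub>W\<^esub> w) \<in> N"
    unfolding N_eq using 4 by (intro generate.incl) (auto simp: gens_def)
  have "proj (frag_of (k \<odot>\<^bsub>V\<^esub> v, w)) \<ominus>\<^bsub>G\<^esub> proj (frag_of (v, k \<odot>\<^bsub>W\<^esub> w)) = \<zero>\<^bsub>G\<^esub>"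
    using proj_eq_zero[OF m] proj_diff[of "frag_of (k \<odot>\<^bsub>V\<^esub> v, w)" "frag_of (v, k \<odot>\<^bsub>W\<^esub> w)"]
      4 smultV smultW by simp
  then show ?case
    using pure_closed[of "k \<odot>\<^bsub>V\<^esub> v" w] pure_closed[of v "k \<odot>\<^bsub>W\<^esub> w"] 4 smultV smultW
    unfolding pure_tensor_proj by (simp add: G.minus_eq_zero_iff)
qed

lemmas pure_add_left = balancedD(2)[OF balanced_pure]
  and pure_add_right = balancedD(3)[OF balanced_pure]
  and pure_smult = balancedD(4)[OF balanced_pure]

lemma pure_minus: "v \<in> carrier V \<Longrightarrow> w \<in> carrier W \<Longrightarrow> pure_tensor K V W (\<ominus>\<^bsub>V\<^esub> v) w = \<ominus>\<^bsub>G\<^esub> pure_tensor K V W v w"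
  using balanced_pure additive_map_minus[OF _ V G_abelian, of "\<lambda>v. pure_tensor K V W v w" v]
  by (simp add: balanced_def)

lemma pure_zero_left: "w \<in> carrier W \<Longrightarrow> pure_tensor K V W \<zero>\<^bsub>V\<^esub> w = \<zero>\<^bsub>G\<^esub>"
  using balanced_pure additive_map_zero[OF _ V G_abelian, of "\<lambda>v. pure_tensor K V W v w"]
  by (simp add: balanced_def)

lemma tensor_induct [consumes 1, case_names pure add]:
  assumes "x \<in> carrier G"
    and pure: "\<And>v w. v \<in> carrier V \<Longrightarrow> w \<in> carrier W \<Longrightarrow> Q (pure_tensor K V W v w)"
    and add: "\<And>x y. x \<in> carrier G \<Longrightarrow> y \<in> carrier G \<Longrightarrow> Q x \<Longrightarrow> Q y \<Longrightarrow> Q (x \<oplus>\<^bsub>G\<^esub> y)"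
  shows "Q x"
proof -
  obtain a where a: "a \<in> carrier F" "x = proj a"
    using assms(1) by (auto simp: G_simps carrier_FactGroup)
  have "Poly_Mapping.keys a \<subseteq> S" using a by simp
  then have "Q (proj a) \<and> Q (\<ominus>\<^bsub>G\<^esub> proj a)"
  proof (rule free_Abelian_group_induct[of a S], goal_cases)
    case 1
    have "Q \<zero>\<^bsub>G\<^esub>" using pure[of "\<zero>\<^bsub>V\<^esub>" "\<zero>\<^bsub>W\<^esub>"] pure_zero_left[of "\<zero>\<^bsub>W\<^esub>"] by simp
    then show ?case by (simp add: proj_zero G.a_inv_zero)
  next
    case (2 x y)
    then have c: "proj x \<in> carrier G" "proj y \<in> carrier G" by (auto intro!: proj_closed)
    have "proj (x - y) = proj x \<oplus>\<^bsub>G\<^esub> \<ominus>\<^bsub>G\<^esub> proj y" using 2 by (simp add: proj_diff G.minus_eq)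
    moreover have "\<ominus>\<^bsub>G\<^esub> (proj x \<oplus>\<^bsub>G\<^esub> \<ominus>\<^bsub>G\<^esub> proj y) = \<ominus>\<^bsub>G\<^esub> proj x \<oplus>\<^bsub>G\<^esub> proj y"
      using c by (simp add: G.minus_add)
    ultimately show ?case using 2 c add by simp
  next
    case (3 p)
    then obtain v w where p: "p = (v, w)" "v \<in> carrier V" "w \<in> carrier W" by auto
    then show ?case using pure[of v w] pure[of "\<ominus>\<^bsub>V\<^esub> v" w] pure_minus[of v w]
      by (simp add: pure_tensor_proj)
  qed
  then show ?thesis using a by simp
qed

lemma additive_maps_eq:
  assumes "additive_map G P f" "additive_map G P g" "x \<in> carrier G"
    and "\<And>v w. v \<in> carrier V \<Longrightarrow> w \<in> carrier W \<Longrightarrow> f (pure_tensor K V W v w) = g (pure_tensor K V W v w)"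
  shows "f x = g x"
  using assms(3) by (induction rule: tensor_induct) (use assms in \<open>auto simp: additive_mapD\<close>)

context
  fixes P :: "('p, 'm) ring_scheme" and f
  assumes P: "abelian_group P" and f: "balanced K V W P f"
begin

interpretation P: abelian_group P by (rule P)

text \<open>
  The extension of \<open>f\<close> to the free group. It kills the tensor relations, so its value does not depend
  on the representative that \<open>tensor_lift\<close> picks from a coset.
\<close>

definition free_lift :: "('a \<times> 'b \<Rightarrow>\<^sub>0 int) \<Rightarrow> 'p" where
  "free_lift x = (\<Oplus>\<^bsub>P\<^esub>k\<in>Poly_Mapping.keys x. [Poly_Mapping.lookup x k] \<cdot>\<^bsub>P\<^esub> f (fst k) (snd k))"

lemma fcl: "k \<in> S \<Longrightarrow> f (fst k) (snd k) \<in> carrier P"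
  using balancedD(1)[OF f] by auto

lemma free_lift_closed: "x \<in> carrier F \<Longrightarrow> free_lift x \<in> carrier P"
  unfolding free_lift_def using fcl by (intro P.finsum_closed) auto

lemma free_lift_superset:
  assumes "finite T" "Poly_Mapping.keys x \<subseteq> T" "T \<subseteq> S"
  shows "free_lift x = (\<Oplus>\<^bsub>P\<^esub>k\<in>T. [Poly_Mapping.lookup x k] \<cdot>\<^bsub>P\<^esub> f (fst k) (snd k))"
  unfolding free_lift_def
proof (rule P.add.finprod_mono_neutral_cong_left)
  show "[Poly_Mapping.lookup x k] \<cdot>\<^bsub>P\<^esub> f (fst k) (snd k) = \<zero>\<^bsub>P\<^esub>" if "k \<in> T - Poly_Mapping.keys x" for k
    using that P.int_mult_zero by (auto simp: in_keys_iff)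
  show "(\<lambda>k. [Poly_Mapping.lookup x k] \<cdot>\<^bsub>P\<^esub> f (fst k) (snd k)) \<in> T \<rightarrow> carrier P"
    using assms fcl by (intro funcsetI P.int_mult_closed fcl) blast
qed (use assms in auto)

lemma free_lift_add:
  assumes "x \<in> carrier F" "y \<in> carrier F"
  shows "free_lift (x + y) = free_lift x \<oplus>\<^bsub>P\<^esub> free_lift y"
proof -
  let ?T = "Poly_Mapping.keys x \<union> Poly_Mapping.keys y"
  have T: "finite ?T" "?T \<subseteq> S" using assms by auto
  have "free_lift (x + y) = (\<Oplus>\<^bsub>P\<^esub>k\<in>?T. [Poly_Mapping.lookup (x + y) k] \<cdot>\<^bsub>P\<^esub> f (fst k) (snd k))"
    using T keys_add[of x y] by (intro free_lift_superset) auto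
  also have "\<dots> = (\<Oplus>\<^bsub>P\<^esub>k\<in>?T. [Poly_Mapping.lookup x k] \<cdot>\<^bsub>P\<^esub> f (fst k) (snd k) \<oplus>\<^bsub>P\<^esub> [Poly_Mapping.lookup y k] \<cdot>\<^bsub>P\<^esub> f (fst k) (snd k))"
  proof (intro P.finsum_cong' refl, goal_cases)
    case 1
    then show ?case using T fcl by auto
  next
    case (2 k)
    then show ?case using T fcl[of k] by (auto simp: lookup_add P.add.int_pow_mult)
  qed
  also have "\<dots> = free_lift x \<oplus>\<^bsub>P\<^esub> free_lift y"
  proof -
    have cl: "(\<lambda>k. [Poly_Mapping.lookup z k] \<cdot>\<^bsub>P\<^esub> f (fst k) (snd k)) \<in> ?T \<rightarrow> carrier P" for z :: "'a \<times> 'b \<Rightarrow>\<^sub>0 int"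
      using T fcl by (intro funcsetI P.int_mult_closed fcl) blast
    show ?thesis
      unfolding free_lift_superset[OF T(1) Un_upper1 T(2)] free_lift_superset[OF T(1) Un_upper2 T(2)]
      by (rule P.finsum_addf[OF cl cl])
  qed
  finally show ?thesis .
qed

lemma free_lift_of: "p \<in> S \<Longrightarrow> free_lift (frag_of p) = f (fst p) (snd p)"
  unfolding free_lift_def using fcl[of p] by (simp add: P.add.int_pow_1)

lemma free_lift_hom: "group_hom F (add_monoid P) free_lift"
  by (rule group_hom.intro[OF group_free_Abelian_group P.a_group])
    (auto simp: group_hom_axioms_def hom_def free_lift_closed free_lift_add
      simp del: carrier_free_Abelian_group_iff)

lemma free_lift_diff:
  assumes "x \<in> carrier F" "y \<in> carrier F"
  shows "free_lift (x - y) = free_lift x \<ominus>\<^bsub>P\<^esub> free_lift y"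
proof -
  have c: "x - y \<in> carrier F" using keys_diff_le[of x y] assms by simp
  have "free_lift (x - y) \<oplus>\<^bsub>P\<^esub> free_lift y = free_lift x"
    using free_lift_add[OF c assms(2)] by simp
  then show ?thesis using free_lift_closed[OF c] free_lift_closed[OF assms(1)] free_lift_closed[OF assms(2)]
    by (metis P.add.inv_solve_right P.minus_eq)
qed

lemma free_lift_relations:
  assumes "x \<in> N"
  shows "free_lift x = \<zero>\<^bsub>P\<^esub>"
proof -
  interpret h: group_hom F "add_monoid P" free_lift by (rule free_lift_hom)
  have cl: "a \<oplus>\<^bsub>P\<^esub> b \<ominus>\<^bsub>P\<^esub> a \<ominus>\<^bsub>P\<^esub> b = \<zero>\<^bsub>P\<^esub>" if "a \<in> carrier P" "b \<in> carrier P" for a b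
    using that P.r_neg[of "a \<oplus>\<^bsub>P\<^esub> b"] by (simp add: P.minus_eq P.minus_add P.a_assoc)
  have "free_lift x = \<zero>\<^bsub>P\<^esub>" if "x \<in> gens" for x
    using that unfolding gens_def
  proof (elim UnE CollectE exE conjE, goal_cases)
    case (1 v v' w)
    have c: "frag_of (v \<oplus>\<^bsub>V\<^esub> v', w) - frag_of (v, w) \<in> carrier F"
      using 1 keys_diff_le[of "frag_of (v \<oplus>\<^bsub>V\<^esub> v', w)" "frag_of (v, w)"] by simp
    show ?case unfolding 1(1) using 1 balancedD(1,2)[OF f]
      by (simp add: free_lift_diff[OF c] free_lift_diff free_lift_of cl del: carrier_free_Abelian_group_iff)
  next
    case (2 v w w')
    have c: "frag_of (v, w \<oplus>\<^bsub>W\<^esub> w') - frag_of (v, w) \<in> carrier F"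
      using 2 keys_diff_le[of "frag_of (v, w \<oplus>\<^bsub>W\<^esub> w')" "frag_of (v, w)"] by simp
    show ?case unfolding 2(1) using 2 balancedD(1,3)[OF f]
      by (simp add: free_lift_diff[OF c] free_lift_diff free_lift_of cl del: carrier_free_Abelian_group_iff)
  next
    case (3 k v w)
    then show ?case using balancedD(1)[OF f, of v "k \<odot>\<^bsub>W\<^esub> w"] balancedD(4)[OF f, of k v w] smultV[of k v] smultW[of k w]
      by (simp add: free_lift_diff free_lift_of P.minus_eq_zero_iff)
  qed
  then have "gens \<subseteq> kernel F (add_monoid P) free_lift"
    using gens_carrier by (auto simp: kernel_def simp del: carrier_free_Abelian_group_iff)
  then have "N \<subseteq> kernel F (add_monoid P) free_lift"
    unfolding N_eq by (intro group.generate_subgroup_incl group_free_Abelian_group h.subgroup_kernel)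
  then show ?thesis using assms by (auto simp: kernel_def)
qed

lemma tensor_lift_proj:
  assumes "x \<in> carrier F"
  shows "tensor_lift P f (proj x) = free_lift x"
proof -
  have "x \<in> proj x" using group.rcos_self[OF group_free_Abelian_group assms N_subgroup] .
  then have "(SOME y. y \<in> proj x) \<in> proj x" by (rule someI)
  then obtain n where n: "n \<in> N" "(SOME y. y \<in> proj x) = n + x" by (auto simp: r_coset_def)
  have "n \<in> carrier F" using n subgroup.subset[OF N_subgroup] by blast
  then have "free_lift (n + x) = free_lift x"
    using free_lift_add[OF _ assms, of n] free_lift_relations[OF n(1)] free_lift_closed[OF assms] by simp
  moreover have "tensor_lift P f (proj x) = free_lift (SOME y. y \<in> proj x)"
    by (simp add: tensor_lift_def free_lift_def Let_def)
  ultimately show ?thesis using n by simp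
qed

lemma tensor_lift_pure:
  assumes "v \<in> carrier V" "w \<in> carrier W"
  shows "tensor_lift P f (pure_tensor K V W v w) = f v w"
  using tensor_lift_proj[of "frag_of (v, w)"] free_lift_of[of "(v, w)"] assms by (simp add: pure_tensor_proj)

lemma additive_map_tensor_lift: "additive_map G P (tensor_lift P f)"
proof (rule additive_mapI)
  fix x assume "x \<in> carrier G"
  then show "tensor_lift P f x \<in> carrier P"
    by (auto simp: G_simps carrier_FactGroup tensor_lift_proj free_lift_closed simp del: carrier_free_Abelian_group_iff)
next
  fix x y assume "x \<in> carrier G" "y \<in> carrier G"
  then obtain a b where ab: "a \<in> carrier F" "b \<in> carrier F" "x = proj a" "y = proj b"
    by (auto simp: G_simps carrier_FactGroup simp del: carrier_free_Abelian_group_iff)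
  have c: "a + b \<in> carrier F" using ab keys_add[of a b] by auto
  have "x \<oplus>\<^bsub>G\<^esub> y = proj (a + b)" using ab proj_add by simp
  then show "tensor_lift P f (x \<oplus>\<^bsub>G\<^esub> y) = tensor_lift P f x \<oplus>\<^bsub>P\<^esub> tensor_lift P f y"
    using ab c by (simp add: tensor_lift_proj free_lift_add del: carrier_free_Abelian_group_iff)
qed

end

end

text \<open>
  The action of the coefficient ring on a complexification and the product of two complexified tensors
  are both computed by a lift inside a lift. Such a map is additive in both tensors as soon as \<open>F\<close> is
  balanced in each of its two pairs of arguments.
\<close>

lemma nested_lift:
  assumes T1: "tensor_pair K1 A B" and T2: "tensor_pair K2 C D" and P: "abelian_group P"
    and F2: "\<And>a b. a \<in> carrier A \<Longrightarrow> b \<in> carrier B \<Longrightarrow> balanced K2 C D P (F a b)"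
    and F1: "\<And>c d. c \<in> carrier C \<Longrightarrow> d \<in> carrier D \<Longrightarrow> balanced K1 A B P (\<lambda>a b. F a b c d)"
  defines "h \<equiv> \<lambda>r x. tensor_lift P (\<lambda>a b. tensor_lift P (F a b) x) r"
  shows "x \<in> carrier (tensor_group K2 C D) \<Longrightarrow> additive_map (tensor_group K1 A B) P (\<lambda>r. h r x)"
    and "r \<in> carrier (tensor_group K1 A B) \<Longrightarrow> additive_map (tensor_group K2 C D) P (h r)"
    and "a \<in> carrier A \<Longrightarrow> b \<in> carrier B \<Longrightarrow> c \<in> carrier C \<Longrightarrow> d \<in> carrier D \<Longrightarrow>
      h (pure_tensor K1 A B a b) (pure_tensor K2 C D c d) = F a b c d"
proof -
  interpret P: abelian_group P by (rule P)
  note A = tensor_pair.V[OF T1] and B = tensor_pair.W[OF T1]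
  note sA = tensor_pair.smultV[OF T1] and sB = tensor_pair.smultW[OF T1]
  note ab1 = tensor_pair.G_abelian[OF T1] and ab2 = tensor_pair.G_abelian[OF T2]
  have aA: "a \<oplus>\<^bsub>A\<^esub> a' \<in> carrier A" if "a \<in> carrier A" "a' \<in> carrier A" for a a'
    using that abelian_groupE(1)[OF A] by blast
  have aB: "b \<oplus>\<^bsub>B\<^esub> b' \<in> carrier B" if "b \<in> carrier B" "b' \<in> carrier B" for b b'
    using that abelian_groupE(1)[OF B] by blast
  define l where "l a b = tensor_lift P (F a b)" for a b
  have l: "additive_map (tensor_group K2 C D) P (l a b)" if "a \<in> carrier A" "b \<in> carrier B" for a b
    unfolding l_def using that F2 by (intro tensor_pair.additive_map_tensor_lift[OF T2 P])
  have lp: "l a b (pure_tensor K2 C D c d) = F a b c d"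
    if "a \<in> carrier A" "b \<in> carrier B" "c \<in> carrier C" "d \<in> carrier D" for a b c d
    unfolding l_def using that F2 by (intro tensor_pair.tensor_lift_pure[OF T2 P])
  have add_l: "additive_map (tensor_group K2 C D) P (\<lambda>x. l a b x \<oplus>\<^bsub>P\<^esub> l a' b' x)"
    if "a \<in> carrier A" "b \<in> carrier B" "a' \<in> carrier A" "b' \<in> carrier B" for a b a' b'
    using additive_mapD[OF l[OF that(1,2)]] additive_mapD[OF l[OF that(3,4)]]
    by (intro additive_mapI) (simp_all add: P.a_ac)
  have bal: "balanced K1 A B P (\<lambda>a b. l a b x)" if x: "x \<in> carrier (tensor_group K2 C D)" for x
  proof (rule balancedI, goal_cases)
    case (1 v w)
    then show ?case using additive_mapD(1)[OF l x] by blast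
  next
    case (2 v v' w)
    show ?case
      using 2 balancedD(2)[OF F1] aA
      by (intro tensor_pair.additive_maps_eq[OF T2 l add_l x]) (simp_all add: lp)
  next
    case (3 v w w')
    show ?case
      using 3 balancedD(3)[OF F1] aB
      by (intro tensor_pair.additive_maps_eq[OF T2 l add_l x]) (simp_all add: lp)
  next
    case (4 k v w)
    show ?case
      using 4 balancedD(4)[OF F1] sA sB
      by (intro tensor_pair.additive_maps_eq[OF T2 l l x]) (simp_all add: lp)
  qed
  have h: "h = (\<lambda>r x. tensor_lift P (\<lambda>a b. l a b x) r)" by (simp add: h_def l_def)
  show 1: "additive_map (tensor_group K1 A B) P (\<lambda>r. h r x)"
    if "x \<in> carrier (tensor_group K2 C D)" for x
    unfolding h using that by (intro tensor_pair.additive_map_tensor_lift[OF T1 P] bal)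
  have hp: "h (pure_tensor K1 A B a b) x = l a b x"
    if "a \<in> carrier A" "b \<in> carrier B" "x \<in> carrier (tensor_group K2 C D)" for a b x
    unfolding h using that by (intro tensor_pair.tensor_lift_pure[OF T1 P] bal)
  show "h (pure_tensor K1 A B a b) (pure_tensor K2 C D c d) = F a b c d"
    if "a \<in> carrier A" "b \<in> carrier B" "c \<in> carrier C" "d \<in> carrier D"
    using that tensor_pair.pure_closed[OF T2] by (simp add: hp lp)
  show "additive_map (tensor_group K2 C D) P (h r)" if r: "r \<in> carrier (tensor_group K1 A B)"
  proof (rule additive_mapI)
    show "h r x \<in> carrier P" if "x \<in> carrier (tensor_group K2 C D)" for x
      using additive_mapD(1)[OF 1[OF that] r] .
    show "h r (x \<oplus>\<^bsub>tensor_group K2 C D\<^esub> y) = h r x \<oplus>\<^bsub>P\<^esub> h r y"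
      if xy: "x \<in> carrier (tensor_group K2 C D)" "y \<in> carrier (tensor_group K2 C D)" for x y
    proof -
      have xy': "x \<oplus>\<^bsub>tensor_group K2 C D\<^esub> y \<in> carrier (tensor_group K2 C D)"
        using abelian_groupE(1)[OF ab2] xy by blast
      have "additive_map (tensor_group K1 A B) P (\<lambda>r. h r x \<oplus>\<^bsub>P\<^esub> h r y)"
        using additive_mapD[OF 1[OF xy(1)]] additive_mapD[OF 1[OF xy(2)]]
        by (intro additive_mapI) (simp_all add: P.a_ac)
      then show ?thesis
        using xy xy' additive_mapD(2)[OF l]
        by (intro tensor_pair.additive_maps_eq[OF T1 1[OF xy'] _ r]) (simp_all add: hp)
    qed
  qed
qed


section \<open>Subfields of the complex numbers\<close>

lemma scalars_simps [simp]:
  "carrier (scalars S) = S" "x \<otimes>\<^bsub>scalars S\<^esub> y = x * y" "\<one>\<^bsub>scalars S\<^esub> = 1" "\<zero>\<^bsub>scalars S\<^esub> = 0"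
  "x \<oplus>\<^bsub>scalars S\<^esub> y = x + y" "x \<odot>\<^bsub>scalars S\<^esub> y = x * y"
  by (simp_all add: scalars_def)

lemma field_CC: "field CC"
proof -
  have "cring CC"
  proof (rule cringI)
    show "abelian_group CC"
      by (rule abelian_groupI) (auto simp: algebra_simps intro: exI[of _ "- x" for x])
    show "comm_monoid CC" by (rule comm_monoidI) (auto simp: algebra_simps)
  qed (simp add: algebra_simps)
  moreover have "Units CC = carrier CC - {\<zero>\<^bsub>CC\<^esub>}"
    by (auto simp: Units_def) (metis left_inverse right_inverse)
  ultimately show ?thesis by (rule cring.cring_fieldI)
qed

lemma subfield_closed:
  assumes "subfield E CC"
  shows "0 \<in> E" "1 \<in> E" "x \<in> E \<Longrightarrow> y \<in> E \<Longrightarrow> x + y \<in> E" "x \<in> E \<Longrightarrow> y \<in> E \<Longrightarrow> x * y \<in> E"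
    "x \<in> E \<Longrightarrow> - x \<in> E" "x \<in> E \<Longrightarrow> inverse x \<in> E" "x \<in> E \<Longrightarrow> y \<in> E \<Longrightarrow> x - y \<in> E"
    "x \<in> E \<Longrightarrow> y \<in> E \<Longrightarrow> x / y \<in> E" "\<rat> \<subseteq> E"
proof -
  interpret CC: field CC by (rule field_CC)
  note sub = subringE[OF subfieldE(1)[OF assms]]
  show 0: "0 \<in> E" "1 \<in> E" "\<And>x y. x \<in> E \<Longrightarrow> y \<in> E \<Longrightarrow> x + y \<in> E" "\<And>x y. x \<in> E \<Longrightarrow> y \<in> E \<Longrightarrow> x * y \<in> E"
    using sub by simp_all
  have "\<ominus>\<^bsub>CC\<^esub> x = - x" for x :: complex by (rule CC.minus_equality) auto
  then show m: "\<And>x. x \<in> E \<Longrightarrow> - x \<in> E" using sub(5) by simp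
  show i: "\<And>x. x \<in> E \<Longrightarrow> inverse x \<in> E"
  proof -
    fix x assume x: "x \<in> E"
    show "inverse x \<in> E"
    proof (cases "x = 0")
      case False
      then have "inv\<^bsub>CC\<^esub> x \<in> E" using CC.subfield_m_inv(1)[OF assms, of x] x by simp
      moreover have "inv\<^bsub>CC\<^esub> x = inverse x"
        using False by (intro CC.comm_inv_char) auto
      ultimately show ?thesis by simp
    qed (use 0 in simp)
  qed
  show "\<And>x y. x \<in> E \<Longrightarrow> y \<in> E \<Longrightarrow> x - y \<in> E" using 0 m by (metis diff_conv_add_uminus)
  show "\<And>x y. x \<in> E \<Longrightarrow> y \<in> E \<Longrightarrow> x / y \<in> E" using 0 i by (simp add: divide_inverse)
  have nat: "of_nat n \<in> E" for n by (induction n) (use 0 in auto)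
  have int: "of_int n \<in> E" for n using nat m by (cases n rule: int_cases2) auto
  show "\<rat> \<subseteq> E"
  proof
    fix x :: complex assume "x \<in> \<rat>"
    then obtain a b where "x = of_int a / of_int b" by (auto elim: Rats_cases')
    then show "x \<in> E" using int 0 i by (auto simp: divide_inverse)
  qed
qed

lemma subfield_UNIV: "subfield UNIV CC"
  using field.carrier_is_subfield[OF field_CC] by simp

lemma cring_scalars:
  assumes "subfield E CC"
  shows "cring (scalars E)"
proof (rule cringI)
  show "abelian_group (scalars E)"
    by (rule abelian_groupI) (auto simp: algebra_simps subfield_closed[OF assms] intro!: bexI[of _ "- x" for x])
  show "comm_monoid (scalars E)"
    by (rule comm_monoidI) (auto simp: algebra_simps subfield_closed[OF assms])
qed (simp add: algebra_simps)

lemma abelian_group_scalars: "subfield E CC \<Longrightarrow> abelian_group (scalars E)"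
  using cring.axioms(1)[OF cring_scalars] ring.axioms(1) by blast

lemma module_scalars: "subfield E CC \<Longrightarrow> module (scalars E) (scalars E)"
  by (rule moduleI) (auto intro: cring_scalars abelian_group_scalars simp: subfield_closed algebra_simps)

lemma finsum_scalars:
  assumes "subfield E CC" "\<And>i. i \<in> I \<Longrightarrow> f i \<in> E"
  shows "finsum (scalars E) f I = sum f I"
proof -
  interpret abelian_group "scalars E" by (rule abelian_group_scalars[OF assms(1)])
  show ?thesis using assms(2)
    by (induction I rule: infinite_finite_induct) (auto simp: Pi_def)
qed

lemma module_restrict_scalars:
  assumes "module (scalars L) V" "subfield E CC" "E \<subseteq> L"
  shows "module (scalars E) V"
proof -
  interpret V: module "scalars L" V by fact
  show ?thesis
    using assms V.smult_l_distr V.smult_r_distr V.smult_assoc1 V.smult_one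
    by (intro moduleI cring_scalars V.abelian_group_axioms) (auto simp: subset_iff)
qed


section \<open>Linear and semilinear maps\<close>

definition semilinear ::
  "('r, 'm) ring_scheme \<Rightarrow> ('r \<Rightarrow> 's) \<Rightarrow> ('r, 'a, 'k) module_scheme \<Rightarrow> ('s, 'b, 'l) module_scheme \<Rightarrow> ('a \<Rightarrow> 'b) \<Rightarrow> bool" where
  "semilinear R \<phi> M N f \<longleftrightarrow> additive_map M N f \<and>
     (\<forall>r\<in>carrier R. \<forall>x\<in>carrier M. f (r \<odot>\<^bsub>M\<^esub> x) = \<phi> r \<odot>\<^bsub>N\<^esub> f x)"

abbreviation linear_map where
  "linear_map R \<equiv> semilinear R (\<lambda>r. r)"

lemma semilinearD:
  assumes "semilinear R \<phi> M N f"
  shows "additive_map M N f" "x \<in> carrier M \<Longrightarrow> f x \<in> carrier N"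
    "x \<in> carrier M \<Longrightarrow> y \<in> carrier M \<Longrightarrow> f (x \<oplus>\<^bsub>M\<^esub> y) = f x \<oplus>\<^bsub>N\<^esub> f y"
    "r \<in> carrier R \<Longrightarrow> x \<in> carrier M \<Longrightarrow> f (r \<odot>\<^bsub>M\<^esub> x) = \<phi> r \<odot>\<^bsub>N\<^esub> f x"
  using assms by (auto simp: semilinear_def additive_map_def)

lemma semilinearI:
  assumes "\<And>x. x \<in> carrier M \<Longrightarrow> f x \<in> carrier N"
    "\<And>x y. x \<in> carrier M \<Longrightarrow> y \<in> carrier M \<Longrightarrow> f (x \<oplus>\<^bsub>M\<^esub> y) = f x \<oplus>\<^bsub>N\<^esub> f y"
    "\<And>r x. r \<in> carrier R \<Longrightarrow> x \<in> carrier M \<Longrightarrow> f (r \<odot>\<^bsub>M\<^esub> x) = \<phi> r \<odot>\<^bsub>N\<^esub> f x"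
  shows "semilinear R \<phi> M N f"
  using assms by (auto simp: semilinear_def additive_map_def)

lemma semilinear_comp:
  assumes "semilinear R \<phi> M N f" "semilinear S \<psi> N P g" "\<phi> \<in> carrier R \<rightarrow> carrier S"
  shows "semilinear R (\<lambda>r. \<psi> (\<phi> r)) M P (\<lambda>x. g (f x))"
  using semilinearD[OF assms(1)] semilinearD[OF assms(2)] assms(3)
  by (intro semilinearI) (auto simp: Pi_iff)

lemma linear_map_comp:
  assumes "linear_map R M N f" "linear_map R N P g"
  shows "linear_map R M P (\<lambda>x. g (f x))"
  using semilinear_comp[OF assms] by simp

definition lincomb :: "('r, 'a, 'k) module_scheme \<Rightarrow> 'i set \<Rightarrow> ('i \<Rightarrow> 'r) \<Rightarrow> ('i \<Rightarrow> 'a) \<Rightarrow> 'a" where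
  "lincomb M I c b = (\<Oplus>\<^bsub>M\<^esub>i\<in>I. c i \<odot>\<^bsub>M\<^esub> b i)"

definition spans :: "('r, 'm) ring_scheme \<Rightarrow> ('r, 'a, 'k) module_scheme \<Rightarrow> 'i set \<Rightarrow> ('i \<Rightarrow> 'a) \<Rightarrow> bool" where
  "spans R M I b \<longleftrightarrow> finite I \<and> b \<in> I \<rightarrow> carrier M \<and>
     (\<forall>x\<in>carrier M. \<exists>c\<in>I \<rightarrow> carrier R. x = lincomb M I c b)"

text \<open>
  A basis is carried together with its coordinate functionals, since functionals, unlike uniqueness of
  coordinates, can be extended along tensor products and complexifications. \<open>R1\<close> is \<open>R\<close> as a module
  over itself; it is a separate argument because the ring \<open>E \<otimes> \<complex>\<close> and that module are different records.
\<close>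

definition dual_basis ::
  "('r, 'm) ring_scheme \<Rightarrow> ('r, 'a, 'k) module_scheme \<Rightarrow> ('r, 'r, 'l) module_scheme \<Rightarrow> 'i set \<Rightarrow> ('i \<Rightarrow> 'a) \<Rightarrow> ('i \<Rightarrow> 'a \<Rightarrow> 'r) \<Rightarrow> bool" where
  "dual_basis R M R1 I b \<eta> \<longleftrightarrow> finite I \<and> b \<in> I \<rightarrow> carrier M \<and>
     (\<forall>i\<in>I. linear_map R M R1 (\<eta> i)) \<and>
     (\<forall>i\<in>I. \<forall>j\<in>I. \<eta> i (b j) = (if i = j then \<one>\<^bsub>R\<^esub> else \<zero>\<^bsub>R\<^esub>)) \<and>
     (\<forall>x\<in>carrier M. x = lincomb M I (\<lambda>i. \<eta> i x) b)"

context module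
begin

lemma abelian_group_M: "abelian_group M" by unfold_locales

lemma lincomb_closed:
  assumes "c \<in> I \<rightarrow> carrier R" "b \<in> I \<rightarrow> carrier M"
  shows "lincomb M I c b \<in> carrier M"
  unfolding lincomb_def using assms by (intro M.finsum_closed) auto

lemma lincomb_cong:
  assumes "\<And>i. i \<in> I \<Longrightarrow> c i = c' i" "\<And>i. i \<in> I \<Longrightarrow> b i = b' i" "c' \<in> I \<rightarrow> carrier R" "b' \<in> I \<rightarrow> carrier M"
  shows "lincomb M I c b = lincomb M I c' b'"
  unfolding lincomb_def using assms by (intro M.finsum_cong') auto

lemma lincomb_add:
  assumes "c \<in> I \<rightarrow> carrier R" "c' \<in> I \<rightarrow> carrier R" "b \<in> I \<rightarrow> carrier M"
  shows "lincomb M I c b \<oplus>\<^bsub>M\<^esub> lincomb M I c' b = lincomb M I (\<lambda>i. c i \<oplus> c' i) b"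
proof -
  have "lincomb M I (\<lambda>i. c i \<oplus> c' i) b = (\<Oplus>\<^bsub>M\<^esub>i\<in>I. c i \<odot>\<^bsub>M\<^esub> b i \<oplus>\<^bsub>M\<^esub> c' i \<odot>\<^bsub>M\<^esub> b i)"
    unfolding lincomb_def using assms by (intro M.finsum_cong') (auto simp: smult_l_distr Pi_iff)
  also have "\<dots> = lincomb M I c b \<oplus>\<^bsub>M\<^esub> lincomb M I c' b"
    unfolding lincomb_def using assms by (intro M.finsum_addf) auto
  finally show ?thesis by simp
qed

lemma lincomb_smult:
  assumes "finite I" "c \<in> I \<rightarrow> carrier R" "b \<in> I \<rightarrow> carrier M" "r \<in> carrier R"
  shows "r \<odot>\<^bsub>M\<^esub> lincomb M I c b = lincomb M I (\<lambda>i. r \<otimes> c i) b"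
proof -
  have "r \<odot>\<^bsub>M\<^esub> lincomb M I c b = (\<Oplus>\<^bsub>M\<^esub>i\<in>I. r \<odot>\<^bsub>M\<^esub> (c i \<odot>\<^bsub>M\<^esub> b i))"
    unfolding lincomb_def using assms by (intro finsum_smult_ldistr) auto
  also have "\<dots> = lincomb M I (\<lambda>i. r \<otimes> c i) b"
    unfolding lincomb_def using assms by (intro M.finsum_cong') (auto simp: smult_assoc1 Pi_iff)
  finally show ?thesis .
qed

lemma finsum_smult_rdistr:
  assumes "finite I" "c \<in> I \<rightarrow> carrier R" "x \<in> carrier M"
  shows "(\<Oplus>i\<in>I. c i) \<odot>\<^bsub>M\<^esub> x = (\<Oplus>\<^bsub>M\<^esub>i\<in>I. c i \<odot>\<^bsub>M\<^esub> x)"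
  using assms(1,2)
proof (induction I)
  case (insert i I)
  then show ?case using assms(3) by (simp add: smult_l_distr Pi_iff R.finsum_closed)
qed (use assms(3) in simp)

lemma lincomb_lincomb:
  assumes "finite I" "finite J" "c \<in> J \<rightarrow> carrier R" "\<And>i j. i \<in> I \<Longrightarrow> j \<in> J \<Longrightarrow> u i j \<in> carrier R" "b \<in> I \<rightarrow> carrier M"
  shows "lincomb M J c (\<lambda>j. lincomb M I (\<lambda>i. u i j) b) = lincomb M I (\<lambda>i. \<Oplus>j\<in>J. u i j \<otimes> c j) b"
proof -
  have "lincomb M J c (\<lambda>j. lincomb M I (\<lambda>i. u i j) b) = (\<Oplus>\<^bsub>M\<^esub>j\<in>J. \<Oplus>\<^bsub>M\<^esub>i\<in>I. (u i j \<otimes> c j) \<odot>\<^bsub>M\<^esub> b i)"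
    unfolding lincomb_def[of M J]
  proof (intro M.finsum_cong' refl, goal_cases)
    case 1
    then show ?case using assms by (auto intro!: M.finsum_closed simp: Pi_iff)
  next
    case (2 j)
    then show ?case using assms
      by (subst lincomb_smult) (auto simp: Pi_iff lincomb_def m_comm intro!: M.finsum_cong')
  qed
  also have "\<dots> = (\<Oplus>\<^bsub>M\<^esub>i\<in>I. \<Oplus>\<^bsub>M\<^esub>j\<in>J. (u i j \<otimes> c j) \<odot>\<^bsub>M\<^esub> b i)"
    using assms by (intro M.finsum_swap) (auto simp: Pi_iff)
  also have "\<dots> = lincomb M I (\<lambda>i. \<Oplus>j\<in>J. u i j \<otimes> c j) b"
    unfolding lincomb_def using assms
    by (intro M.finsum_cong' finsum_smult_rdistr[symmetric]) (auto intro!: M.finsum_closed simp: Pi_iff)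
  finally show ?thesis .
qed

lemma lincomb_single:
  assumes "finite I" "i \<in> I" "b \<in> I \<rightarrow> carrier M"
  shows "lincomb M I (\<lambda>j. if j = i then \<one> else \<zero>) b = b i"
proof -
  have "lincomb M I (\<lambda>j. if j = i then \<one> else \<zero>) b = (\<Oplus>\<^bsub>M\<^esub>j\<in>I. if i = j then b j else \<zero>\<^bsub>M\<^esub>)"
    unfolding lincomb_def using assms by (intro M.finsum_cong') (auto simp: Pi_iff)
  also have "\<dots> = b i" using assms by (intro M.finsum_singleton) auto
  finally show ?thesis .
qed

lemma linear_map_lincomb:
  assumes f: "semilinear R \<phi> M N f" and N: "module S N" and c: "c \<in> I \<rightarrow> carrier R" and b: "b \<in> I \<rightarrow> carrier M"
    and \<phi>: "\<phi> \<in> carrier R \<rightarrow> carrier S"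
  shows "f (lincomb M I c b) = lincomb N I (\<lambda>i. \<phi> (c i)) (\<lambda>i. f (b i))"
proof -
  interpret N: module S N by fact
  have "f (lincomb M I c b) = (\<Oplus>\<^bsub>N\<^esub>i\<in>I. f (c i \<odot>\<^bsub>M\<^esub> b i))"
    unfolding lincomb_def using c b
    by (intro additive_map_finsum[OF semilinearD(1)[OF f] abelian_group_M N.abelian_group_M]) auto
  also have "\<dots> = lincomb N I (\<lambda>i. \<phi> (c i)) (\<lambda>i. f (b i))"
    unfolding lincomb_def using semilinearD[OF f] c b \<phi> by (intro N.finsum_cong') (auto simp: Pi_iff)
  finally show ?thesis .
qed

lemma dual_basis_spans:
  assumes "dual_basis R M R1 I b \<eta>" "carrier R1 = carrier R"
  shows "spans R M I b"
  unfolding spans_def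
proof (intro conjI ballI)
  fix x assume x: "x \<in> carrier M"
  have "(\<lambda>i. \<eta> i x) \<in> I \<rightarrow> carrier R"
    using assms x by (auto simp: dual_basis_def dest: semilinearD(2))
  then show "\<exists>c\<in>I \<rightarrow> carrier R. x = lincomb M I c b" using assms x by (auto simp: dual_basis_def)
qed (use assms in \<open>auto simp: dual_basis_def\<close>)

lemma dual_basis_coord:
  assumes d: "dual_basis R M R1 I b \<eta>" and R1: "module R R1" "carrier R1 = carrier R" "zero R1 = zero R"
    "add R1 = add R" "smult R1 = mult R"
    and c: "c \<in> I \<rightarrow> carrier R" and i: "i \<in> I"
  shows "\<eta> i (lincomb M I c b) = c i"
proof -
  interpret R1: module R R1 by (rule R1)
  have fI: "finite I" "b \<in> I \<rightarrow> carrier M" and l: "linear_map R M R1 (\<eta> i)" using d i by (auto simp: dual_basis_def)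
  have "\<eta> i (lincomb M I c b) = lincomb R1 I c (\<lambda>j. \<eta> i (b j))"
    using linear_map_lincomb[OF l R1(1) c fI(2)] by simp
  also have "\<dots> = (\<Oplus>\<^bsub>R1\<^esub>j\<in>I. if i = j then c j else \<zero>\<^bsub>R1\<^esub>)"
    unfolding lincomb_def using d i c by (intro R1.finsum_cong') (auto simp: dual_basis_def R1 Pi_iff)
  also have "\<dots> = c i" using c i fI by (intro R1.finsum_singleton) (auto simp: R1)
  finally show ?thesis .
qed

end


lemma (in module) lincomb_reindex:
  assumes "bij_betw g K I" "c \<in> I \<rightarrow> carrier R" "b \<in> I \<rightarrow> carrier M"
  shows "lincomb M I c b = lincomb M K (\<lambda>k. c (g k)) (\<lambda>k. b (g k))"
proof -
  have "I = g ` K" "inj_on g K" using assms(1) by (auto simp: bij_betw_def)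
  then show ?thesis unfolding lincomb_def using assms
    by (simp only:) (rule M.finsum_reindex, auto simp: Pi_iff)
qed

lemma (in module) zero_in_submodule:
  assumes "submodule H R M"
  shows "\<zero>\<^bsub>M\<^esub> \<in> H"
  using submoduleE(1,2,3,5)[OF assms] by (metis M.r_neg all_not_in_conv subset_eq)

lemma (in module) mod_span_submodule:
  assumes "X \<subseteq> carrier M"
  shows "submodule (mod_span R M X) R M"
proof -
  have eq: "mod_span R M X = \<Inter>{H. submodule H R M \<and> X \<subseteq> H}" by (simp add: mod_span_def hull_def)
  have c: "carrier M \<in> {H. submodule H R M \<and> X \<subseteq> H}" using assms carrier_is_submodule by simp
  have z: "\<zero>\<^bsub>M\<^esub> \<in> H" if "submodule H R M" for H
    using submoduleE(1,2,3,5)[OF that] by (metis M.r_neg all_not_in_conv subset_eq)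
  show ?thesis unfolding eq
  proof (rule submoduleI)
    show "\<Inter>{H. submodule H R M \<and> X \<subseteq> H} \<subseteq> carrier M" using c by blast
  qed (use z submoduleE(3,4,5) in blast)+
qed

lemma (in module) zero_in_mod_span: "\<zero>\<^bsub>M\<^esub> \<in> mod_span R M X"
  using zero_in_submodule by (auto simp: mod_span_def hull_def)


section \<open>Modules of tensors\<close>

lemma module_smult_in:
  assumes "module (scalars L) V" "k \<in> L" "v \<in> carrier V"
  shows "k \<odot>\<^bsub>V\<^esub> v \<in> carrier V"
  using module.smult_closed[OF assms(1)] assms by simp

lemma module_scalarsD:
  assumes "module (scalars L) V"
  shows "abelian_group V"
    "a \<in> L \<Longrightarrow> b \<in> L \<Longrightarrow> x \<in> carrier V \<Longrightarrow> (a + b) \<odot>\<^bsub>V\<^esub> x = a \<odot>\<^bsub>V\<^esub> x \<oplus>\<^bsub>V\<^esub> b \<odot>\<^bsub>V\<^esub> x"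
    "a \<in> L \<Longrightarrow> x \<in> carrier V \<Longrightarrow> y \<in> carrier V \<Longrightarrow> a \<odot>\<^bsub>V\<^esub> (x \<oplus>\<^bsub>V\<^esub> y) = a \<odot>\<^bsub>V\<^esub> x \<oplus>\<^bsub>V\<^esub> a \<odot>\<^bsub>V\<^esub> y"
    "a \<in> L \<Longrightarrow> b \<in> L \<Longrightarrow> x \<in> carrier V \<Longrightarrow> (a * b) \<odot>\<^bsub>V\<^esub> x = a \<odot>\<^bsub>V\<^esub> (b \<odot>\<^bsub>V\<^esub> x)"
    "x \<in> carrier V \<Longrightarrow> 1 \<odot>\<^bsub>V\<^esub> x = x"
    "a \<in> L \<Longrightarrow> x \<in> carrier V \<Longrightarrow> a \<odot>\<^bsub>V\<^esub> x \<in> carrier V"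
    "x \<in> carrier V \<Longrightarrow> y \<in> carrier V \<Longrightarrow> x \<oplus>\<^bsub>V\<^esub> y \<in> carrier V"
    "\<zero>\<^bsub>V\<^esub> \<in> carrier V"
proof -
  interpret V: module "scalars L" V by fact
  show "abelian_group V" ..
  show "a \<in> L \<Longrightarrow> b \<in> L \<Longrightarrow> x \<in> carrier V \<Longrightarrow> (a + b) \<odot>\<^bsub>V\<^esub> x = a \<odot>\<^bsub>V\<^esub> x \<oplus>\<^bsub>V\<^esub> b \<odot>\<^bsub>V\<^esub> x"
    "a \<in> L \<Longrightarrow> x \<in> carrier V \<Longrightarrow> y \<in> carrier V \<Longrightarrow> a \<odot>\<^bsub>V\<^esub> (x \<oplus>\<^bsub>V\<^esub> y) = a \<odot>\<^bsub>V\<^esub> x \<oplus>\<^bsub>V\<^esub> a \<odot>\<^bsub>V\<^esub> y"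
    "a \<in> L \<Longrightarrow> b \<in> L \<Longrightarrow> x \<in> carrier V \<Longrightarrow> (a * b) \<odot>\<^bsub>V\<^esub> x = a \<odot>\<^bsub>V\<^esub> (b \<odot>\<^bsub>V\<^esub> x)"
    "x \<in> carrier V \<Longrightarrow> 1 \<odot>\<^bsub>V\<^esub> x = x"
    "a \<in> L \<Longrightarrow> x \<in> carrier V \<Longrightarrow> a \<odot>\<^bsub>V\<^esub> x \<in> carrier V"
    "x \<in> carrier V \<Longrightarrow> y \<in> carrier V \<Longrightarrow> x \<oplus>\<^bsub>V\<^esub> y \<in> carrier V"
    "\<zero>\<^bsub>V\<^esub> \<in> carrier V"
    using V.smult_l_distr[of a b x] V.smult_r_distr[of a x y] V.smult_assoc1[of a b x]
      V.smult_one[of x] V.smult_closed[of a x] by simp_all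
qed

lemma tensor_pairI:
  assumes "module (scalars L) V" "module (scalars L') W" "K \<subseteq> L" "K \<subseteq> L'"
  shows "tensor_pair K V W"
  using assms by (intro tensor_pair.intro) (auto intro: module_smult_in module_scalarsD)

lemma tensor_module_simps:
  "carrier (tensor_module K V W) = carrier (tensor_group K V W)"
  "add (tensor_module K V W) = add (tensor_group K V W)"
  "zero (tensor_module K V W) = zero (tensor_group K V W)"
  by (simp_all add: tensor_module_def Let_def)

lemma abelian_group_transfer:
  assumes "abelian_group G" "carrier H = carrier G" "add H = add G" "zero H = zero G"
  shows "abelian_group H"
  using abelian_groupE[OF assms(1)] by (intro abelian_groupI) (simp_all add: assms(2-4))

text \<open>
  \<open>L\<close> acts through the left factor. The case \<open>K = L\<close> is the tensor product over \<open>L\<close>; the case where the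
  left factor is \<open>L\<close> itself is the extension of coefficients from \<open>K\<close> to \<open>L\<close>.
\<close>

locale tensor_over =
  fixes L K :: "complex set" and V :: "(complex, 'a) module" and W :: "(complex, 'b) module"
  assumes L: "subfield L CC" and KL: "K \<subseteq> L" and V: "module (scalars L) V" and W: "module (scalars K) W"
begin

sublocale tp: tensor_pair K V W
  using KL by (intro tensor_pairI[OF V W]) auto

abbreviation "T \<equiv> tensor_module K V W"
abbreviation pt (infixl \<open>\<otimes>\<^sub>T\<close> 75) where "v \<otimes>\<^sub>T w \<equiv> pure_tensor K V W v w"

lemma T_abelian: "abelian_group T"
  by (rule abelian_group_transfer[OF tp.G_abelian]) (simp_all add: tensor_module_simps)

lemma T_balanced: "balanced K V W T pt"
  using tp.balanced_pure by (simp add: balanced_def additive_map_def tensor_module_simps)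

lemma pt_closed: "v \<in> carrier V \<Longrightarrow> w \<in> carrier W \<Longrightarrow> v \<otimes>\<^sub>T w \<in> carrier T"
  using balancedD(1)[OF T_balanced] .

lemmas pt_add_left = balancedD(2)[OF T_balanced]
  and pt_add_right = balancedD(3)[OF T_balanced]
  and pt_balanced = balancedD(4)[OF T_balanced]

lemma T_induct [consumes 1, case_names pure add]:
  assumes "x \<in> carrier T" "\<And>v w. v \<in> carrier V \<Longrightarrow> w \<in> carrier W \<Longrightarrow> Q (v \<otimes>\<^sub>T w)"
    "\<And>x y. x \<in> carrier T \<Longrightarrow> y \<in> carrier T \<Longrightarrow> Q x \<Longrightarrow> Q y \<Longrightarrow> Q (x \<oplus>\<^bsub>T\<^esub> y)"
  shows "Q x"
  using assms tp.tensor_induct[of x Q] by (simp add: tensor_module_simps)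

lemma T_lift:
  assumes "abelian_group P" "balanced K V W P f"
  shows "additive_map T P (tensor_lift P f)"
    "v \<in> carrier V \<Longrightarrow> w \<in> carrier W \<Longrightarrow> tensor_lift P f (v \<otimes>\<^sub>T w) = f v w"
  using tp.additive_map_tensor_lift[OF assms] tp.tensor_lift_pure[OF assms]
  by (auto simp: additive_map_def tensor_module_simps)

lemma T_smult_balanced:
  assumes "k \<in> L"
  shows "balanced K V W (tensor_group K V W) (\<lambda>v w. (k \<odot>\<^bsub>V\<^esub> v) \<otimes>\<^sub>T w)"
proof (rule balancedI, goal_cases)
  case (4 k' v w)
  have "k \<odot>\<^bsub>V\<^esub> (k' \<odot>\<^bsub>V\<^esub> v) = k' \<odot>\<^bsub>V\<^esub> (k \<odot>\<^bsub>V\<^esub> v)"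
    using module_scalarsD(4)[OF V, of k k' v] module_scalarsD(4)[OF V, of k' k v] 4 assms KL
    by (auto simp: mult.commute)
  then show ?case using 4 assms module_smult_in[OF V] tp.pure_smult by simp
qed (use assms module_scalarsD[OF V] tp.pure_closed tp.pure_add_left tp.pure_add_right in simp_all)

lemma T_smult:
  assumes "k \<in> L"
  shows "additive_map T T (\<lambda>x. k \<odot>\<^bsub>T\<^esub> x)"
    "v \<in> carrier V \<Longrightarrow> w \<in> carrier W \<Longrightarrow> k \<odot>\<^bsub>T\<^esub> (v \<otimes>\<^sub>T w) = (k \<odot>\<^bsub>V\<^esub> v) \<otimes>\<^sub>T w"
  using T_lift[OF tp.G_abelian T_smult_balanced[OF assms]]
  by (simp_all add: tensor_module_def Let_def additive_map_def)

lemma T_module: "module (scalars L) T"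
proof (rule moduleI)
  interpret T: abelian_group T by (rule T_abelian)
  show "cring (scalars L)" by (rule cring_scalars[OF L])
  show "abelian_group T" by (rule T_abelian)
  note sm = additive_mapD[OF T_smult(1)]
  note LC = subfield_closed[OF L]
  show "a \<odot>\<^bsub>T\<^esub> x \<in> carrier T" if "a \<in> carrier (scalars L)" "x \<in> carrier T" for a x
    using that sm(1) by simp
  show "a \<odot>\<^bsub>T\<^esub> (x \<oplus>\<^bsub>T\<^esub> y) = a \<odot>\<^bsub>T\<^esub> x \<oplus>\<^bsub>T\<^esub> a \<odot>\<^bsub>T\<^esub> y"
    if "a \<in> carrier (scalars L)" "x \<in> carrier T" "y \<in> carrier T" for a x y
    using that sm(2) by simp
  show "(a \<oplus>\<^bsub>scalars L\<^esub> b) \<odot>\<^bsub>T\<^esub> x = a \<odot>\<^bsub>T\<^esub> x \<oplus>\<^bsub>T\<^esub> b \<odot>\<^bsub>T\<^esub> x"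
    if "a \<in> carrier (scalars L)" "b \<in> carrier (scalars L)" "x \<in> carrier T" for a b x
    using that(3)
  proof (induction rule: T_induct)
    case (pure v w)
    then show ?case using that(1,2) module_scalarsD[OF V] LC by (simp add: T_smult(2) pt_add_left)
  next
    case (add x y)
    then show ?case using that(1,2) LC by (simp add: sm T.a_ac)
  qed
  show "(a \<otimes>\<^bsub>scalars L\<^esub> b) \<odot>\<^bsub>T\<^esub> x = a \<odot>\<^bsub>T\<^esub> (b \<odot>\<^bsub>T\<^esub> x)"
    if "a \<in> carrier (scalars L)" "b \<in> carrier (scalars L)" "x \<in> carrier T" for a b x
    using that(3)
  proof (induction rule: T_induct)
    case (pure v w)
    then show ?case using that(1,2) module_scalarsD[OF V] LC by (simp add: T_smult(2))
  next
    case (add x y)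
    then show ?case using that(1,2) LC by (simp add: sm)
  qed
  show "\<one>\<^bsub>scalars L\<^esub> \<odot>\<^bsub>T\<^esub> x = x" if "x \<in> carrier T" for x
    using that
  proof (induction rule: T_induct)
    case (pure v w)
    then show ?case using module_scalarsD[OF V] LC by (simp add: T_smult(2))
  next
    case (add x y)
    then show ?case using LC by (simp add: sm)
  qed
qed

lemma T_maps_eq:
  assumes "additive_map T P f" "additive_map T P g" "x \<in> carrier T"
    and "\<And>v w. v \<in> carrier V \<Longrightarrow> w \<in> carrier W \<Longrightarrow> f (v \<otimes>\<^sub>T w) = g (v \<otimes>\<^sub>T w)"
  shows "f x = g x"
  using assms(3) by (induction rule: T_induct) (use assms in \<open>auto simp: additive_mapD\<close>)

lemma T_lift_linear:
  assumes P: "module (scalars L) P" and f: "balanced K V W P f"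
    and hom: "\<And>k v w. k \<in> L \<Longrightarrow> v \<in> carrier V \<Longrightarrow> w \<in> carrier W \<Longrightarrow> f (k \<odot>\<^bsub>V\<^esub> v) w = k \<odot>\<^bsub>P\<^esub> f v w"
  shows "linear_map (scalars L) T P (tensor_lift P f)"
proof -
  note l = T_lift[OF module_scalarsD(1)[OF P] f]
  have "tensor_lift P f (k \<odot>\<^bsub>T\<^esub> x) = k \<odot>\<^bsub>P\<^esub> tensor_lift P f x" if k: "k \<in> L" and x: "x \<in> carrier T" for k x
  proof (rule T_maps_eq[OF _ _ x])
    show "additive_map T P (\<lambda>x. tensor_lift P f (k \<odot>\<^bsub>T\<^esub> x))"
      by (rule additive_map_comp[OF T_smult(1)[OF k] l(1)])
    show "additive_map T P (\<lambda>x. k \<odot>\<^bsub>P\<^esub> tensor_lift P f x)"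
      by (rule additive_map_comp[OF l(1)]) (use k module_scalarsD[OF P] in \<open>auto intro!: additive_mapI\<close>)
  qed (use k module_smult_in[OF V] hom in \<open>simp_all add: T_smult l(2)\<close>)
  then show ?thesis using l(1) by (simp add: semilinear_def)
qed

end


section \<open>Complexification\<close>

lemma complexify_simps:
  "carrier (complexify V) = carrier (tensor_group \<rat> V CC)"
  "add (complexify V) = add (tensor_group \<rat> V CC)"
  "zero (complexify V) = zero (tensor_group \<rat> V CC)"
  by (simp_all add: complexify_def Let_def)

lemma coeff_ring_simps:
  "carrier (coeff_ring E) = carrier (complexify (scalars E))"
  "add (coeff_ring E) = add (complexify (scalars E))"
  "zero (coeff_ring E) = zero (complexify (scalars E))"
  "mult (coeff_ring E) = smult (complexify (scalars E))"
  "one (coeff_ring E) = ctensor (scalars E) 1 1"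
  by (simp_all add: coeff_ring_def Let_def)

locale cspace =
  fixes E :: "complex set" and V :: "(complex, 'a) module"
  assumes E: "subfield E CC" and V: "module (scalars E) V"
begin

sublocale tp: tensor_pair \<rat> V CC
  using subfield_closed(9)[OF E] V by (intro tensor_pairI[OF V module_scalars[OF subfield_UNIV]]) auto

abbreviation "VC \<equiv> complexify V"
abbreviation "R \<equiv> coeff_ring E"

lemma VC_abelian: "abelian_group VC"
  by (rule abelian_group_transfer[OF tp.G_abelian]) (simp_all add: complexify_simps)

lemma VC_balanced: "balanced \<rat> V CC VC (ctensor V)"
proof -
  have "ctensor V = pure_tensor \<rat> V CC" by (intro ext) (simp add: ctensor_def)
  then show ?thesis using tp.balanced_pure by (simp add: balanced_def additive_map_def complexify_simps)
qed

lemma ct_closed: "v \<in> carrier V \<Longrightarrow> ctensor V v z \<in> carrier VC"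
  using balancedD(1)[OF VC_balanced] by simp

lemma ct_add_left: "v \<in> carrier V \<Longrightarrow> v' \<in> carrier V \<Longrightarrow> ctensor V (v \<oplus>\<^bsub>V\<^esub> v') z = ctensor V v z \<oplus>\<^bsub>VC\<^esub> ctensor V v' z"
  using balancedD(2)[OF VC_balanced] by simp

lemma ct_add_right: "v \<in> carrier V \<Longrightarrow> ctensor V v (z + z') = ctensor V v z \<oplus>\<^bsub>VC\<^esub> ctensor V v z'"
  using balancedD(3)[OF VC_balanced] by simp

lemma ct_rat: "v \<in> carrier V \<Longrightarrow> q \<in> \<rat> \<Longrightarrow> ctensor V (q \<odot>\<^bsub>V\<^esub> v) z = ctensor V v (q * z)"
  using balancedD(4)[OF VC_balanced] by simp

lemma VC_induct [consumes 1, case_names pure add]: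
  assumes "x \<in> carrier VC" "\<And>v z. v \<in> carrier V \<Longrightarrow> Q (ctensor V v z)"
    "\<And>x y. x \<in> carrier VC \<Longrightarrow> y \<in> carrier VC \<Longrightarrow> Q x \<Longrightarrow> Q y \<Longrightarrow> Q (x \<oplus>\<^bsub>VC\<^esub> y)"
  shows "Q x"
  using assms tp.tensor_induct[of x Q] by (simp add: complexify_simps ctensor_def)

lemma VC_lift:
  assumes "abelian_group P" "balanced \<rat> V CC P f"
  shows "additive_map VC P (tensor_lift P f)"
    "v \<in> carrier V \<Longrightarrow> tensor_lift P f (ctensor V v z) = f v z"
  using tp.additive_map_tensor_lift[OF assms] tp.tensor_lift_pure[OF assms]
  by (auto simp: additive_map_def complexify_simps ctensor_def)

lemma VC_maps_eq:
  assumes "additive_map VC P f" "additive_map VC P g" "x \<in> carrier VC"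
    and "\<And>v z. v \<in> carrier V \<Longrightarrow> f (ctensor V v z) = g (ctensor V v z)"
  shows "f x = g x"
  using assms(3) by (induction rule: VC_induct) (use assms in \<open>auto simp: additive_mapD\<close>)

end

lemma cspace_scalars: "subfield E CC \<Longrightarrow> cspace E (scalars E)"
  by (simp add: cspace_def module_scalars)

context cspace
begin

interpretation E: cspace E "scalars E" by (rule cspace_scalars[OF E])

lemma smult_pair:
  assumes "e \<in> E" "v \<in> carrier V"
  shows "e \<odot>\<^bsub>V\<^esub> v \<in> carrier V"
  using assms module_smult_in[OF V] by blast

lemma smult_aux1:
  assumes "e \<in> E"
  shows "balanced \<rat> V CC (tensor_group \<rat> V CC) (\<lambda>v z'. ctensor V (e \<odot>\<^bsub>V\<^esub> v) (z * z'))"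
proof (rule balancedI, goal_cases)
  case (4 q v z')
  then have q: "q \<in> E" using subfield_closed(9)[OF E] by blast
  have "e \<odot>\<^bsub>V\<^esub> (q \<odot>\<^bsub>V\<^esub> v) = q \<odot>\<^bsub>V\<^esub> (e \<odot>\<^bsub>V\<^esub> v)"
    using module_scalarsD(4)[OF V, of e q v] module_scalarsD(4)[OF V, of q e v] 4 assms q
    by (simp add: mult.commute)
  then show ?case using 4 assms smult_pair ct_rat[of "e \<odot>\<^bsub>V\<^esub> v" q "z * z'"] by (simp add: mult.left_commute)
qed (use assms smult_pair ct_closed ct_add_left ct_add_right module_scalarsD[OF V] in
    \<open>simp_all add: complexify_simps[symmetric] distrib_left\<close>)

lemma smult_aux2:
  assumes "v \<in> carrier V"
  shows "balanced \<rat> (scalars E) CC (tensor_group \<rat> V CC) (\<lambda>e z. ctensor V (e \<odot>\<^bsub>V\<^esub> v) (z * z'))"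
proof (rule balancedI, goal_cases)
  case (4 q e z)
  then have q: "q \<in> E" "e \<in> E" using subfield_closed(9)[OF E] by auto
  then show ?case using 4 assms smult_pair[of e v] ct_rat[of "e \<odot>\<^bsub>V\<^esub> v" q "z * z'"] module_scalarsD(4)[OF V, of q e v]
    by (simp add: mult.assoc)
qed (use assms smult_pair ct_closed ct_add_left ct_add_right module_scalarsD[OF V] in
    \<open>simp_all add: complexify_simps[symmetric] distrib_right\<close>)

lemma smult_VC:
  shows "x \<in> carrier VC \<Longrightarrow> additive_map R VC (\<lambda>r. r \<odot>\<^bsub>VC\<^esub> x)"
    and "r \<in> carrier R \<Longrightarrow> additive_map VC VC (\<lambda>x. r \<odot>\<^bsub>VC\<^esub> x)"
    and "e \<in> E \<Longrightarrow> v \<in> carrier V \<Longrightarrow> ctensor (scalars E) e z \<odot>\<^bsub>VC\<^esub> ctensor V v z' = ctensor V (e \<odot>\<^bsub>V\<^esub> v) (z * z')"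
proof -
  have s: "smult VC = (\<lambda>r x. tensor_lift (tensor_group \<rat> V CC)
      (\<lambda>e z. tensor_lift (tensor_group \<rat> V CC) (\<lambda>v z'. ctensor V (e \<odot>\<^bsub>V\<^esub> v) (z * z')) x) r)"
    by (simp add: complexify_def Let_def)
  note n = nested_lift[OF E.tp.tensor_pair_axioms tp.tensor_pair_axioms tp.G_abelian,
      of "\<lambda>e z v z'. ctensor V (e \<odot>\<^bsub>V\<^esub> v) (z * z')", OF smult_aux1 smult_aux2, simplified]
  show "x \<in> carrier VC \<Longrightarrow> additive_map R VC (\<lambda>r. r \<odot>\<^bsub>VC\<^esub> x)"
    using n(1)[of x] by (simp add: s additive_map_def complexify_simps coeff_ring_simps)
  show "r \<in> carrier R \<Longrightarrow> additive_map VC VC (\<lambda>x. r \<odot>\<^bsub>VC\<^esub> x)"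
    using n(2)[of r] by (simp add: s additive_map_def complexify_simps coeff_ring_simps)
  show "e \<in> E \<Longrightarrow> v \<in> carrier V \<Longrightarrow> ctensor (scalars E) e z \<odot>\<^bsub>VC\<^esub> ctensor V v z' = ctensor V (e \<odot>\<^bsub>V\<^esub> v) (z * z')"
    using n(3)[of e v z' z] by (simp add: s ctensor_def)
qed

lemmas smult_VC_closed = additive_mapD(1)[OF smult_VC(2)]
  and smult_VC_add_right = additive_mapD(2)[OF smult_VC(2)]
  and smult_VC_add_left = additive_mapD(2)[OF smult_VC(1)]

end

context cspace
begin

interpretation E: cspace E "scalars E" by (rule cspace_scalars[OF E])

lemma R_eq: "carrier R = carrier E.VC" "add R = add E.VC" "mult R = smult E.VC" "zero R = zero E.VC"
  by (simp_all add: coeff_ring_simps)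

lemma smult_VC_assoc:
  assumes r: "r \<in> carrier R" and s: "s \<in> carrier R" and x: "x \<in> carrier VC"
  shows "(r \<otimes>\<^bsub>R\<^esub> s) \<odot>\<^bsub>VC\<^esub> x = r \<odot>\<^bsub>VC\<^esub> (s \<odot>\<^bsub>VC\<^esub> x)"
proof -
  interpret VC: abelian_group VC by (rule VC_abelian)
  note EC = subfield_closed[OF E]
  note r' = r[unfolded R_eq] and s' = s[unfolded R_eq]
  show ?thesis
    unfolding R_eq using r'
  proof (induction rule: E.VC_induct)
    case r: (pure e z)
    have rc: "ctensor (scalars E) e z \<in> carrier R" using r E.ct_closed by (simp add: R_eq)
    show ?case using s'
    proof (induction rule: E.VC_induct)
      case s: (pure e' z')
      show ?case using x
      proof (induction rule: VC_induct)
        case (pure v y)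
        then show ?case
          using r s EC smult_pair module_scalarsD[OF V] by (simp add: E.smult_VC(3) smult_VC(3) mult.assoc)
      next
        case (add x y)
        have sc: "ctensor (scalars E) e' z' \<in> carrier R" using s E.ct_closed by (simp add: R_eq)
        have "ctensor (scalars E) e z \<odot>\<^bsub>E.VC\<^esub> ctensor (scalars E) e' z' \<in> carrier R"
          using rc s E.smult_VC_closed E.ct_closed[of e' z'] by (simp add: R_eq)
        then show ?case using add sc rc smult_VC_closed by (simp add: smult_VC_add_right)
      qed
    next
      case (add s t)
      then show ?case using rc x smult_VC_closed E.smult_VC_closed
        by (simp add: E.smult_VC_add_right smult_VC_add_left[unfolded R_eq] smult_VC_add_right R_eq)
    qed
  next
    case (add r t)
    then show ?case using s x smult_VC_closed E.smult_VC_closed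
      by (simp add: E.smult_VC_add_left[unfolded R_eq] smult_VC_add_left[unfolded R_eq] R_eq)
  qed
qed

lemma smult_VC_one:
  assumes "x \<in> carrier VC"
  shows "\<one>\<^bsub>R\<^esub> \<odot>\<^bsub>VC\<^esub> x = x"
  using assms
proof (induction rule: VC_induct)
  case (pure v z)
  then show ?case using subfield_closed[OF E] module_scalarsD[OF V] by (simp add: coeff_ring_simps smult_VC(3))
next
  case (add x y)
  have "\<one>\<^bsub>R\<^esub> \<in> carrier R" using subfield_closed[OF E] E.ct_closed[of 1 1] by (simp add: coeff_ring_simps)
  then show ?case using add by (simp add: smult_VC_add_right)
qed

end

lemma coeff_ring_cring:
  assumes E: "subfield E CC"
  shows "cring (coeff_ring E)"
proof -
  interpret E: cspace E "scalars E" by (rule cspace_scalars[OF E])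
  note EC = subfield_closed[OF E]
  have ab: "abelian_group (coeff_ring E)"
    by (rule abelian_group_transfer[OF E.VC_abelian]) (simp_all add: coeff_ring_simps)
  have one: "\<one>\<^bsub>coeff_ring E\<^esub> \<in> carrier (coeff_ring E)"
    using EC E.ct_closed[of 1 1] by (simp add: coeff_ring_simps)
  note e = E.R_eq[symmetric]
  have comm: "x \<otimes>\<^bsub>coeff_ring E\<^esub> y = y \<otimes>\<^bsub>coeff_ring E\<^esub> x"
    if x: "x \<in> carrier (coeff_ring E)" and y: "y \<in> carrier (coeff_ring E)" for x y
    unfolding E.R_eq using x[unfolded E.R_eq]
  proof (induction rule: E.VC_induct)
    case x: (pure a z)
    show ?case using y[unfolded E.R_eq]
    proof (induction rule: E.VC_induct)
      case (pure b z')
      then show ?case using x by (simp add: E.smult_VC(3) mult.commute)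
    next
      case (add s t)
      then show ?case using x E.ct_closed by (simp add: E.smult_VC_add_left[unfolded E.R_eq] E.smult_VC_add_right[unfolded E.R_eq])
    qed
  next
    case (add s t)
    then show ?case using y by (simp add: E.smult_VC_add_left[unfolded E.R_eq] E.smult_VC_add_right[unfolded E.R_eq] E.R_eq)
  qed
  show ?thesis
  proof (rule cringI[OF ab])
    show "comm_monoid (coeff_ring E)"
    proof (rule comm_monoidI)
      show "x \<otimes>\<^bsub>coeff_ring E\<^esub> y \<in> carrier (coeff_ring E)"
        if "x \<in> carrier (coeff_ring E)" "y \<in> carrier (coeff_ring E)" for x y
        using E.smult_VC_closed that by (simp add: E.R_eq)
      show "x \<otimes>\<^bsub>coeff_ring E\<^esub> y \<otimes>\<^bsub>coeff_ring E\<^esub> z = x \<otimes>\<^bsub>coeff_ring E\<^esub> (y \<otimes>\<^bsub>coeff_ring E\<^esub> z)"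
        if "x \<in> carrier (coeff_ring E)" "y \<in> carrier (coeff_ring E)" "z \<in> carrier (coeff_ring E)" for x y z
        using E.smult_VC_assoc[of x y z] that by (simp add: E.R_eq)
      show "\<one>\<^bsub>coeff_ring E\<^esub> \<otimes>\<^bsub>coeff_ring E\<^esub> x = x" if "x \<in> carrier (coeff_ring E)" for x
        using E.smult_VC_one[of x] that by (simp add: E.R_eq)
    qed (use one comm in auto)
    show "(x \<oplus>\<^bsub>coeff_ring E\<^esub> y) \<otimes>\<^bsub>coeff_ring E\<^esub> z = x \<otimes>\<^bsub>coeff_ring E\<^esub> z \<oplus>\<^bsub>coeff_ring E\<^esub> y \<otimes>\<^bsub>coeff_ring E\<^esub> z"
      if "x \<in> carrier (coeff_ring E)" "y \<in> carrier (coeff_ring E)" "z \<in> carrier (coeff_ring E)" for x y z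
      using E.smult_VC_add_left[of z x y] that by (simp add: E.R_eq)
  qed
qed

lemma (in cspace) VC_module: "module R VC"
  using coeff_ring_cring[OF E] VC_abelian smult_VC_closed smult_VC_add_left smult_VC_add_right
    smult_VC_assoc smult_VC_one
  by (intro moduleI) auto


context module
begin

lemma span_trans:
  assumes a: "spans R M I a" and b: "finite J" "b \<in> J \<rightarrow> carrier M"
    and ab: "\<And>i. i \<in> I \<Longrightarrow> \<exists>c\<in>J \<rightarrow> carrier R. a i = lincomb M J c b"
  shows "spans R M J b"
  unfolding spans_def
proof (intro conjI ballI b)
  fix x assume x: "x \<in> carrier M"
  obtain c where c: "c \<in> I \<rightarrow> carrier R" "x = lincomb M I c a" using a x by (auto simp: spans_def)
  have fI: "finite I" and aI: "a \<in> I \<rightarrow> carrier M" using a by (auto simp: spans_def)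
  obtain u where u: "\<And>i. i \<in> I \<Longrightarrow> u i \<in> J \<rightarrow> carrier R" "\<And>i. i \<in> I \<Longrightarrow> a i = lincomb M J (u i) b"
    using ab by metis
  have "x = lincomb M I c (\<lambda>i. lincomb M J (u i) b)"
    unfolding c(2) using c u b by (intro lincomb_cong) (auto intro: lincomb_closed)
  also have "\<dots> = lincomb M J (\<lambda>j. \<Oplus>i\<in>I. u i j \<otimes> c i) b"
    using lincomb_lincomb[of J I c "\<lambda>j i. u i j" b] fI b c u by (force simp: Pi_iff)
  finally show "\<exists>c\<in>J \<rightarrow> carrier R. x = lincomb M J c b"
    using u c by (intro bexI[of _ "\<lambda>j. \<Oplus>i\<in>I. u i j \<otimes> c i"]) (auto intro!: R.finsum_closed simp: Pi_iff)
qed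

end

definition bilinear_map where
  "bilinear_map R M N P m \<longleftrightarrow> (\<forall>y\<in>carrier N. linear_map R M P (\<lambda>x. m x y)) \<and> (\<forall>x\<in>carrier M. linear_map R N P (m x))"

lemma bilinear_lincomb:
  assumes M: "module R M" and N: "module R N" and P: "module R P" and m: "bilinear_map R M N P m"
    and fin: "finite I" "finite J"
    and cl: "c \<in> I \<rightarrow> carrier R" "b \<in> I \<rightarrow> carrier M" "d \<in> J \<rightarrow> carrier R" "a \<in> J \<rightarrow> carrier N"
  shows "m (lincomb M I c b) (lincomb N J d a) = lincomb P (I \<times> J) (\<lambda>(i, j). c i \<otimes>\<^bsub>R\<^esub> d j) (\<lambda>(i, j). m (b i) (a j))"
proof -
  interpret M: module R M by fact
  interpret N: module R N by fact
  interpret P: module R P by fact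
  have y: "lincomb N J d a \<in> carrier N" using cl by (intro N.lincomb_closed)
  have mc: "m x y \<in> carrier P" if "x \<in> carrier M" "y \<in> carrier N" for x y
    using m that by (auto simp: bilinear_map_def dest: semilinearD(2))
  have "m (lincomb M I c b) (lincomb N J d a) = lincomb P I c (\<lambda>i. m (b i) (lincomb N J d a))"
    using M.linear_map_lincomb[OF _ P cl(1,2), of "\<lambda>r. r" "\<lambda>x. m x (lincomb N J d a)"] m y by (simp add: bilinear_map_def)
  also have "\<dots> = lincomb P I c (\<lambda>i. lincomb P J d (\<lambda>j. m (b i) (a j)))"
  proof (rule P.lincomb_cong[OF refl])
    fix i assume "i \<in> I"
    then show "m (b i) (lincomb N J d a) = lincomb P J d (\<lambda>j. m (b i) (a j))"
      using N.linear_map_lincomb[OF _ P cl(3,4), of "\<lambda>r. r" "m (b i)"] m cl by (auto simp: bilinear_map_def Pi_iff)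
  qed (use cl mc in \<open>auto intro!: P.lincomb_closed simp: Pi_iff\<close>)
  also have "\<dots> = (\<Oplus>\<^bsub>P\<^esub>i\<in>I. \<Oplus>\<^bsub>P\<^esub>j\<in>J. (c i \<otimes>\<^bsub>R\<^esub> d j) \<odot>\<^bsub>P\<^esub> m (b i) (a j))"
    unfolding lincomb_def[of P I]
  proof (intro P.M.finsum_cong' refl, goal_cases)
    case 1
    then show ?case using cl mc by (auto intro!: P.M.finsum_closed simp: Pi_iff)
  next
    case (2 i)
    then show ?case using cl mc fin by (subst P.lincomb_smult) (auto simp: lincomb_def Pi_iff)
  qed
  also have "\<dots> = lincomb P (I \<times> J) (\<lambda>(i, j). c i \<otimes>\<^bsub>R\<^esub> d j) (\<lambda>(i, j). m (b i) (a j))"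
  proof -
    have "lincomb P (I \<times> J) (\<lambda>(i, j). c i \<otimes>\<^bsub>R\<^esub> d j) (\<lambda>(i, j). m (b i) (a j))
        = finsum P (\<lambda>(i, j). (c i \<otimes>\<^bsub>R\<^esub> d j) \<odot>\<^bsub>P\<^esub> m (b i) (a j)) (I \<times> J)"
      unfolding lincomb_def using cl mc by (intro P.M.finsum_cong') (auto simp: Pi_iff)
    then show ?thesis using cl mc fin by (subst (asm) P.M.finsum_Times) (auto simp: Pi_iff)
  qed
  finally show ?thesis .
qed

text \<open>
  Coordinates with respect to a basis are unique, hence additive and homogeneous.
\<close>

lemma is_basis_dual_basis:
  assumes E: "subfield E CC" and V: "module (scalars E) V" and b: "is_basis (scalars E) V bs"
  shows "\<exists>\<eta>. dual_basis (scalars E) V (scalars E) {..<length bs} ((!) bs) \<eta>"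
proof -
  interpret V: module "scalars E" V by fact
  let ?I = "{..<length bs}"
  note EC = subfield_closed[OF E]
  have bc: "(!) bs \<in> ?I \<rightarrow> carrier V" using b by (auto simp: is_basis_def)
  define K where "K x = (THE c. c \<in> ?I \<rightarrow>\<^sub>E E \<and> x = lincomb V ?I c ((!) bs))" for x
  have ex1: "\<exists>!c. c \<in> ?I \<rightarrow>\<^sub>E E \<and> x = lincomb V ?I c ((!) bs)" if "x \<in> carrier V" for x
    using b that by (simp add: is_basis_def lincomb_def)
  have K: "K x \<in> ?I \<rightarrow>\<^sub>E E" "x = lincomb V ?I (K x) ((!) bs)" if "x \<in> carrier V" for x
    using theI'[OF ex1[OF that]] unfolding K_def by auto
  have Kmem: "K x i \<in> E" if "x \<in> carrier V" "i \<in> ?I" for x i using K(1)[OF that(1)] that(2) by (auto simp: PiE_def Pi_iff)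
  have uniq: "K x i = c i" if "x = lincomb V ?I c ((!) bs)" "c \<in> ?I \<rightarrow> E" "i \<in> ?I" for x c i
  proof -
    have x: "x \<in> carrier V" using that bc V.lincomb_closed[of c ?I] by simp
    have "x = lincomb V ?I (restrict c ?I) ((!) bs)"
      unfolding that(1) using that bc by (intro V.lincomb_cong) (auto simp: Pi_iff)
    moreover have "restrict c ?I \<in> ?I \<rightarrow>\<^sub>E E" using that by auto
    ultimately have "K x = restrict c ?I" using ex1[OF x] K[OF x] by blast
    then show ?thesis using that by simp
  qed
  have "dual_basis (scalars E) V (scalars E) ?I ((!) bs) (\<lambda>i x. K x i)"
    unfolding dual_basis_def
  proof (intro conjI ballI bc)
    fix i assume i: "i \<in> ?I"
    show "linear_map (scalars E) V (scalars E) (\<lambda>x. K x i)"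
    proof (rule semilinearI)
      fix x y assume xy: "x \<in> carrier V" "y \<in> carrier V"
      show "K (x \<oplus>\<^bsub>V\<^esub> y) i = K x i \<oplus>\<^bsub>scalars E\<^esub> K y i"
        using uniq[of "x \<oplus>\<^bsub>V\<^esub> y" "\<lambda>i. K x i + K y i" i] V.lincomb_add[of "K x" ?I "K y" "(!) bs"]
          K xy Kmem bc EC i by (auto simp: Pi_iff)
    next
      fix r x assume rx: "r \<in> carrier (scalars E)" "x \<in> carrier V"
      show "K (r \<odot>\<^bsub>V\<^esub> x) i = r \<odot>\<^bsub>scalars E\<^esub> K x i"
        using uniq[of "r \<odot>\<^bsub>V\<^esub> x" "\<lambda>i. r * K x i" i] V.lincomb_smult[of ?I "K x" "(!) bs" r]
          K rx Kmem bc EC i by (auto simp: Pi_iff)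
    qed (use Kmem i in auto)
  next
    fix i j assume ij: "i \<in> ?I" "j \<in> ?I"
    show "K (bs ! j) i = (if i = j then \<one>\<^bsub>scalars E\<^esub> else \<zero>\<^bsub>scalars E\<^esub>)"
    proof -
      have "bs ! j = lincomb V ?I (\<lambda>i. if i = j then 1 else 0) ((!) bs)"
        using V.lincomb_single[of ?I j "(!) bs"] ij bc by (simp cong: if_cong)
      from uniq[OF this _ ij(1)] show ?thesis using EC by auto
    qed
  qed (use K in auto)
  then show ?thesis by blast
qed

context cspace
begin

lemma V_sp: "abelian_group V" by (rule module_scalarsD(1)[OF V])

lemma emb_closed: "e \<in> E \<Longrightarrow> ctensor (scalars E) e z \<in> carrier R"
  using cspace.ct_closed[OF cspace_scalars[OF E]] by (simp add: coeff_ring_simps)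

lemma ct_smult: "e \<in> E \<Longrightarrow> v \<in> carrier V \<Longrightarrow> ctensor (scalars E) e 1 \<odot>\<^bsub>VC\<^esub> ctensor V v z = ctensor V (e \<odot>\<^bsub>V\<^esub> v) z"
  by (simp add: smult_VC)

lemma ct_lincomb:
  assumes "c \<in> I \<rightarrow> E" "b \<in> I \<rightarrow> carrier V"
  shows "ctensor V (lincomb V I c b) z = lincomb VC I (\<lambda>i. ctensor (scalars E) (c i) z) (\<lambda>i. ctensor V (b i) 1)"
proof -
  interpret VC: abelian_group VC by (rule VC_abelian)
  have "additive_map V VC (\<lambda>v. ctensor V v z)"
    by (intro additive_mapI ct_closed ct_add_left)
  then have "ctensor V (lincomb V I c b) z = (\<Oplus>\<^bsub>VC\<^esub>i\<in>I. ctensor V (c i \<odot>\<^bsub>V\<^esub> b i) z)"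
    unfolding lincomb_def using assms smult_pair
    by (intro additive_map_finsum V_sp VC_abelian) (auto simp: Pi_iff)
  also have "\<dots> = lincomb VC I (\<lambda>i. ctensor (scalars E) (c i) z) (\<lambda>i. ctensor V (b i) 1)"
    unfolding lincomb_def using assms emb_closed smult_VC_closed ct_closed smult_pair
    by (intro VC.finsum_cong') (auto simp: smult_VC(3) Pi_iff)
  finally show ?thesis .
qed

lemma spans_complexify:
  assumes "spans (scalars E) V I b"
  shows "spans R VC I (\<lambda>i. ctensor V (b i) 1)"
  unfolding spans_def
proof (intro conjI ballI)
  interpret VC: module R VC by (rule VC_module)
  fix x assume "x \<in> carrier VC"
  then show "\<exists>c\<in>I \<rightarrow> carrier R. x = lincomb VC I c (\<lambda>i. ctensor V (b i) 1)"
  proof (induction rule: VC_induct)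
    case (pure v z)
    then obtain c where c: "c \<in> I \<rightarrow> E" "v = lincomb V I c b" using assms by (auto simp: spans_def)
    then show ?case using ct_lincomb[of c I b z] assms emb_closed
      by (intro bexI[of _ "\<lambda>i. ctensor (scalars E) (c i) z"]) (auto simp: spans_def Pi_iff)
  next
    case (add x y)
    then obtain c d where cd: "c \<in> I \<rightarrow> carrier R" "x = lincomb VC I c (\<lambda>i. ctensor V (b i) 1)"
      "d \<in> I \<rightarrow> carrier R" "y = lincomb VC I d (\<lambda>i. ctensor V (b i) 1)" by blast
    then show ?case using VC.lincomb_add[of c I d "\<lambda>i. ctensor V (b i) 1"] assms ct_closed
      by (intro bexI[of _ "\<lambda>i. c i \<oplus>\<^bsub>R\<^esub> d i"]) (auto simp: spans_def Pi_iff)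
  qed
qed (use assms ct_closed in \<open>auto simp: spans_def\<close>)

end

locale cspace_map = V: cspace E V + W: cspace L W for E V L W +
  fixes f
  assumes EL: "E \<subseteq> L" and f: "linear_map (scalars E) V W f"
begin

lemma map_balanced: "balanced \<rat> V CC W.VC (\<lambda>v z. ctensor W (f v) z)"
proof (rule balancedI, goal_cases)
  case (4 q v z)
  then have q: "q \<in> E" using subfield_closed(9)[OF V.E] by blast
  then show ?case using 4 W.ct_rat[of "f v" q z] semilinearD[OF f] by simp
qed (use semilinearD[OF f] W.ct_closed W.ct_add_left W.ct_add_right in simp_all)

lemma cmap_ct: "v \<in> carrier V \<Longrightarrow> complexify_map W f (ctensor V v z) = ctensor W (f v) z"
  unfolding complexify_map_def by (rule V.VC_lift(2)[OF W.VC_abelian map_balanced])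

lemma cmap_additive: "additive_map V.VC W.VC (complexify_map W f)"
  unfolding complexify_map_def by (rule V.VC_lift(1)[OF W.VC_abelian map_balanced])

end

lemma cspace_map_scalars:
  assumes "subfield E CC" "subfield L CC" "E \<subseteq> L"
  shows "cspace_map E (scalars E) L (scalars L) id"
  using assms by (auto simp: cspace_map_def cspace_map_axioms_def cspace_scalars intro!: semilinearI)

context
  fixes E L :: "complex set"
  assumes E: "subfield E CC" and L: "subfield L CC" and EL: "E \<subseteq> L"
begin

interpretation s: cspace_map E "scalars E" L "scalars L" id
  by (rule cspace_map_scalars[OF E L EL])

lemma extend_coeff_ct: "e \<in> E \<Longrightarrow> extend_coeff L (ctensor (scalars E) e z) = ctensor (scalars L) e z"
  unfolding extend_coeff_def using s.cmap_ct[of e z] by simp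

lemma extend_coeff_additive: "additive_map (coeff_ring E) (coeff_ring L) (extend_coeff L)"
  unfolding extend_coeff_def using s.cmap_additive by (simp add: additive_map_def coeff_ring_simps)

lemma extend_coeff_closed: "r \<in> carrier (coeff_ring E) \<Longrightarrow> extend_coeff L r \<in> carrier (coeff_ring L)"
  using additive_mapD(1)[OF extend_coeff_additive] .

end

context cspace_map
begin

lemma cmap_smult:
  assumes r: "r \<in> carrier V.R" and x: "x \<in> carrier V.VC"
  shows "complexify_map W f (r \<odot>\<^bsub>V.VC\<^esub> x) = extend_coeff L r \<odot>\<^bsub>W.VC\<^esub> complexify_map W f x"
proof -
  interpret E: cspace E "scalars E" by (rule cspace_scalars[OF V.E])
  note ec = extend_coeff_ct[OF V.E W.E EL] and ea = additive_mapD[OF extend_coeff_additive[OF V.E W.E EL]]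
  note m = additive_mapD[OF cmap_additive]
  show ?thesis using r[unfolded V.R_eq]
  proof (induction rule: E.VC_induct)
    case r: (pure e z)
    show ?case using x
    proof (induction rule: V.VC_induct)
      case (pure v y)
      have "e \<in> L" using r EL by auto
      then show ?case using pure r semilinearD[OF f] V.smult_pair
        by (simp add: V.smult_VC(3) W.smult_VC(3) cmap_ct ec)
    next
      case (add x y)
      have "ctensor (scalars E) e z \<in> carrier V.R" using r V.emb_closed by simp
      then show ?case using add m ea(1) V.smult_VC_closed
        by (simp add: V.smult_VC_add_right W.smult_VC_add_right)
    qed
  next
    case (add s t)
    then show ?case using x m ea V.smult_VC_closed
      by (simp add: V.smult_VC_add_left W.smult_VC_add_left V.R_eq[symmetric])
  qed
qed

lemma cmap_semilinear: "semilinear V.R (extend_coeff L) V.VC W.VC (complexify_map W f)"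
  using cmap_additive cmap_smult by (simp add: semilinear_def)

end

lemma extend_coeff_self:
  assumes "subfield E CC" "r \<in> carrier (coeff_ring E)"
  shows "extend_coeff E r = r"
proof -
  interpret E: cspace E "scalars E" by (rule cspace_scalars[OF assms(1)])
  show ?thesis using assms(2)[unfolded E.R_eq]
    by (induction rule: E.VC_induct)
      (use additive_mapD[OF extend_coeff_additive[OF assms(1) assms(1)]] extend_coeff_ct[OF assms(1) assms(1)]
        in \<open>auto simp: E.R_eq\<close>)
qed

lemma (in cspace_map) cmap_linear:
  assumes "E = L"
  shows "linear_map V.R V.VC W.VC (complexify_map W f)"
  using cmap_semilinear extend_coeff_self[OF V.E] assms by (auto simp: semilinear_def)

lemma extend_coeff_hom:
  assumes "subfield E CC" "subfield L CC" "E \<subseteq> L"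
  shows "ring_hom_cring (coeff_ring E) (coeff_ring L) (extend_coeff L)"
proof (intro ring_hom_cring.intro coeff_ring_cring[OF assms(1)] coeff_ring_cring[OF assms(2)] ring_hom_cring_axioms.intro)
  interpret s: cspace_map E "scalars E" L "scalars L" id by (rule cspace_map_scalars[OF assms])
  show "extend_coeff L \<in> ring_hom (coeff_ring E) (coeff_ring L)"
  proof (rule ring_hom_memI)
    show "extend_coeff L (x \<otimes>\<^bsub>coeff_ring E\<^esub> y) = extend_coeff L x \<otimes>\<^bsub>coeff_ring L\<^esub> extend_coeff L y"
      if "x \<in> carrier (coeff_ring E)" "y \<in> carrier (coeff_ring E)" for x y
      using s.cmap_smult[of x y] that by (simp add: coeff_ring_simps extend_coeff_def)
    show "extend_coeff L \<one>\<^bsub>coeff_ring E\<^esub> = \<one>\<^bsub>coeff_ring L\<^esub>"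
      using extend_coeff_ct[OF assms, of 1 1] subfield_closed[OF assms(1)] by (simp add: coeff_ring_simps)
  qed (use additive_mapD[OF extend_coeff_additive[OF assms]] in auto)
qed

lemma emb_hom:
  assumes "subfield E CC"
  shows "ring_hom_cring (scalars E) (coeff_ring E) (\<lambda>e. ctensor (scalars E) e 1)"
proof (intro ring_hom_cring.intro cring_scalars[OF assms] coeff_ring_cring[OF assms] ring_hom_cring_axioms.intro)
  interpret E: cspace E "scalars E" by (rule cspace_scalars[OF assms])
  show "(\<lambda>e. ctensor (scalars E) e 1) \<in> ring_hom (scalars E) (coeff_ring E)"
    using E.ct_closed E.ct_add_left E.smult_VC(3)
    by (intro ring_hom_memI) (auto simp: coeff_ring_simps)
qed

text \<open>Multiplication \<open>e \<otimes> z \<mapsto> e z\<close> shows that \<open>E\<close> embeds into \<open>E \<otimes> \<complex>\<close>.\<close>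

lemma emb_inj:
  assumes "subfield E CC" "e \<in> E" "ctensor (scalars E) e 1 = \<zero>\<^bsub>coeff_ring E\<^esub>"
  shows "e = 0"
proof -
  interpret E: cspace E "scalars E" by (rule cspace_scalars[OF assms(1)])
  have ab: "abelian_group CC" by (rule abelian_group_scalars[OF subfield_UNIV])
  have bal: "balanced \<rat> (scalars E) CC CC (*)"
    by (rule balancedI) (auto simp: algebra_simps)
  note l = E.VC_lift[OF ab bal]
  have "e = tensor_lift CC (*) (ctensor (scalars E) e 1)" using l(2)[of e 1] assms by simp
  also have "\<dots> = 0"
    using additive_map_zero[OF l(1) E.VC_abelian ab] assms(3) by (simp add: coeff_ring_simps)
  finally show ?thesis .
qed

lemma (in cspace) dual_basis_complexify:
  assumes d: "dual_basis (scalars E) V (scalars E) I b \<eta>"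
  shows "dual_basis R VC (complexify (scalars E)) I (\<lambda>i. ctensor V (b i) 1) (\<lambda>i. complexify_map (scalars E) (\<eta> i))"
proof -
  interpret E: cspace E "scalars E" by (rule cspace_scalars[OF E])
  interpret VC: module R VC by (rule VC_module)
  have b: "b \<in> I \<rightarrow> carrier V" "finite I" using d by (auto simp: dual_basis_def)
  have m: "cspace_map E V E (scalars E) (\<eta> i)" if "i \<in> I" for i
    using d that cspace_axioms E.cspace_axioms by (auto simp: cspace_map_def cspace_map_axioms_def dual_basis_def)
  have \<eta>E: "\<eta> i v \<in> E" if "i \<in> I" "v \<in> carrier V" for i v
    using d that semilinearD(2)[of "scalars E" _ V "scalars E" "\<eta> i" v] by (auto simp: dual_basis_def)
  show ?thesis unfolding dual_basis_def
  proof (intro conjI ballI)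
    show "linear_map R VC (complexify (scalars E)) (complexify_map (scalars E) (\<eta> i))" if "i \<in> I" for i
      by (rule cspace_map.cmap_linear[OF m[OF that] refl])
    show "complexify_map (scalars E) (\<eta> i) (ctensor V (b j) 1) = (if i = j then \<one>\<^bsub>R\<^esub> else \<zero>\<^bsub>R\<^esub>)"
      if "i \<in> I" "j \<in> I" for i j
    proof -
      have "ctensor (scalars E) 0 1 = \<zero>\<^bsub>R\<^esub>"
        using ring_hom_cring.hom_zero[OF emb_hom[OF E]] by simp
      then show ?thesis
        using cspace_map.cmap_ct[OF m[OF that(1)], of "b j" 1] b d that by (auto simp: dual_basis_def coeff_ring_simps Pi_iff)
    qed
    fix x assume "x \<in> carrier VC"
    then show "x = lincomb VC I (\<lambda>i. complexify_map (scalars E) (\<eta> i) x) (\<lambda>i. ctensor V (b i) 1)"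
    proof (induction rule: VC_induct)
      case (pure v z)
      have "ctensor V v z = ctensor V (lincomb V I (\<lambda>i. \<eta> i v) b) z" using d pure by (simp add: dual_basis_def)
      also have "\<dots> = lincomb VC I (\<lambda>i. ctensor (scalars E) (\<eta> i v) z) (\<lambda>i. ctensor V (b i) 1)"
        using b \<eta>E pure by (intro ct_lincomb) auto
      also have "\<dots> = lincomb VC I (\<lambda>i. complexify_map (scalars E) (\<eta> i) (ctensor V v z)) (\<lambda>i. ctensor V (b i) 1)"
        using b \<eta>E pure cspace_map.cmap_ct[OF m] emb_closed ct_closed
        by (intro VC.lincomb_cong) (auto simp: Pi_iff)
      finally show ?case .
    next
      case (add x y)
      have cl: "(\<lambda>i. complexify_map (scalars E) (\<eta> i) x) \<in> I \<rightarrow> carrier R" if "x \<in> carrier VC" for x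
        using additive_mapD(1)[OF cspace_map.cmap_additive[OF m] that] by (auto simp: coeff_ring_simps)
      have "x \<oplus>\<^bsub>VC\<^esub> y = lincomb VC I (\<lambda>i. complexify_map (scalars E) (\<eta> i) x \<oplus>\<^bsub>R\<^esub> complexify_map (scalars E) (\<eta> i) y) (\<lambda>i. ctensor V (b i) 1)"
        using add cl b ct_closed by (subst VC.lincomb_add[symmetric]) (auto simp: Pi_iff)
      also have "\<dots> = lincomb VC I (\<lambda>i. complexify_map (scalars E) (\<eta> i) (x \<oplus>\<^bsub>VC\<^esub> y)) (\<lambda>i. ctensor V (b i) 1)"
        using add cl b ct_closed additive_mapD(2)[OF cspace_map.cmap_additive[OF m]]
          abelian_groupE(1)[OF E.VC_abelian]
        by (intro VC.lincomb_cong) (auto simp: Pi_iff coeff_ring_simps)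
      finally show ?case .
    qed
  qed (use b ct_closed in auto)
qed


section \<open>Bases of tensor products\<close>

context tensor_over
begin

interpretation T: module "scalars L" T by (rule T_module)

lemma spans_from_pure:
  assumes "finite J" "b \<in> J \<rightarrow> carrier T"
    and pure: "\<And>v w. v \<in> carrier V \<Longrightarrow> w \<in> carrier W \<Longrightarrow> \<exists>c\<in>J \<rightarrow> L. v \<otimes>\<^sub>T w = lincomb T J c b"
  shows "spans (scalars L) T J b"
  unfolding spans_def
proof (intro conjI ballI assms(1,2))
  fix x assume "x \<in> carrier T"
  then show "\<exists>c\<in>J \<rightarrow> carrier (scalars L). x = lincomb T J c b"
  proof (induction rule: T_induct)
    case (pure v w)
    then show ?case using assms(3) by simp
  next
    case (add x y)
    then obtain c d where cd: "c \<in> J \<rightarrow> L" "x = lincomb T J c b" "d \<in> J \<rightarrow> L" "y = lincomb T J d b" by auto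
    then show ?case using T.lincomb_add[of c J d b] assms subfield_closed[OF L]
      by (intro bexI[of _ "\<lambda>i. c i + d i"]) (auto simp: Pi_iff)
  qed
qed

lemma dual_basis_from_pure:
  assumes J: "finite J" "b \<in> J \<rightarrow> carrier T"
    and lin: "\<And>j. j \<in> J \<Longrightarrow> linear_map (scalars L) T (scalars L) (\<eta> j)"
    and dual: "\<And>i j. i \<in> J \<Longrightarrow> j \<in> J \<Longrightarrow> \<eta> i (b j) = (if i = j then 1 else 0)"
    and pure: "\<And>v w. v \<in> carrier V \<Longrightarrow> w \<in> carrier W \<Longrightarrow> v \<otimes>\<^sub>T w = lincomb T J (\<lambda>j. \<eta> j (v \<otimes>\<^sub>T w)) b"
  shows "dual_basis (scalars L) T (scalars L) J b \<eta>"
  unfolding dual_basis_def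
proof (intro conjI ballI J)
  fix x assume "x \<in> carrier T"
  then show "x = lincomb T J (\<lambda>j. \<eta> j x) b"
  proof (induction rule: T_induct)
    case (add x y)
    have cl: "(\<lambda>j. \<eta> j x) \<in> J \<rightarrow> L" if "x \<in> carrier T" for x using semilinearD(2)[OF lin that] by simp
    have "x \<oplus>\<^bsub>T\<^esub> y = lincomb T J (\<lambda>j. \<eta> j x \<oplus>\<^bsub>scalars L\<^esub> \<eta> j y) b"
      using add cl J by (subst T.lincomb_add[symmetric]) auto
    also have "\<dots> = lincomb T J (\<lambda>j. \<eta> j (x \<oplus>\<^bsub>T\<^esub> y)) b"
      using add cl J semilinearD(3)[OF lin] subfield_closed[OF L]
      by (intro T.lincomb_cong) (auto simp: Pi_iff)
    finally show ?case .
  qed (rule pure)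
qed (use lin dual in auto)

end

lemma bilinear_pure:
  assumes "tensor_over L L V W"
  shows "bilinear_map (scalars L) V W (tensor_module L V W) (pure_tensor L V W)"
proof -
  interpret tensor_over L L V W by fact
  have sw: "r \<odot>\<^bsub>W\<^esub> y \<in> carrier W" if "r \<in> L" "y \<in> carrier W" for r y using module_smult_in[OF W] that by blast
  have sv: "r \<odot>\<^bsub>V\<^esub> y \<in> carrier V" if "r \<in> L" "y \<in> carrier V" for r y using module_smult_in[OF V] that by blast
  show ?thesis unfolding bilinear_map_def
    by (intro conjI ballI semilinearI)
      (use sv sw pt_balanced in \<open>simp_all add: pt_closed pt_add_left pt_add_right T_smult(2)\<close>)
qed

lemma tensor_spans:
  assumes T: "tensor_over L L V W" and b: "spans (scalars L) V I b" and d: "spans (scalars L) W J d"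
  shows "spans (scalars L) (tensor_module L V W) (I \<times> J) (\<lambda>(i, j). pure_tensor L V W (b i) (d j))"
proof -
  interpret tensor_over L L V W by fact
  show ?thesis
  proof (rule spans_from_pure)
    fix v w assume vw: "v \<in> carrier V" "w \<in> carrier W"
    obtain c where c: "c \<in> I \<rightarrow> L" "v = lincomb V I c b" using b vw by (auto simp: spans_def)
    obtain e where e: "e \<in> J \<rightarrow> L" "w = lincomb W J e d" using d vw by (auto simp: spans_def)
    have "pt v w = lincomb T (I \<times> J) (\<lambda>(i, j). c i \<otimes>\<^bsub>scalars L\<^esub> e j) (\<lambda>(i, j). pt (b i) (d j))"
      unfolding c(2) e(2) using b d c e
      by (intro bilinear_lincomb[OF V W T_module bilinear_pure[OF T]]) (auto simp: spans_def)
    then show "\<exists>x\<in>I \<times> J \<rightarrow> L. pt v w = lincomb T (I \<times> J) x (\<lambda>(i, j). pt (b i) (d j))"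
      using c e subfield_closed[OF L]
      by (intro bexI[of _ "\<lambda>(i, j). c i \<otimes>\<^bsub>scalars L\<^esub> e j"]) (auto simp: Pi_iff)
  qed (use b d pt_closed in \<open>auto simp: spans_def Pi_iff\<close>)
qed

lemma tensor_dual_basis:
  assumes T: "tensor_over L L V W"
    and b: "dual_basis (scalars L) V (scalars L) I b \<eta>" and d: "dual_basis (scalars L) W (scalars L) J d \<theta>"
  shows "\<exists>\<eta>. dual_basis (scalars L) (tensor_module L V W) (scalars L) (I \<times> J) (\<lambda>(i, j). pure_tensor L V W (b i) (d j)) \<eta>"
proof -
  interpret tensor_over L L V W by fact
  note EC = subfield_closed[OF L]
  define f where "f = (\<lambda>(i, j) v w. \<eta> i v * \<theta> j w)"
  define \<kappa> where "\<kappa> = (\<lambda>p. tensor_lift (scalars L) (f p))"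
  have \<eta>: "linear_map (scalars L) V (scalars L) (\<eta> i)" if "i \<in> I" for i using b that by (auto simp: dual_basis_def)
  have \<theta>: "linear_map (scalars L) W (scalars L) (\<theta> j)" if "j \<in> J" for j using d that by (auto simp: dual_basis_def)
  note \<eta>D = semilinearD[OF \<eta>, simplified] and \<theta>D = semilinearD[OF \<theta>, simplified]
  have bal: "balanced L V W (scalars L) (f p)" if "p \<in> I \<times> J" for p
    by (rule balancedI) (use that \<eta>D \<theta>D EC in \<open>auto simp: f_def algebra_simps\<close>)
  have lin: "linear_map (scalars L) T (scalars L) (\<kappa> p)" if "p \<in> I \<times> J" for p
    unfolding \<kappa>_def
    by (rule T_lift_linear[OF module_scalars[OF L] bal[OF that]]) (use that \<eta>D in \<open>auto simp: f_def\<close>)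
  have val: "\<kappa> p (pt v w) = f p v w" if "p \<in> I \<times> J" "v \<in> carrier V" "w \<in> carrier W" for p v w
    unfolding \<kappa>_def using T_lift(2)[OF abelian_group_scalars[OF L] bal[OF that(1)]] that by simp
  have "dual_basis (scalars L) T (scalars L) (I \<times> J) (\<lambda>(i, j). pt (b i) (d j)) \<kappa>"
  proof (rule dual_basis_from_pure)
    fix v w assume vw: "v \<in> carrier V" "w \<in> carrier W"
    have "pt v w = pt (lincomb V I (\<lambda>i. \<eta> i v) b) (lincomb W J (\<lambda>j. \<theta> j w) d)"
      using b d vw by (simp add: dual_basis_def)
    also have "\<dots> = lincomb T (I \<times> J) (\<lambda>(i, j). \<eta> i v \<otimes>\<^bsub>scalars L\<^esub> \<theta> j w) (\<lambda>(i, j). pt (b i) (d j))"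
      using b d \<eta>D \<theta>D vw
      by (intro bilinear_lincomb[OF V W T_module bilinear_pure[OF T]]) (auto simp: dual_basis_def)
    also have "(\<lambda>(i, j). \<eta> i v \<otimes>\<^bsub>scalars L\<^esub> \<theta> j w) = (\<lambda>p. f p v w)" by (auto simp: f_def)
    also have "lincomb T (I \<times> J) (\<lambda>p. f p v w) (\<lambda>(i, j). pt (b i) (d j)) = lincomb T (I \<times> J) (\<lambda>p. \<kappa> p (pt v w)) (\<lambda>(i, j). pt (b i) (d j))"
      using b d vw val pt_closed balancedD(1)[OF bal]
      by (intro module.lincomb_cong[OF T_module]) (auto simp: dual_basis_def Pi_iff)
    finally show "pt v w = lincomb T (I \<times> J) (\<lambda>p. \<kappa> p (pt v w)) (\<lambda>(i, j). pt (b i) (d j))" .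
  next
    fix p q assume pq: "p \<in> I \<times> J" "q \<in> I \<times> J"
    then have "b (fst q) \<in> carrier V" "d (snd q) \<in> carrier W" using b d by (auto simp: dual_basis_def)
    then show "\<kappa> p ((\<lambda>(i, j). pt (b i) (d j)) q) = (if p = q then 1 else 0)"
      using pq val[OF pq(1), of "b (fst q)" "d (snd q)"] b d by (auto simp: f_def dual_basis_def split: prod.splits)
  qed (use b d pt_closed lin in \<open>auto simp: dual_basis_def Pi_iff\<close>)
  then show ?thesis by blast
qed

locale extension =
  fixes E L :: "complex set" and V :: "(complex, 'a) module"
  assumes E: "subfield E CC" and L: "subfield L CC" and EL: "E \<subseteq> L" and V: "module (scalars E) V"
begin

sublocale t: tensor_over L E "scalars L" V
  using L EL V by (simp add: tensor_over_def module_scalars)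

abbreviation "X \<equiv> extend_module E L V"
abbreviation "xv \<equiv> extend_vector E L V"

lemma X_eq: "X = t.T" by (simp add: extend_module_def)

lemma X_module: "module (scalars L) X" unfolding X_eq by (rule t.T_module)

lemma xv_linear: "linear_map (scalars E) V X xv"
proof (rule semilinearI)
  note EC = subfield_closed[OF L]
  show "xv (r \<odot>\<^bsub>V\<^esub> x) = r \<odot>\<^bsub>X\<^esub> xv x" if "r \<in> carrier (scalars E)" "x \<in> carrier V" for r x
    using t.pt_balanced[of r 1 x] t.T_smult(2)[of r 1 x] that EL EC by (auto simp: X_eq extend_vector_def)
qed (use t.pt_closed t.pt_add_right subfield_closed[OF L] in \<open>simp_all add: X_eq extend_vector_def\<close>)

lemma pure_extend:
  assumes "l \<in> L" "v \<in> carrier V"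
  shows "pure_tensor E (scalars L) V l v = l \<odot>\<^bsub>X\<^esub> xv v"
  using assms t.T_smult(2)[of l 1 v] subfield_closed[OF L] by (simp add: X_eq extend_vector_def)

lemma X_pure_lincomb:
  assumes "l \<in> L" "c \<in> J \<rightarrow> E" "d \<in> J \<rightarrow> carrier V" "finite J"
  shows "pure_tensor E (scalars L) V l (lincomb V J c d) = lincomb X J (\<lambda>j. l * c j) (\<lambda>j. xv (d j))"
proof -
  interpret X: module "scalars L" X by (rule X_module)
  interpret V: module "scalars E" V by (rule V)
  have "module (scalars E) X" by (rule module_restrict_scalars[OF X_module E EL])
  then have "xv (lincomb V J c d) = lincomb X J c (\<lambda>j. xv (d j))"
    using V.linear_map_lincomb[OF xv_linear, of "scalars E"] assms by simp
  moreover have "c \<in> J \<rightarrow> L" "(\<lambda>j. xv (d j)) \<in> J \<rightarrow> carrier X"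
    using assms EL semilinearD(2)[OF xv_linear] by auto
  ultimately show ?thesis
    using pure_extend[OF assms(1) V.lincomb_closed[of c J d]] assms
      X.lincomb_smult[of J c "\<lambda>j. xv (d j)" l]
    by simp
qed

lemma extend_spans:
  assumes d: "spans (scalars E) V J d"
  shows "spans (scalars L) X J (\<lambda>j. xv (d j))"
  unfolding X_eq
proof (rule t.spans_from_pure)
  fix l v assume lv: "l \<in> carrier (scalars L)" "v \<in> carrier V"
  obtain c where c: "c \<in> J \<rightarrow> E" "v = lincomb V J c d" using d lv by (auto simp: spans_def)
  then show "\<exists>c\<in>J \<rightarrow> L. pure_tensor E (scalars L) V l v = lincomb t.T J c (\<lambda>j. xv (d j))"
    using X_pure_lincomb[of l c J d] lv d subfield_closed[OF L] EL
    by (intro bexI[of _ "\<lambda>j. l * c j"]) (auto simp: X_eq spans_def Pi_iff)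
qed (use d semilinearD(2)[OF xv_linear] in \<open>auto simp: spans_def X_eq\<close>)

lemma extend_dual_basis:
  assumes d: "dual_basis (scalars E) V (scalars E) J d \<theta>"
  shows "\<exists>\<eta>. dual_basis (scalars L) X (scalars L) J (\<lambda>j. xv (d j)) \<eta>"
proof -
  note EC = subfield_closed[OF L]
  have \<theta>: "linear_map (scalars E) V (scalars E) (\<theta> j)" if "j \<in> J" for j using d that by (auto simp: dual_basis_def)
  note \<theta>D = semilinearD[OF \<theta>, simplified]
  have \<theta>L: "\<theta> j v \<in> L" if "j \<in> J" "v \<in> carrier V" for j v using \<theta>D(2)[OF that] EL by auto
  define \<kappa> where "\<kappa> j = tensor_lift (scalars L) (\<lambda>l v. l * \<theta> j v)" for j
  have bal: "balanced E (scalars L) V (scalars L) (\<lambda>l v. l * \<theta> j v)" if "j \<in> J" for j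
    by (rule balancedI) (use that \<theta>D \<theta>L EC EL in \<open>auto simp: algebra_simps\<close>)
  have lin: "linear_map (scalars L) t.T (scalars L) (\<kappa> j)" if "j \<in> J" for j
    unfolding \<kappa>_def
    by (rule t.T_lift_linear[OF module_scalars[OF L] bal[OF that]]) auto
  have val: "\<kappa> j (pure_tensor E (scalars L) V l v) = l * \<theta> j v" if "j \<in> J" "v \<in> carrier V" "l \<in> L" for j v l
    unfolding \<kappa>_def using t.T_lift(2)[OF abelian_group_scalars[OF L] bal[OF that(1)]] that by simp
  have "dual_basis (scalars L) t.T (scalars L) J (\<lambda>j. xv (d j)) \<kappa>"
  proof (rule t.dual_basis_from_pure)
    fix l v assume lv: "l \<in> carrier (scalars L)" "v \<in> carrier V"
    have "pure_tensor E (scalars L) V l v = pure_tensor E (scalars L) V l (lincomb V J (\<lambda>j. \<theta> j v) d)"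
      using d lv by (simp add: dual_basis_def)
    also have "\<dots> = lincomb t.T J (\<lambda>j. l * \<theta> j v) (\<lambda>j. xv (d j))"
      using X_pure_lincomb[of l "\<lambda>j. \<theta> j v" J d] d \<theta>D lv by (simp add: X_eq dual_basis_def)
    also have "\<dots> = lincomb t.T J (\<lambda>j. \<kappa> j (pure_tensor E (scalars L) V l v)) (\<lambda>j. xv (d j))"
      using d lv val \<theta>L EC semilinearD(2)[OF xv_linear]
      by (intro module.lincomb_cong[OF t.T_module]) (auto simp: dual_basis_def Pi_iff X_eq)
    finally show "pure_tensor E (scalars L) V l v = lincomb t.T J (\<lambda>j. \<kappa> j (pure_tensor E (scalars L) V l v)) (\<lambda>j. xv (d j))" .
  next
    fix i j assume "i \<in> J" "j \<in> J"
    then show "\<kappa> i (xv (d j)) = (if i = j then 1 else 0)"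
      using val[of i "d j" 1] d EC by (auto simp: dual_basis_def extend_vector_def Pi_iff)
  qed (use d lin semilinearD(2)[OF xv_linear] in \<open>auto simp: dual_basis_def X_eq\<close>)
  then show ?thesis unfolding X_eq by blast
qed

sublocale m: cspace_map E V L X xv
  using E L V EL X_module xv_linear by (simp add: cspace_map_def cspace_def cspace_map_axioms_def)

abbreviation "xc \<equiv> extend_complexified E L V"

lemma xc_ct: "v \<in> carrier V \<Longrightarrow> xc (ctensor V v z) = ctensor X (xv v) z"
  unfolding extend_complexified_def by (rule m.cmap_ct)

lemma xc_semilinear: "semilinear (coeff_ring E) (extend_coeff L) (complexify V) (complexify X) xc"
  unfolding extend_complexified_def by (rule m.cmap_semilinear)

end


section \<open>Linear maps out of a complexified tensor product\<close>

context tensor_over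
begin

sublocale c: cspace L T
  by (simp add: cspace_def L T_module)

text \<open>
  The comparison maps of an extension of coefficients and of a tensor product are prescribed by their
  values \<open>F z v w\<close> on the tensors \<open>(v \<otimes> w) \<otimes> z\<close>. Such a map is linear over \<open>L \<otimes> \<complex>\<close> as soon as the
  scalar \<open>m \<otimes> y\<close> acts on the values by multiplying \<open>v\<close> by \<open>m\<close> and \<open>z\<close> by \<open>y\<close>.
\<close>

context
  fixes P :: "((complex, complex) tensor, 'p) module" and F :: "complex \<Rightarrow> 'a \<Rightarrow> 'b \<Rightarrow> 'p"
  assumes P: "module (coeff_ring L) P"
    and bal: "\<And>z. balanced K V W P (F z)"
    and Fadd: "\<And>z z' v w. v \<in> carrier V \<Longrightarrow> w \<in> carrier W \<Longrightarrow> F (z + z') v w = F z v w \<oplus>\<^bsub>P\<^esub> F z' v w"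
    and Fhom: "\<And>m y z v w. m \<in> L \<Longrightarrow> v \<in> carrier V \<Longrightarrow> w \<in> carrier W \<Longrightarrow>
      ctensor (scalars L) m y \<odot>\<^bsub>P\<^esub> F z v w = F (y * z) (m \<odot>\<^bsub>V\<^esub> v) w"
begin

interpretation P: module "coeff_ring L" P by (rule P)
interpretation l: cspace L "scalars L" by (rule cspace_scalars[OF L])

definition "G x z = tensor_lift P (F z) x"

lemma G: "additive_map T P (\<lambda>x. G x z)" "v \<in> carrier V \<Longrightarrow> w \<in> carrier W \<Longrightarrow> G (v \<otimes>\<^sub>T w) z = F z v w"
  unfolding G_def using T_lift[OF P.abelian_group_M bal] by auto

lemma G_hom:
  assumes m: "m \<in> L" and x: "x \<in> carrier T"
  shows "ctensor (scalars L) m y \<odot>\<^bsub>P\<^esub> G x z = G (m \<odot>\<^bsub>T\<^esub> x) (y * z)"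
proof (rule T_maps_eq[OF _ _ x])
  have mc: "ctensor (scalars L) m y \<in> carrier (coeff_ring L)" using l.emb_closed[OF m] .
  show "additive_map T P (\<lambda>x. ctensor (scalars L) m y \<odot>\<^bsub>P\<^esub> G x z)"
    using additive_mapD[OF G(1)] mc by (intro additive_mapI) (auto simp: P.smult_r_distr)
  show "additive_map T P (\<lambda>x. G (m \<odot>\<^bsub>T\<^esub> x) (y * z))"
    by (rule additive_map_comp[OF T_smult(1)[OF m] G(1)])
qed (use m Fhom module_smult_in[OF V] in \<open>simp add: G T_smult(2)\<close>)

lemma G_balanced: "balanced \<rat> T CC P G"
proof (rule balancedI, goal_cases)
  case (3 x z z')
  show ?case
  proof (rule T_maps_eq[OF G(1) _ 3(1)])
    show "additive_map T P (\<lambda>x. G x z \<oplus>\<^bsub>P\<^esub> G x z')"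
      using additive_mapD[OF G(1)] by (intro additive_mapI) (auto simp: P.M.a_ac)
  qed (use Fadd in \<open>simp add: G\<close>)
next
  case (4 q x z)
  have q: "q \<in> L" using 4 subfield_closed(9)[OF L] by blast
  have "ctensor (scalars L) q 1 = ctensor (scalars L) 1 q"
    using l.ct_rat[of 1 q 1] 4 subfield_closed[OF L] by simp
  then show ?case using G_hom[OF q 4(2), of 1 z] G_hom[of 1 x q z] 4 subfield_closed[OF L]
      module_scalarsD(5)[OF T_module] by simp
qed (use additive_mapD[OF G(1)] in auto)

lemma prescribed_linear:
  defines "C \<equiv> tensor_lift P (\<lambda>x z. tensor_lift P (F z) x)"
  shows "linear_map (coeff_ring L) (complexify T) P C"
    and "v \<in> carrier V \<Longrightarrow> w \<in> carrier W \<Longrightarrow> C (ctensor T (v \<otimes>\<^sub>T w) z) = F z v w"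
proof -
  have C: "C = tensor_lift P G" by (simp add: C_def G_def[abs_def])
  note lift = c.VC_lift[OF P.abelian_group_M G_balanced]
  show "v \<in> carrier V \<Longrightarrow> w \<in> carrier W \<Longrightarrow> C (ctensor T (v \<otimes>\<^sub>T w) z) = F z v w"
    unfolding C by (simp add: lift(2) pt_closed G)
  note La = additive_mapD[OF lift(1)]
  show "linear_map (coeff_ring L) (complexify T) P C"
    unfolding C
  proof (rule semilinearI)
    fix r x assume r: "r \<in> carrier (coeff_ring L)" and x: "x \<in> carrier c.VC"
    show "tensor_lift P G (r \<odot>\<^bsub>c.VC\<^esub> x) = r \<odot>\<^bsub>P\<^esub> tensor_lift P G x"
      using r[unfolded l.R_eq]
    proof (induction rule: l.VC_induct)
      case r: (pure m y)
      then have rc: "ctensor (scalars L) m y \<in> carrier (coeff_ring L)" using l.emb_closed by simp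
      show ?case using x
      proof (induction rule: c.VC_induct)
        case (pure x z)
        then show ?case using r c.smult_pair[of m x] G_hom[of m x y z]
          by (simp add: c.smult_VC(3) lift(2))
      next
        case (add x y)
        then show ?case using rc La c.smult_VC_closed by (simp add: c.smult_VC_add_right P.smult_r_distr)
      qed
    next
      case (add s t)
      then show ?case using x La c.smult_VC_closed
        by (simp add: l.R_eq[symmetric] c.smult_VC_add_left P.smult_l_distr)
    qed
  qed (use La in auto)
qed

end

end


lemma tensor_map:
  assumes T: "tensor_over L K V W" and T': "tensor_over L K V' W'"
    and f: "linear_map (scalars L) V V' f" and g: "linear_map (scalars K) W W' g"
  defines "h \<equiv> tensor_lift (tensor_module K V' W') (\<lambda>v w. pure_tensor K V' W' (f v) (g w))"
  shows "linear_map (scalars L) (tensor_module K V W) (tensor_module K V' W') h"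
    and "v \<in> carrier V \<Longrightarrow> w \<in> carrier W \<Longrightarrow> h (pure_tensor K V W v w) = pure_tensor K V' W' (f v) (g w)"
proof -
  interpret T: tensor_over L K V W by fact
  interpret T': tensor_over L K V' W' by fact
  note fD = semilinearD[OF f] and gD = semilinearD[OF g]
  have bal: "balanced K V W (tensor_module K V' W') (\<lambda>v w. pure_tensor K V' W' (f v) (g w))"
  proof (rule balancedI, goal_cases)
    case (4 k v w)
    then have "k \<in> L" using T.KL by auto
    then show ?case using 4 fD gD T'.pt_balanced[of k "f v" "g w"] by simp
  qed (use fD gD in \<open>simp_all add: T'.pt_closed T'.pt_add_left T'.pt_add_right\<close>)
  show "linear_map (scalars L) (tensor_module K V W) (tensor_module K V' W') h"
    unfolding h_def
    by (rule T.T_lift_linear[OF T'.T_module bal]) (use fD gD in \<open>simp add: T'.T_smult(2)\<close>)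
  show "v \<in> carrier V \<Longrightarrow> w \<in> carrier W \<Longrightarrow> h (pure_tensor K V W v w) = pure_tensor K V' W' (f v) (g w)"
    unfolding h_def by (rule T.T_lift(2)[OF T'.T_abelian bal])
qed

lemma linear_id: "linear_map R M M (\<lambda>x. x)"
  by (auto intro!: semilinearI)

lemma tensor_map_inverse:
  assumes T: "tensor_over L K V W" and T': "tensor_over L K V' W'"
    and f: "linear_map (scalars L) V V' f" and g: "linear_map (scalars K) W W' g"
    and f': "linear_map (scalars L) V' V f'" and g': "linear_map (scalars K) W' W g'"
    and inv: "\<And>v. v \<in> carrier V \<Longrightarrow> f' (f v) = v" "\<And>w. w \<in> carrier W \<Longrightarrow> g' (g w) = w"
  defines "h \<equiv> tensor_lift (tensor_module K V' W') (\<lambda>v w. pure_tensor K V' W' (f v) (g w))"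
  shows "\<exists>h'. linear_map (scalars L) (tensor_module K V' W') (tensor_module K V W) h' \<and>
    (\<forall>x\<in>carrier (tensor_module K V W). h' (h x) = x)"
proof -
  interpret T: tensor_over L K V W by fact
  note h = tensor_map[OF T T' f g, folded h_def] and h' = tensor_map[OF T' T f' g']
  let ?h' = "tensor_lift (tensor_module K V W) (\<lambda>v w. pure_tensor K V W (f' v) (g' w))"
  have "?h' (h x) = x" if "x \<in> carrier T.T" for x
    by (rule T.T_maps_eq[OF semilinearD(1)[OF linear_map_comp[OF h(1) h'(1)]] semilinearD(1)[OF linear_id] that])
      (use h(2) h'(2) inv semilinearD(2)[OF f] semilinearD(2)[OF g] in simp)
  with h'(1) show ?thesis by blast
qed

lemma complexify_mult:
  assumes "tensor_over L L V W"
  shows "v \<in> carrier V \<Longrightarrow> w \<in> carrier W \<Longrightarrow>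
      complexify_mult L V W (ctensor V v z) (ctensor W w z') = ctensor (tensor_module L V W) (pure_tensor L V W v w) (z * z')"
    and "bilinear_map (coeff_ring L) (complexify V) (complexify W) (complexify (tensor_module L V W)) (complexify_mult L V W)"
proof -
  interpret tensor_over L L V W by fact
  interpret V: cspace L V by (simp add: cspace_def L V)
  interpret W: cspace L W by (simp add: cspace_def L W)
  interpret l: cspace L "scalars L" by (rule cspace_scalars[OF L])
  interpret TC: module "coeff_ring L" "complexify T" by (rule c.VC_module)
  note sv = module_smult_in[OF V] and sw = module_smult_in[OF W]
  have q: "q \<in> L" if "q \<in> \<rat>" for q using that subfield_closed(9)[OF L] by blast
  have F2: "balanced \<rat> W CC (complexify T) (\<lambda>w z'. ctensor T (pt v w) (z * z'))" if "v \<in> carrier V" for v z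
  proof (rule balancedI, goal_cases)
    case (4 q' w z')
    then have "pt v (q' \<odot>\<^bsub>W\<^esub> w) = q' \<odot>\<^bsub>T\<^esub> pt v w"
      using pt_balanced[of q' v w] T_smult(2)[of q' v w] q that by simp
    then show ?case using 4 that c.ct_rat[of "pt v w" q' "z * z'"] pt_closed by (simp add: mult.left_commute)
  qed (use that in \<open>simp_all add: c.ct_closed pt_closed pt_add_right c.ct_add_left c.ct_add_right distrib_left\<close>)
  have F1: "balanced \<rat> V CC (complexify T) (\<lambda>v z. ctensor T (pt v w) (z * z'))" if "w \<in> carrier W" for w z'
  proof (rule balancedI, goal_cases)
    case (4 q' v z)
    then have "pt (q' \<odot>\<^bsub>V\<^esub> v) w = q' \<odot>\<^bsub>T\<^esub> pt v w" using T_smult(2)[of q' v w] q that by simp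
    then show ?case using 4 that c.ct_rat[of "pt v w" q' "z * z'"] pt_closed by (simp add: mult.assoc)
  qed (use that in \<open>simp_all add: c.ct_closed pt_closed pt_add_left c.ct_add_left c.ct_add_right distrib_right\<close>)
  have cm: "complexify_mult L V W = (\<lambda>r x. tensor_lift (complexify T) (\<lambda>v z.
      tensor_lift (complexify T) (\<lambda>w z'. ctensor T (pt v w) (z * z')) x) r)"
    by (intro ext) (simp add: complexify_mult_def Let_def)
  note n = nested_lift[OF V.tp.tensor_pair_axioms W.tp.tensor_pair_axioms c.VC_abelian,
      of "\<lambda>v z w z'. ctensor T (pt v w) (z * z')", OF F2 F1, folded cm]
  have am1: "additive_map V.VC (complexify T) (\<lambda>x. complexify_mult L V W x y)" if "y \<in> carrier W.VC" for y
    using n(1)[of y] that by (simp add: cm additive_map_def complexify_simps)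
  have am2: "additive_map W.VC (complexify T) (complexify_mult L V W x)" if "x \<in> carrier V.VC" for x
    using n(2)[of x] that by (simp add: cm additive_map_def complexify_simps)
  show val: "complexify_mult L V W (ctensor V v z) (ctensor W w z') = ctensor T (pt v w) (z * z')"
    if "v \<in> carrier V" "w \<in> carrier W" for v w z z'
    using n(3)[where a = v and b = z and c = w and d = z'] that by (simp add: cm ctensor_def)
  note a1 = additive_mapD[OF am1] and a2 = additive_mapD[OF am2]
  have hom: "complexify_mult L V W (r \<odot>\<^bsub>V.VC\<^esub> x) y = r \<odot>\<^bsub>complexify T\<^esub> complexify_mult L V W x y \<and>
      complexify_mult L V W x (r \<odot>\<^bsub>W.VC\<^esub> y) = r \<odot>\<^bsub>complexify T\<^esub> complexify_mult L V W x y"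
    if r: "r \<in> carrier (coeff_ring L)" and x: "x \<in> carrier V.VC" and y: "y \<in> carrier W.VC" for r x y
    using r[unfolded l.R_eq]
  proof (induction rule: l.VC_induct)
    case r: (pure m c)
    then have rc: "ctensor (scalars L) m c \<in> carrier (coeff_ring L)" using l.emb_closed by simp
    show ?case using x
    proof (induction rule: V.VC_induct)
      case v: (pure v z)
      show ?case using y
      proof (induction rule: W.VC_induct)
        case (pure w z')
        have "pt v (m \<odot>\<^bsub>W\<^esub> w) = m \<odot>\<^bsub>T\<^esub> pt v w"
          using pt_balanced[of m v w] T_smult(2)[of m v w] r v pure by simp
        then show ?case using pure v r sv sw pt_closed
          by (simp add: V.smult_VC(3) W.smult_VC(3) c.smult_VC(3) val T_smult(2) mult.assoc mult.left_commute)
      next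
        case (add x y)
        then show ?case using rc v V.ct_closed V.smult_VC_closed W.smult_VC_closed
          by (simp add: a2 W.smult_VC_add_right TC.smult_r_distr)
      qed
    next
      case (add x x')
      then show ?case using rc y V.smult_VC_closed W.smult_VC_closed
        by (simp add: a1 V.smult_VC_add_right TC.smult_r_distr)
    qed
  next
    case (add s t)
    then show ?case using x y V.smult_VC_closed W.smult_VC_closed
      by (simp add: l.R_eq[symmetric] a1 a2 V.smult_VC_add_left W.smult_VC_add_left TC.smult_l_distr)
  qed
  show "bilinear_map (coeff_ring L) V.VC W.VC (complexify T) (complexify_mult L V W)"
    unfolding bilinear_map_def semilinear_def using am1 am2 hom by blast
qed


section \<open>Frames of realizations\<close>

text \<open>
  The part of the structure of a realization that extension of coefficients and tensor products
  preserve by their construction. Bijectivity of the comparison map and the Hodge decomposition enter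
  only where frames are constructed.
\<close>

definition linear_realization where
  "linear_realization L N \<longleftrightarrow> subfield L CC \<and> module (scalars L) (betti N) \<and> module (scalars L) (derham N) \<and>
     linear_map (coeff_ring L) (complexify (betti N)) (complexify (derham N)) (compar N)"

text \<open>
  An \<open>L\<close>-basis \<open>e\<close> of the Betti space, de Rham vectors \<open>x\<close>, elements \<open>\<omega>\<close> of the complexified Betti
  space, and the matrix \<open>u\<close> of the comparison map from \<open>\<omega>\<close> to \<open>x\<close>. It is enough that \<open>x\<close> and \<open>\<omega>\<close>
  generate: a generating family with as many members as a basis is related to it by an invertible matrix.
\<close>

definition frame where
  "frame L N J e I x \<omega> u \<longleftrightarrow> linear_realization L N \<and>
     (\<exists>\<eta>. dual_basis (scalars L) (betti N) (scalars L) J e \<eta>) \<and>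
     spans (scalars L) (derham N) I x \<and> spans (coeff_ring L) (complexify (betti N)) I \<omega> \<and>
     (\<forall>i\<in>I. \<forall>j\<in>I. u i j \<in> carrier (coeff_ring L)) \<and>
     (\<forall>j\<in>I. compar N (\<omega> j) = lincomb (complexify (derham N)) I (\<lambda>i. u i j) (\<lambda>i. ctensor (derham N) (x i) 1))"

definition unitriangular where
  "unitriangular R I u \<longleftrightarrow> (\<forall>i\<in>I. \<forall>j\<in>I. u i j \<in> carrier R) \<and> (\<forall>i\<in>I. u i i = \<one>\<^bsub>R\<^esub>) \<and>
     (\<forall>i\<in>I. \<forall>j\<in>I. u i j \<noteq> \<zero>\<^bsub>R\<^esub> \<longrightarrow> i \<le> j)"

lemma dual_basis_spans_scalars:
  assumes "subfield L CC" "module (scalars L) V" "dual_basis (scalars L) V (scalars L) J e \<eta>"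
  shows "spans (scalars L) V J e"
  using module.dual_basis_spans[OF assms(2,3)] by simp

lemma extend_compar:
  assumes N: "linear_realization E N" and L: "subfield L CC" and EL: "E \<subseteq> L"
  shows "linear_realization L (extend_realization E L N)"
    and "x \<in> carrier (complexify (betti N)) \<Longrightarrow>
      compar (extend_realization E L N) (extend_complexified E L (betti N) x) = extend_complexified E L (derham N) (compar N x)"
proof -
  have E: "subfield E CC" and VE: "module (scalars E) (betti N)" and DE: "module (scalars E) (derham N)"
    and I: "linear_map (coeff_ring E) (complexify (betti N)) (complexify (derham N)) (compar N)"
    using N by (auto simp: linear_realization_def)
  interpret V: extension E L "betti N" using E L EL VE by (simp add: extension_def)
  interpret D: extension E L "derham N" using E L EL DE by (simp add: extension_def)
  interpret l: cspace L "scalars L" by (rule cspace_scalars[OF L])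
  interpret DC: module "coeff_ring L" "complexify D.X" by (rule D.m.W.VC_module)
  have ID: "compar N (ctensor (betti N) v z) \<in> carrier (complexify (derham N))" if "v \<in> carrier (betti N)" for v z
    using semilinearD(2)[OF I] that V.m.V.ct_closed by simp
  define k where "k v = D.xc (compar N (ctensor (betti N) v 1))" for v
  have kcl: "k v \<in> carrier (complexify D.X)" if "v \<in> carrier (betti N)" for v
    unfolding k_def using semilinearD(2)[OF D.xc_semilinear] ID that by simp
  have kadd: "k (v \<oplus>\<^bsub>betti N\<^esub> v') = k v \<oplus>\<^bsub>complexify D.X\<^esub> k v'" if "v \<in> carrier (betti N)" "v' \<in> carrier (betti N)" for v v'
    unfolding k_def using that V.m.V.ct_closed
    by (simp add: V.m.V.ct_add_left semilinearD(3)[OF I] semilinearD(3)[OF D.xc_semilinear] ID)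
  have ksm: "k (a \<odot>\<^bsub>betti N\<^esub> v) = ctensor (scalars L) a 1 \<odot>\<^bsub>complexify D.X\<^esub> k v" if "a \<in> E" "v \<in> carrier (betti N)" for a v
  proof -
    have "k (a \<odot>\<^bsub>betti N\<^esub> v) = D.xc (compar N (ctensor (scalars E) a 1 \<odot>\<^bsub>complexify (betti N)\<^esub> ctensor (betti N) v 1))"
      using that by (simp add: k_def V.m.V.ct_smult)
    then show ?thesis using that V.m.V.emb_closed[of a 1] V.m.V.ct_closed[of v 1]
      by (simp add: k_def semilinearD(4)[OF I] semilinearD(4)[OF D.xc_semilinear] ID extend_coeff_ct[OF E L EL])
  qed
  define F where "F z m v = ctensor (scalars L) m z \<odot>\<^bsub>complexify D.X\<^esub> k v" for z m v
  have lc: "ctensor (scalars L) m z \<in> carrier (coeff_ring L)" if "m \<in> L" for m z using l.emb_closed that .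
  have lm: "ctensor (scalars L) m z \<otimes>\<^bsub>coeff_ring L\<^esub> ctensor (scalars L) m' z' = ctensor (scalars L) (m * m') (z * z')"
    if "m \<in> L" "m' \<in> L" for m m' z z' using that l.smult_VC(3) by (simp add: l.R_eq)
  have la: "ctensor (scalars L) (m + m') z = ctensor (scalars L) m z \<oplus>\<^bsub>coeff_ring L\<^esub> ctensor (scalars L) m' z"
    if "m \<in> L" "m' \<in> L" for m m' z using that l.ct_add_left by (simp add: l.R_eq)
  have la': "ctensor (scalars L) m (z + z') = ctensor (scalars L) m z \<oplus>\<^bsub>coeff_ring L\<^esub> ctensor (scalars L) m z'"
    if "m \<in> L" for m z z' using that l.ct_add_right by (simp add: l.R_eq)
  have bal: "balanced E (scalars L) (betti N) (complexify D.X) (F z)" for z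
  proof (rule balancedI, goal_cases)
    case (4 a m v)
    then have "a \<in> L" using EL by auto
    then show ?case using 4 by (simp add: F_def ksm kcl lc lm DC.smult_assoc1[symmetric] mult.commute)
  qed (use kcl kadd lc la in \<open>simp_all add: F_def DC.smult_l_distr DC.smult_r_distr\<close>)
  note C = V.t.prescribed_linear[OF D.m.W.VC_module bal]
  have Fadd: "F (z + z') m v = F z m v \<oplus>\<^bsub>complexify D.X\<^esub> F z' m v" if "m \<in> carrier (scalars L)" "v \<in> carrier (betti N)" for z z' m v
    using that kcl lc la' by (simp add: F_def DC.smult_l_distr)
  have Fhom: "ctensor (scalars L) a y \<odot>\<^bsub>complexify D.X\<^esub> F z m v = F (y * z) (a \<odot>\<^bsub>scalars L\<^esub> m) v"
    if "a \<in> L" "m \<in> carrier (scalars L)" "v \<in> carrier (betti N)" for a y z m v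
    using that kcl lc by (simp add: F_def DC.smult_assoc1[symmetric] lm)
  have comp: "compar (extend_realization E L N) = tensor_lift (complexify D.X) (\<lambda>x z. tensor_lift (complexify D.X) (F z) x)"
    by (simp add: extend_realization_def Let_def F_def[abs_def] k_def)
  have bd: "betti (extend_realization E L N) = V.X" "derham (extend_realization E L N) = D.X"
    by (simp_all add: extend_realization_def Let_def)
  note C = V.t.prescribed_linear[OF D.m.W.VC_module bal Fadd Fhom, folded comp]
  show "linear_realization L (extend_realization E L N)"
    unfolding linear_realization_def bd using C(1) L V.X_module D.X_module by (simp add: V.X_eq)
  show "compar (extend_realization E L N) (V.xc x) = D.xc (compar N x)" if x: "x \<in> carrier (complexify (betti N))" for x
  proof (rule V.m.V.VC_maps_eq[OF _ _ x])
    have CX: "linear_map (coeff_ring L) (complexify V.X) (complexify D.X) (compar (extend_realization E L N))"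
      using C(1) by (simp add: V.X_eq)
    show "additive_map V.m.V.VC (complexify D.X) (\<lambda>x. compar (extend_realization E L N) (V.xc x))"
      by (rule additive_map_comp[OF semilinearD(1)[OF V.xc_semilinear] semilinearD(1)[OF CX]])
    show "additive_map V.m.V.VC (complexify D.X) (\<lambda>x. D.xc (compar N x))"
      by (rule additive_map_comp[OF semilinearD(1)[OF I] semilinearD(1)[OF D.xc_semilinear]])
    fix v z assume v: "v \<in> carrier (betti N)"
    have 1: "1 \<in> E" "1 \<in> L" using subfield_closed[OF E] subfield_closed[OF L] by auto
    have "compar (extend_realization E L N) (V.xc (ctensor (betti N) v z)) = F z 1 v"
      using C(2)[of 1 v z] v 1 by (simp add: V.xc_ct V.X_eq extend_vector_def)
    also have "\<dots> = D.xc (compar N (ctensor (betti N) v z))"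
    proof -
      have "ctensor (betti N) v z = ctensor (scalars E) 1 z \<odot>\<^bsub>complexify (betti N)\<^esub> ctensor (betti N) v 1"
        using v 1 module_scalarsD(5)[OF VE] by (simp add: V.m.V.smult_VC(3))
      then have "D.xc (compar N (ctensor (betti N) v z)) = ctensor (scalars L) 1 z \<odot>\<^bsub>complexify D.X\<^esub> k v"
        using V.m.V.emb_closed[of 1 z] V.m.V.ct_closed[of v 1] v 1
        by (simp add: k_def semilinearD(4)[OF I] semilinearD(4)[OF D.xc_semilinear] ID extend_coeff_ct[OF E L EL])
      then show ?thesis by (simp add: F_def)
    qed
    finally show "compar (extend_realization E L N) (V.xc (ctensor (betti N) v z)) = D.xc (compar N (ctensor (betti N) v z))" .
  qed
qed

lemma tensor_compar:
  assumes N: "linear_realization L N" and N': "linear_realization L N'"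
  shows "linear_realization L (tensor_realization L N N')"
    and "x \<in> carrier (complexify (betti N)) \<Longrightarrow> y \<in> carrier (complexify (betti N')) \<Longrightarrow>
      compar (tensor_realization L N N') (complexify_mult L (betti N) (betti N') x y)
        = complexify_mult L (derham N) (derham N') (compar N x) (compar N' y)"
proof -
  have L: "subfield L CC" and mods: "module (scalars L) (betti N)" "module (scalars L) (derham N)"
    "module (scalars L) (betti N')" "module (scalars L) (derham N')"
    and I: "linear_map (coeff_ring L) (complexify (betti N)) (complexify (derham N)) (compar N)"
    and I': "linear_map (coeff_ring L) (complexify (betti N')) (complexify (derham N')) (compar N')"
    using N N' by (auto simp: linear_realization_def)
  interpret V: cspace L "betti N" using L mods by (simp add: cspace_def)
  interpret V': cspace L "betti N'" using L mods by (simp add: cspace_def)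
  interpret l: cspace L "scalars L" by (rule cspace_scalars[OF L])
  interpret B: tensor_over L L "betti N" "betti N'" using L mods by (simp add: tensor_over_def)
  interpret D: tensor_over L L "derham N" "derham N'" using L mods by (simp add: tensor_over_def)
  interpret DC: module "coeff_ring L" "complexify D.T" by (rule D.c.VC_module)
  let ?m = "complexify_mult L (derham N) (derham N')" and ?mB = "complexify_mult L (betti N) (betti N')"
  note bm = complexify_mult(2)[OF D.tensor_over_axioms] and bmB = complexify_mult(2)[OF B.tensor_over_axioms]
  have ID: "compar N x \<in> carrier (complexify (derham N))" if "x \<in> carrier V.VC" for x
    using semilinearD(2)[OF I] that .
  have ID': "compar N' x \<in> carrier (complexify (derham N'))" if "x \<in> carrier V'.VC" for x
    using semilinearD(2)[OF I'] that .
  have m1: "linear_map (coeff_ring L) V.VC (complexify D.T) (\<lambda>x. ?m (compar N x) (compar N' y))" if "y \<in> carrier V'.VC" for y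
    using linear_map_comp[OF I, of "complexify D.T" "\<lambda>x. ?m x (compar N' y)"] bm ID'[OF that] by (simp add: bilinear_map_def)
  have m2: "linear_map (coeff_ring L) V'.VC (complexify D.T) (\<lambda>y. ?m (compar N x) (compar N' y))" if "x \<in> carrier V.VC" for x
    using linear_map_comp[OF I', of "complexify D.T" "\<lambda>y. ?m (compar N x) y"] bm ID[OF that] by (simp add: bilinear_map_def)
  define k where "k v v' = ?m (compar N (ctensor (betti N) v 1)) (compar N' (ctensor (betti N') v' 1))" for v v'
  have kcl: "k v v' \<in> carrier (complexify D.T)" if "v \<in> carrier (betti N)" "v' \<in> carrier (betti N')" for v v'
    unfolding k_def using semilinearD(2)[OF m1] that V.ct_closed V'.ct_closed by simp
  have kadd1: "k (v \<oplus>\<^bsub>betti N\<^esub> w) v' = k v v' \<oplus>\<^bsub>complexify D.T\<^esub> k w v'"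
    if "v \<in> carrier (betti N)" "w \<in> carrier (betti N)" "v' \<in> carrier (betti N')" for v w v'
    unfolding k_def using that V.ct_closed V'.ct_closed by (simp add: V.ct_add_left semilinearD(3)[OF m1])
  have kadd2: "k v (v' \<oplus>\<^bsub>betti N'\<^esub> w) = k v v' \<oplus>\<^bsub>complexify D.T\<^esub> k v w"
    if "v \<in> carrier (betti N)" "w \<in> carrier (betti N')" "v' \<in> carrier (betti N')" for v w v'
    unfolding k_def using that V.ct_closed V'.ct_closed by (simp add: V'.ct_add_left semilinearD(3)[OF m2])
  have ksm1: "k (a \<odot>\<^bsub>betti N\<^esub> v) v' = ctensor (scalars L) a 1 \<odot>\<^bsub>complexify D.T\<^esub> k v v'"
    if "a \<in> L" "v \<in> carrier (betti N)" "v' \<in> carrier (betti N')" for a v v'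
    unfolding k_def using that V.ct_closed V'.ct_closed l.emb_closed
    by (simp add: V.ct_smult[symmetric] semilinearD(4)[OF m1])
  have ksm2: "k v (a \<odot>\<^bsub>betti N'\<^esub> v') = ctensor (scalars L) a 1 \<odot>\<^bsub>complexify D.T\<^esub> k v v'"
    if "a \<in> L" "v \<in> carrier (betti N)" "v' \<in> carrier (betti N')" for a v v'
    unfolding k_def using that V.ct_closed V'.ct_closed l.emb_closed
    by (simp add: V'.ct_smult[symmetric] semilinearD(4)[OF m2])
  have 1: "1 \<in> L" using subfield_closed[OF L] by simp
  define F where "F z v v' = ctensor (scalars L) 1 z \<odot>\<^bsub>complexify D.T\<^esub> k v v'" for z v v'
  have lc: "ctensor (scalars L) m z \<in> carrier (coeff_ring L)" if "m \<in> L" for m z using l.emb_closed that .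
  have lm: "ctensor (scalars L) m z \<otimes>\<^bsub>coeff_ring L\<^esub> ctensor (scalars L) m' z' = ctensor (scalars L) (m * m') (z * z')"
    if "m \<in> L" "m' \<in> L" for m m' z z' using that l.smult_VC(3) by (simp add: l.R_eq)
  have la': "ctensor (scalars L) m (z + z') = ctensor (scalars L) m z \<oplus>\<^bsub>coeff_ring L\<^esub> ctensor (scalars L) m z'"
    if "m \<in> L" for m z z' using that l.ct_add_right by (simp add: l.R_eq)
  have bal: "balanced L (betti N) (betti N') (complexify D.T) (F z)" for z
    by (rule balancedI) (use kcl kadd1 kadd2 ksm1 ksm2 lc 1 in \<open>simp_all add: F_def DC.smult_r_distr\<close>)
  have Fadd: "F (z + z') v w = F z v w \<oplus>\<^bsub>complexify D.T\<^esub> F z' v w" if "v \<in> carrier (betti N)" "w \<in> carrier (betti N')" for z z' v w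
    using that kcl lc 1 la' by (simp add: F_def DC.smult_l_distr)
  have Fhom: "ctensor (scalars L) a y \<odot>\<^bsub>complexify D.T\<^esub> F z v w = F (y * z) (a \<odot>\<^bsub>betti N\<^esub> v) w"
    if "a \<in> L" "v \<in> carrier (betti N)" "w \<in> carrier (betti N')" for a y z v w
    using that kcl lc 1 ksm1 by (simp add: F_def DC.smult_assoc1[symmetric] lm)
  have comp: "compar (tensor_realization L N N') = tensor_lift (complexify D.T) (\<lambda>x z. tensor_lift (complexify D.T) (F z) x)"
    by (simp add: tensor_realization_def Let_def F_def[abs_def] k_def)
  have bd: "betti (tensor_realization L N N') = B.T" "derham (tensor_realization L N N') = D.T"
    by (simp_all add: tensor_realization_def Let_def)
  note C = B.prescribed_linear[OF D.c.VC_module bal Fadd Fhom, folded comp]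
  show "linear_realization L (tensor_realization L N N')"
    unfolding linear_realization_def bd using C(1) L B.T_module D.T_module by simp
  show "compar (tensor_realization L N N') (?mB x y) = ?m (compar N x) (compar N' y)"
    if x: "x \<in> carrier V.VC" and y: "y \<in> carrier V'.VC" for x y
  proof (rule V.VC_maps_eq[OF _ semilinearD(1)[OF m1[OF y]] x])
    show "additive_map V.VC (complexify D.T) (\<lambda>x. compar (tensor_realization L N N') (?mB x y))"
      by (rule additive_map_comp[OF _ semilinearD(1)[OF C(1)]]) (use bmB y in \<open>auto simp: bilinear_map_def semilinear_def\<close>)
    fix v z assume v: "v \<in> carrier (betti N)"
    show "compar (tensor_realization L N N') (?mB (ctensor (betti N) v z) y) = ?m (compar N (ctensor (betti N) v z)) (compar N' y)"
    proof (rule V'.VC_maps_eq[OF _ semilinearD(1)[OF m2[OF V.ct_closed[OF v]]] y])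
      show "additive_map V'.VC (complexify D.T) (\<lambda>y. compar (tensor_realization L N N') (?mB (ctensor (betti N) v z) y))"
        by (rule additive_map_comp[OF _ semilinearD(1)[OF C(1)]])
          (use bmB V.ct_closed[OF v] in \<open>auto simp: bilinear_map_def semilinear_def\<close>)
      fix w z' assume w: "w \<in> carrier (betti N')"
      have s1: "ctensor (betti N) v z = ctensor (scalars L) 1 z \<odot>\<^bsub>V.VC\<^esub> ctensor (betti N) v 1"
        using v 1 module_scalarsD(5)[OF mods(1)] by (simp add: V.smult_VC(3))
      have s2: "ctensor (betti N') w z' = ctensor (scalars L) 1 z' \<odot>\<^bsub>V'.VC\<^esub> ctensor (betti N') w 1"
        using w 1 module_scalarsD(5)[OF mods(3)] by (simp add: V'.smult_VC(3))
      have "?m (compar N (ctensor (betti N) v z)) (compar N' (ctensor (betti N') w z')) = F (z * z') v w"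
        unfolding s1 s2 using v w 1 lc V.ct_closed V'.ct_closed V.smult_VC_closed V'.smult_VC_closed kcl
        by (simp add: semilinearD(4)[OF m1] semilinearD(4)[OF m2] F_def k_def[symmetric] DC.smult_assoc1[symmetric] lm mult.commute)
      then show "compar (tensor_realization L N N') (?mB (ctensor (betti N) v z) (ctensor (betti N') w z'))
          = ?m (compar N (ctensor (betti N) v z)) (compar N' (ctensor (betti N') w z'))"
        using C(2)[of v w "z * z'"] v w complexify_mult(1)[OF B.tensor_over_axioms v w] by simp
    qed
  qed
qed

lemma extend_frame:
  assumes fr: "frame E N J e I x \<omega> u" and L: "subfield L CC" and EL: "E \<subseteq> L"
  shows "frame L (extend_realization E L N) J (\<lambda>j. extend_vector E L (betti N) (e j)) I
    (\<lambda>i. extend_vector E L (derham N) (x i)) (\<lambda>i. extend_complexified E L (betti N) (\<omega> i)) (\<lambda>i j. extend_coeff L (u i j))"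
proof -
  have N: "linear_realization E N" using fr by (simp add: frame_def)
  then have E: "subfield E CC" and VE: "module (scalars E) (betti N)" and DE: "module (scalars E) (derham N)"
    by (auto simp: linear_realization_def)
  interpret V: extension E L "betti N" using E L EL VE by (simp add: extension_def)
  interpret D: extension E L "derham N" using E L EL DE by (simp add: extension_def)
  interpret VC: module "coeff_ring L" "complexify V.X" by (rule V.m.W.VC_module)
  interpret DC: module "coeff_ring L" "complexify D.X" by (rule D.m.W.VC_module)
  interpret VC0: module "coeff_ring E" "complexify (betti N)" by (rule V.m.V.VC_module)
  interpret DC0: module "coeff_ring E" "complexify (derham N)" by (rule D.m.V.VC_module)
  have bd: "betti (extend_realization E L N) = V.X" "derham (extend_realization E L N) = D.X"
    by (simp_all add: extend_realization_def Let_def)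
  obtain \<eta> where \<eta>: "dual_basis (scalars E) (betti N) (scalars E) J e \<eta>" using fr by (auto simp: frame_def)
  have x: "spans (scalars E) (derham N) I x" and \<omega>: "spans (coeff_ring E) (complexify (betti N)) I \<omega>"
    and u: "\<And>i j. i \<in> I \<Longrightarrow> j \<in> I \<Longrightarrow> u i j \<in> carrier (coeff_ring E)"
    and c: "\<And>j. j \<in> I \<Longrightarrow> compar N (\<omega> j) = lincomb (complexify (derham N)) I (\<lambda>i. u i j) (\<lambda>i. ctensor (derham N) (x i) 1)"
    using fr by (auto simp: frame_def)
  have \<omega>c: "\<omega> \<in> I \<rightarrow> carrier (complexify (betti N))" "finite I" and xc: "x \<in> I \<rightarrow> carrier (derham N)"
    using \<omega> x by (auto simp: spans_def)
  note ecl = extend_coeff_closed[OF E L EL]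
  have \<phi>: "extend_coeff L \<in> carrier (coeff_ring E) \<rightarrow> carrier (coeff_ring L)" using ecl by auto
  have eJ: "e \<in> J \<rightarrow> carrier (betti N)" "finite J" using \<eta> by (auto simp: dual_basis_def)
  show ?thesis
    unfolding frame_def bd
  proof (intro conjI ballI extend_compar(1)[OF N L EL] V.extend_dual_basis[OF \<eta>] D.extend_spans[OF x])
    show "spans (coeff_ring L) (complexify V.X) I (\<lambda>i. V.xc (\<omega> i))"
    proof (rule VC.span_trans)
      show "spans (coeff_ring L) (complexify V.X) J (\<lambda>j. ctensor V.X (V.xv (e j)) 1)"
        by (intro V.m.W.spans_complexify V.extend_spans dual_basis_spans_scalars[OF E VE \<eta>])
      show "(\<lambda>i. V.xc (\<omega> i)) \<in> I \<rightarrow> carrier (complexify V.X)"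
        using \<omega>c semilinearD(2)[OF V.xc_semilinear] by auto
    next
      fix j assume j: "j \<in> J"
      obtain d where d: "d \<in> I \<rightarrow> carrier (coeff_ring E)" "ctensor (betti N) (e j) 1 = lincomb (complexify (betti N)) I d \<omega>"
        using \<omega> V.m.V.ct_closed[of "e j" 1] eJ j by (auto simp: spans_def Pi_iff)
      have "ctensor V.X (V.xv (e j)) 1 = V.xc (ctensor (betti N) (e j) 1)" using eJ j by (simp add: V.xc_ct Pi_iff)
      also have "\<dots> = lincomb (complexify V.X) I (\<lambda>i. extend_coeff L (d i)) (\<lambda>i. V.xc (\<omega> i))"
        unfolding d(2) by (rule VC0.linear_map_lincomb[OF V.xc_semilinear VC.module_axioms d(1) \<omega>c(1) \<phi>])
      finally show "\<exists>c\<in>I \<rightarrow> carrier (coeff_ring L). ctensor V.X (V.xv (e j)) 1 = lincomb (complexify V.X) I c (\<lambda>i. V.xc (\<omega> i))"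
        using d(1) ecl by (intro bexI[of _ "\<lambda>i. extend_coeff L (d i)"]) auto
    qed (rule \<omega>c)
  next
    fix j assume j: "j \<in> I"
    have "compar (extend_realization E L N) (V.xc (\<omega> j)) = D.xc (compar N (\<omega> j))"
      using \<omega>c j by (intro extend_compar(2)[OF N L EL]) auto
    also have "\<dots> = lincomb (complexify D.X) I (\<lambda>i. extend_coeff L (u i j)) (\<lambda>i. D.xc (ctensor (derham N) (x i) 1))"
      unfolding c[OF j] using u j xc D.m.V.ct_closed
      by (intro DC0.linear_map_lincomb[OF D.xc_semilinear DC.module_axioms _ _ \<phi>]) (auto simp: Pi_iff)
    also have "\<dots> = lincomb (complexify D.X) I (\<lambda>i. extend_coeff L (u i j)) (\<lambda>i. ctensor D.X (D.xv (x i)) 1)"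
      using u j xc ecl D.m.W.ct_closed semilinearD(2)[OF D.xv_linear] by (intro DC.lincomb_cong) (auto simp: D.xc_ct Pi_iff)
    finally show "compar (extend_realization E L N) (V.xc (\<omega> j)) = \<dots>" .
  qed (use u ecl in auto)
qed

lemma tensor_frame:
  assumes fr: "frame L N J e I x \<omega> u" and fr': "frame L N' J' e' I' x' \<omega>' u'"
  shows "frame L (tensor_realization L N N') (J \<times> J') (\<lambda>(j, j'). pure_tensor L (betti N) (betti N') (e j) (e' j')) (I \<times> I')
    (\<lambda>(i, i'). pure_tensor L (derham N) (derham N') (x i) (x' i'))
    (\<lambda>(i, i'). complexify_mult L (betti N) (betti N') (\<omega> i) (\<omega>' i'))
    (\<lambda>(i, i') (j, j'). u i j \<otimes>\<^bsub>coeff_ring L\<^esub> u' i' j')"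
proof -
  have N: "linear_realization L N" and N': "linear_realization L N'" using fr fr' by (simp_all add: frame_def)
  then have L: "subfield L CC" and mods: "module (scalars L) (betti N)" "module (scalars L) (derham N)"
    "module (scalars L) (betti N')" "module (scalars L) (derham N')"
    by (auto simp: linear_realization_def)
  interpret V: cspace L "betti N" using L mods by (simp add: cspace_def)
  interpret V': cspace L "betti N'" using L mods by (simp add: cspace_def)
  interpret W: cspace L "derham N" using L mods by (simp add: cspace_def)
  interpret W': cspace L "derham N'" using L mods by (simp add: cspace_def)
  interpret B: tensor_over L L "betti N" "betti N'" using L mods by (simp add: tensor_over_def)
  interpret D: tensor_over L L "derham N" "derham N'" using L mods by (simp add: tensor_over_def)
  interpret DC: module "coeff_ring L" "complexify D.T" by (rule D.c.VC_module)
  interpret BC: module "coeff_ring L" "complexify B.T" by (rule B.c.VC_module)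
  let ?m = "complexify_mult L (derham N) (derham N')" and ?mB = "complexify_mult L (betti N) (betti N')"
  note bm = complexify_mult(2)[OF D.tensor_over_axioms] and bmB = complexify_mult(2)[OF B.tensor_over_axioms]
  have bd: "betti (tensor_realization L N N') = B.T" "derham (tensor_realization L N N') = D.T"
    by (simp_all add: tensor_realization_def Let_def)
  have mc: "?m a b \<in> carrier (complexify D.T)" if "a \<in> carrier W.VC" "b \<in> carrier W'.VC" for a b
    using bm that by (auto simp: bilinear_map_def dest: semilinearD(2))
  have mcB: "?mB a b \<in> carrier (complexify B.T)" if "a \<in> carrier V.VC" "b \<in> carrier V'.VC" for a b
    using bmB that by (auto simp: bilinear_map_def dest: semilinearD(2))
  obtain \<eta> where \<eta>: "dual_basis (scalars L) (betti N) (scalars L) J e \<eta>" using fr by (auto simp: frame_def)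
  obtain \<eta>' where \<eta>': "dual_basis (scalars L) (betti N') (scalars L) J' e' \<eta>'" using fr' by (auto simp: frame_def)
  have x: "spans (scalars L) (derham N) I x" "spans (scalars L) (derham N') I' x'"
    and \<omega>: "spans (coeff_ring L) (complexify (betti N)) I \<omega>" "spans (coeff_ring L) (complexify (betti N')) I' \<omega>'"
    and u: "\<And>i j. i \<in> I \<Longrightarrow> j \<in> I \<Longrightarrow> u i j \<in> carrier (coeff_ring L)"
    and u': "\<And>i j. i \<in> I' \<Longrightarrow> j \<in> I' \<Longrightarrow> u' i j \<in> carrier (coeff_ring L)"
    and c: "\<And>j. j \<in> I \<Longrightarrow> compar N (\<omega> j) = lincomb (complexify (derham N)) I (\<lambda>i. u i j) (\<lambda>i. ctensor (derham N) (x i) 1)"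
    and c': "\<And>j. j \<in> I' \<Longrightarrow> compar N' (\<omega>' j) = lincomb (complexify (derham N')) I' (\<lambda>i. u' i j) (\<lambda>i. ctensor (derham N') (x' i) 1)"
    using fr fr' by (auto simp: frame_def)
  have \<omega>c: "\<omega> \<in> I \<rightarrow> carrier V.VC" "\<omega>' \<in> I' \<rightarrow> carrier V'.VC" and fin: "finite I" "finite I'"
    and xc: "x \<in> I \<rightarrow> carrier (derham N)" "x' \<in> I' \<rightarrow> carrier (derham N')"
    using \<omega> x by (auto simp: spans_def)
  have eJ: "e \<in> J \<rightarrow> carrier (betti N)" "finite J" "e' \<in> J' \<rightarrow> carrier (betti N')" "finite J'"
    using \<eta> \<eta>' by (auto simp: dual_basis_def)
  have rm: "a \<otimes>\<^bsub>coeff_ring L\<^esub> b \<in> carrier (coeff_ring L)" if "a \<in> carrier (coeff_ring L)" "b \<in> carrier (coeff_ring L)" for a b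
    using that by simp
  show ?thesis
    unfolding frame_def bd
  proof (intro conjI ballI tensor_compar(1)[OF N N'] tensor_dual_basis[OF B.tensor_over_axioms \<eta> \<eta>'] tensor_spans[OF D.tensor_over_axioms x])
    show "spans (coeff_ring L) (complexify B.T) (I \<times> I') (\<lambda>(i, i'). ?mB (\<omega> i) (\<omega>' i'))"
    proof (rule BC.span_trans)
      show "spans (coeff_ring L) (complexify B.T) (J \<times> J') (\<lambda>p. ctensor B.T ((\<lambda>(j, j'). B.pt (e j) (e' j')) p) 1)"
        by (intro B.c.spans_complexify tensor_spans[OF B.tensor_over_axioms] dual_basis_spans_scalars[OF L mods(1) \<eta>]
            dual_basis_spans_scalars[OF L mods(3) \<eta>'])
      show "(\<lambda>(i, i'). ?mB (\<omega> i) (\<omega>' i')) \<in> I \<times> I' \<rightarrow> carrier (complexify B.T)" using \<omega>c mcB by auto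
    next
      fix p assume "p \<in> J \<times> J'"
      then obtain j j' where p: "p = (j, j')" "j \<in> J" "j' \<in> J'" by auto
      obtain d where d: "d \<in> I \<rightarrow> carrier (coeff_ring L)" "ctensor (betti N) (e j) 1 = lincomb V.VC I d \<omega>"
        using \<omega> V.ct_closed[of "e j" 1] eJ p by (auto simp: spans_def Pi_iff)
      obtain d' where d': "d' \<in> I' \<rightarrow> carrier (coeff_ring L)" "ctensor (betti N') (e' j') 1 = lincomb V'.VC I' d' \<omega>'"
        using \<omega> V'.ct_closed[of "e' j'" 1] eJ p by (auto simp: spans_def Pi_iff)
      have "ctensor B.T (B.pt (e j) (e' j')) 1 = ?mB (ctensor (betti N) (e j) 1) (ctensor (betti N') (e' j') 1)"
        using complexify_mult(1)[OF B.tensor_over_axioms, of "e j" "e' j'" 1 1] eJ p by auto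
      also have "\<dots> = lincomb (complexify B.T) (I \<times> I') (\<lambda>(i, i'). d i \<otimes>\<^bsub>coeff_ring L\<^esub> d' i') (\<lambda>(i, i'). ?mB (\<omega> i) (\<omega>' i'))"
        unfolding d(2) d'(2)
        by (rule bilinear_lincomb[OF V.VC_module V'.VC_module BC.module_axioms bmB fin d(1) \<omega>c(1) d'(1) \<omega>c(2)])
      finally show "\<exists>c\<in>I \<times> I' \<rightarrow> carrier (coeff_ring L). ctensor B.T ((\<lambda>(j, j'). B.pt (e j) (e' j')) p) 1
          = lincomb (complexify B.T) (I \<times> I') c (\<lambda>(i, i'). ?mB (\<omega> i) (\<omega>' i'))"
        using d(1) d'(1) p by (intro bexI[of _ "\<lambda>(i, i'). d i \<otimes>\<^bsub>coeff_ring L\<^esub> d' i'"]) auto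
    qed (use fin in auto)
  next
    fix q assume "q \<in> I \<times> I'"
    then obtain j j' where q: "q = (j, j')" "j \<in> I" "j' \<in> I'" by auto
    have "compar (tensor_realization L N N') (?mB (\<omega> j) (\<omega>' j')) = ?m (compar N (\<omega> j)) (compar N' (\<omega>' j'))"
      using \<omega>c q by (intro tensor_compar(2)[OF N N']) auto
    also have "\<dots> = lincomb (complexify D.T) (I \<times> I') (\<lambda>(i, i'). u i j \<otimes>\<^bsub>coeff_ring L\<^esub> u' i' j')
        (\<lambda>(i, i'). ?m (ctensor (derham N) (x i) 1) (ctensor (derham N') (x' i') 1))"
      unfolding c[OF q(2)] c'[OF q(3)] using u u' q xc W.ct_closed W'.ct_closed
      by (intro bilinear_lincomb[OF W.VC_module W'.VC_module DC.module_axioms bm fin]) (auto simp: Pi_iff)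
    also have "\<dots> = lincomb (complexify D.T) (I \<times> I') (\<lambda>p. (\<lambda>(i, i') (j, j'). u i j \<otimes>\<^bsub>coeff_ring L\<^esub> u' i' j') p q)
        (\<lambda>p. ctensor D.T ((\<lambda>(i, i'). D.pt (x i) (x' i')) p) 1)"
      using u u' q xc D.c.ct_closed D.pt_closed complexify_mult(1)[OF D.tensor_over_axioms, of _ _ 1 1]
      by (intro DC.lincomb_cong) (auto simp: Pi_iff)
    finally show "compar (tensor_realization L N N') ((\<lambda>(i, i'). ?mB (\<omega> i) (\<omega>' i')) q) = \<dots>" using q by simp
  qed (use u u' in auto)
qed

lemma extend_hodge:
  "y \<in> hodge N p q \<Longrightarrow> extend_complexified E L (betti N) y \<in> hodge (extend_realization E L N) p q"
  unfolding extend_realization_def mod_span_def Let_def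
  using hull_subset[of "extend_complexified E L (betti N) ` hodge N p q"] by auto

lemma tensor_hodge:
  assumes "y \<in> hodge N a b" "y' \<in> hodge N' c d"
  shows "complexify_mult L (betti N) (betti N') y y' \<in> hodge (tensor_realization L N N') (a + c) (b + d)"
  unfolding tensor_realization_def mod_span_def Let_def
  using assms by simp (rule hull_inc, blast)


section \<open>Bases adapted to the Hodge filtration\<close>

text \<open>
  Gaussian elimination of one unknown, by induction on the number of equations.
\<close>

lemma linear_relation:
  assumes E: "subfield E CC" and "finite J" "card J > n" "\<And>i j. i < n \<Longrightarrow> j \<in> J \<Longrightarrow> X i j \<in> E"
  shows "\<exists>c. (\<forall>j\<in>J. c j \<in> E) \<and> (\<exists>j\<in>J. c j \<noteq> 0) \<and> (\<forall>i<n. (\<Sum>j\<in>J. X i j * c j) = 0)"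
  using assms(2-)
proof (induction n arbitrary: J X)
  case 0
  then obtain j where "j \<in> J" by (metis card_gt_0_iff ex_in_conv)
  then show ?case using subfield_closed[OF E] by (intro exI[of _ "\<lambda>_. 1"]) auto
next
  case (Suc n)
  note EC = subfield_closed[OF E]
  show ?case
  proof (cases "\<forall>j\<in>J. X n j = 0")
    case True
    obtain c where "(\<forall>j\<in>J. c j \<in> E) \<and> (\<exists>j\<in>J. c j \<noteq> 0) \<and> (\<forall>i<n. (\<Sum>j\<in>J. X i j * c j) = 0)"
      using Suc.IH[of J X] Suc.prems by auto
    then show ?thesis using True by (intro exI[of _ c]) (auto simp: less_Suc_eq)
  next
    case False
    then obtain k where k: "k \<in> J" "X n k \<noteq> 0" by auto
    let ?J = "J - {k}" and ?X = "\<lambda>i j. X i j - X i k * X n j / X n k"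
    have "\<exists>c. (\<forall>j\<in>?J. c j \<in> E) \<and> (\<exists>j\<in>?J. c j \<noteq> 0) \<and> (\<forall>i<n. (\<Sum>j\<in>?J. ?X i j * c j) = 0)"
      using Suc.prems k EC by (intro Suc.IH) auto
    then obtain c where c: "\<And>j. j \<in> ?J \<Longrightarrow> c j \<in> E" "\<exists>j\<in>?J. c j \<noteq> 0" "\<And>i. i < n \<Longrightarrow> (\<Sum>j\<in>?J. ?X i j * c j) = 0"
      by auto
    define s where "s = (\<Sum>j\<in>?J. X n j * c j)"
    define c' where "c' j = (if j = k then - s / X n k else c j)" for j
    have sum_mem: "(\<Sum>j\<in>S. f j) \<in> E" if "\<And>j. j \<in> S \<Longrightarrow> f j \<in> E" for S and f :: "'a \<Rightarrow> complex"
      using that by (induction S rule: infinite_finite_induct) (auto simp: EC)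
    have sE: "s \<in> E" unfolding s_def using Suc.prems c EC by (intro sum_mem) auto
    have split: "(\<Sum>j\<in>J. X i j * c' j) = (\<Sum>j\<in>?J. X i j * c j) - X i k * s / X n k" for i
    proof -
      have "(\<Sum>j\<in>J. X i j * c' j) = X i k * c' k + (\<Sum>j\<in>?J. X i j * c' j)"
        using Suc.prems k by (intro sum.remove) auto
      also have "(\<Sum>j\<in>?J. X i j * c' j) = (\<Sum>j\<in>?J. X i j * c j)" by (intro sum.cong) (auto simp: c'_def)
      finally show ?thesis by (simp add: c'_def)
    qed
    have "(\<Sum>j\<in>J. X i j * c' j) = 0" if "i < Suc n" for i
    proof (cases "i = n")
      case True
      then show ?thesis using k by (simp add: split s_def)
    next
      case False
      then have "0 = (\<Sum>j\<in>?J. ?X i j * c j)" using c that by simp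
      also have "\<dots> = (\<Sum>j\<in>?J. X i j * c j) - X i k * s / X n k"
        by (simp add: s_def left_diff_distrib right_diff_distrib sum_subtractf sum_distrib_left sum_divide_distrib mult_ac)
      finally show ?thesis by (simp add: split)
    qed
    then show ?thesis using c Suc.prems k sE EC
      by (intro exI[of _ c']) (auto simp: c'_def)
  qed
qed

context module
begin

lemma submodule_lincomb:
  assumes H: "submodule H R M" and cb: "c \<in> I \<rightarrow> carrier R" "b \<in> I \<rightarrow> H"
  shows "lincomb M I c b \<in> H"
proof -
  note E = submoduleE[OF H]
  have z: "\<zero>\<^bsub>M\<^esub> \<in> H" using E(2) E(3) E(5) E(1)
    by (metis M.r_neg all_not_in_conv subset_eq)
  show ?thesis
    unfolding lincomb_def using cb
  proof (induction I rule: infinite_finite_induct)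
    case (insert i I)
    then have "c i \<odot>\<^bsub>M\<^esub> b i \<in> H" "(\<Oplus>\<^bsub>M\<^esub>i\<in>I. c i \<odot>\<^bsub>M\<^esub> b i) \<in> H" using E(4) by auto
    moreover have "(\<lambda>i. c i \<odot>\<^bsub>M\<^esub> b i) \<in> I \<rightarrow> carrier M" "c i \<odot>\<^bsub>M\<^esub> b i \<in> carrier M"
      using insert E(1) by (auto simp: Pi_iff subset_iff)
    ultimately show ?case using insert E(5) by (simp add: M.finsum_insert)
  qed (use z in auto)
qed

lemma lincomb_span_submodule:
  assumes fin: "finite I" and b: "b \<in> I \<rightarrow> carrier M"
  shows "submodule {lincomb M I c b |c. c \<in> I \<rightarrow> carrier R} R M"
proof (rule submoduleI)
  show "{lincomb M I c b |c. c \<in> I \<rightarrow> carrier R} \<subseteq> carrier M" using b lincomb_closed by auto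
  have "lincomb M I (\<lambda>_. \<zero>) b = (\<Oplus>\<^bsub>M\<^esub>i\<in>I. \<zero>\<^bsub>M\<^esub>)"
    unfolding lincomb_def using b by (intro M.finsum_cong') (auto simp: Pi_iff)
  then have "\<zero>\<^bsub>M\<^esub> = lincomb M I (\<lambda>_. \<zero>) b" by simp
  then show "\<zero>\<^bsub>M\<^esub> \<in> {lincomb M I c b |c. c \<in> I \<rightarrow> carrier R}" by (intro CollectI exI[of _ "\<lambda>_. \<zero>"]) auto
next
  fix x y assume "x \<in> {lincomb M I c b |c. c \<in> I \<rightarrow> carrier R}" "y \<in> {lincomb M I c b |c. c \<in> I \<rightarrow> carrier R}"
  then obtain c d where cd: "c \<in> I \<rightarrow> carrier R" "d \<in> I \<rightarrow> carrier R" "x = lincomb M I c b" "y = lincomb M I d b" by auto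
  then show "x \<oplus>\<^bsub>M\<^esub> y \<in> {lincomb M I c b |c. c \<in> I \<rightarrow> carrier R}"
    using lincomb_add[of c I d b] b by (intro CollectI exI[of _ "\<lambda>i. c i \<oplus> d i"]) auto
next
  fix r x assume r: "r \<in> carrier R" and "x \<in> {lincomb M I c b |c. c \<in> I \<rightarrow> carrier R}"
  then obtain c where c: "c \<in> I \<rightarrow> carrier R" "x = lincomb M I c b" by auto
  show "r \<odot>\<^bsub>M\<^esub> x \<in> {lincomb M I c b |c. c \<in> I \<rightarrow> carrier R}"
    using lincomb_smult[OF fin c(1) b r] c r by (intro CollectI exI[of _ "\<lambda>i. r \<otimes> c i"]) auto
next
  fix x assume "x \<in> {lincomb M I c b |c. c \<in> I \<rightarrow> carrier R}"
  then obtain c where c: "c \<in> I \<rightarrow> carrier R" "x = lincomb M I c b" by auto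
  have "\<ominus>\<^bsub>M\<^esub> x = (\<ominus> \<one>) \<odot>\<^bsub>M\<^esub> x" using c b lincomb_closed[of c I b] by (simp add: smult_l_minus)
  then show "\<ominus>\<^bsub>M\<^esub> x \<in> {lincomb M I c b |c. c \<in> I \<rightarrow> carrier R}"
    using lincomb_smult[OF fin c(1) b, of "\<ominus> \<one>"] c
    by (intro CollectI exI[of _ "\<lambda>i. \<ominus> \<one> \<otimes> c i"]) auto
qed

text \<open>
  The span of the summands indexed by \<open>S\<close> consists of sums whose component at \<open>i\<close> is zero. If it
  contains \<open>y\<close>, then uniqueness of components compares this with the component \<open>y\<close> at \<open>i\<close>.
\<close>

lemma direct_sum_disjoint:
  assumes D: "direct_sum_decomposition R M H" and i: "i \<notin> S" and y: "y \<in> H i" "y \<in> mod_span R M (\<Union>s\<in>S. H s)"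
  shows "y = \<zero>\<^bsub>M\<^esub>"
proof -
  define J where "J = {i. H i \<noteq> {\<zero>\<^bsub>M\<^esub>}}"
  have H: "submodule (H i) R M" for i using D by (simp add: direct_sum_decomposition_def)
  have fin: "finite J" using D by (simp add: direct_sum_decomposition_def J_def)
  have ex1: "\<exists>!f. (\<forall>i. f i \<in> H i) \<and> x = (\<Oplus>\<^bsub>M\<^esub>i\<in>J. f i)" if "x \<in> carrier M" for x
    using D that by (simp add: direct_sum_decomposition_def J_def)
  note HE = submoduleE[OF H]
  have z: "\<zero>\<^bsub>M\<^esub> \<in> H i" for i
    using HE(2)[of i] HE(3)[of _ i] HE(5)[of _ i] HE(1)[of i] by (metis M.r_neg all_not_in_conv subset_eq)
  define U where "U = {x. \<exists>f. (\<forall>i. f i \<in> H i) \<and> (\<forall>i. i \<notin> S \<longrightarrow> f i = \<zero>\<^bsub>M\<^esub>) \<and> x = (\<Oplus>\<^bsub>M\<^esub>i\<in>J. f i)}"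
  have cl: "f \<in> J \<rightarrow> carrier M" if "\<forall>i. f i \<in> H i" for f using that HE(1) by blast
  have "submodule U R M"
  proof (rule submoduleI)
    show "U \<subseteq> carrier M" unfolding U_def using cl by (auto intro!: M.finsum_closed)
    show "\<zero>\<^bsub>M\<^esub> \<in> U" unfolding U_def using z by (intro CollectI exI[of _ "\<lambda>_. \<zero>\<^bsub>M\<^esub>"]) auto
    fix x assume "x \<in> U"
    then obtain f where f: "\<forall>i. f i \<in> H i" "\<forall>i. i \<notin> S \<longrightarrow> f i = \<zero>\<^bsub>M\<^esub>" "x = (\<Oplus>\<^bsub>M\<^esub>i\<in>J. f i)" by (auto simp: U_def)
    show "\<ominus>\<^bsub>M\<^esub> x \<in> U" unfolding U_def using f HE(3) M.finsum_neg[OF cl[OF f(1)]] M.a_inv_zero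
      by (intro CollectI exI[of _ "\<lambda>i. \<ominus>\<^bsub>M\<^esub> f i"]) auto
    show "a \<odot>\<^bsub>M\<^esub> x \<in> U" if "a \<in> carrier R" for a
      unfolding U_def using f HE(4) that finsum_smult_ldistr[OF fin that cl[OF f(1)]]
      by (intro CollectI exI[of _ "\<lambda>i. a \<odot>\<^bsub>M\<^esub> f i"]) auto
    fix x' assume "x' \<in> U"
    then obtain g where g: "\<forall>i. g i \<in> H i" "\<forall>i. i \<notin> S \<longrightarrow> g i = \<zero>\<^bsub>M\<^esub>" "x' = (\<Oplus>\<^bsub>M\<^esub>i\<in>J. g i)" by (auto simp: U_def)
    show "x \<oplus>\<^bsub>M\<^esub> x' \<in> U" unfolding U_def using f g HE(5) M.finsum_addf[OF cl[OF f(1)] cl[OF g(1)]]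
      by (intro CollectI exI[of _ "\<lambda>i. f i \<oplus>\<^bsub>M\<^esub> g i"]) auto
  qed
  have single: "x = (\<Oplus>\<^bsub>M\<^esub>j\<in>J. if j = s then x else \<zero>\<^bsub>M\<^esub>)" if "x \<in> H s" for x s
  proof (cases "s \<in> J")
    case True
    have "(\<Oplus>\<^bsub>M\<^esub>j\<in>J. if j = s then x else \<zero>\<^bsub>M\<^esub>) = x"
      using that HE(1)[of s] True fin by (intro M.add.finprod_singleton_swap[of s J "\<lambda>_. x"]) auto
    then show ?thesis by simp
  next
    case False
    have "(\<Oplus>\<^bsub>M\<^esub>j\<in>J. if j = s then x else \<zero>\<^bsub>M\<^esub>) = (\<Oplus>\<^bsub>M\<^esub>j\<in>J. \<zero>\<^bsub>M\<^esub>)"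
      using False by (intro M.finsum_cong') auto
    then show ?thesis using that False by (simp add: J_def)
  qed
  have "(\<Union>s\<in>S. H s) \<subseteq> U"
  proof
    fix x assume "x \<in> (\<Union>s\<in>S. H s)"
    then obtain s where "s \<in> S" "x \<in> H s" by auto
    then show "x \<in> U" unfolding U_def using z single[of x s]
      by (intro CollectI exI[of _ "\<lambda>j. if j = s then x else \<zero>\<^bsub>M\<^esub>"]) auto
  qed
  then have "mod_span R M (\<Union>s\<in>S. H s) \<subseteq> U"
    unfolding mod_span_def using \<open>submodule U R M\<close> by (intro hull_minimal)
  then obtain f where f: "\<forall>i. f i \<in> H i" "\<forall>i. i \<notin> S \<longrightarrow> f i = \<zero>\<^bsub>M\<^esub>" "y = (\<Oplus>\<^bsub>M\<^esub>i\<in>J. f i)"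
    using y by (auto simp: U_def)
  let ?g = "\<lambda>j. if j = i then y else \<zero>\<^bsub>M\<^esub>"
  have g: "(\<forall>j. ?g j \<in> H j) \<and> y = (\<Oplus>\<^bsub>M\<^esub>j\<in>J. ?g j)" using y(1) z single[OF y(1)] by auto
  have yM: "y \<in> carrier M" using y HE(1) by auto
  have uniq: "h = (THE f. (\<forall>i. f i \<in> H i) \<and> y = (\<Oplus>\<^bsub>M\<^esub>i\<in>J. f i))"
    if "(\<forall>i. h i \<in> H i) \<and> y = (\<Oplus>\<^bsub>M\<^esub>i\<in>J. h i)" for h
    using the1_equality[OF ex1[OF yM], OF that] by (rule sym)
  have "f = ?g"
    by (rule trans[OF uniq[OF conjI[OF f(1,3)]] uniq[OF g, symmetric]])
  then have "f i = y" by simp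
  then show ?thesis using f(2) i by simp
qed

end

context cspace
begin

lemma restrict_cspace:
  assumes "submodule U (scalars E) V"
  shows "cspace E (V\<lparr>carrier := U\<rparr>)" "cspace_map E (V\<lparr>carrier := U\<rparr>) E V id"
proof -
  have "U \<subseteq> carrier V" using module.submoduleE(1)[OF V assms] .
  then show "cspace E (V\<lparr>carrier := U\<rparr>)" "cspace_map E (V\<lparr>carrier := U\<rparr>) E V id"
    using submodule.submodule_is_module[OF assms V] E V
    by (auto simp: cspace_def cspace_map_def cspace_map_axioms_def intro!: semilinearI)
qed

lemma complexify_sub_induct [consumes 2, case_names pure add]:
  assumes U: "submodule U (scalars E) V" and y: "y \<in> complexify_sub V U"
    and pure: "\<And>u z. u \<in> U \<Longrightarrow> Q (ctensor V u z)"
    and add: "\<And>x y. x \<in> carrier VC \<Longrightarrow> y \<in> carrier VC \<Longrightarrow> Q x \<Longrightarrow> Q y \<Longrightarrow> Q (x \<oplus>\<^bsub>VC\<^esub> y)"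
  shows "Q y"
proof -
  interpret U: cspace_map E "V\<lparr>carrier := U\<rparr>" E V id by (rule restrict_cspace[OF U])
  obtain x where x: "x \<in> carrier U.V.VC" "y = complexify_map V id x"
    using y by (auto simp: complexify_sub_def)
  show ?thesis unfolding x(2) using x(1)
  proof (induction rule: U.V.VC_induct)
    case (pure v z)
    then show ?case using U.cmap_ct[of v z] assms(3)[of v z] by (simp add: id_def)
  next
    case (add x y)
    then show ?case using additive_mapD[OF U.cmap_additive] assms(4) by (simp add: id_def)
  qed
qed

lemma complexify_sub_pure:
  assumes U: "submodule U (scalars E) V" and u: "u \<in> U"
  shows "ctensor V u z \<in> complexify_sub V U"
proof -
  interpret U: cspace_map E "V\<lparr>carrier := U\<rparr>" E V id by (rule restrict_cspace[OF U])
  show ?thesis unfolding complexify_sub_def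
    using U.cmap_ct[of u z] U.V.ct_closed[of u z] u by (intro image_eqI[of _ _ "ctensor (V\<lparr>carrier := U\<rparr>) u z"]) auto
qed

lemma complexify_sub_add:
  assumes U: "submodule U (scalars E) V" and "x \<in> complexify_sub V U" "y \<in> complexify_sub V U"
  shows "x \<oplus>\<^bsub>VC\<^esub> y \<in> complexify_sub V U" "x \<in> carrier VC"
proof -
  interpret U: cspace_map E "V\<lparr>carrier := U\<rparr>" E V id by (rule restrict_cspace[OF U])
  obtain a b where ab: "a \<in> carrier U.V.VC" "x = complexify_map V id a" "b \<in> carrier U.V.VC" "y = complexify_map V id b"
    using assms by (auto simp: complexify_sub_def)
  show "x \<oplus>\<^bsub>VC\<^esub> y \<in> complexify_sub V U" "x \<in> carrier VC"
    unfolding complexify_sub_def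
    using ab additive_mapD[OF U.cmap_additive] abelian_groupE(1)[OF U.V.VC_abelian]
    by (auto intro!: image_eqI[of _ _ "a \<oplus>\<^bsub>U.V.VC\<^esub> b"])
qed

text \<open>
  The coordinates of a pure tensor \<open>u \<otimes> z\<close> are those of \<open>u\<close> tensored with \<open>z\<close>, and vanishing of
  coordinates survives sums.
\<close>

lemma complexify_sub_lincomb:
  assumes U: "submodule U (scalars E) V" and y: "y \<in> complexify_sub V U" and b: "b \<in> I \<rightarrow> carrier V"
    and c: "\<And>u. u \<in> U \<Longrightarrow> \<exists>c\<in>I \<rightarrow> E. u = lincomb V I c b \<and> (\<forall>i\<in>Z. c i = 0)" and Z: "Z \<subseteq> I"
  shows "\<exists>c\<in>I \<rightarrow> carrier R. y = lincomb VC I c (\<lambda>i. ctensor V (b i) 1) \<and> (\<forall>i\<in>Z. c i = \<zero>\<^bsub>R\<^esub>)"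
  using U y
proof (induction rule: complexify_sub_induct)
  case (pure u z)
  interpret E: cspace E "scalars E" by (rule cspace_scalars[OF E])
  obtain c where c: "c \<in> I \<rightarrow> E" "u = lincomb V I c b" "\<forall>i\<in>Z. c i = 0" using c[OF pure] by auto
  have "ctensor (scalars E) 0 z = \<zero>\<^bsub>R\<^esub>"
    using E.tp.pure_zero_left[of z] by (simp add: ctensor_def coeff_ring_simps complexify_simps)
  then show ?case using c ct_lincomb[OF c(1) b, of z] emb_closed
    by (intro bexI[of _ "\<lambda>i. ctensor (scalars E) (c i) z"]) (auto simp: Pi_iff)
next
  case (add x y)
  interpret VC: module R VC by (rule VC_module)
  obtain c d where cd: "c \<in> I \<rightarrow> carrier R" "x = lincomb VC I c (\<lambda>i. ctensor V (b i) 1)" "\<forall>i\<in>Z. c i = \<zero>\<^bsub>R\<^esub>"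
    "d \<in> I \<rightarrow> carrier R" "y = lincomb VC I d (\<lambda>i. ctensor V (b i) 1)" "\<forall>i\<in>Z. d i = \<zero>\<^bsub>R\<^esub>"
    using add by blast
  have "(\<lambda>i. ctensor V (b i) 1) \<in> I \<rightarrow> carrier VC" using b ct_closed by (auto simp: Pi_iff)
  then show ?case using VC.lincomb_add[OF cd(1,4)] cd
    by (intro bexI[of _ "\<lambda>i. c i \<oplus>\<^bsub>R\<^esub> d i"]) auto
qed

end

text \<open>
  Each step of the flag contains a vector that the previous one does not. A linear combination lying in
  \<open>F i\<close> therefore has no coefficient beyond the \<open>i\<close>-th; in particular (\<open>i = 0\<close>) the vectors are
  independent. Since \<open>n + 1\<close> vectors of a space of rank \<open>n\<close> are related, they also generate.
\<close>

lemma flag_basis: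
  assumes E: "subfield E CC" and V: "module (scalars E) V" and rank: "free_of_rank (scalars E) V n"
    and F: "\<And>i. i \<le> n \<Longrightarrow> submodule (F i) (scalars E) V" and mono: "\<And>i. i < n \<Longrightarrow> F i \<subseteq> F (Suc i)"
    and x: "\<And>i. i \<in> {1..n} \<Longrightarrow> x i \<in> F i" "\<And>i. i \<in> {1..n} \<Longrightarrow> x i \<notin> F (i - 1)"
  shows "spans (scalars E) V {1..n} x"
    and "y \<in> F i \<Longrightarrow> i \<le> n \<Longrightarrow> \<exists>c\<in>{1..n} \<rightarrow> E. y = lincomb V {1..n} c x \<and> (\<forall>j\<in>{i<..n}. c j = 0)"
proof -
  interpret V: module "scalars E" V by fact
  note EC = subfield_closed[OF E]
  let ?I = "{1..n}"
  have FV: "F i \<subseteq> carrier V" if "i \<le> n" for i using V.submoduleE(1)[OF F[OF that]] .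
  have xV: "x \<in> ?I \<rightarrow> carrier V" using x(1) FV by fastforce
  have F_le: "F i \<subseteq> F j" if "i \<le> j" "j \<le> n" for i j
    using that by (induction j rule: dec_induct) (use mono in \<open>auto simp: Suc_le_eq\<close>)
  have Fs: "f \<odot>\<^bsub>V\<^esub> y \<in> F i" if "f \<in> E" "y \<in> F i" "i \<le> n" for f y i
    using V.submoduleE(4)[OF F[OF that(3)]] that by simp
  have Fa: "y \<oplus>\<^bsub>V\<^esub> y' \<in> F i" if "y \<in> F i" "y' \<in> F i" "i \<le> n" for y y' i
    using V.submoduleE(5)[OF F[OF that(3)]] that by simp
  have Fn: "\<ominus>\<^bsub>V\<^esub> y \<in> F i" if "y \<in> F i" "i \<le> n" for y i
    using V.submoduleE(3)[OF F[OF that(2)]] that by simp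
  \<comment> \<open>If the last nonzero coefficient of \<open>y \<in> F i\<close> came at \<open>m > i\<close>, then \<open>x m\<close> would lie in \<open>F (m - 1)\<close>.\<close>
  have coeff: "c j = 0" if c: "c \<in> ?I \<rightarrow> E" and i: "i \<le> n" and y: "lincomb V ?I c x \<in> F i" and j: "j \<in> {i<..n}" for c i j
  proof (rule ccontr)
    assume "c j \<noteq> 0"
    define m where "m = Max {k \<in> ?I. c k \<noteq> 0}"
    have ne: "finite {k \<in> ?I. c k \<noteq> 0}" "{k \<in> ?I. c k \<noteq> 0} \<noteq> {}" using \<open>c j \<noteq> 0\<close> j by auto
    have m: "m \<in> ?I" "c m \<noteq> 0" using Max_in[OF ne] unfolding m_def by auto
    have mmax: "c k = 0" if "k \<in> ?I" "k > m" for k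
      using Max_ge[OF ne(1), of k] that unfolding m_def by fastforce
    have "j \<le> m" using Max_ge[OF ne(1), of j] \<open>c j \<noteq> 0\<close> j unfolding m_def by auto
    then have im: "i \<le> m - 1" "m - 1 \<le> n" using j m by auto
    define s where "s = (\<Oplus>\<^bsub>V\<^esub>k\<in>{1..m - 1}. c k \<odot>\<^bsub>V\<^esub> x k)"
    have cx: "c k \<odot>\<^bsub>V\<^esub> x k \<in> carrier V" if "k \<in> ?I" for k using c xV that by (auto simp: Pi_iff)
    have "lincomb V ?I c x = (\<Oplus>\<^bsub>V\<^esub>k\<in>insert m {1..m - 1}. c k \<odot>\<^bsub>V\<^esub> x k)"
      unfolding lincomb_def
    proof (rule V.M.add.finprod_mono_neutral_cong_right)
      show "insert m {1..m - 1} \<subseteq> ?I" using m by auto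
      show "c k \<odot>\<^bsub>V\<^esub> x k = \<zero>\<^bsub>V\<^esub>" if "k \<in> ?I - insert m {1..m - 1}" for k
      proof -
        have "k > m" using that m by auto
        then have "c k = 0" using mmax that by auto
        moreover have "x k \<in> carrier V" using xV that by blast
        ultimately show ?thesis using V.smult_l_null[of "x k"] by simp
      qed
    qed (use cx in auto)
    also have "\<dots> = c m \<odot>\<^bsub>V\<^esub> x m \<oplus>\<^bsub>V\<^esub> s"
      unfolding s_def using m cx by (subst V.M.finsum_insert) auto
    finally have eq: "lincomb V ?I c x = c m \<odot>\<^bsub>V\<^esub> x m \<oplus>\<^bsub>V\<^esub> s" .
    have s: "s \<in> F (m - 1)"
    proof -
      have "s = lincomb V {1..m - 1} c x" by (simp add: s_def lincomb_def)
      moreover have "x k \<in> F (m - 1)" if "k \<in> {1..m - 1}" for k using that x(1)[of k] F_le[of k "m - 1"] im by auto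
      moreover have "c \<in> {1..m - 1} \<rightarrow> carrier (scalars E)" using c m by auto
      ultimately show ?thesis using V.submodule_lincomb[OF F[OF im(2)], of c "{1..m - 1}" x] by auto
    qed
    have y': "lincomb V ?I c x \<in> F (m - 1)" using y F_le[OF im] by auto
    have cmx: "c m \<odot>\<^bsub>V\<^esub> x m \<in> carrier V" and sV: "s \<in> carrier V" using cx m s FV[OF im(2)] by auto
    have "c m \<odot>\<^bsub>V\<^esub> x m = (c m \<odot>\<^bsub>V\<^esub> x m \<oplus>\<^bsub>V\<^esub> s) \<oplus>\<^bsub>V\<^esub> \<ominus>\<^bsub>V\<^esub> s"
      using cmx sV by (simp add: V.M.a_assoc V.M.r_neg)
    also have "\<dots> \<in> F (m - 1)" using Fa[OF y'[unfolded eq] Fn[OF s im(2)] im(2)] .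
    finally have "inverse (c m) \<odot>\<^bsub>V\<^esub> (c m \<odot>\<^bsub>V\<^esub> x m) \<in> F (m - 1)"
      using Fs[of "inverse (c m)"] EC(6) c m im by (auto simp: Pi_iff)
    moreover have "inverse (c m) \<odot>\<^bsub>V\<^esub> (c m \<odot>\<^bsub>V\<^esub> x m) = x m"
      using m c xV EC(6)[of "c m"] V.smult_assoc1[of "inverse (c m)" "c m" "x m"] V.smult_one[of "x m"]
      by (auto simp: Pi_iff)
    ultimately show False using x(2)[OF m(1)] by simp
  qed
  obtain bs where bs: "is_basis (scalars E) V bs" "length bs = n" using rank by (auto simp: free_of_rank_def)
  obtain \<eta> where \<eta>: "dual_basis (scalars E) V (scalars E) {..<n} ((!) bs) \<eta>"
    using is_basis_dual_basis[OF E V bs(1)] bs(2) by auto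
  have \<eta>D: "linear_map (scalars E) V (scalars E) (\<eta> i)" if "i < n" for i using \<eta> that by (auto simp: dual_basis_def)
  show sp: "spans (scalars E) V ?I x"
    unfolding spans_def
  proof (intro conjI ballI xV)
    fix d assume d: "d \<in> carrier V"
    define X where "X i j = (if j = 0 then \<eta> i d else \<eta> i (x j))" for i j
    have "\<exists>c. (\<forall>j\<in>{0..n}. c j \<in> E) \<and> (\<exists>j\<in>{0..n}. c j \<noteq> 0) \<and> (\<forall>i<n. (\<Sum>j\<in>{0..n}. X i j * c j) = 0)"
      using semilinearD(2)[OF \<eta>D] d xV by (intro linear_relation[OF E]) (auto simp: X_def Pi_iff)
    then obtain c where c: "\<And>j. j \<in> {0..n} \<Longrightarrow> c j \<in> E" "\<exists>j\<in>{0..n}. c j \<noteq> 0" "\<And>i. i < n \<Longrightarrow> (\<Sum>j\<in>{0..n}. X i j * c j) = 0"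
      by blast
    define v where "v = c 0 \<odot>\<^bsub>V\<^esub> d \<oplus>\<^bsub>V\<^esub> lincomb V ?I c x"
    have cI: "c \<in> ?I \<rightarrow> E" using c by auto
    have lc: "lincomb V ?I c x \<in> carrier V" using V.lincomb_closed[of c ?I x] cI xV by simp
    have vV: "v \<in> carrier V" using d c(1)[of 0] lc by (simp add: v_def)
    have "\<eta> i v = 0" if i: "i < n" for i
    proof -
      have "\<eta> i v = c 0 * \<eta> i d + \<eta> i (lincomb V ?I c x)"
        using semilinearD[OF \<eta>D[OF i]] d c(1)[of 0] lc by (simp add: v_def)
      also have "\<eta> i (lincomb V ?I c x) = lincomb (scalars E) ?I c (\<lambda>j. \<eta> i (x j))"
        using V.linear_map_lincomb[OF \<eta>D[OF i] module_scalars[OF E], of c ?I x] cI xV by simp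
      also have "\<dots> = (\<Sum>j\<in>?I. c j * \<eta> i (x j))"
        unfolding lincomb_def using cI xV semilinearD(2)[OF \<eta>D[OF i]] EC
        by (subst finsum_scalars[OF E]) (auto simp: Pi_iff)
      also have "c 0 * \<eta> i d + \<dots> = (\<Sum>j\<in>{0..n}. X i j * c j)"
        by (simp add: X_def sum.atLeast_Suc_atMost mult.commute)
      finally show ?thesis using c(3)[OF i] by simp
    qed
    moreover have "v = lincomb V {..<n} (\<lambda>i. \<eta> i v) ((!) bs)" using \<eta> vV by (simp add: dual_basis_def)
    moreover have bsV: "(!) bs \<in> {..<n} \<rightarrow> carrier V" using \<eta> by (simp add: dual_basis_def)
    ultimately have "v = lincomb V {..<n} (\<lambda>i. 0) ((!) bs)"
      using V.lincomb_cong[of "{..<n}" "\<lambda>i. \<eta> i v" "\<lambda>i. 0" "(!) bs" "(!) bs"] EC by simp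
    then have "v = (\<Oplus>\<^bsub>V\<^esub>i\<in>{..<n}. \<zero>\<^bsub>V\<^esub>)"
      unfolding lincomb_def using bsV V.smult_l_null by (simp add: Pi_iff cong: V.M.finsum_cong)
    then have v0: "v = \<zero>\<^bsub>V\<^esub>" by simp
    have c0: "c 0 \<noteq> 0"
    proof
      assume "c 0 = 0"
      then have "lincomb V ?I c x = \<zero>\<^bsub>V\<^esub>" using v0 lc d V.smult_l_null[of d] by (simp add: v_def)
      moreover have "\<zero>\<^bsub>V\<^esub> \<in> F 0"
        using V.submoduleE(2,3,5)[OF F[of 0]] FV[of 0] by (metis V.M.r_neg all_not_in_conv le0 subset_eq)
      ultimately have "c j = 0" if "j \<in> ?I" for j using coeff[OF cI, of 0 j] that by simp
      then show False using c(2) \<open>c 0 = 0\<close> by (metis One_nat_def Suc_leI atLeastAtMost_iff not_gr_zero)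
    qed
    have iE: "- inverse (c 0) \<in> E" using c(1)[of 0] EC by auto
    have "d = (- inverse (c 0)) \<odot>\<^bsub>V\<^esub> lincomb V ?I c x"
    proof -
      have "lincomb V ?I c x = \<ominus>\<^bsub>V\<^esub> (c 0 \<odot>\<^bsub>V\<^esub> d)"
        using v0 lc d c(1)[of 0] by (simp add: v_def) (metis V.M.minus_equality V.M.minus_minus V.smult_closed scalars_simps(1))
      also have "\<dots> = (- c 0) \<odot>\<^bsub>V\<^esub> d"
      proof -
        have "(- c 0) \<odot>\<^bsub>V\<^esub> d \<oplus>\<^bsub>V\<^esub> c 0 \<odot>\<^bsub>V\<^esub> d = \<zero>\<^bsub>V\<^esub>"
          using V.smult_l_distr[of "- c 0" "c 0" d] c(1)[of 0] EC(5) d V.smult_l_null[of d] by simp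
        then show ?thesis using c(1)[of 0] EC(5) d by (intro V.M.minus_equality) auto
      qed
      finally show ?thesis
        using c0 c(1)[of 0] EC(5) iE d V.smult_assoc1[of "- inverse (c 0)" "- c 0" d] V.smult_one[of d] by simp
    qed
    also have "\<dots> = lincomb V ?I (\<lambda>j. - inverse (c 0) * c j) x"
      using V.lincomb_smult[of ?I c x "- inverse (c 0)"] cI xV iE by simp
    finally show "\<exists>c\<in>?I \<rightarrow> carrier (scalars E). d = lincomb V ?I c x"
      using cI iE EC(4)[OF iE] by (intro bexI[of _ "\<lambda>j. - inverse (c 0) * c j"]) (auto simp: Pi_iff simp del: mult_minus_left)
  qed simp
  show "\<exists>c\<in>?I \<rightarrow> E. y = lincomb V ?I c x \<and> (\<forall>j\<in>{i<..n}. c j = 0)" if "y \<in> F i" "i \<le> n"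
  proof -
    have "y \<in> carrier V" using that FV by auto
    then obtain c where c: "c \<in> ?I \<rightarrow> E" "y = lincomb V ?I c x" using sp by (auto simp: spans_def)
    then show ?thesis using coeff[OF c(1) that(2)] that by auto
  qed
qed

text \<open>
  The \<open>x i\<close> are rational representatives of the classes. If \<open>x i\<close> already lay in the previous step of
  the filtration, then \<open>\<omega> i\<close> would lie in the sum of the Hodge components with larger \<open>p\<close>, hence be
  zero because the Hodge decomposition is direct. So the \<open>x i\<close> are a basis adapted to the filtration,
  in which the difference of the comparison image of \<open>\<omega> i\<close> and \<open>x i\<close> only involves smaller indices.
\<close>

lemma frame_of_rational_classes:
  assumes E: "subfield E CC" and N: "realization_with_coeffs E n N" and p: "strict_antimono_on {1..n} p"
    and \<omega>: "\<And>i. i \<in> {1..n} \<Longrightarrow> rational_hodge_class N w p i (\<omega> i)"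
  shows "\<exists>e x u. frame E N {..<n} e {1..n} x \<omega> u \<and>
    unitriangular (coeff_ring E) {1..n} u"
proof -
  have VE: "module (scalars E) (betti N)" and rV: "free_of_rank (scalars E) (betti N) n"
    and DE: "module (scalars E) (derham N)" and rD: "free_of_rank (scalars E) (derham N) n"
    and iso: "linear_iso (coeff_ring E) (complexify (betti N)) (complexify (derham N)) (compar N)"
    and dec: "direct_sum_decomposition (coeff_ring E) (complexify (betti N)) (\<lambda>(p, q). hodge N p q)"
    and Fsub: "\<And>i. submodule (hodge_filt N i) (scalars E) (derham N)" and Fanti: "antimono (hodge_filt N)"
    and FI: "\<And>i. compar N ` hodge_sum E N {(p, q). p \<ge> i} = complexify_sub (derham N) (hodge_filt N i)"
    using N by (auto simp: realization_with_coeffs_def)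
  interpret V: cspace E "betti N" using E VE by (simp add: cspace_def)
  interpret D: cspace E "derham N" using E DE by (simp add: cspace_def)
  interpret VC: module "coeff_ring E" "complexify (betti N)" by (rule V.VC_module)
  interpret DC: module "coeff_ring E" "complexify (derham N)" by (rule D.VC_module)
  interpret DM: module "scalars E" "derham N" by (rule DE)
  let ?I = "{1..n}"
  have I: "linear_map (coeff_ring E) V.VC D.VC (compar N)"
    using iso by (auto simp: linear_iso_def bij_betw_def intro!: semilinearI)
  have Iinj: "inj_on (compar N) (carrier V.VC)" using iso by (simp add: linear_iso_def bij_betw_def)
  have lin: "linear_realization E N" using E VE DE I by (simp add: linear_realization_def)
  have \<omega>V: "\<omega> i \<in> carrier V.VC" if "i \<in> ?I" for i
  proof -
    have "submodule (hodge N (p i) (w - p i)) (coeff_ring E) V.VC"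
      using dec by (auto simp: direct_sum_decomposition_def)
    then show ?thesis using \<omega>[OF that] VC.submoduleE(1) by (auto simp: rational_hodge_class_def)
  qed
  \<comment> \<open>\<open>F 0 = 0\<close> serves as the step before the first one, as in the definition of a rational class.\<close>
  define F where "F i = (if i = 0 then {\<zero>\<^bsub>derham N\<^esub>} else hodge_filt N (p i))" for i
  have zsub: "submodule {\<zero>\<^bsub>derham N\<^esub>} (scalars E) (derham N)"
    by (rule DM.submoduleI) (use DM.M.a_inv_zero in auto)
  have F: "submodule (F i) (scalars E) (derham N)" if "i \<le> n" for i
    unfolding F_def using zsub Fsub by simp
  have Fmono: "F i \<subseteq> F (Suc i)" if "i < n" for i
  proof (cases "i = 0")
    case True
    have "\<zero>\<^bsub>derham N\<^esub> \<in> hodge_filt N (p (Suc i))"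
      using DM.submoduleE(1,2,3,5)[OF Fsub[of "p (Suc i)"]] by (metis DM.M.r_neg all_not_in_conv subset_eq)
    then show ?thesis by (simp add: F_def True)
  next
    case False
    then have "p (Suc i) < p i" using p that by (auto simp: monotone_on_def)
    then show ?thesis using Fanti False by (simp add: F_def antimonoD)
  qed
  have "\<exists>x. \<forall>i\<in>?I. x i \<in> F i \<and> compar N (\<omega> i) \<ominus>\<^bsub>D.VC\<^esub> ctensor (derham N) (x i) 1 \<in> complexify_sub (derham N) (F (i - 1))"
  proof (rule bchoice, rule ballI)
    fix i assume i: "i \<in> ?I"
    have "(if i = 1 then {\<zero>\<^bsub>derham N\<^esub>} else hodge_filt N (p (i - 1))) = F (i - 1)" using i by (auto simp: F_def)
    then show "\<exists>x. x \<in> F i \<and> compar N (\<omega> i) \<ominus>\<^bsub>D.VC\<^esub> ctensor (derham N) x 1 \<in> complexify_sub (derham N) (F (i - 1))"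
      using \<omega>[OF i] i by (auto simp: rational_hodge_class_def F_def[of i])
  qed
  then obtain x where xF: "\<And>i. i \<in> ?I \<Longrightarrow> x i \<in> F i"
    and xd: "\<And>i. i \<in> ?I \<Longrightarrow> compar N (\<omega> i) \<ominus>\<^bsub>D.VC\<^esub> ctensor (derham N) (x i) 1 \<in> complexify_sub (derham N) (F (i - 1))"
    by blast
  have xD: "x i \<in> carrier (derham N)" if "i \<in> ?I" for i using xF[OF that] DM.submoduleE(1)[OF F[of i]] that by auto
  have x1: "ctensor (derham N) (x i) 1 \<in> carrier D.VC" if "i \<in> ?I" for i using D.ct_closed xD[OF that] .
  have I\<omega>: "compar N (\<omega> i) \<in> carrier D.VC" if "i \<in> ?I" for i using semilinearD(2)[OF I] \<omega>V[OF that] .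
  have recover: "compar N (\<omega> i) = ctensor (derham N) (x i) 1 \<oplus>\<^bsub>D.VC\<^esub> (compar N (\<omega> i) \<ominus>\<^bsub>D.VC\<^esub> ctensor (derham N) (x i) 1)"
    if "i \<in> ?I" for i
    using x1[OF that] I\<omega>[OF that] by (simp add: DC.M.minus_eq DC.M.a_lcomm DC.M.r_neg)
  have xnF: "x i \<notin> F (i - 1)" if i: "i \<in> ?I" for i
  proof
    assume xi: "x i \<in> F (i - 1)"
    have Fs: "submodule (F (i - 1)) (scalars E) (derham N)" using F[of "i - 1"] i by auto
    have mem: "compar N (\<omega> i) \<in> complexify_sub (derham N) (F (i - 1))"
      by (subst recover[OF i]) (intro D.complexify_sub_add[OF Fs] D.complexify_sub_pure[OF Fs] xi xd[OF i])
    have \<omega>i: "\<omega> i \<in> hodge N (p i) (w - p i)" "\<omega> i \<noteq> \<zero>\<^bsub>V.VC\<^esub>"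
      using \<omega>[OF i] by (auto simp: rational_hodge_class_def)
    show False
    proof (cases "i = 1")
      case True
      have "y = \<zero>\<^bsub>D.VC\<^esub>" if "y \<in> complexify_sub (derham N) {\<zero>\<^bsub>derham N\<^esub>}" for y
        using zsub that
      proof (induction rule: D.complexify_sub_induct)
        case (pure u z)
        then show ?case using D.tp.pure_zero_left[of z] by (simp add: ctensor_def complexify_simps)
      qed simp
      then have "compar N (\<omega> i) = compar N \<zero>\<^bsub>V.VC\<^esub>"
        using mem True additive_map_zero[OF semilinearD(1)[OF I] V.VC_abelian D.VC_abelian] by (simp add: F_def)
      then show False using Iinj \<omega>V[OF i] \<omega>i by (auto dest: inj_onD)
    next
      case False
      then have "compar N (\<omega> i) \<in> compar N ` hodge_sum E N {(a, b). a \<ge> p (i - 1)}"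
        using mem i by (simp add: F_def FI)
      then obtain y where y: "y \<in> hodge_sum E N {(a, b). a \<ge> p (i - 1)}" "compar N (\<omega> i) = compar N y" by auto
      have "(\<Union>s\<in>{(a, b). a \<ge> p (i - 1)}. (\<lambda>(p, q). hodge N p q) s) \<subseteq> carrier V.VC"
        using dec VC.submoduleE(1) by (auto simp: direct_sum_decomposition_def)
      then have "y \<in> carrier V.VC"
        using y(1) hull_minimal[of _ "carrier V.VC" "\<lambda>H. submodule H (coeff_ring E) V.VC"] VC.carrier_is_submodule
        by (auto simp: hodge_sum_def mod_span_def split_def)
      then have "\<omega> i = y" using Iinj y(2) \<omega>V[OF i] by (auto dest: inj_onD)
      moreover have "p i < p (i - 1)" using monotone_onD[OF p, of "i - 1" i] i False by auto
      ultimately have "\<omega> i = \<zero>\<^bsub>V.VC\<^esub>"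
        using VC.direct_sum_disjoint[OF dec, of "(p i, w - p i)" "{(a, b). a \<ge> p (i - 1)}" "\<omega> i"] \<omega>i y(1)
        by (auto simp: hodge_sum_def split_def)
      then show False using \<omega>i by simp
    qed
  qed
  note flag = flag_basis[OF E DE rD F Fmono xF xnF]
  have "\<exists>u. \<forall>j\<in>?I. u j \<in> ?I \<rightarrow> carrier (coeff_ring E) \<and> u j j = \<one>\<^bsub>coeff_ring E\<^esub> \<and> (\<forall>i\<in>{j<..n}. u j i = \<zero>\<^bsub>coeff_ring E\<^esub>) \<and>
      compar N (\<omega> j) = lincomb D.VC ?I (u j) (\<lambda>i. ctensor (derham N) (x i) 1)"
  proof (rule bchoice, rule ballI)
    fix j assume j: "j \<in> ?I"
    have Fs: "submodule (F (j - 1)) (scalars E) (derham N)" using F[of "j - 1"] j by auto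
    have xc: "(\<lambda>i. ctensor (derham N) (x i) 1) \<in> ?I \<rightarrow> carrier D.VC" using x1 by auto
    have "\<exists>c\<in>?I \<rightarrow> carrier (coeff_ring E). compar N (\<omega> j) \<ominus>\<^bsub>D.VC\<^esub> ctensor (derham N) (x j) 1
        = lincomb D.VC ?I c (\<lambda>i. ctensor (derham N) (x i) 1) \<and> (\<forall>i\<in>{j - 1<..n}. c i = \<zero>\<^bsub>coeff_ring E\<^esub>)"
      by (rule D.complexify_sub_lincomb[OF Fs xd[OF j]]) (use xD flag(2)[of _ "j - 1"] j in auto)
    then obtain c where c: "c \<in> ?I \<rightarrow> carrier (coeff_ring E)" "\<And>i. i \<in> {j - 1<..n} \<Longrightarrow> c i = \<zero>\<^bsub>coeff_ring E\<^esub>"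
      "compar N (\<omega> j) \<ominus>\<^bsub>D.VC\<^esub> ctensor (derham N) (x j) 1 = lincomb D.VC ?I c (\<lambda>i. ctensor (derham N) (x i) 1)" by blast
    let ?u = "\<lambda>i. (if i = j then \<one>\<^bsub>coeff_ring E\<^esub> else \<zero>\<^bsub>coeff_ring E\<^esub>) \<oplus>\<^bsub>coeff_ring E\<^esub> c i"
    have sc: "(\<lambda>i. if i = j then \<one>\<^bsub>coeff_ring E\<^esub> else \<zero>\<^bsub>coeff_ring E\<^esub>) \<in> ?I \<rightarrow> carrier (coeff_ring E)" by auto
    have "compar N (\<omega> j) = lincomb D.VC ?I (\<lambda>i. if i = j then \<one>\<^bsub>coeff_ring E\<^esub> else \<zero>\<^bsub>coeff_ring E\<^esub>) (\<lambda>i. ctensor (derham N) (x i) 1)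
        \<oplus>\<^bsub>D.VC\<^esub> lincomb D.VC ?I c (\<lambda>i. ctensor (derham N) (x i) 1)"
      using recover[OF j] c(3) DC.lincomb_single[OF _ j xc] by simp
    also have "\<dots> = lincomb D.VC ?I ?u (\<lambda>i. ctensor (derham N) (x i) 1)" by (rule DC.lincomb_add[OF sc c(1) xc])
    finally have "compar N (\<omega> j) = lincomb D.VC ?I ?u (\<lambda>i. ctensor (derham N) (x i) 1)" .
    moreover have "?u \<in> ?I \<rightarrow> carrier (coeff_ring E)" using c(1) by auto
    moreover have "c j = \<zero>\<^bsub>coeff_ring E\<^esub>" "\<And>i. i \<in> {j<..n} \<Longrightarrow> c i = \<zero>\<^bsub>coeff_ring E\<^esub>" using c(2) j by auto
    ultimately show "\<exists>u. u \<in> ?I \<rightarrow> carrier (coeff_ring E) \<and> u j = \<one>\<^bsub>coeff_ring E\<^esub> \<and> (\<forall>i\<in>{j<..n}. u i = \<zero>\<^bsub>coeff_ring E\<^esub>) \<and>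
        compar N (\<omega> j) = lincomb D.VC ?I u (\<lambda>i. ctensor (derham N) (x i) 1)"
      by (intro exI[of _ ?u]) auto
  qed
  then obtain u where U: "\<forall>j\<in>?I. u j \<in> ?I \<rightarrow> carrier (coeff_ring E) \<and> u j j = \<one>\<^bsub>coeff_ring E\<^esub> \<and>
      (\<forall>i\<in>{j<..n}. u j i = \<zero>\<^bsub>coeff_ring E\<^esub>) \<and> compar N (\<omega> j) = lincomb D.VC ?I (u j) (\<lambda>i. ctensor (derham N) (x i) 1)" ..
  have u: "\<And>j. j \<in> ?I \<Longrightarrow> u j \<in> ?I \<rightarrow> carrier (coeff_ring E)" "\<And>j. j \<in> ?I \<Longrightarrow> u j j = \<one>\<^bsub>coeff_ring E\<^esub>"
    "\<And>i j. j \<in> ?I \<Longrightarrow> i \<in> {j<..n} \<Longrightarrow> u j i = \<zero>\<^bsub>coeff_ring E\<^esub>"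
    "\<And>j. j \<in> ?I \<Longrightarrow> compar N (\<omega> j) = lincomb D.VC ?I (u j) (\<lambda>i. ctensor (derham N) (x i) 1)"
    using U by simp_all
  obtain bs where bs: "is_basis (scalars E) (betti N) bs" "length bs = n" using rV by (auto simp: free_of_rank_def)
  obtain \<eta> where \<eta>: "dual_basis (scalars E) (betti N) (scalars E) {..<n} ((!) bs) \<eta>"
    using is_basis_dual_basis[OF E VE bs(1)] bs(2) by auto
  \<comment> \<open>The matrix \<open>u\<close> is unitriangular, so the \<open>x i\<close> can be solved for in terms of the comparison images.\<close>
  define S where "S = {lincomb D.VC ?I c (\<lambda>i. compar N (\<omega> i)) |c. c \<in> ?I \<rightarrow> carrier (coeff_ring E)}"
  have Ic: "(\<lambda>i. compar N (\<omega> i)) \<in> ?I \<rightarrow> carrier D.VC" using I\<omega> by auto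
  have S: "submodule S (coeff_ring E) D.VC" unfolding S_def by (rule DC.lincomb_span_submodule[OF _ Ic]) simp
  have IS: "compar N (\<omega> i) \<in> S" if "i \<in> ?I" for i
    unfolding S_def using DC.lincomb_single[OF _ that Ic]
    by (intro CollectI exI[of _ "\<lambda>j. if j = i then \<one>\<^bsub>coeff_ring E\<^esub> else \<zero>\<^bsub>coeff_ring E\<^esub>"]) auto
  have xS: "ctensor (derham N) (x i) 1 \<in> S" if "i \<in> ?I" for i
    using that
  proof (induction i rule: less_induct)
    case (less i)
    let ?X = "\<lambda>i. ctensor (derham N) (x i) 1"
    have uc: "u i k \<odot>\<^bsub>D.VC\<^esub> ?X k \<in> carrier D.VC" if "k \<in> ?I" for k using u(1)[OF less.prems] x1 that by (auto simp: Pi_iff)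
    have "compar N (\<omega> i) = (\<Oplus>\<^bsub>D.VC\<^esub>k\<in>insert i {1..i - 1}. u i k \<odot>\<^bsub>D.VC\<^esub> ?X k)"
      unfolding u(4)[OF less.prems] lincomb_def
    proof (rule DC.M.add.finprod_mono_neutral_cong_right)
      show "insert i {1..i - 1} \<subseteq> ?I" using less.prems by auto
      show "u i k \<odot>\<^bsub>D.VC\<^esub> ?X k = \<zero>\<^bsub>D.VC\<^esub>" if "k \<in> ?I - insert i {1..i - 1}" for k
        using u(3)[OF less.prems, of k] that x1[of k] by (auto simp: not_le)
    qed (use uc in auto)
    also have "\<dots> = ?X i \<oplus>\<^bsub>D.VC\<^esub> (\<Oplus>\<^bsub>D.VC\<^esub>k\<in>{1..i - 1}. u i k \<odot>\<^bsub>D.VC\<^esub> ?X k)"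
      using uc less.prems u(2)[OF less.prems] x1[OF less.prems] by (subst DC.M.finsum_insert) auto
    finally have eq: "compar N (\<omega> i) = ?X i \<oplus>\<^bsub>D.VC\<^esub> (\<Oplus>\<^bsub>D.VC\<^esub>k\<in>{1..i - 1}. u i k \<odot>\<^bsub>D.VC\<^esub> ?X k)" .
    define t where "t = (\<Oplus>\<^bsub>D.VC\<^esub>k\<in>{1..i - 1}. u i k \<odot>\<^bsub>D.VC\<^esub> ?X k)"
    have "t = lincomb D.VC {1..i - 1} (u i) ?X" by (simp add: t_def lincomb_def)
    moreover have "u i \<in> {1..i - 1} \<rightarrow> carrier (coeff_ring E)" using u(1)[OF less.prems] less.prems by auto
    moreover have "?X \<in> {1..i - 1} \<rightarrow> S" using less.IH less.prems by auto
    ultimately have tS: "t \<in> S" using DC.submodule_lincomb[OF S] by simp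
    then have tc: "t \<in> carrier D.VC" using DC.submoduleE(1)[OF S] by auto
    have "?X i = compar N (\<omega> i) \<oplus>\<^bsub>D.VC\<^esub> \<ominus>\<^bsub>D.VC\<^esub> t"
      using eq[folded t_def] tc x1[OF less.prems] by (simp add: DC.M.a_assoc DC.M.r_neg)
    then show ?case using DC.submoduleE(3,5)[OF S] tS IS[OF less.prems] by simp
  qed
  have spI: "spans (coeff_ring E) D.VC ?I (\<lambda>i. compar N (\<omega> i))"
    by (rule DC.span_trans[OF D.spans_complexify[OF flag(1)] _ Ic]) (use xS in \<open>auto simp: S_def Bex_def conj_commute\<close>)
  have "spans (coeff_ring E) V.VC ?I \<omega>"
    unfolding spans_def
  proof (intro conjI ballI)
    fix v assume v: "v \<in> carrier V.VC"
    obtain c where c: "c \<in> ?I \<rightarrow> carrier (coeff_ring E)" "compar N v = lincomb D.VC ?I c (\<lambda>i. compar N (\<omega> i))"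
      using spI semilinearD(2)[OF I v] by (auto simp: spans_def)
    have \<omega>I: "\<omega> \<in> ?I \<rightarrow> carrier V.VC" using \<omega>V by auto
    have "compar N (lincomb V.VC ?I c \<omega>) = compar N v"
      unfolding c(2) using VC.linear_map_lincomb[OF I DC.module_axioms c(1) \<omega>I] by simp
    then show "\<exists>c\<in>?I \<rightarrow> carrier (coeff_ring E). v = lincomb V.VC ?I c \<omega>"
      using Iinj v VC.lincomb_closed[OF c(1) \<omega>I] c(1) by (auto dest: inj_onD)
  qed (use \<omega>V in auto)
  then have "frame E N {..<n} ((!) bs) ?I x \<omega> (\<lambda>i j. u j i)"
    unfolding frame_def using lin \<eta> flag(1) u by blast
  moreover have "unitriangular (coeff_ring E) ?I (\<lambda>i j. u j i)"
    unfolding unitriangular_def using u(1-3) by (auto simp: Pi_iff not_le[symmetric])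
  ultimately show ?thesis by blast
qed


section \<open>Direct sums and quotients\<close>

lemma direct_sum_simps [simp]:
  "carrier (direct_sum_module M N) = carrier M \<times> carrier N"
  "zero (direct_sum_module M N) = (\<zero>\<^bsub>M\<^esub>, \<zero>\<^bsub>N\<^esub>)"
  "x \<oplus>\<^bsub>direct_sum_module M N\<^esub> y = (fst x \<oplus>\<^bsub>M\<^esub> fst y, snd x \<oplus>\<^bsub>N\<^esub> snd y)"
  "r \<odot>\<^bsub>direct_sum_module M N\<^esub> x = (r \<odot>\<^bsub>M\<^esub> fst x, r \<odot>\<^bsub>N\<^esub> snd x)"
  by (simp_all add: direct_sum_module_def)

lemma direct_sum_module_module:
  assumes "module R M" "module R N"
  shows "module R (direct_sum_module M N)"
proof -
  interpret M: module R M by fact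
  interpret N: module R N by fact
  show ?thesis
  proof (rule moduleI)
    show "abelian_group (direct_sum_module M N)"
    proof (rule abelian_groupI)
      fix x assume x: "x \<in> carrier (direct_sum_module M N)"
      then show "\<exists>y\<in>carrier (direct_sum_module M N). y \<oplus>\<^bsub>direct_sum_module M N\<^esub> x = \<zero>\<^bsub>direct_sum_module M N\<^esub>"
        by (intro bexI[of _ "(\<ominus>\<^bsub>M\<^esub> fst x, \<ominus>\<^bsub>N\<^esub> snd x)"]) (auto simp: M.M.l_neg N.M.l_neg)
    qed (auto simp: M.M.a_ac N.M.a_ac)
  qed (auto simp: M.R.cring_axioms M.smult_l_distr N.smult_l_distr M.smult_r_distr N.smult_r_distr M.smult_assoc1 N.smult_assoc1)
qed

lemma direct_sum_maps:
  assumes "module R M" "module R N"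
  shows "linear_map R M (direct_sum_module M N) (\<lambda>x. (x, \<zero>\<^bsub>N\<^esub>))"
    "linear_map R N (direct_sum_module M N) (\<lambda>y. (\<zero>\<^bsub>M\<^esub>, y))"
    "linear_map R (direct_sum_module M N) M fst" "linear_map R (direct_sum_module M N) N snd"
proof -
  interpret M: module R M by fact
  interpret N: module R N by fact
  show "linear_map R M (direct_sum_module M N) (\<lambda>x. (x, \<zero>\<^bsub>N\<^esub>))"
    "linear_map R N (direct_sum_module M N) (\<lambda>y. (\<zero>\<^bsub>M\<^esub>, y))"
    "linear_map R (direct_sum_module M N) M fst" "linear_map R (direct_sum_module M N) N snd"
    by (auto intro!: semilinearI)
qed

locale quotient = module R M for R :: "('r, 'm) ring_scheme" (structure) and M :: "('r, 'a) module" (structure) +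
  fixes U
  assumes U: "submodule U R M"
begin

abbreviation "Q \<equiv> quotient_module M U"
abbreviation "\<pi> x \<equiv> U +>\<^bsub>M\<^esub> x"

lemma ab: "abelian_subgroup U M"
  by (rule abelian_subgroupI3[OF additive_subgroupI[OF submodule.axioms(1)[OF U]] abelian_group_M])

lemma Q_carrier: "carrier Q = \<pi> ` carrier M"
  by (auto simp: quotient_module_def A_RCOSETS_def')

lemma Q_add: "x \<in> carrier M \<Longrightarrow> y \<in> carrier M \<Longrightarrow> \<pi> x \<oplus>\<^bsub>Q\<^esub> \<pi> y = \<pi> (x \<oplus>\<^bsub>M\<^esub> y)"
  using abelian_subgroup.a_rcos_sum[OF ab] by (simp add: quotient_module_def)

lemma U_sub: "U \<subseteq> carrier M" using submoduleE(1)[OF U] .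

lemma Q_smult:
  assumes "r \<in> carrier R" "x \<in> carrier M"
  shows "r \<odot>\<^bsub>Q\<^esub> \<pi> x = \<pi> (r \<odot>\<^bsub>M\<^esub> x)"
proof -
  have "\<pi> (r \<odot>\<^bsub>M\<^esub> y) = \<pi> (r \<odot>\<^bsub>M\<^esub> x)" if y: "y \<in> \<pi> x" for y
  proof -
    obtain h where h: "h \<in> U" "y = h \<oplus>\<^bsub>M\<^esub> x" using y by (auto simp: a_r_coset_def')
    have "r \<odot>\<^bsub>M\<^esub> y = (r \<odot>\<^bsub>M\<^esub> h) \<oplus>\<^bsub>M\<^esub> (r \<odot>\<^bsub>M\<^esub> x)" using h assms U_sub by (auto simp: smult_r_distr)
    moreover have "r \<odot>\<^bsub>M\<^esub> h \<in> U" using submoduleE(4)[OF U] h assms by auto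
    ultimately have "r \<odot>\<^bsub>M\<^esub> y \<in> \<pi> (r \<odot>\<^bsub>M\<^esub> x)" by (auto simp: a_r_coset_def')
    then show ?thesis
      using M.a_repr_independence[of "r \<odot>\<^bsub>M\<^esub> y" U "r \<odot>\<^bsub>M\<^esub> x"] submodule.axioms(1)[OF U] assms by auto
  qed
  moreover have "x \<in> \<pi> x" using abelian_subgroup.a_rcos_self[OF ab assms(2)] .
  ultimately have "(\<Union>y\<in>\<pi> x. \<pi> (r \<odot>\<^bsub>M\<^esub> y)) = \<pi> (r \<odot>\<^bsub>M\<^esub> x)" by blast
  then show ?thesis by (simp add: quotient_module_def)
qed

lemma Q_zero: "\<zero>\<^bsub>Q\<^esub> = U" by (simp add: quotient_module_def)

lemma \<pi>_zero: "u \<in> U \<Longrightarrow> \<pi> u = \<zero>\<^bsub>Q\<^esub>"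
  unfolding Q_zero using M.a_coset_join2[OF _ submodule.axioms(1)[OF U]] U_sub by auto

lemma U_zero: "\<zero>\<^bsub>M\<^esub> \<in> U"
  using submoduleE(2,3,5)[OF U] U_sub by (metis M.r_neg all_not_in_conv subset_eq)

lemma Q_module: "module R Q"
proof (rule moduleI)
  have z: "\<zero>\<^bsub>Q\<^esub> = \<pi> \<zero>\<^bsub>M\<^esub>" using \<pi>_zero[OF U_zero] by simp
  show "abelian_group Q"
  proof (rule abelian_groupI)
    fix x assume "x \<in> carrier Q"
    then obtain a where a: "a \<in> carrier M" "x = \<pi> a" by (auto simp: Q_carrier)
    then show "\<exists>y\<in>carrier Q. y \<oplus>\<^bsub>Q\<^esub> x = \<zero>\<^bsub>Q\<^esub>"
      by (intro bexI[of _ "\<pi> (\<ominus>\<^bsub>M\<^esub> a)"]) (auto simp: Q_carrier Q_add z M.l_neg)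
  qed (auto simp: Q_carrier Q_add z M.a_ac)
qed (auto simp: Q_carrier Q_add Q_smult R.cring_axioms smult_l_distr smult_r_distr smult_assoc1)

lemma \<pi>_linear: "linear_map R M Q \<pi>"
  by (rule semilinearI) (auto simp: Q_carrier Q_add Q_smult)

end


section \<open>Comparing determinants\<close>

text \<open>
  Both cardinalities equal the sum of all products \<open>\<theta> j (b i) * \<eta> i (d j)\<close>, the trace of the identity,
  and the scalars have characteristic zero.
\<close>

lemma card_dual_basis:
  assumes E: "subfield E CC" and V: "module (scalars E) V"
    and b: "dual_basis (scalars E) V (scalars E) I b \<eta>" and d: "dual_basis (scalars E) V (scalars E) J d \<theta>"
  shows "card I = card J"
proof -
  interpret V: module "scalars E" V by fact
  have bV: "b \<in> I \<rightarrow> carrier V" "finite I" and dV: "d \<in> J \<rightarrow> carrier V" "finite J" using b d by (auto simp: dual_basis_def)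
  have \<eta>: "linear_map (scalars E) V (scalars E) (\<eta> i)" if "i \<in> I" for i using b that by (simp add: dual_basis_def)
  have \<theta>: "linear_map (scalars E) V (scalars E) (\<theta> j)" if "j \<in> J" for j using d that by (simp add: dual_basis_def)
  have mE: "\<eta> i v \<in> E" if "i \<in> I" "v \<in> carrier V" for i v using semilinearD(2)[OF \<eta> that(2)] that by simp
  have tE: "\<theta> i v \<in> E" if "i \<in> J" "v \<in> carrier V" for i v using semilinearD(2)[OF \<theta> that(2)] that by simp
  have 1: "1 = (\<Sum>j\<in>J. \<theta> j (b i) * \<eta> i (d j))" if i: "i \<in> I" for i
  proof -
    have bi: "b i \<in> carrier V" using bV i by auto
    have "1 = \<eta> i (b i)" using b i by (simp add: dual_basis_def)
    also have "\<dots> = \<eta> i (lincomb V J (\<lambda>j. \<theta> j (b i)) d)" using d bi by (simp add: dual_basis_def)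
    also have "\<dots> = lincomb (scalars E) J (\<lambda>j. \<theta> j (b i)) (\<lambda>j. \<eta> i (d j))"
      using V.linear_map_lincomb[OF \<eta>[OF i] module_scalars[OF E], of "\<lambda>j. \<theta> j (b i)" J d] dV tE bi by auto
    also have "\<dots> = (\<Sum>j\<in>J. \<theta> j (b i) * \<eta> i (d j))"
      unfolding lincomb_def using tE mE bi i dV subfield_closed[OF E]
      by (subst finsum_scalars[OF E]) (auto simp: Pi_iff)
    finally show ?thesis .
  qed
  have 2: "1 = (\<Sum>i\<in>I. \<eta> i (d j) * \<theta> j (b i))" if j: "j \<in> J" for j
  proof -
    have dj: "d j \<in> carrier V" using dV j by auto
    have "1 = \<theta> j (d j)" using d j by (simp add: dual_basis_def)
    also have "\<dots> = \<theta> j (lincomb V I (\<lambda>i. \<eta> i (d j)) b)" using b dj by (simp add: dual_basis_def)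
    also have "\<dots> = lincomb (scalars E) I (\<lambda>i. \<eta> i (d j)) (\<lambda>i. \<theta> j (b i))"
      using V.linear_map_lincomb[OF \<theta>[OF j] module_scalars[OF E], of "\<lambda>i. \<eta> i (d j)" I b] bV mE dj by auto
    also have "\<dots> = (\<Sum>i\<in>I. \<eta> i (d j) * \<theta> j (b i))"
      unfolding lincomb_def using tE mE dj j bV subfield_closed[OF E]
      by (subst finsum_scalars[OF E]) (auto simp: Pi_iff)
    finally show ?thesis .
  qed
  have "(of_nat (card I) :: complex) = (\<Sum>i\<in>I. \<Sum>j\<in>J. \<theta> j (b i) * \<eta> i (d j))" using 1 by simp
  also have "\<dots> = (\<Sum>j\<in>J. \<Sum>i\<in>I. \<eta> i (d j) * \<theta> j (b i))" by (subst sum.swap) (simp add: mult.commute)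
  also have "\<dots> = of_nat (card J)" using 2 by simp
  finally show ?thesis by (simp only: of_nat_eq_iff)
qed

lemma dual_basis_uniq:
  assumes E: "subfield E CC" and V: "module (scalars E) V" and b: "dual_basis (scalars E) V (scalars E) I b \<eta>"
    and c: "c \<in> I \<rightarrow> E" and i: "i \<in> I"
  shows "\<eta> i (lincomb V I c b) = c i"
  by (rule module.dual_basis_coord[OF V b module_scalars[OF E]]) (use c i in \<open>auto simp: fun_eq_iff\<close>)

text \<open>
  The basis can be written back in the generating family, which gives a right inverse of the matrix.
\<close>

lemma base_change_unit:
  assumes E: "subfield E CC" and V: "module (scalars E) V"
    and b: "dual_basis (scalars E) V (scalars E) {..<m} b \<eta>" and y: "spans (scalars E) V {..<m} y"
  shows "\<exists>C. (\<forall>i<m. \<forall>k<m. C i k \<in> E) \<and> (\<forall>k<m. y k = lincomb V {..<m} (\<lambda>i. C i k) b) \<and>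
    ring_det (scalars E) m C \<in> E - {0}"
proof -
  interpret E: cring "scalars E" by (rule cring_scalars[OF E])
  interpret V: module "scalars E" V by fact
  let ?I = "{..<m}"
  have bV: "b \<in> ?I \<rightarrow> carrier V" and yV: "y \<in> ?I \<rightarrow> carrier V" using b y by (auto simp: dual_basis_def spans_def)
  define C where "C i k = \<eta> i (y k)" for i k
  have C: "C i k \<in> E" if "i < m" "k < m" for i k
    using b yV that semilinearD(2)[of "scalars E" _ V "scalars E" "\<eta> i" "y k"] by (auto simp: C_def dual_basis_def)
  have yC: "y k = lincomb V ?I (\<lambda>i. C i k) b" if "k < m" for k using b yV that by (auto simp: C_def dual_basis_def)
  have "\<exists>S. \<forall>j\<in>?I. S j \<in> ?I \<rightarrow> E \<and> b j = lincomb V ?I (S j) y"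
    by (rule bchoice) (use y bV in \<open>auto simp: spans_def Pi_iff Bex_def\<close>)
  then obtain S where S: "\<forall>j\<in>?I. S j \<in> ?I \<rightarrow> E \<and> b j = lincomb V ?I (S j) y" ..
  have CS: "mat_mult (scalars E) m C (\<lambda>k j. S j k) i j = (if i = j then \<one>\<^bsub>scalars E\<^esub> else \<zero>\<^bsub>scalars E\<^esub>)" if "i < m" "j < m" for i j
  proof -
    have "b j = lincomb V ?I (S j) (\<lambda>k. lincomb V ?I (\<lambda>i. C i k) b)"
      using S that V.lincomb_cong[of ?I "S j" "S j" y "\<lambda>k. lincomb V ?I (\<lambda>i. C i k) b"] yC yV by (auto simp: Pi_iff)
    also have "\<dots> = lincomb V ?I (\<lambda>i. mat_mult (scalars E) m C (\<lambda>k j. S j k) i j) b"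
      unfolding mat_mult_def using S that C bV by (intro V.lincomb_lincomb) auto
    finally have bj: "b j = lincomb V ?I (\<lambda>i. mat_mult (scalars E) m C (\<lambda>k j. S j k) i j) b" .
    have mc: "mat_mult (scalars E) m C (\<lambda>k j. S j k) i j \<in> E" if "i < m" for i
      using E.mat_mult_closed[of m C "\<lambda>k j. S j k" i j] C S that \<open>j < m\<close> by (auto simp: Pi_iff)
    have "mat_mult (scalars E) m C (\<lambda>k j. S j k) i j = \<eta> i (b j)"
      by (subst bj) (use dual_basis_uniq[OF E V b] mc that in auto)
    then show ?thesis using b that by (auto simp: dual_basis_def)
  qed
  have "ring_det (scalars E) m C * ring_det (scalars E) m (\<lambda>k j. S j k) = 1"
    using E.ring_det_inverse[of m C "\<lambda>k j. S j k"] C S CS by (auto simp: Pi_iff)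
  moreover have "ring_det (scalars E) m C \<in> E" using E.ring_det_closed[of m C] C by simp
  ultimately have "ring_det (scalars E) m C \<in> E - {0}" by auto
  then show ?thesis using C yC by blast
qed

text \<open>
  The matrix \<open>A\<close> of a map in rational bases factors through an auxiliary family \<open>\<omega>\<close> of the complexified
  source and a rational generating family \<open>y\<close> of the target: \<open>P\<close> writes the source basis in \<open>\<omega>\<close>, \<open>U\<close>
  writes the images of \<open>\<omega>\<close> in \<open>y\<close>, and the last factor writes \<open>y\<close> in the target basis. The last one is
  rational, so it only contributes a nonzero element of \<open>L\<close>.
\<close>

lemma determinant_factor:
  assumes W: "cspace L W"
    and cs: "dual_basis (scalars L) W (scalars L) {..<m} cs \<eta>" and y: "spans (scalars L) W {..<m} y"
    and U: "\<And>i k. i < m \<Longrightarrow> k < m \<Longrightarrow> U i k \<in> carrier (coeff_ring L)"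
    and P: "\<And>i k. i < m \<Longrightarrow> k < m \<Longrightarrow> P i k \<in> carrier (coeff_ring L)"
    and A: "\<And>i k. i < m \<Longrightarrow> k < m \<Longrightarrow> A i k \<in> carrier (coeff_ring L)"
    and eq: "\<And>j. j < m \<Longrightarrow> lincomb (complexify W) {..<m} (\<lambda>i. A i j) (\<lambda>i. ctensor W (cs i) 1)
      = lincomb (complexify W) {..<m} (\<lambda>k. P k j) (\<lambda>k. lincomb (complexify W) {..<m} (\<lambda>i. U i k) (\<lambda>i. ctensor W (y i) 1))"
  shows "\<exists>e\<in>L - {0}. ring_det (coeff_ring L) m A
    = ctensor (scalars L) e 1 \<otimes>\<^bsub>coeff_ring L\<^esub> (ring_det (coeff_ring L) m U \<otimes>\<^bsub>coeff_ring L\<^esub> ring_det (coeff_ring L) m P)"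
proof -
  interpret W: cspace L W by fact
  interpret R: cring "coeff_ring L" by (rule coeff_ring_cring[OF W.E])
  interpret WC: module "coeff_ring L" "complexify W" by (rule W.VC_module)
  interpret emb: ring_hom_cring "scalars L" "coeff_ring L" "\<lambda>e. ctensor (scalars L) e 1" by (rule emb_hom[OF W.E])
  let ?I = "{..<m}"
  obtain C where C: "\<forall>i<m. \<forall>k<m. C i k \<in> L" "\<forall>k<m. y k = lincomb W ?I (\<lambda>i. C i k) cs" "ring_det (scalars L) m C \<in> L - {0}"
    using base_change_unit[OF W.E W.V cs y] by blast
  let ?C = "\<lambda>i k. ctensor (scalars L) (C i k) 1"
  have cC: "?C i k \<in> carrier (coeff_ring L)" if "i < m" "k < m" for i k using C that W.emb_closed by auto
  have csW: "cs \<in> ?I \<rightarrow> carrier W" using cs by (simp add: dual_basis_def)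
  let ?c = "\<lambda>i. ctensor W (cs i) 1"
  have csC: "?c \<in> ?I \<rightarrow> carrier (complexify W)" using csW W.ct_closed by auto
  have yW: "y \<in> ?I \<rightarrow> carrier W" using y by (simp add: spans_def)
  have yc: "ctensor W (y k) 1 = lincomb (complexify W) ?I (\<lambda>i. ?C i k) ?c" if "k < m" for k
    using C that W.ct_lincomb[of "\<lambda>i. C i k" ?I cs 1] csW by auto
  let ?CU = "mat_mult (coeff_ring L) m ?C U"
  let ?CUP = "mat_mult (coeff_ring L) m ?CU P"
  have cCU: "?CU i k \<in> carrier (coeff_ring L)" if "i < m" "k < m" for i k using that cC U by (intro R.mat_mult_closed) auto
  have cCUP: "?CUP i k \<in> carrier (coeff_ring L)" if "i < m" "k < m" for i k using that cC U cCU P by (intro R.mat_mult_closed) auto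
  have 1: "lincomb (complexify W) ?I (\<lambda>i. U i k) (\<lambda>i. ctensor W (y i) 1) = lincomb (complexify W) ?I (\<lambda>i. ?CU i k) ?c" if "k < m" for k
  proof -
    have "lincomb (complexify W) ?I (\<lambda>i. U i k) (\<lambda>i. ctensor W (y i) 1)
        = lincomb (complexify W) ?I (\<lambda>i. U i k) (\<lambda>l. lincomb (complexify W) ?I (\<lambda>i. ?C i l) ?c)"
      using that yc U cC csC by (intro WC.lincomb_cong) (auto intro!: WC.lincomb_closed)
    also have "\<dots> = lincomb (complexify W) ?I (\<lambda>i. ?CU i k) ?c"
      unfolding mat_mult_def using that U cC csC by (intro WC.lincomb_lincomb) auto
    finally show ?thesis .
  qed
  have 2: "lincomb (complexify W) ?I (\<lambda>i. A i j) ?c = lincomb (complexify W) ?I (\<lambda>i. ?CUP i j) ?c" if "j < m" for j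
  proof -
    have "lincomb (complexify W) ?I (\<lambda>i. A i j) ?c = lincomb (complexify W) ?I (\<lambda>k. P k j) (\<lambda>k. lincomb (complexify W) ?I (\<lambda>i. ?CU i k) ?c)"
      unfolding eq[OF that] by (rule WC.lincomb_cong) (use that 1 P cCU csC in \<open>auto intro!: WC.lincomb_closed\<close>)
    also have "\<dots> = lincomb (complexify W) ?I (\<lambda>i. ?CUP i j) ?c"
      unfolding mat_mult_def[of _ _ ?CU] using that P cCU csC by (intro WC.lincomb_lincomb) auto
    finally show ?thesis .
  qed
  have AC: "A i j = ?CUP i j" if "i < m" "j < m" for i j
  proof -
    note dc = W.dual_basis_complexify[OF cs]
    interpret E: cspace L "scalars L" by (rule cspace_scalars[OF W.E])
    have coord: "complexify_map (scalars L) (\<eta> i) (lincomb (complexify W) ?I c ?c) = c i"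
      if "c \<in> ?I \<rightarrow> carrier (coeff_ring L)" "i < m" for c i
      by (rule WC.dual_basis_coord[OF dc E.VC_module]) (use that in \<open>auto simp: coeff_ring_simps\<close>)
    show ?thesis
      using coord[of "\<lambda>i. A i j" i] coord[of "\<lambda>i. ?CUP i j" i] 2[OF that(2)] A cCUP that by auto
  qed
  have "ring_det (coeff_ring L) m A = ring_det (coeff_ring L) m ?CUP"
    using A AC by (intro R.ring_det_cong) auto
  also have "\<dots> = ring_det (coeff_ring L) m ?CU \<otimes>\<^bsub>coeff_ring L\<^esub> ring_det (coeff_ring L) m P"
    by (rule R.ring_det_mult[OF cCU P])
  also have "ring_det (coeff_ring L) m ?CU = ring_det (coeff_ring L) m ?C \<otimes>\<^bsub>coeff_ring L\<^esub> ring_det (coeff_ring L) m U"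
    by (rule R.ring_det_mult[OF cC U])
  also have "ring_det (coeff_ring L) m ?C = ctensor (scalars L) (ring_det (scalars L) m C) 1"
    using emb.hom_ring_det[of m C] C by simp
  finally show ?thesis
    using C(3) R.ring_det_closed[of m U] R.ring_det_closed[of m P] U P W.emb_closed
    by (intro bexI[of _ "ring_det (scalars L) m C"]) (auto simp: R.m_assoc)
qed

text \<open>
  Let \<open>Q\<close> be the quotient of the de Rham space by a filtration step of which only the complexification
  is known, and \<open>z i\<close> the image of a de Rham vector. The comparison images of certain classes vanish in
  the complexified quotient, where they are triangular combinations of the \<open>z i\<close>. By induction on the height, the relation at \<open>j\<close> reduces to \<open>z j \<otimes> 1 = 0\<close>, and \<open>Q\<close> embeds into
  its complexification.
\<close>

lemma triangular_kernel:
  fixes \<rho> :: "'i \<Rightarrow> int"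
  assumes Q: "cspace L Q" and cs: "dual_basis (scalars L) Q (scalars L) J cs \<eta>"
    and fin: "finite I" and z: "\<And>i. i \<in> I \<Longrightarrow> z i \<in> carrier Q"
    and u: "\<And>i j. i \<in> I \<Longrightarrow> j \<in> I \<Longrightarrow> u i j \<in> carrier (coeff_ring L)" "\<And>i. i \<in> I \<Longrightarrow> u i i = \<one>\<^bsub>coeff_ring L\<^esub>"
    and A: "A \<subseteq> I" and \<rho>: "\<And>i j. i \<in> I \<Longrightarrow> j \<in> A \<Longrightarrow> i \<noteq> j \<Longrightarrow> u i j \<noteq> \<zero>\<^bsub>coeff_ring L\<^esub> \<Longrightarrow> i \<in> A \<and> 0 \<le> \<rho> i \<and> \<rho> i < \<rho> j"
    and ker: "\<And>j. j \<in> A \<Longrightarrow> lincomb (complexify Q) I (\<lambda>i. u i j) (\<lambda>i. ctensor Q (z i) 1) = \<zero>\<^bsub>complexify Q\<^esub>"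
    and j: "j \<in> A"
  shows "z j = \<zero>\<^bsub>Q\<^esub>"
  using j
proof (induction "nat (\<rho> j)" arbitrary: j rule: less_induct)
  case less
  interpret Q: cspace L Q by fact
  interpret QC: module "coeff_ring L" "complexify Q" by (rule Q.VC_module)
  interpret l: cspace L "scalars L" by (rule cspace_scalars[OF Q.E])
  have jI: "j \<in> I" using less.prems A by auto
  have z0: "ctensor Q \<zero>\<^bsub>Q\<^esub> 1 = \<zero>\<^bsub>complexify Q\<^esub>"
    using Q.tp.pure_zero_left[of 1] by (simp add: ctensor_def complexify_simps)
  have "lincomb (complexify Q) I (\<lambda>i. u i j) (\<lambda>i. ctensor Q (z i) 1) = (\<Oplus>\<^bsub>complexify Q\<^esub>i\<in>I. if j = i then ctensor Q (z i) 1 else \<zero>\<^bsub>complexify Q\<^esub>)"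
    unfolding lincomb_def
  proof (intro QC.M.finsum_cong' refl)
    fix i assume i: "i \<in> I"
    show "u i j \<odot>\<^bsub>complexify Q\<^esub> ctensor Q (z i) 1 = (if j = i then ctensor Q (z i) 1 else \<zero>\<^bsub>complexify Q\<^esub>)"
    proof (cases "i = j \<or> u i j = \<zero>\<^bsub>coeff_ring L\<^esub>")
      case False
      then have ii: "i \<in> A" "0 \<le> \<rho> i" "\<rho> i < \<rho> j" using \<rho>[OF i less.prems] by auto
      then have "z i = \<zero>\<^bsub>Q\<^esub>" by (intro less.hyps) auto
      then show ?thesis using False u(1)[OF i jI] z0 by auto
    qed (use u(2)[OF i] z[OF i] Q.ct_closed in auto)
  qed (use z Q.ct_closed in auto)
  also have "\<dots> = ctensor Q (z j) 1" using jI fin z Q.ct_closed by (intro QC.M.finsum_singleton) auto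
  finally have zero: "ctensor Q (z j) 1 = \<zero>\<^bsub>complexify Q\<^esub>" using ker[OF less.prems] by simp
  have "\<eta> i (z j) = 0" if i: "i \<in> J" for i
  proof -
    have \<eta>: "linear_map (scalars L) Q (scalars L) (\<eta> i)" using cs i by (simp add: dual_basis_def)
    interpret m: cspace_map L Q L "scalars L" "\<eta> i"
      using \<eta> Q.cspace_axioms l.cspace_axioms by (simp add: cspace_map_def cspace_map_axioms_def)
    have "ctensor (scalars L) (\<eta> i (z j)) 1 = \<zero>\<^bsub>coeff_ring L\<^esub>"
      using m.cmap_ct[OF z[OF jI], of 1] zero additive_map_zero[OF m.cmap_additive Q.VC_abelian l.VC_abelian]
      by (simp add: coeff_ring_simps)
    then show ?thesis using emb_inj[OF Q.E] semilinearD(2)[OF \<eta> z[OF jI]] by simp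
  qed
  then have "z j = lincomb Q J (\<lambda>i. 0) cs"
    using cs z[OF jI] module.lincomb_cong[OF Q.V, of J "\<lambda>i. \<eta> i (z j)" "\<lambda>i. 0" cs cs] subfield_closed[OF Q.E]
    by (simp add: dual_basis_def)
  also have "\<dots> = \<zero>\<^bsub>Q\<^esub>"
  proof -
    interpret QM: module "scalars L" Q by (rule Q.V)
    have "lincomb Q J (\<lambda>i. 0) cs = (\<Oplus>\<^bsub>Q\<^esub>i\<in>J. \<zero>\<^bsub>Q\<^esub>)"
      unfolding lincomb_def using cs QM.smult_l_null by (intro QM.M.finsum_cong') (auto simp: dual_basis_def Pi_iff)
    then show ?thesis by simp
  qed
  finally show ?case .
qed


section \<open>The Deligne period of the restriction\<close>

lemma cspace_mapI:
  assumes "cspace L V" "cspace L W" "linear_map (scalars L) V W f"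
  shows "cspace_map L V L W f"
  using assms by (simp add: cspace_map_def cspace_map_axioms_def)

lemma dual_basis_transport:
  assumes b: "dual_basis R M R1 I b \<eta>" and M: "module R M" and N: "module R N" and carrier: "carrier R1 = carrier R"
    and f: "linear_map R M N f" and g: "linear_map R N M g"
    and gf: "\<And>x. x \<in> carrier M \<Longrightarrow> g (f x) = x" and fg: "\<And>y. y \<in> carrier N \<Longrightarrow> f (g y) = y"
  shows "dual_basis R N R1 I (\<lambda>i. f (b i)) (\<lambda>i y. \<eta> i (g y))"
proof -
  interpret M: module R M by fact
  interpret N: module R N by fact
  have bM: "b \<in> I \<rightarrow> carrier M" and \<eta>: "\<And>i. i \<in> I \<Longrightarrow> linear_map R M R1 (\<eta> i)" using b by (auto simp: dual_basis_def)
  show ?thesis unfolding dual_basis_def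
  proof (intro conjI ballI)
    fix y assume y: "y \<in> carrier N"
    have gy: "g y \<in> carrier M" using semilinearD(2)[OF g y] .
    have "y = f (lincomb M I (\<lambda>i. \<eta> i (g y)) b)" using b gy fg[OF y] by (simp add: dual_basis_def)
    also have "\<dots> = lincomb N I (\<lambda>i. \<eta> i (g y)) (\<lambda>i. f (b i))"
      using M.linear_map_lincomb[OF f N, of "\<lambda>i. \<eta> i (g y)" I b] bM semilinearD(2)[OF \<eta> gy] carrier by auto
    finally show "y = lincomb N I (\<lambda>i. \<eta> i (g y)) (\<lambda>i. f (b i))" .
  qed (use b gf bM linear_map_comp[OF g \<eta>] semilinearD(2)[OF f] in \<open>auto simp: dual_basis_def Pi_iff\<close>)
qed

text \<open>
  Frames in the two realizations of a motive, matched by Frobenius through an involution \<open>star\<close> of the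
  index set. For a tensor product the indices are pairs \<open>(a, b)\<close>, their image under \<open>star\<close> is
  \<open>(n + 1 - a, n' + 1 - b)\<close>, and \<open>A\<close> is the set of those pairs whose class has \<open>p > q\<close>; as no class has
  \<open>p = q\<close>, the conjugate class at \<open>i\<close> has \<open>p > q\<close> exactly if \<open>star i \<notin> A\<close>. The comparison matrices are
  triangular for the heights \<open>\<rho>\<close> and \<open>\<rho>'\<close>, and \<open>A\<close> and its counterpart are closed under going down;
  heights are nonnegative on the support of these matrices so that one can use induction on them.
\<close>

locale frobenius_frames =
  fixes L :: "complex set" and Mt :: "('b, 'd) motive"
    and J :: "'j set" and e and J' :: "'j' set" and e' and I :: "'i set" and x and x' and \<omega> and \<omega>' and u and u'
    and star :: "'i \<Rightarrow> 'i" and q :: "'i \<Rightarrow> (complex, complex) tensor" and A :: "'i set" and \<rho> \<rho>' :: "'i \<Rightarrow> int" and g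
  assumes fr: "frame L (at_id Mt) J e I x \<omega> u"
    and fr': "frame L (at_conj Mt) J' e' I x' \<omega>' u'"
    and card: "card J = card I"
    and frob: "linear_map (scalars L) (betti (at_id Mt)) (betti (at_conj Mt)) (frob Mt)"
    and inv: "\<And>v. v \<in> carrier (betti (at_id Mt)) \<Longrightarrow> g (frob Mt v) = v"
    and star: "\<And>i. i \<in> I \<Longrightarrow> star i \<in> I" "\<And>i. i \<in> I \<Longrightarrow> star (star i) = i"
    and q: "\<And>i. i \<in> I \<Longrightarrow> q i \<in> Units (coeff_ring L)"
    and period: "\<And>i. i \<in> I \<Longrightarrow> complexify_map (betti (at_conj Mt)) (frob Mt) (\<omega> i)
      = q i \<odot>\<^bsub>complexify (betti (at_conj Mt))\<^esub> \<omega>' (star i)"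
    and A: "A \<subseteq> I"
    and hodgeA: "\<And>i. i \<in> A \<Longrightarrow> \<exists>a b. a > b \<and> \<omega> i \<in> hodge (at_id Mt) a b"
    and hodgeA': "\<And>i. i \<in> I \<Longrightarrow> star i \<notin> A \<Longrightarrow> \<exists>a b. a > b \<and> \<omega>' i \<in> hodge (at_conj Mt) a b"
    and hodge_zero: "\<And>a b. \<zero>\<^bsub>complexify (betti (at_id Mt))\<^esub> \<in> hodge (at_id Mt) a b"
      "\<And>a b. \<zero>\<^bsub>complexify (betti (at_conj Mt))\<^esub> \<in> hodge (at_conj Mt) a b"
    and filt: "\<And>k. submodule (hodge_filt (at_id Mt) k) (scalars L) (derham (at_id Mt))"
      "\<And>k. submodule (hodge_filt (at_conj Mt) k) (scalars L) (derham (at_conj Mt))"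
    and u_diag: "\<And>i. i \<in> I \<Longrightarrow> u i i = \<one>\<^bsub>coeff_ring L\<^esub>" "\<And>i. i \<in> I \<Longrightarrow> u' i i = \<one>\<^bsub>coeff_ring L\<^esub>"
    and tri: "\<And>i j. i \<in> I \<Longrightarrow> j \<in> I \<Longrightarrow> i \<noteq> j \<Longrightarrow> u i j \<noteq> \<zero>\<^bsub>coeff_ring L\<^esub> \<Longrightarrow> 0 \<le> \<rho> i \<and> \<rho> i < \<rho> j \<and> (j \<in> A \<longrightarrow> i \<in> A)"
    and tri': "\<And>i j. i \<in> I \<Longrightarrow> j \<in> I \<Longrightarrow> i \<noteq> j \<Longrightarrow> u' i j \<noteq> \<zero>\<^bsub>coeff_ring L\<^esub> \<Longrightarrow>
      0 \<le> \<rho>' i \<and> \<rho>' i < \<rho>' j \<and> (star j \<notin> A \<longrightarrow> star i \<notin> A)"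
begin

abbreviation "R \<equiv> coeff_ring L"
abbreviation "V \<equiv> betti (at_id Mt)"
abbreviation "V' \<equiv> betti (at_conj Mt)"
abbreviation "D \<equiv> derham (at_id Mt)"
abbreviation "D' \<equiv> derham (at_conj Mt)"
abbreviation "B2 \<equiv> direct_sum_module V V'"
abbreviation "D2 \<equiv> direct_sum_module D D'"
abbreviation "f \<equiv> frob Mt"
abbreviation "N2 \<equiv> restrict_to_rat Mt"

lemma L: "subfield L CC"
  and mods: "module (scalars L) V" "module (scalars L) V'" "module (scalars L) D" "module (scalars L) D'"
  and compar_linear: "linear_map R (complexify V) (complexify D) (compar (at_id Mt))"
    "linear_map R (complexify V') (complexify D') (compar (at_conj Mt))"
  using fr fr' by (auto simp: frame_def linear_realization_def)

lemma x: "spans (scalars L) D I x" and x': "spans (scalars L) D' I x'"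
  and \<omega>: "spans R (complexify V) I \<omega>" and \<omega>': "spans R (complexify V') I \<omega>'"
  and u: "\<And>i j. i \<in> I \<Longrightarrow> j \<in> I \<Longrightarrow> u i j \<in> carrier R" and u': "\<And>i j. i \<in> I \<Longrightarrow> j \<in> I \<Longrightarrow> u' i j \<in> carrier R"
  and I\<omega>: "\<And>j. j \<in> I \<Longrightarrow> compar (at_id Mt) (\<omega> j) = lincomb (complexify D) I (\<lambda>i. u i j) (\<lambda>i. ctensor D (x i) 1)"
  and I\<omega>': "\<And>j. j \<in> I \<Longrightarrow> compar (at_conj Mt) (\<omega>' j) = lincomb (complexify D') I (\<lambda>i. u' i j) (\<lambda>i. ctensor D' (x' i) 1)"
  using fr fr' by (auto simp: frame_def)

lemma finI: "finite I" and \<omega>V: "\<omega> \<in> I \<rightarrow> carrier (complexify V)" and \<omega>V': "\<omega>' \<in> I \<rightarrow> carrier (complexify V')"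
  and xD: "x \<in> I \<rightarrow> carrier D" and xD': "x' \<in> I \<rightarrow> carrier D'"
  using x x' \<omega> \<omega>' by (auto simp: spans_def)

sublocale RR: cring R by (rule coeff_ring_cring[OF L])
sublocale cV: cspace L V by (simp add: cspace_def L mods)
sublocale cV': cspace L V' by (simp add: cspace_def L mods)
sublocale cD: cspace L D by (simp add: cspace_def L mods)
sublocale cD': cspace L D' by (simp add: cspace_def L mods)
sublocale cB2: cspace L B2 by (simp add: cspace_def L direct_sum_module_module mods)
sublocale cD2: cspace L D2 by (simp add: cspace_def L direct_sum_module_module mods)
sublocale mf: cspace_map L V L V' f by (rule cspace_mapI[OF cV.cspace_axioms cV'.cspace_axioms frob])
sublocale i1: cspace_map L V L B2 "\<lambda>x. (x, \<zero>\<^bsub>V'\<^esub>)"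
  by (rule cspace_mapI[OF cV.cspace_axioms cB2.cspace_axioms direct_sum_maps(1)[OF mods(1,2)]])
sublocale i2: cspace_map L V' L B2 "\<lambda>x. (\<zero>\<^bsub>V\<^esub>, x)"
  by (rule cspace_mapI[OF cV'.cspace_axioms cB2.cspace_axioms direct_sum_maps(2)[OF mods(1,2)]])
sublocale p1: cspace_map L B2 L V fst
  by (rule cspace_mapI[OF cB2.cspace_axioms cV.cspace_axioms direct_sum_maps(3)[OF mods(1,2)]])
sublocale p2: cspace_map L B2 L V' snd
  by (rule cspace_mapI[OF cB2.cspace_axioms cV'.cspace_axioms direct_sum_maps(4)[OF mods(1,2)]])
sublocale j1: cspace_map L D L D2 "\<lambda>x. (x, \<zero>\<^bsub>D'\<^esub>)"
  by (rule cspace_mapI[OF cD.cspace_axioms cD2.cspace_axioms direct_sum_maps(1)[OF mods(3,4)]])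
sublocale j2: cspace_map L D' L D2 "\<lambda>x. (\<zero>\<^bsub>D\<^esub>, x)"
  by (rule cspace_mapI[OF cD'.cspace_axioms cD2.cspace_axioms direct_sum_maps(2)[OF mods(3,4)]])

abbreviation "f_C \<equiv> complexify_map V' f"
abbreviation "i1_C \<equiv> complexify_map B2 (\<lambda>x. (x, \<zero>\<^bsub>V'\<^esub>))"
abbreviation "i2_C \<equiv> complexify_map B2 (\<lambda>x. (\<zero>\<^bsub>V\<^esub>, x))"
abbreviation "p1_C \<equiv> complexify_map V fst"
abbreviation "p2_C \<equiv> complexify_map V' snd"
abbreviation "j1_C \<equiv> complexify_map D2 (\<lambda>x. (x, \<zero>\<^bsub>D'\<^esub>))"
abbreviation "j2_C \<equiv> complexify_map D2 (\<lambda>x. (\<zero>\<^bsub>D\<^esub>, x))"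

lemma N2_simps: "betti N2 = B2" "derham N2 = D2"
  "hodge_filt N2 k = hodge_filt (at_id Mt) k \<times> hodge_filt (at_conj Mt) k"
  "hodge N2 a b = {i1_C x \<oplus>\<^bsub>complexify B2\<^esub> i2_C y |x y. x \<in> hodge (at_id Mt) a b \<and> y \<in> hodge (at_conj Mt) a b}"
  "involution N2 (v, w) = (inv_into (carrier V) f w, f v)"
  "compar N2 X = j1_C (compar (at_id Mt) (p1_C X)) \<oplus>\<^bsub>complexify D2\<^esub> j2_C (compar (at_conj Mt) (p2_C X))"
  by (simp_all add: restrict_to_rat_def Let_def)

lemma finj: "inj_on f (carrier V)"
  by (rule inj_on_inverseI[of _ g]) (rule inv)

lemma plus_iff: "(v, w) \<in> carrier (betti_plus N2) \<longleftrightarrow> v \<in> carrier V \<and> w = f v"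
  using semilinearD(2)[OF frob] inv_into_f_f[OF finj]
  by (auto simp: betti_plus_def N2_simps)

lemma plus_sub: "submodule (carrier (betti_plus N2)) (scalars L) B2"
proof -
  interpret B: module "scalars L" B2 by (rule cB2.V)
  interpret v: module "scalars L" V by (rule mods)
  interpret v': module "scalars L" V' by (rule mods)
  have m: "p \<in> carrier (betti_plus N2) \<longleftrightarrow> fst p \<in> carrier V \<and> snd p = f (fst p)" for p
    using plus_iff[of "fst p" "snd p"] by simp
  show ?thesis
  proof (rule B.submoduleI)
    show sub: "carrier (betti_plus N2) \<subseteq> carrier B2" using semilinearD(2)[OF frob] by (auto simp: plus_iff)
    show "\<zero>\<^bsub>B2\<^esub> \<in> carrier (betti_plus N2)"
      using additive_map_zero[OF semilinearD(1)[OF frob] v.abelian_group_M v'.abelian_group_M] by (simp add: m)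
    fix a b assume a: "a \<in> carrier (betti_plus N2)" and b: "b \<in> carrier (betti_plus N2)"
    show "a \<oplus>\<^bsub>B2\<^esub> b \<in> carrier (betti_plus N2)" using a b by (simp add: m semilinearD(3)[OF frob])
    have "(\<ominus>\<^bsub>V\<^esub> fst a, \<ominus>\<^bsub>V'\<^esub> snd a) = \<ominus>\<^bsub>B2\<^esub> a"
      using a semilinearD(2)[OF frob] by (intro B.M.minus_equality[symmetric]) (auto simp: m v.M.l_neg v'.M.l_neg mem_Times_iff)
    then have "\<ominus>\<^bsub>B2\<^esub> a = (\<ominus>\<^bsub>V\<^esub> fst a, \<ominus>\<^bsub>V'\<^esub> snd a)" by simp
    then show "\<ominus>\<^bsub>B2\<^esub> a \<in> carrier (betti_plus N2)"
      using a additive_map_minus[OF semilinearD(1)[OF frob] v.abelian_group_M v'.abelian_group_M, of "fst a"]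
      by (simp add: m)
    show "r \<odot>\<^bsub>B2\<^esub> a \<in> carrier (betti_plus N2)" if "r \<in> carrier (scalars L)" for r
      using a that by (simp add: m semilinearD(4)[OF frob])
  qed
qed

lemma betti_plus_eq: "betti_plus N2 = B2\<lparr>carrier := carrier (betti_plus N2)\<rparr>"
  by (simp add: betti_plus_def N2_simps)

text \<open>
  The invariants of the involution are the pairs \<open>(v, f v)\<close>, so the first projection turns their bases
  into bases of \<open>V\<close>.
\<close>

lemma plus_dual_basis:
  assumes "is_basis (scalars L) (betti_plus N2) bs"
  shows "\<exists>\<eta>. dual_basis (scalars L) V (scalars L) {..<length bs} (\<lambda>j. fst (bs ! j)) \<eta>"
proof -
  have M: "module (scalars L) (betti_plus N2)"
    using submodule.submodule_is_module[OF plus_sub cB2.V] betti_plus_eq by simp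
  obtain \<eta> where \<eta>: "dual_basis (scalars L) (betti_plus N2) (scalars L) {..<length bs} ((!) bs) \<eta>"
    using is_basis_dual_basis[OF L M assms] by blast
  have ops: "add (betti_plus N2) = add B2" "smult (betti_plus N2) = smult B2"
    by (subst betti_plus_eq, simp)+
  have m: "p \<in> carrier (betti_plus N2) \<longleftrightarrow> fst p \<in> carrier V \<and> snd p = f (fst p)" for p
    using plus_iff[of "fst p" "snd p"] by simp
  have "dual_basis (scalars L) V (scalars L) {..<length bs} (\<lambda>j. fst (bs ! j)) (\<lambda>i y. \<eta> i (y, f y))"
    by (rule dual_basis_transport[OF \<eta> M mods(1) refl])
      (use m semilinearD[OF frob] in \<open>auto intro!: semilinearI simp: ops prod_eq_iff\<close>)
  then show ?thesis by blast
qed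

lemma p_i: "v \<in> carrier (complexify V) \<Longrightarrow> p1_C (i1_C v) = v" "v \<in> carrier (complexify V) \<Longrightarrow> p2_C (i1_C v) = \<zero>\<^bsub>complexify V'\<^esub>"
  "y \<in> carrier (complexify V') \<Longrightarrow> p2_C (i2_C y) = y" "y \<in> carrier (complexify V') \<Longrightarrow> p1_C (i2_C y) = \<zero>\<^bsub>complexify V\<^esub>"
proof -
  have zV: "ctensor V \<zero>\<^bsub>V\<^esub> z = \<zero>\<^bsub>complexify V\<^esub>" "ctensor V' \<zero>\<^bsub>V'\<^esub> z = \<zero>\<^bsub>complexify V'\<^esub>" for z
    using cV.tp.pure_zero_left[of z] cV'.tp.pure_zero_left[of z] by (simp_all add: ctensor_def complexify_simps)
  note z = module_scalarsD(8)[OF mods(1)] module_scalarsD(8)[OF mods(2)]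
  have id: "additive_map G G (\<lambda>x. x)" for G :: "('z, 'zz) ring_scheme" by (auto intro: additive_mapI)
  have zero: "additive_map G H (\<lambda>x. \<zero>\<^bsub>H\<^esub>)" if "abelian_group H" for G :: "('z, 'zz) ring_scheme" and H :: "('y, 'yy) ring_scheme"
  proof -
    interpret H: abelian_group H by fact
    show ?thesis by (auto intro: additive_mapI)
  qed
  show "v \<in> carrier (complexify V) \<Longrightarrow> p1_C (i1_C v) = v"
    by (rule cV.VC_maps_eq[OF additive_map_comp[OF i1.cmap_additive p1.cmap_additive] id])
      (use z in \<open>auto simp: i1.cmap_ct p1.cmap_ct\<close>)
  show "v \<in> carrier (complexify V) \<Longrightarrow> p2_C (i1_C v) = \<zero>\<^bsub>complexify V'\<^esub>"
    by (rule cV.VC_maps_eq[OF additive_map_comp[OF i1.cmap_additive p2.cmap_additive] zero[OF cV'.VC_abelian]])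
      (use z in \<open>auto simp: i1.cmap_ct p2.cmap_ct zV\<close>)
  show "y \<in> carrier (complexify V') \<Longrightarrow> p2_C (i2_C y) = y"
    by (rule cV'.VC_maps_eq[OF additive_map_comp[OF i2.cmap_additive p2.cmap_additive] id])
      (use z in \<open>auto simp: i2.cmap_ct p2.cmap_ct\<close>)
  show "y \<in> carrier (complexify V') \<Longrightarrow> p1_C (i2_C y) = \<zero>\<^bsub>complexify V\<^esub>"
    by (rule cV'.VC_maps_eq[OF additive_map_comp[OF i2.cmap_additive p1.cmap_additive] zero[OF cV.VC_abelian]])
      (use z in \<open>auto simp: i2.cmap_ct p1.cmap_ct zV\<close>)
qed

lemma compar_i:
  "v \<in> carrier (complexify V) \<Longrightarrow> compar N2 (i1_C v) = j1_C (compar (at_id Mt) v)"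
  "y \<in> carrier (complexify V') \<Longrightarrow> compar N2 (i2_C y) = j2_C (compar (at_conj Mt) y)"
proof -
  interpret A: abelian_group "complexify D2" by (rule cD2.VC_abelian)
  have z: "compar (at_id Mt) \<zero>\<^bsub>complexify V\<^esub> = \<zero>\<^bsub>complexify D\<^esub>" "compar (at_conj Mt) \<zero>\<^bsub>complexify V'\<^esub> = \<zero>\<^bsub>complexify D'\<^esub>"
    using additive_map_zero[OF semilinearD(1)[OF compar_linear(1)] cV.VC_abelian cD.VC_abelian]
      additive_map_zero[OF semilinearD(1)[OF compar_linear(2)] cV'.VC_abelian cD'.VC_abelian] by auto
  have z2: "j1_C \<zero>\<^bsub>complexify D\<^esub> = \<zero>\<^bsub>complexify D2\<^esub>" "j2_C \<zero>\<^bsub>complexify D'\<^esub> = \<zero>\<^bsub>complexify D2\<^esub>"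
    using additive_map_zero[OF j1.cmap_additive cD.VC_abelian cD2.VC_abelian]
      additive_map_zero[OF j2.cmap_additive cD'.VC_abelian cD2.VC_abelian] by auto
  show "v \<in> carrier (complexify V) \<Longrightarrow> compar N2 (i1_C v) = j1_C (compar (at_id Mt) v)"
    using additive_mapD(1)[OF j1.cmap_additive semilinearD(2)[OF compar_linear(1)]] by (simp add: N2_simps p_i z z2)
  show "y \<in> carrier (complexify V') \<Longrightarrow> compar N2 (i2_C y) = j2_C (compar (at_conj Mt) y)"
    using additive_mapD(1)[OF j2.cmap_additive semilinearD(2)[OF compar_linear(2)]] by (simp add: N2_simps p_i z z2)
qed

lemma hodge_sum_i1: "a > b \<Longrightarrow> y \<in> hodge (at_id Mt) a b \<Longrightarrow> y \<in> carrier (complexify V) \<Longrightarrow> i1_C y \<in> hodge_sum L N2 {(p, q). p > q}"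
  and hodge_sum_i2: "a > b \<Longrightarrow> z \<in> hodge (at_conj Mt) a b \<Longrightarrow> z \<in> carrier (complexify V') \<Longrightarrow> i2_C z \<in> hodge_sum L N2 {(p, q). p > q}"
proof -
  interpret A: abelian_group "complexify B2" by (rule cB2.VC_abelian)
  have z2: "i1_C \<zero>\<^bsub>complexify V\<^esub> = \<zero>\<^bsub>complexify B2\<^esub>" "i2_C \<zero>\<^bsub>complexify V'\<^esub> = \<zero>\<^bsub>complexify B2\<^esub>"
    using additive_map_zero[OF i1.cmap_additive cV.VC_abelian cB2.VC_abelian]
      additive_map_zero[OF i2.cmap_additive cV'.VC_abelian cB2.VC_abelian] by auto
  have inc: "X \<in> hodge_sum L N2 {(p, q). p > q}" if "a > b" "X \<in> hodge N2 a b" for X and a b :: int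
    unfolding hodge_sum_def mod_span_def by (rule hull_inc) (use that in auto)
  show "i1_C y \<in> hodge_sum L N2 {(p, q). p > q}" if "a > b" "y \<in> hodge (at_id Mt) a b" "y \<in> carrier (complexify V)" for a b
  proof (rule inc[OF that(1)])
    have "i1_C y = i1_C y \<oplus>\<^bsub>complexify B2\<^esub> i2_C \<zero>\<^bsub>complexify V'\<^esub>"
      using additive_mapD(1)[OF i1.cmap_additive that(3)] by (simp add: z2)
    then show "i1_C y \<in> hodge N2 a b" unfolding N2_simps using that(2) hodge_zero(2) by blast
  qed
  show "i2_C z \<in> hodge_sum L N2 {(p, q). p > q}" if "a > b" "z \<in> hodge (at_conj Mt) a b" "z \<in> carrier (complexify V')" for a b
  proof (rule inc[OF that(1)])
    have "i2_C z = i1_C \<zero>\<^bsub>complexify V\<^esub> \<oplus>\<^bsub>complexify B2\<^esub> i2_C z"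
      using additive_mapD(1)[OF i2.cmap_additive that(3)] by (simp add: z2)
    then show "i2_C z \<in> hodge N2 a b" unfolding N2_simps using that(2) hodge_zero(1) by blast
  qed
qed

text \<open>
  The matrix of the Deligne map \<open>\<Phi>\<close> from \<open>\<omega>\<close> to the family \<open>y\<close>, both defined below: block diagonal with
  respect to \<open>A\<close> and its complement, with unitriangular blocks, of which the one for \<open>A\<close> has its
  columns multiplied by the periods.
\<close>

definition "W i j = (if j \<in> A then (if i \<in> A then q j \<otimes>\<^bsub>R\<^esub> u' (star i) (star j) else \<zero>\<^bsub>R\<^esub>)
  else (if i \<in> A then \<zero>\<^bsub>R\<^esub> else u i j))"

lemma q_closed: "i \<in> I \<Longrightarrow> q i \<in> carrier R"
  using q by (auto simp: Units_def)

lemma W_closed: "i \<in> I \<Longrightarrow> j \<in> I \<Longrightarrow> W i j \<in> carrier R"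
  using q_closed u u' star by (auto simp: W_def)

context
  fixes F :: "('d \<times> 'd) set"
  assumes F_plus: "is_F_plus L N2 F"
begin

lemma F_sub: "submodule F (scalars L) D2"
proof -
  obtain k where k: "F = hodge_filt (at_id Mt) k \<times> hodge_filt (at_conj Mt) k"
    using F_plus by (auto simp: is_F_plus_def N2_simps)
  interpret d: module "scalars L" D by (rule mods)
  interpret d': module "scalars L" D' by (rule mods)
  interpret d2: module "scalars L" D2 by (rule cD2.V)
  note E = d.submoduleE[OF filt(1)[of k]] and E' = d'.submoduleE[OF filt(2)[of k]]
  show ?thesis
  proof (rule d2.submoduleI)
    show "F \<subseteq> carrier D2" using k E(1) E'(1) by auto
    show "\<zero>\<^bsub>D2\<^esub> \<in> F" using k d.zero_in_submodule[OF filt(1)] d'.zero_in_submodule[OF filt(2)] by simp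
    fix a b assume a: "a \<in> F" and b: "b \<in> F"
    show "a \<oplus>\<^bsub>D2\<^esub> b \<in> F" using a b k E(5) E'(5) by auto
    have "(\<ominus>\<^bsub>D\<^esub> fst a, \<ominus>\<^bsub>D'\<^esub> snd a) = \<ominus>\<^bsub>D2\<^esub> a"
      using a k E(1) E'(1) by (intro d2.M.minus_equality[symmetric]) (auto simp: d.M.l_neg d'.M.l_neg)
    then have "\<ominus>\<^bsub>D2\<^esub> a = (\<ominus>\<^bsub>D\<^esub> fst a, \<ominus>\<^bsub>D'\<^esub> snd a)" by simp
    then show "\<ominus>\<^bsub>D2\<^esub> a \<in> F" using a k E(3) E'(3) by auto
    show "r \<odot>\<^bsub>D2\<^esub> a \<in> F" if "r \<in> carrier (scalars L)" for r using a that k E(4) E'(4) by auto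
  qed
qed

interpretation qu: quotient "scalars L" D2 F
  by (rule quotient.intro[OF cD2.V]) (simp add: quotient_axioms_def F_sub)

abbreviation "Q \<equiv> quotient_module D2 F"
abbreviation "\<pi> \<equiv> (\<lambda>x. F +>\<^bsub>D2\<^esub> x)"

lemma Q_cspace: "cspace L Q"
  by (simp add: cspace_def L qu.Q_module)

interpretation cQ: cspace L Q by (rule Q_cspace)

interpretation mp: cspace_map L D2 L Q \<pi>
  by (rule cspace_mapI[OF cD2.cspace_axioms cQ.cspace_axioms qu.\<pi>_linear])

abbreviation "\<pi>_C \<equiv> complexify_map Q \<pi>"

interpretation QC: module R "complexify Q" by (rule cQ.VC_module)
interpretation DC: module R "complexify D" by (rule cD.VC_module)
interpretation DC': module R "complexify D'" by (rule cD'.VC_module)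

lemma \<pi>_kills:
  assumes "y \<in> complexify_sub D2 F"
  shows "\<pi>_C y = \<zero>\<^bsub>complexify Q\<^esub>"
  using F_sub assms
proof (induction rule: cD2.complexify_sub_induct)
  case (pure v z)
  then have "v \<in> carrier D2" using qu.U_sub by auto
  then show ?case using mp.cmap_ct[of v z] qu.\<pi>_zero[OF pure] cQ.tp.pure_zero_left[of z]
    by (simp add: ctensor_def complexify_simps)
next
  case (add a b)
  then show ?case by (simp add: additive_mapD(2)[OF mp.cmap_additive])
qed

definition "z i = \<pi> (x i, \<zero>\<^bsub>D'\<^esub>)"
definition "z' i = \<pi> (\<zero>\<^bsub>D\<^esub>, x' i)"

lemma zQ: "i \<in> I \<Longrightarrow> z i \<in> carrier Q" "i \<in> I \<Longrightarrow> z' i \<in> carrier Q"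
  using xD xD' module_scalarsD(8)[OF mods(3)] module_scalarsD(8)[OF mods(4)] semilinearD(2)[OF qu.\<pi>_linear]
  by (auto simp: z_def z'_def Pi_iff)

definition "a_C y = \<pi>_C (j1_C y)"
definition "b_C y = \<pi>_C (j2_C y)"

lemma a_C: "linear_map R (complexify D) (complexify Q) a_C" and b_C: "linear_map R (complexify D') (complexify Q) b_C"
  unfolding a_C_def[abs_def] b_C_def[abs_def]
  by (rule linear_map_comp[OF j1.cmap_linear[OF refl] mp.cmap_linear[OF refl]],
      rule linear_map_comp[OF j2.cmap_linear[OF refl] mp.cmap_linear[OF refl]])

lemma a_C_x: "i \<in> I \<Longrightarrow> a_C (ctensor D (x i) 1) = ctensor Q (z i) 1"
  and b_C_x: "i \<in> I \<Longrightarrow> b_C (ctensor D' (x' i) 1) = ctensor Q (z' i) 1"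
  using xD xD' module_scalarsD(8)[OF mods(3)] module_scalarsD(8)[OF mods(4)]
  by (auto simp: a_C_def b_C_def z_def z'_def j1.cmap_ct j2.cmap_ct mp.cmap_ct Pi_iff)

lemma a_C_\<omega>:
  assumes j: "j \<in> I"
  shows "a_C (compar (at_id Mt) (\<omega> j)) = lincomb (complexify Q) I (\<lambda>i. u i j) (\<lambda>i. ctensor Q (z i) 1)"
proof -
  have "a_C (compar (at_id Mt) (\<omega> j)) = lincomb (complexify Q) I (\<lambda>i. u i j) (\<lambda>i. a_C (ctensor D (x i) 1))"
    unfolding I\<omega>[OF j] using u j xD cD.ct_closed
    by (intro DC.linear_map_lincomb[OF a_C QC.module_axioms]) (auto simp: Pi_iff)
  also have "\<dots> = lincomb (complexify Q) I (\<lambda>i. u i j) (\<lambda>i. ctensor Q (z i) 1)"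
    by (rule QC.lincomb_cong) (use u j zQ cQ.ct_closed a_C_x in auto)
  finally show ?thesis .
qed

lemma b_C_\<omega>:
  assumes j: "j \<in> I"
  shows "b_C (compar (at_conj Mt) (\<omega>' j)) = lincomb (complexify Q) I (\<lambda>i. u' i j) (\<lambda>i. ctensor Q (z' i) 1)"
proof -
  have "b_C (compar (at_conj Mt) (\<omega>' j)) = lincomb (complexify Q) I (\<lambda>i. u' i j) (\<lambda>i. b_C (ctensor D' (x' i) 1))"
    unfolding I\<omega>'[OF j] using u' j xD' cD'.ct_closed
    by (intro DC'.linear_map_lincomb[OF b_C QC.module_axioms]) (auto simp: Pi_iff)
  also have "\<dots> = lincomb (complexify Q) I (\<lambda>i. u' i j) (\<lambda>i. ctensor Q (z' i) 1)"
    by (rule QC.lincomb_cong) (use u' j zQ cQ.ct_closed b_C_x in auto)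
  finally show ?thesis .
qed

lemma F_plus_mem: "X \<in> hodge_sum L N2 {(p, q). p > q} \<Longrightarrow> compar N2 X \<in> complexify_sub D2 F"
  using F_plus by (auto simp: is_F_plus_def N2_simps)

lemma a_C_zero: "j \<in> A \<Longrightarrow> a_C (compar (at_id Mt) (\<omega> j)) = \<zero>\<^bsub>complexify Q\<^esub>"
  and b_C_zero: "j \<in> I \<Longrightarrow> star j \<notin> A \<Longrightarrow> b_C (compar (at_conj Mt) (\<omega>' j)) = \<zero>\<^bsub>complexify Q\<^esub>"
proof -
  show "a_C (compar (at_id Mt) (\<omega> j)) = \<zero>\<^bsub>complexify Q\<^esub>" if j: "j \<in> A"
  proof -
    have w: "\<omega> j \<in> carrier (complexify V)" using \<omega>V j A by auto
    obtain a b where "a > b" "\<omega> j \<in> hodge (at_id Mt) a b" using hodgeA[OF j] by auto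
    then have "compar N2 (i1_C (\<omega> j)) \<in> complexify_sub D2 F"
      using w by (intro F_plus_mem hodge_sum_i1)
    then show ?thesis using \<pi>_kills compar_i(1)[OF w] by (simp add: a_C_def)
  qed
  show "b_C (compar (at_conj Mt) (\<omega>' j)) = \<zero>\<^bsub>complexify Q\<^esub>" if j: "j \<in> I" "star j \<notin> A"
  proof -
    have w: "\<omega>' j \<in> carrier (complexify V')" using \<omega>V' j by auto
    obtain a b where "a > b" "\<omega>' j \<in> hodge (at_conj Mt) a b" using hodgeA'[OF j] by auto
    then have "compar N2 (i2_C (\<omega>' j)) \<in> complexify_sub D2 F"
      using w by (intro F_plus_mem hodge_sum_i2)
    then show ?thesis using \<pi>_kills compar_i(2)[OF w] by (simp add: b_C_def)
  qed
qed

lemma z_vanish: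
  assumes cs: "dual_basis (scalars L) Q (scalars L) K cs \<eta>"
  shows "j \<in> A \<Longrightarrow> z j = \<zero>\<^bsub>Q\<^esub>" "j \<in> I \<Longrightarrow> star j \<notin> A \<Longrightarrow> z' j = \<zero>\<^bsub>Q\<^esub>"
proof -
  show "z j = \<zero>\<^bsub>Q\<^esub>" if "j \<in> A"
  proof (rule triangular_kernel[OF Q_cspace cs finI zQ(1) u u_diag(1) A _ _ that])
    show "i \<in> A \<and> 0 \<le> \<rho> i \<and> \<rho> i < \<rho> j" if "i \<in> I" "j \<in> A" "i \<noteq> j" "u i j \<noteq> \<zero>\<^bsub>R\<^esub>" for i j
      using tri[OF that(1) _ that(3,4)] that(2) A by blast
    show "lincomb (complexify Q) I (\<lambda>i. u i j) (\<lambda>i. ctensor Q (z i) 1) = \<zero>\<^bsub>complexify Q\<^esub>" if "j \<in> A" for j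
      using a_C_\<omega>[of j] a_C_zero[OF that] A that by (simp add: subset_iff)
  qed
  show "z' j = \<zero>\<^bsub>Q\<^esub>" if "j \<in> I" "star j \<notin> A"
  proof (rule triangular_kernel[where A = "{i \<in> I. star i \<notin> A}" and \<rho> = \<rho>', OF Q_cspace cs finI zQ(2) u' u_diag(2)])
    show "i \<in> {i \<in> I. star i \<notin> A} \<and> 0 \<le> \<rho>' i \<and> \<rho>' i < \<rho>' j"
      if "i \<in> I" "j \<in> {i \<in> I. star i \<notin> A}" "i \<noteq> j" "u' i j \<noteq> \<zero>\<^bsub>R\<^esub>" for i j
      using tri'[OF that(1) _ that(3,4)] that(1,2) by blast
    show "lincomb (complexify Q) I (\<lambda>i. u' i j) (\<lambda>i. ctensor Q (z' i) 1) = \<zero>\<^bsub>complexify Q\<^esub>" if "j \<in> {i \<in> I. star i \<notin> A}" for j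
      using b_C_\<omega>[of j] b_C_zero[of j] that by simp
  qed (use that in simp_all)
qed

text \<open>
  The quotient by \<open>F\<close> is generated by the \<open>z i\<close> and \<open>z' i\<close>. Half of them vanish (\<open>z_vanish\<close>); the
  others are numbered by \<open>I\<close> once more, through \<open>star\<close>.
\<close>

definition "y i = (if i \<in> A then z' (star i) else z i)"

lemma yQ: "i \<in> I \<Longrightarrow> y i \<in> carrier Q"
  using zQ star by (auto simp: y_def)

lemma y_spans:
  assumes cs: "dual_basis (scalars L) Q (scalars L) K cs \<eta>"
  shows "spans (scalars L) Q I y"
  unfolding spans_def
proof (intro conjI ballI finI)
  interpret q: module "scalars L" Q by (rule cQ.V)
  interpret dd: module "scalars L" D by (rule mods)
  interpret dd': module "scalars L" D' by (rule mods)
  note zv = z_vanish[OF cs]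
  show yI: "y \<in> I \<rightarrow> carrier Q" using yQ by auto
  let ?S = "{lincomb Q I c y |c. c \<in> I \<rightarrow> carrier (scalars L)}"
  have S: "submodule ?S (scalars L) Q" by (rule q.lincomb_span_submodule[OF finI yI])
  have yS: "y i \<in> ?S" if "i \<in> I" for i
    using q.lincomb_single[OF finI that yI] subfield_closed[OF L]
    by (intro CollectI exI[of _ "\<lambda>j. if j = i then \<one>\<^bsub>scalars L\<^esub> else \<zero>\<^bsub>scalars L\<^esub>"]) auto
  have zS: "z i \<in> ?S" if "i \<in> I" for i
    using yS[OF that] zv(1)[of i] q.zero_in_submodule[OF S] by (cases "i \<in> A") (auto simp: y_def)
  have zS': "z' i \<in> ?S" if "i \<in> I" for i
    using yS[OF star(1)[OF that]] zv(2)[OF that] q.zero_in_submodule[OF S] star that by (cases "star i \<in> A") (auto simp: y_def)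
  fix X assume "X \<in> carrier Q"
  then obtain p where p: "p \<in> carrier D2" "X = \<pi> p" by (auto simp: qu.Q_carrier)
  then have p12: "fst p \<in> carrier D" "snd p \<in> carrier D'" by auto
  have l1: "linear_map (scalars L) D Q (\<lambda>d. \<pi> (d, \<zero>\<^bsub>D'\<^esub>))" by (rule linear_map_comp[OF direct_sum_maps(1)[OF mods(3,4)] qu.\<pi>_linear])
  have l2: "linear_map (scalars L) D' Q (\<lambda>d. \<pi> (\<zero>\<^bsub>D\<^esub>, d))" by (rule linear_map_comp[OF direct_sum_maps(2)[OF mods(3,4)] qu.\<pi>_linear])
  obtain c where c: "c \<in> I \<rightarrow> L" "fst p = lincomb D I c x" using x p12 by (auto simp: spans_def)
  obtain c' where c': "c' \<in> I \<rightarrow> L" "snd p = lincomb D' I c' x'" using x' p12 by (auto simp: spans_def)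
  have "\<pi> (fst p, \<zero>\<^bsub>D'\<^esub>) = lincomb Q I c z"
    unfolding c(2) z_def[abs_def] using c(1) xD by (intro dd.linear_map_lincomb[OF l1 cQ.V]) auto
  then have 1: "\<pi> (fst p, \<zero>\<^bsub>D'\<^esub>) \<in> ?S" using q.submodule_lincomb[OF S, of c I z] zS c(1) by auto
  have "\<pi> (\<zero>\<^bsub>D\<^esub>, snd p) = lincomb Q I c' z'"
    unfolding c'(2) z'_def[abs_def] using c'(1) xD' by (intro dd'.linear_map_lincomb[OF l2 cQ.V]) auto
  then have 2: "\<pi> (\<zero>\<^bsub>D\<^esub>, snd p) \<in> ?S" using q.submodule_lincomb[OF S, of c' I z'] zS' c'(1) by auto
  have "p = (fst p, \<zero>\<^bsub>D'\<^esub>) \<oplus>\<^bsub>D2\<^esub> (\<zero>\<^bsub>D\<^esub>, snd p)" using p12 by simp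
  then have "X = \<pi> (fst p, \<zero>\<^bsub>D'\<^esub>) \<oplus>\<^bsub>Q\<^esub> \<pi> (\<zero>\<^bsub>D\<^esub>, snd p)"
    unfolding p(2) using p12 module_scalarsD(8)[OF mods(3)] module_scalarsD(8)[OF mods(4)]
    by (subst qu.Q_add) auto
  then have "X \<in> ?S" using q.submoduleE(5)[OF S 1 2] by simp
  then show "\<exists>c\<in>I \<rightarrow> carrier (scalars L). X = lincomb Q I c y" by auto
qed

text \<open>
  Under the identification of the invariants with \<open>V\<close>, the Deligne map sends \<open>v\<close> to the class of
  the pair of comparison images of \<open>v\<close> and \<open>f v\<close>.
\<close>

definition "\<Phi> v = a_C (compar (at_id Mt) v) \<oplus>\<^bsub>complexify Q\<^esub> b_C (compar (at_conj Mt) (f_C v))"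

lemma \<Phi>_linear: "linear_map R (complexify V) (complexify Q) \<Phi>"
proof -
  note l1 = linear_map_comp[OF compar_linear(1) a_C]
  note l2 = linear_map_comp[OF linear_map_comp[OF mf.cmap_linear[OF refl] compar_linear(2)] b_C]
  show ?thesis unfolding \<Phi>_def[abs_def]
    using semilinearD[OF l1] semilinearD[OF l2]
    by (intro semilinearI) (simp_all add: QC.M.a_ac QC.smult_r_distr)
qed

text \<open>
  For \<open>j \<notin> A\<close> the conjugate class \<open>\<omega>' (star j)\<close> has \<open>p > q\<close>, so the second component of the pair dies in
  the quotient; for \<open>j \<in> A\<close> the first one does, and the period appears in the second.
\<close>

lemma \<Phi>_\<omega>:
  assumes cs: "dual_basis (scalars L) Q (scalars L) K cs \<eta>" and j: "j \<in> I"
  shows "\<Phi> (\<omega> j) = lincomb (complexify Q) I (\<lambda>i. W i j) (\<lambda>i. ctensor Q (y i) 1)"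
proof -
  note zv = z_vanish[OF cs]
  have z0: "ctensor Q \<zero>\<^bsub>Q\<^esub> 1 = \<zero>\<^bsub>complexify Q\<^esub>"
    using cQ.tp.pure_zero_left[of 1] by (simp add: ctensor_def complexify_simps)
  have w': "\<omega>' (star j) \<in> carrier (complexify V')" using \<omega>V' star(1)[OF j] by auto
  have I': "compar (at_conj Mt) (\<omega>' (star j)) \<in> carrier (complexify D')" using semilinearD(2)[OF compar_linear(2) w'] .
  have fj: "b_C (compar (at_conj Mt) (f_C (\<omega> j))) = q j \<odot>\<^bsub>complexify Q\<^esub> b_C (compar (at_conj Mt) (\<omega>' (star j)))"
    unfolding period[OF j] using semilinearD(4)[OF compar_linear(2) q_closed[OF j] w'] semilinearD(4)[OF b_C q_closed[OF j] I'] by simp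
  have yc: "ctensor Q (y i) 1 \<in> carrier (complexify Q)" if "i \<in> I" for i using yQ[OF that] cQ.ct_closed by blast
  show ?thesis
  proof (cases "j \<in> A")
    case False
    have "b_C (compar (at_conj Mt) (\<omega>' (star j))) = \<zero>\<^bsub>complexify Q\<^esub>"
      using b_C_zero[of "star j"] star j False by auto
    then have "\<Phi> (\<omega> j) = a_C (compar (at_id Mt) (\<omega> j))"
      using q_closed[OF j] \<omega>V j semilinearD(2)[OF a_C semilinearD(2)[OF compar_linear(1)]] by (simp add: \<Phi>_def fj Pi_iff)
    also have "\<dots> = lincomb (complexify Q) I (\<lambda>i. u i j) (\<lambda>i. ctensor Q (z i) 1)" by (rule a_C_\<omega>[OF j])
    also have "\<dots> = lincomb (complexify Q) I (\<lambda>i. W i j) (\<lambda>i. ctensor Q (y i) 1)"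
      unfolding lincomb_def
    proof (intro QC.M.finsum_cong' refl)
      fix i assume i: "i \<in> I"
      show "u i j \<odot>\<^bsub>complexify Q\<^esub> ctensor Q (z i) 1 = W i j \<odot>\<^bsub>complexify Q\<^esub> ctensor Q (y i) 1"
        using False zv(1)[of i] u[OF i j] yc[OF i] by (cases "i \<in> A") (auto simp: W_def y_def z0)
    qed (use W_closed j yc in auto)
    finally show ?thesis .
  next
    case True
    have "\<Phi> (\<omega> j) = q j \<odot>\<^bsub>complexify Q\<^esub> b_C (compar (at_conj Mt) (\<omega>' (star j)))"
      using a_C_zero[OF True] q_closed[OF j] semilinearD(2)[OF b_C I'] by (simp add: \<Phi>_def fj)
    also have "\<dots> = q j \<odot>\<^bsub>complexify Q\<^esub> lincomb (complexify Q) I (\<lambda>i. u' i (star j)) (\<lambda>i. ctensor Q (z' i) 1)"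
      using b_C_\<omega>[OF star(1)[OF j]] by simp
    also have "\<dots> = lincomb (complexify Q) I (\<lambda>i. q j \<otimes>\<^bsub>R\<^esub> u' i (star j)) (\<lambda>i. ctensor Q (z' i) 1)"
      by (rule QC.lincomb_smult[OF finI]) (use u' star j zQ cQ.ct_closed q_closed in auto)
    also have "\<dots> = lincomb (complexify Q) I (\<lambda>i. q j \<otimes>\<^bsub>R\<^esub> u' (star i) (star j)) (\<lambda>i. ctensor Q (z' (star i)) 1)"
      by (rule QC.lincomb_reindex) (use u' star j zQ cQ.ct_closed q_closed in \<open>auto simp: bij_betw_def inj_on_def image_iff, metis+\<close>)
    also have "\<dots> = lincomb (complexify Q) I (\<lambda>i. W i j) (\<lambda>i. ctensor Q (y i) 1)"
      unfolding lincomb_def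
    proof (intro QC.M.finsum_cong' refl)
      fix i assume i: "i \<in> I"
      show "q j \<otimes>\<^bsub>R\<^esub> u' (star i) (star j) \<odot>\<^bsub>complexify Q\<^esub> ctensor Q (z' (star i)) 1 = W i j \<odot>\<^bsub>complexify Q\<^esub> ctensor Q (y i) 1"
        using True zv(2)[of "star i"] star[OF i] star(1)[OF j] u' yc[OF i] q_closed[OF j] by (cases "i \<in> A") (auto simp: W_def y_def z0)
    qed (use W_closed j yc in auto)
    finally show ?thesis .
  qed
qed

lemma deligne_map:
  assumes b: "b \<in> carrier (betti_plus N2)"
  shows "\<pi>_C (compar N2 (complexify_map (betti N2) id (ctensor (betti_plus N2) b 1))) = \<Phi> (ctensor V (fst b) 1)"
proof -
  have m: "fst b \<in> carrier V" "snd b = f (fst b)" using b plus_iff[of "fst b" "snd b"] by auto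
  have fb: "f (fst b) \<in> carrier V'" using semilinearD(2)[OF frob m(1)] .
  have bB: "b \<in> carrier B2" using m fb by (simp add: mem_Times_iff)
  interpret s: cspace_map L "B2\<lparr>carrier := carrier (betti_plus N2)\<rparr>" L B2 id by (rule cB2.restrict_cspace(2)[OF plus_sub])
  have "complexify_map (betti N2) id (ctensor (betti_plus N2) b 1) = ctensor B2 b 1"
    using s.cmap_ct[of b 1] b betti_plus_eq by (simp add: N2_simps)
  moreover have "p1_C (ctensor B2 b 1) = ctensor V (fst b) 1" "p2_C (ctensor B2 b 1) = f_C (ctensor V (fst b) 1)"
    using bB m by (simp_all add: p1.cmap_ct p2.cmap_ct mf.cmap_ct)
  moreover have "compar (at_id Mt) (ctensor V (fst b) 1) \<in> carrier (complexify D)"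
    "compar (at_conj Mt) (f_C (ctensor V (fst b) 1)) \<in> carrier (complexify D')"
    using semilinearD(2)[OF compar_linear(1)] semilinearD(2)[OF compar_linear(2)] cV.ct_closed[OF m(1)] cV'.ct_closed[OF fb] mf.cmap_ct[OF m(1)] by auto
  ultimately show ?thesis
    by (simp add: N2_simps(6) \<Phi>_def a_C_def b_C_def additive_mapD(2)[OF mp.cmap_additive]
        additive_mapD(1)[OF j1.cmap_additive] additive_mapD(1)[OF j2.cmap_additive])
qed

end

text \<open>
  Let \<open>P\<close> be the matrix of an \<open>L\<close>-basis of \<open>V\<close> in the family \<open>\<omega>\<close>. Up to nonzero factors in \<open>L\<close>, the determinant
  period is \<open>det P\<close> times the determinant of the unitriangular matrix \<open>u\<close>, and the Deligne period is
  \<open>det P\<close> times the determinant of \<open>W\<close>, which is the product of the periods over \<open>A\<close>.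
\<close>

theorem deligne_determinant_ratio:
  assumes \<delta>: "is_determinant_period L (at_id Mt) \<delta>" and c: "is_deligne_period L N2 c"
  shows "\<exists>e\<in>L - {0}. c = ctensor (scalars L) e 1 \<otimes>\<^bsub>R\<^esub> (finprod R q A \<otimes>\<^bsub>R\<^esub> \<delta>)" and "\<delta> \<in> Units R"
proof -
  interpret emb: ring_hom_cring "scalars L" R "\<lambda>e. ctensor (scalars L) e 1" by (rule emb_hom[OF L])
  interpret VC: module R "complexify V" by (rule cV.VC_module)
  interpret DC: module R "complexify D" by (rule cD.VC_module)
  interpret vm: module "scalars L" V by (rule mods)
  note EC = subfield_closed[OF L]
  have i1: "ctensor (scalars L) 1 1 = \<one>\<^bsub>R\<^esub>" using emb.hom_one by simp
  define m where "m = card I"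
  obtain h where h: "bij_betw h {..<m} I" unfolding m_def using ex_bij_betw_nat_finite[OF finI] by (auto simp: atLeast0LessThan)
  have hI: "h k \<in> I" if "k < m" for k using h that by (auto simp: bij_betw_def)
  have hinj: "h k = h l \<longleftrightarrow> k = l" if "k < m" "l < m" for k l
    using h that by (auto simp: bij_betw_def inj_on_def)
  obtain \<eta>0 where \<eta>0: "dual_basis (scalars L) V (scalars L) J e \<eta>0" using fr by (auto simp: frame_def)
  have len: "length bs = m" if "dual_basis (scalars L) V (scalars L) {..<length bs} b \<eta>" for bs :: "'z list" and b \<eta>
    using card_dual_basis[OF L mods(1) that \<eta>0] card by (simp add: m_def)
  have spans_h: "spans S M {..<m} (\<lambda>k. b (h k))" if sp: "spans S M I b" and Mm: "module S M" for S :: "('s, 'ss) ring_scheme" and M :: "('s, 'v, 'vv) module_scheme" and b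
  proof -
    interpret M: module S M by fact
    show ?thesis unfolding spans_def
    proof (intro conjI ballI)
      fix v assume "v \<in> carrier M"
      then obtain c where c: "c \<in> I \<rightarrow> carrier S" "v = lincomb M I c b" using sp by (auto simp: spans_def)
      have "v = lincomb M {..<m} (\<lambda>k. c (h k)) (\<lambda>k. b (h k))"
        unfolding c(2) using c(1) sp by (intro M.lincomb_reindex[OF h]) (auto simp: spans_def)
      then show "\<exists>c\<in>{..<m} \<rightarrow> carrier S. v = lincomb M {..<m} c (\<lambda>k. b (h k))"
        using c(1) hI by (intro bexI[of _ "\<lambda>k. c (h k)"]) auto
    qed (use sp hI in \<open>auto simp: spans_def\<close>)
  qed

  \<comment> \<open>The determinant period is \<open>det P\<close> up to a factor in \<open>L\<close>, as the comparison matrix \<open>u\<close> is unitriangular.\<close>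
  obtain E1 cs1 A1 where 1: "is_basis (scalars L) V E1" "is_basis (scalars L) D cs1" "length E1 = length cs1"
    "\<And>i j. i < length cs1 \<Longrightarrow> j < length E1 \<Longrightarrow> A1 i j \<in> carrier R"
    "\<And>j. j < length E1 \<Longrightarrow> compar (at_id Mt) (ctensor V (E1 ! j) 1) = lincomb (complexify D) {..<length cs1} (\<lambda>i. A1 i j) (\<lambda>i. ctensor D (cs1 ! i) 1)"
    "\<delta> = ring_det R (length E1) A1"
    using \<delta> unfolding is_determinant_period_def is_determinant_def lincomb_def by blast
  obtain \<eta>1 where \<eta>1: "dual_basis (scalars L) V (scalars L) {..<length E1} ((!) E1) \<eta>1"
    using is_basis_dual_basis[OF L mods(1) 1(1)] by blast
  have m1: "length E1 = m" "length cs1 = m" using len[OF \<eta>1] 1(3) by auto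
  note \<eta>1 = \<eta>1[unfolded m1]
  obtain \<theta>1 where \<theta>1: "dual_basis (scalars L) D (scalars L) {..<m} ((!) cs1) \<theta>1"
    using is_basis_dual_basis[OF L mods(3) 1(2)] m1 by auto
  have E1V: "(!) E1 \<in> {..<m} \<rightarrow> carrier V" using \<eta>1 by (simp add: dual_basis_def)
  let ?e1 = "\<lambda>j. ctensor V (E1 ! j) 1"
  have e1C: "?e1 \<in> {..<m} \<rightarrow> carrier (complexify V)" using E1V cV.ct_closed by auto
  let ?w = "\<lambda>k. \<omega> (h k)"
  have wC: "?w \<in> {..<m} \<rightarrow> carrier (complexify V)" using \<omega>V hI by auto
  have spw: "spans R (complexify V) {..<m} ?w" by (rule spans_h[OF \<omega> VC.module_axioms])
  have "\<exists>P. \<forall>j\<in>{..<m}. P j \<in> {..<m} \<rightarrow> carrier R \<and> ?e1 j = lincomb (complexify V) {..<m} (P j) ?w"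
    by (rule bchoice) (use spw e1C in \<open>auto simp: spans_def Pi_iff Bex_def\<close>)
  then obtain P where P: "\<forall>j\<in>{..<m}. P j \<in> {..<m} \<rightarrow> carrier R \<and> ?e1 j = lincomb (complexify V) {..<m} (P j) ?w" ..
  let ?P = "\<lambda>k j. P j k"
  have Pc: "?P k j \<in> carrier R" if "k < m" "j < m" for k j using P that by (auto simp: Pi_iff)
  have P_unit: "ring_det R m ?P \<in> Units R"
  proof -
    note sp1 = cV.spans_complexify[OF dual_basis_spans_scalars[OF L mods(1) \<eta>1]]
    have "\<exists>S. \<forall>j\<in>{..<m}. S j \<in> {..<m} \<rightarrow> carrier R \<and> ?w j = lincomb (complexify V) {..<m} (S j) ?e1"
      by (rule bchoice) (use sp1 wC in \<open>auto simp: spans_def Pi_iff Bex_def\<close>)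
    then obtain S where S: "\<forall>j\<in>{..<m}. S j \<in> {..<m} \<rightarrow> carrier R \<and> ?w j = lincomb (complexify V) {..<m} (S j) ?e1" ..
    let ?S = "\<lambda>k j. S j k"
    have Sc: "?S k j \<in> carrier R" if "k < m" "j < m" for k j using S that by (auto simp: Pi_iff)
    have "mat_mult R m ?S ?P i j = (if i = j then \<one>\<^bsub>R\<^esub> else \<zero>\<^bsub>R\<^esub>)" if ij: "i < m" "j < m" for i j
    proof -
      interpret l: cspace L "scalars L" by (rule cspace_scalars[OF L])
      note dc = cV.dual_basis_complexify[OF \<eta>1]
      have "?e1 j = lincomb (complexify V) {..<m} (P j) (\<lambda>k. lincomb (complexify V) {..<m} (S k) ?e1)"
      proof -
        have "lincomb (complexify V) {..<m} (P j) ?w = lincomb (complexify V) {..<m} (P j) (\<lambda>k. lincomb (complexify V) {..<m} (S k) ?e1)"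
          by (rule VC.lincomb_cong) (use S P ij e1C in \<open>auto intro!: VC.lincomb_closed\<close>)
        then show ?thesis using P ij by simp
      qed
      also have "\<dots> = lincomb (complexify V) {..<m} (\<lambda>i. mat_mult R m ?S ?P i j) ?e1"
        unfolding mat_mult_def using P ij Sc e1C by (intro VC.lincomb_lincomb) auto
      finally have ej: "?e1 j = lincomb (complexify V) {..<m} (\<lambda>i. mat_mult R m ?S ?P i j) ?e1" .
      have mc: "mat_mult R m ?S ?P i j \<in> carrier R" if "i < m" for i
        using that ij Sc Pc by (intro RR.mat_mult_closed) auto
      have "complexify_map (scalars L) (\<eta>1 i) (?e1 j) = mat_mult R m ?S ?P i j"
        by (subst ej, rule VC.dual_basis_coord[OF dc l.VC_module]) (use mc ij in \<open>auto simp: coeff_ring_simps\<close>)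
      then show ?thesis using dc ij by (simp add: dual_basis_def)
    qed
    then have "ring_det R m ?S \<otimes>\<^bsub>R\<^esub> ring_det R m ?P = \<one>\<^bsub>R\<^esub>" using Sc Pc by (intro RR.ring_det_inverse) auto
    then show ?thesis
      using RR.ring_det_closed[of m ?S] RR.ring_det_closed[of m ?P] Sc Pc
      by (auto simp: Units_def RR.m_comm intro!: bexI[of _ "ring_det R m ?S"])
  qed
  let ?U = "\<lambda>k l. u (h k) (h l)"
  have Uc: "?U k l \<in> carrier R" if "k < m" "l < m" for k l using u hI that by auto
  have det_U: "ring_det R m ?U = \<one>\<^bsub>R\<^esub>"
  proof -
    have "ring_det R m ?U = (\<Otimes>\<^bsub>R\<^esub>k\<in>{..<m}. ?U k k)"
      by (rule RR.ring_det_triangular[where \<rho> = "\<lambda>k. \<rho> (h k)"]) (use Uc tri hI hinj in blast)+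
    also have "\<dots> = (\<Otimes>\<^bsub>R\<^esub>k\<in>{..<m}. \<one>\<^bsub>R\<^esub>)" using u_diag hI by (intro RR.finprod_cong') auto
    finally show ?thesis by simp
  qed
  have yD: "spans (scalars L) D {..<m} (\<lambda>k. x (h k))" by (rule spans_h[OF x mods(3)])
  have xh: "(\<lambda>i. ctensor D (x i) 1) \<in> I \<rightarrow> carrier (complexify D)" using xD cD.ct_closed by (auto simp: Pi_iff)
  have "\<exists>e\<in>L - {0}. ring_det R m A1 = ctensor (scalars L) e 1 \<otimes>\<^bsub>R\<^esub> (ring_det R m ?U \<otimes>\<^bsub>R\<^esub> ring_det R m ?P)"
  proof (rule determinant_factor[OF cD.cspace_axioms \<theta>1 yD])
    fix j assume j: "j < m"
    have "lincomb (complexify D) {..<m} (\<lambda>i. A1 i j) (\<lambda>i. ctensor D (cs1 ! i) 1) = compar (at_id Mt) (lincomb (complexify V) {..<m} (P j) ?w)"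
      using 1(5)[of j] P j m1 by simp
    also have "\<dots> = lincomb (complexify D) {..<m} (P j) (\<lambda>k. compar (at_id Mt) (?w k))"
      using P j wC by (intro VC.linear_map_lincomb[OF compar_linear(1) DC.module_axioms]) auto
    also have "\<dots> = lincomb (complexify D) {..<m} (P j) (\<lambda>k. lincomb (complexify D) {..<m} (\<lambda>i. ?U i k) (\<lambda>i. ctensor D (x (h i)) 1))"
    proof (rule DC.lincomb_cong[OF refl])
      fix k assume "k \<in> {..<m}"
      then show "compar (at_id Mt) (?w k) = lincomb (complexify D) {..<m} (\<lambda>i. ?U i k) (\<lambda>i. ctensor D (x (h i)) 1)"
        using I\<omega>[OF hI, of k] u hI xh by (subst DC.lincomb_reindex[OF h, symmetric]) auto
    qed (use P j Uc xh hI in \<open>auto intro!: DC.lincomb_closed\<close>)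
    finally show "lincomb (complexify D) {..<m} (\<lambda>i. A1 i j) (\<lambda>i. ctensor D (cs1 ! i) 1)
      = lincomb (complexify D) {..<m} (\<lambda>k. ?P k j) (\<lambda>k. lincomb (complexify D) {..<m} (\<lambda>i. ?U i k) (\<lambda>i. ctensor D (x (h i)) 1))" .
  qed (use Uc Pc 1(4) m1 in auto)
  then obtain e1 where e1: "e1 \<in> L - {0}" "\<delta> = ctensor (scalars L) e1 1 \<otimes>\<^bsub>R\<^esub> ring_det R m ?P"
    using det_U 1(6) m1 RR.ring_det_closed[of m ?P] Pc by auto
  have emb_unit: "ctensor (scalars L) a 1 \<in> Units R" if "a \<in> L - {0}" for a
  proof -
    have "ctensor (scalars L) a 1 \<otimes>\<^bsub>R\<^esub> ctensor (scalars L) (inverse a) 1 = \<one>\<^bsub>R\<^esub>"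
      using emb.hom_mult[of a "inverse a"] that EC(6) i1 by simp
    then show ?thesis using that EC(6) emb.hom_closed[of a] emb.hom_closed[of "inverse a"]
      by (auto simp: Units_def RR.m_comm intro!: bexI[of _ "ctensor (scalars L) (inverse a) 1"])
  qed
  show "\<delta> \<in> Units R" unfolding e1(2) using emb_unit[OF e1(1)] P_unit by (rule RR.Units_m_closed)

  \<comment> \<open>The Deligne period: the same \<open>P\<close>, followed by the matrix \<open>W\<close> instead of \<open>u\<close>.\<close>
  obtain F where F: "is_F_plus L N2 F" and dF: "is_determinant L (betti_plus N2) (quotient_module D2 F)
       (\<lambda>X. complexify_map (quotient_module D2 F) (\<lambda>x. F +>\<^bsub>D2\<^esub> x) (compar N2 (complexify_map (betti N2) id X))) c"
    using c by (auto simp: is_deligne_period_def N2_simps)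
  let ?Q = "quotient_module D2 F"
  interpret cQ: cspace L ?Q by (rule Q_cspace[OF F])
  interpret QC: module R "complexify ?Q" by (rule cQ.VC_module)
  obtain bs cs2 A2 where 2: "is_basis (scalars L) (betti_plus N2) bs" "is_basis (scalars L) ?Q cs2" "length bs = length cs2"
    "\<And>i j. i < length cs2 \<Longrightarrow> j < length bs \<Longrightarrow> A2 i j \<in> carrier R"
    "\<And>j. j < length bs \<Longrightarrow> complexify_map ?Q (\<lambda>x. F +>\<^bsub>D2\<^esub> x) (compar N2 (complexify_map (betti N2) id (ctensor (betti_plus N2) (bs ! j) 1)))
      = lincomb (complexify ?Q) {..<length cs2} (\<lambda>i. A2 i j) (\<lambda>i. ctensor ?Q (cs2 ! i) 1)"
    "c = ring_det R (length bs) A2"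
    using dF unfolding is_determinant_def lincomb_def by blast
  obtain \<eta>2 where \<eta>2: "dual_basis (scalars L) V (scalars L) {..<length bs} (\<lambda>j. fst (bs ! j)) \<eta>2"
    using plus_dual_basis[OF 2(1)] by blast
  have m2: "length bs = m" "length cs2 = m" using len[OF \<eta>2] 2(3) by auto
  note \<eta>2 = \<eta>2[unfolded m2]
  obtain \<theta>2 where \<theta>2: "dual_basis (scalars L) ?Q (scalars L) {..<m} ((!) cs2) \<theta>2"
    using is_basis_dual_basis[OF L cQ.V 2(2)] m2 by auto
  obtain B where B: "\<forall>i<m. \<forall>k<m. B i k \<in> L" "\<forall>k<m. fst (bs ! k) = lincomb V {..<m} (\<lambda>i. B i k) ((!) E1)"
    "ring_det (scalars L) m B \<in> L - {0}"
    using base_change_unit[OF L mods(1) \<eta>1 dual_basis_spans_scalars[OF L mods(1) \<eta>2]] by blast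
  let ?B = "\<lambda>i k. ctensor (scalars L) (B i k) 1"
  have Bc: "?B i k \<in> carrier R" if "i < m" "k < m" for i k using B that emb.hom_closed by auto
  let ?PB = "mat_mult R m ?P ?B"
  have PBc: "?PB i k \<in> carrier R" if "i < m" "k < m" for i k using that Pc Bc by (intro RR.mat_mult_closed) auto
  have e2: "ctensor V (fst (bs ! j)) 1 = lincomb (complexify V) {..<m} (\<lambda>k. ?PB k j) ?w" if j: "j < m" for j
  proof -
    have "ctensor V (fst (bs ! j)) 1 = lincomb (complexify V) {..<m} (\<lambda>i. ?B i j) ?e1"
      using B j cV.ct_lincomb[of "\<lambda>i. B i j" "{..<m}" "(!) E1" 1] E1V by auto
    also have "\<dots> = lincomb (complexify V) {..<m} (\<lambda>i. ?B i j) (\<lambda>i. lincomb (complexify V) {..<m} (\<lambda>k. ?P k i) ?w)"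
      by (rule VC.lincomb_cong) (use P Bc j wC in \<open>auto intro!: VC.lincomb_closed\<close>)
    also have "\<dots> = lincomb (complexify V) {..<m} (\<lambda>k. ?PB k j) ?w"
      unfolding mat_mult_def using Pc Bc j wC by (intro VC.lincomb_lincomb) auto
    finally show ?thesis .
  qed
  let ?W = "\<lambda>k l. W (h k) (h l)"
  have Wc: "?W k l \<in> carrier R" if "k < m" "l < m" for k l using W_closed hI that by auto
  let ?y = "\<lambda>i. y F (h i)"
  have sy: "spans (scalars L) ?Q {..<m} ?y" by (rule spans_h[OF y_spans[OF F \<theta>2] cQ.V])
  have yh: "(\<lambda>i. ctensor ?Q (y F i) 1) \<in> I \<rightarrow> carrier (complexify ?Q)" using yQ[OF F] cQ.ct_closed by auto
  have "\<exists>e\<in>L - {0}. ring_det R m A2 = ctensor (scalars L) e 1 \<otimes>\<^bsub>R\<^esub> (ring_det R m ?W \<otimes>\<^bsub>R\<^esub> ring_det R m ?PB)"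
  proof (rule determinant_factor[OF cQ.cspace_axioms \<theta>2 sy])
    fix j assume j: "j < m"
    have bj: "bs ! j \<in> carrier (betti_plus N2)" using 2(1) j m2 by (auto simp: is_basis_def)
    have "lincomb (complexify ?Q) {..<m} (\<lambda>i. A2 i j) (\<lambda>i. ctensor ?Q (cs2 ! i) 1) = \<Phi> F (lincomb (complexify V) {..<m} (\<lambda>k. ?PB k j) ?w)"
      using 2(5)[of j] deligne_map[OF F bj] e2[OF j] j m2 by simp
    also have "\<dots> = lincomb (complexify ?Q) {..<m} (\<lambda>k. ?PB k j) (\<lambda>k. \<Phi> F (?w k))"
      using PBc j wC by (intro VC.linear_map_lincomb[OF \<Phi>_linear[OF F] QC.module_axioms]) auto
    also have "\<dots> = lincomb (complexify ?Q) {..<m} (\<lambda>k. ?PB k j) (\<lambda>k. lincomb (complexify ?Q) {..<m} (\<lambda>i. ?W i k) (\<lambda>i. ctensor ?Q (?y i) 1))"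
    proof (rule QC.lincomb_cong[OF refl])
      fix k assume "k \<in> {..<m}"
      then show "\<Phi> F (?w k) = lincomb (complexify ?Q) {..<m} (\<lambda>i. ?W i k) (\<lambda>i. ctensor ?Q (?y i) 1)"
        using \<Phi>_\<omega>[OF F \<theta>2 hI, of k] W_closed hI yh by (subst QC.lincomb_reindex[OF h, symmetric]) auto
    qed (use PBc j Wc yh hI in \<open>auto intro!: QC.lincomb_closed\<close>)
    finally show "lincomb (complexify ?Q) {..<m} (\<lambda>i. A2 i j) (\<lambda>i. ctensor ?Q (cs2 ! i) 1)
      = lincomb (complexify ?Q) {..<m} (\<lambda>k. ?PB k j) (\<lambda>k. lincomb (complexify ?Q) {..<m} (\<lambda>i. ?W i k) (\<lambda>i. ctensor ?Q (?y i) 1))" .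
  qed (use Wc PBc 2(4) m2 in auto)
  then obtain e2 where e2': "e2 \<in> L - {0}" "c = ctensor (scalars L) e2 1 \<otimes>\<^bsub>R\<^esub> (ring_det R m ?W \<otimes>\<^bsub>R\<^esub> ring_det R m ?PB)"
    using 2(6) m2 by auto
  have det_W: "ring_det R m ?W = finprod R q A"
  proof -
    \<comment> \<open>Both blocks of \<open>W\<close> are triangular for this height, and entries outside the blocks are zero.\<close>
    let ?r = "\<lambda>k. if h k \<in> A then \<rho>' (star (h k)) else \<rho> (h k)"
    have "?W k l = \<zero>\<^bsub>R\<^esub>" if kl: "k < m" "l < m" "k \<noteq> l" "\<not> ?r k < ?r l" for k l
    proof -
      have hk: "h k \<in> I" "h l \<in> I" "h k \<noteq> h l" "star (h k) \<in> I" "star (h l) \<in> I"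
        using hinj hI kl star(1) by auto
      then have st: "star (h k) \<noteq> star (h l)" using star(2) by metis
      consider "h k \<in> A" "h l \<in> A" | "h k \<notin> A" "h l \<notin> A" | "h k \<in> A \<longleftrightarrow> h l \<notin> A" by blast
      then show ?thesis
      proof cases
        case 1
        then have "u' (star (h k)) (star (h l)) = \<zero>\<^bsub>R\<^esub>" using tri'[OF hk(4,5) st] kl(4) by auto
        then show ?thesis using 1 q_closed[OF hk(2)] by (simp add: W_def)
      next
        case 2
        then have "u (h k) (h l) = \<zero>\<^bsub>R\<^esub>" using tri[OF hk(1,2,3)] kl(4) by auto
        then show ?thesis using 2 by (simp add: W_def)
      next
        case 3
        then show ?thesis by (auto simp: W_def)
      qed
    qed
    then have "ring_det R m ?W = (\<Otimes>\<^bsub>R\<^esub>k\<in>{..<m}. ?W k k)"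
      using Wc by (intro RR.ring_det_triangular[where \<rho> = ?r]) auto
    also have "\<dots> = (\<Otimes>\<^bsub>R\<^esub>k\<in>{..<m}. (\<lambda>i. if i \<in> A then q i else \<one>\<^bsub>R\<^esub>) (h k))"
      using hI u_diag star(1) q_closed by (intro RR.finprod_cong') (auto simp: W_def)
    also have "\<dots> = (\<Otimes>\<^bsub>R\<^esub>i\<in>h ` {..<m}. if i \<in> A then q i else \<one>\<^bsub>R\<^esub>)"
      using h hI q_closed by (intro RR.finprod_reindex[symmetric]) (auto simp: bij_betw_def)
    also have "h ` {..<m} = I" using h by (simp add: bij_betw_def)
    also have "(\<Otimes>\<^bsub>R\<^esub>i\<in>I. if i \<in> A then q i else \<one>\<^bsub>R\<^esub>) = finprod R q A"
      using A finI q_closed by (intro RR.finprod_mono_neutral_cong_right) auto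
    finally show ?thesis .
  qed
  have qA: "finprod R q A \<in> carrier R" using A q_closed by (intro RR.finprod_closed) auto
  have detB: "ring_det R m ?B = ctensor (scalars L) (ring_det (scalars L) m B) 1" using emb.hom_ring_det[of m B] B by simp
  have detPB: "ring_det R m ?PB = ring_det R m ?P \<otimes>\<^bsub>R\<^esub> ring_det R m ?B" using Pc Bc by (intro RR.ring_det_mult) auto
  define b where "b = ring_det (scalars L) m B"
  have b: "b \<in> L - {0}" using B(3) by (simp add: b_def)
  let ?\<iota> = "\<lambda>a. ctensor (scalars L) a 1"
  have ic: "?\<iota> e2 \<in> carrier R" "?\<iota> b \<in> carrier R" "?\<iota> e1 \<in> carrier R" "?\<iota> (inverse e1) \<in> carrier R"
    using e2'(1) b e1(1) EC(6) emb.hom_closed by auto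
  have Pd: "ring_det R m ?P \<in> carrier R" using Pc by (intro RR.ring_det_closed) auto
  have inv1: "?\<iota> (inverse e1) \<otimes>\<^bsub>R\<^esub> ?\<iota> e1 = \<one>\<^bsub>R\<^esub>" using emb.hom_mult[of "inverse e1" e1] e1(1) EC(6) i1 by simp
  have "?\<iota> (e2 * b * inverse e1) = ?\<iota> e2 \<otimes>\<^bsub>R\<^esub> ?\<iota> b \<otimes>\<^bsub>R\<^esub> ?\<iota> (inverse e1)"
    using emb.hom_mult[of "e2 * b" "inverse e1"] emb.hom_mult[of e2 b] e2'(1) b e1(1) EC(4,6) by simp
  then have "?\<iota> (e2 * b * inverse e1) \<otimes>\<^bsub>R\<^esub> (finprod R q A \<otimes>\<^bsub>R\<^esub> \<delta>)
      = ?\<iota> e2 \<otimes>\<^bsub>R\<^esub> ?\<iota> b \<otimes>\<^bsub>R\<^esub> ?\<iota> (inverse e1) \<otimes>\<^bsub>R\<^esub> (finprod R q A \<otimes>\<^bsub>R\<^esub> (?\<iota> e1 \<otimes>\<^bsub>R\<^esub> ring_det R m ?P))"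
    using e1(2) by simp
  also have "\<dots> = (?\<iota> (inverse e1) \<otimes>\<^bsub>R\<^esub> ?\<iota> e1) \<otimes>\<^bsub>R\<^esub> (?\<iota> e2 \<otimes>\<^bsub>R\<^esub> (finprod R q A \<otimes>\<^bsub>R\<^esub> (ring_det R m ?P \<otimes>\<^bsub>R\<^esub> ?\<iota> b)))"
    using ic qA Pd by (simp add: RR.m_ac)
  also have "\<dots> = c"
    using ic qA Pd e2'(2) by (simp add: inv1 det_W detPB detB b_def[symmetric])
  finally have "c = ?\<iota> (e2 * b * inverse e1) \<otimes>\<^bsub>R\<^esub> (finprod R q A \<otimes>\<^bsub>R\<^esub> \<delta>)" by simp
  moreover have "e2 * b * inverse e1 \<in> L - {0}" using e2'(1) b e1(1) EC(4,6) by auto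
  ultimately show "\<exists>e\<in>L - {0}. c = ctensor (scalars L) e 1 \<otimes>\<^bsub>R\<^esub> (finprod R q A \<otimes>\<^bsub>R\<^esub> \<delta>)" by blast
qed

end


section \<open>Frobenius on the tensor product\<close>

lemma linear_iso_inverse:
  assumes M: "module R M" and f: "linear_iso R M N f"
  shows "linear_map R M N f" "linear_map R N M (inv_into (carrier M) f)"
    "\<And>x. x \<in> carrier M \<Longrightarrow> inv_into (carrier M) f (f x) = x"
proof -
  interpret M: module R M by fact
  have bij: "bij_betw f (carrier M) (carrier N)"
    and add: "\<And>x y. x \<in> carrier M \<Longrightarrow> y \<in> carrier M \<Longrightarrow> f (x \<oplus>\<^bsub>M\<^esub> y) = f x \<oplus>\<^bsub>N\<^esub> f y"
    and sm: "\<And>r x. r \<in> carrier R \<Longrightarrow> x \<in> carrier M \<Longrightarrow> f (r \<odot>\<^bsub>M\<^esub> x) = r \<odot>\<^bsub>N\<^esub> f x"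
    using f by (auto simp: linear_iso_def)
  let ?g = "inv_into (carrier M) f"
  have g: "?g y \<in> carrier M" "f (?g y) = y" if "y \<in> carrier N" for y
    using bij that by (auto simp: bij_betw_def inv_into_into f_inv_into_f)
  show gf: "?g (f x) = x" if "x \<in> carrier M" for x using bij that by (simp add: bij_betw_def)
  show "linear_map R M N f" using bij add sm by (auto intro!: semilinearI simp: bij_betw_def)
  show "linear_map R N M ?g"
  proof (rule semilinearI)
    show "?g (x \<oplus>\<^bsub>N\<^esub> y) = ?g x \<oplus>\<^bsub>M\<^esub> ?g y" if "x \<in> carrier N" "y \<in> carrier N" for x y
      using gf[of "?g x \<oplus>\<^bsub>M\<^esub> ?g y"] add[of "?g x" "?g y"] g that by simp
    show "?g (r \<odot>\<^bsub>N\<^esub> x) = r \<odot>\<^bsub>M\<^esub> ?g x" if "r \<in> carrier R" "x \<in> carrier N" for r x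
      using gf[of "r \<odot>\<^bsub>M\<^esub> ?g x"] sm[of r "?g x"] g that by simp
  qed (rule g)
qed

text \<open>
  Frobenius is an isomorphism; a linear left inverse is the form of injectivity that functoriality of
  the tensor product carries along.
\<close>

definition split_map where
  "split_map L V W f \<longleftrightarrow> linear_map (scalars L) V W f \<and>
     (\<exists>g. linear_map (scalars L) W V g \<and> (\<forall>v\<in>carrier V. g (f v) = v))"

lemma extend_frob:
  assumes E: "subfield E CC" and L: "subfield L CC" and EL: "E \<subseteq> L"
    and V: "module (scalars E) V" and W: "module (scalars E) W" and f: "split_map E V W f"
  defines "fe \<equiv> tensor_lift (extend_module E L W) (\<lambda>l v. pure_tensor E (scalars L) W l (f v))"
  shows "split_map L (extend_module E L V) (extend_module E L W) fe"
    and "y \<in> carrier (complexify V) \<Longrightarrow>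
      complexify_map (extend_module E L W) fe (extend_complexified E L V y) = extend_complexified E L W (complexify_map W f y)"
proof -
  interpret V: extension E L V using E L EL V by (simp add: extension_def)
  interpret W: extension E L W using E L EL W by (simp add: extension_def)
  obtain g where fg: "linear_map (scalars E) V W f" "linear_map (scalars E) W V g" "\<forall>v\<in>carrier V. g (f v) = v"
    using f by (auto simp: split_map_def)
  note tm = tensor_map[OF V.t.tensor_over_axioms W.t.tensor_over_axioms linear_id fg(1), folded extend_module_def, folded fe_def]
  have "\<exists>h'. linear_map (scalars L) W.X V.X h' \<and> (\<forall>x\<in>carrier V.X. h' (fe x) = x)"
    using tensor_map_inverse[OF V.t.tensor_over_axioms W.t.tensor_over_axioms linear_id fg(1) linear_id fg(2)] fg(3)
    by (simp add: extend_module_def fe_def)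
  then show "split_map L V.X W.X fe" using tm(1) by (auto simp: split_map_def)
  interpret m: cspace_map L V.X L W.X fe
    using tm(1) V.m.W.cspace_axioms W.m.W.cspace_axioms by (simp add: cspace_mapI)
  interpret n: cspace_map E V E W f
    using fg(1) V.m.V.cspace_axioms W.m.V.cspace_axioms by (simp add: cspace_mapI)
  show "y \<in> carrier (complexify V) \<Longrightarrow> complexify_map W.X fe (V.xc y) = W.xc (complexify_map W f y)"
  proof (rule V.m.V.VC_maps_eq)
    show "additive_map V.m.V.VC W.m.W.VC (\<lambda>y. complexify_map W.X fe (V.xc y))"
      by (rule additive_map_comp[OF semilinearD(1)[OF V.xc_semilinear] m.cmap_additive])
    show "additive_map V.m.V.VC W.m.W.VC (\<lambda>y. W.xc (complexify_map W f y))"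
      by (rule additive_map_comp[OF n.cmap_additive semilinearD(1)[OF W.xc_semilinear]])
    fix v z assume v: "v \<in> carrier V"
    have "fe (V.xv v) = W.xv (f v)" using tm(2)[of 1 v] v subfield_closed[OF L] by (simp add: extend_vector_def)
    then show "complexify_map W.X fe (V.xc (ctensor V v z)) = W.xc (complexify_map W f (ctensor V v z))"
      using v semilinearD(2)[OF fg(1)] semilinearD(2)[OF V.xv_linear] by (simp add: V.xc_ct W.xc_ct m.cmap_ct n.cmap_ct)
  qed
qed

lemma tensor_frob:
  assumes L: "subfield L CC"
    and V: "module (scalars L) V" and W: "module (scalars L) W" and f: "split_map L V W f"
    and V': "module (scalars L) V'" and W': "module (scalars L) W'" and f': "split_map L V' W' f'"
  defines "ft \<equiv> tensor_lift (tensor_module L W W') (\<lambda>v v'. pure_tensor L W W' (f v) (f' v'))"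
  shows "split_map L (tensor_module L V V') (tensor_module L W W') ft"
    and "y \<in> carrier (complexify V) \<Longrightarrow> y' \<in> carrier (complexify V') \<Longrightarrow>
      complexify_map (tensor_module L W W') ft (complexify_mult L V V' y y')
        = complexify_mult L W W' (complexify_map W f y) (complexify_map W' f' y')"
proof -
  interpret V: tensor_over L L V V' using L V V' by (simp add: tensor_over_def)
  interpret W: tensor_over L L W W' using L W W' by (simp add: tensor_over_def)
  obtain g where fg: "linear_map (scalars L) V W f" "linear_map (scalars L) W V g" "\<forall>v\<in>carrier V. g (f v) = v"
    using f by (auto simp: split_map_def)
  obtain g' where fg': "linear_map (scalars L) V' W' f'" "linear_map (scalars L) W' V' g'" "\<forall>v\<in>carrier V'. g' (f' v) = v"
    using f' by (auto simp: split_map_def)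
  note tm = tensor_map[OF V.tensor_over_axioms W.tensor_over_axioms fg(1) fg'(1), folded ft_def]
  have "\<exists>h'. linear_map (scalars L) W.T V.T h' \<and> (\<forall>x\<in>carrier V.T. h' (ft x) = x)"
    using tensor_map_inverse[OF V.tensor_over_axioms W.tensor_over_axioms fg(1) fg'(1) fg(2) fg'(2)] fg(3) fg'(3)
    by (simp add: ft_def)
  then show "split_map L V.T W.T ft" using tm(1) by (auto simp: split_map_def)
  have cs: "cspace L V" "cspace L W" "cspace L V'" "cspace L W'" using L V W V' W' by (simp_all add: cspace_def)
  interpret m: cspace_map L V.T L W.T ft
    using tm(1) V.c.cspace_axioms W.c.cspace_axioms by (simp add: cspace_mapI)
  interpret n: cspace_map L V L W f using cs fg(1) by (simp add: cspace_mapI)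
  interpret n': cspace_map L V' L W' f' using cs fg'(1) by (simp add: cspace_mapI)
  note bV = complexify_mult(2)[OF V.tensor_over_axioms] and bW = complexify_mult(2)[OF W.tensor_over_axioms]
  note cV = complexify_mult(1)[OF V.tensor_over_axioms] and cW = complexify_mult(1)[OF W.tensor_over_axioms]
  have bW1: "additive_map (complexify W) (complexify W.T) (\<lambda>x. complexify_mult L W W' x y)" if "y \<in> carrier (complexify W')" for y
    using bW that by (auto simp: bilinear_map_def semilinear_def)
  have bW2: "additive_map (complexify W') (complexify W.T) (complexify_mult L W W' x)" if "x \<in> carrier (complexify W)" for x
    using bW that by (auto simp: bilinear_map_def semilinear_def)
  have bV1: "additive_map (complexify V) (complexify V.T) (\<lambda>x. complexify_mult L V V' x y)" if "y \<in> carrier (complexify V')" for y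
    using bV that by (auto simp: bilinear_map_def semilinear_def)
  have bV2: "additive_map (complexify V') (complexify V.T) (complexify_mult L V V' x)" if "x \<in> carrier (complexify V)" for x
    using bV that by (auto simp: bilinear_map_def semilinear_def)
  show "complexify_map W.T ft (complexify_mult L V V' y y') = complexify_mult L W W' (complexify_map W f y) (complexify_map W' f' y')"
    if y: "y \<in> carrier (complexify V)" and y': "y' \<in> carrier (complexify V')"
  proof (rule n.V.VC_maps_eq[OF additive_map_comp[OF bV1[OF y'] m.cmap_additive]
        additive_map_comp[OF n.cmap_additive bW1[OF additive_mapD(1)[OF n'.cmap_additive y']]] y])
    fix v z assume v: "v \<in> carrier V"
    have fv: "f v \<in> carrier W" using semilinearD(2)[OF fg(1) v] .
    have c: "complexify_map W f (ctensor V v z) \<in> carrier (complexify W)"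
      using additive_mapD(1)[OF n.cmap_additive n.V.ct_closed[OF v]] .
    show "complexify_map W.T ft (complexify_mult L V V' (ctensor V v z) y')
        = complexify_mult L W W' (complexify_map W f (ctensor V v z)) (complexify_map W' f' y')"
    proof (rule n'.V.VC_maps_eq[OF additive_map_comp[OF bV2[OF n.V.ct_closed[OF v]] m.cmap_additive]
          additive_map_comp[OF n'.cmap_additive bW2[OF c]] y'])
      fix v' z' assume v': "v' \<in> carrier V'"
      have fv': "f' v' \<in> carrier W'" using semilinearD(2)[OF fg'(1) v'] .
      show "complexify_map W.T ft (complexify_mult L V V' (ctensor V v z) (ctensor V' v' z'))
          = complexify_mult L W W' (complexify_map W f (ctensor V v z)) (complexify_map W' f' (ctensor V' v' z'))"
        using v v' fv fv' V.pt_closed by (simp add: cV cW n.cmap_ct n'.cmap_ct m.cmap_ct tm(2))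
    qed
  qed
qed

lemma tensor_hodge_filt_submodule:
  assumes N: "linear_realization E N" and N': "linear_realization E' N'"
    and L: "subfield L CC" and EL: "E \<subseteq> L" "E' \<subseteq> L"
    and F: "\<And>i. hodge_filt N i \<subseteq> carrier (derham N)" and F': "\<And>i. hodge_filt N' i \<subseteq> carrier (derham N')"
  shows "submodule (hodge_filt (tensor_realization L (extend_realization E L N) (extend_realization E' L N')) k) (scalars L)
    (derham (tensor_realization L (extend_realization E L N) (extend_realization E' L N')))"
proof -
  interpret D: extension E L "derham N" using N L EL by (simp add: extension_def linear_realization_def)
  interpret D': extension E' L "derham N'" using N' L EL by (simp add: extension_def linear_realization_def)
  interpret X: module "scalars L" D.X by (rule D.X_module)
  interpret X': module "scalars L" D'.X by (rule D'.X_module)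
  interpret T: tensor_over L L D.X D'.X using L D.X_module D'.X_module by (simp add: tensor_over_def)
  interpret TM: module "scalars L" T.T by (rule T.T_module)
  have c: "hodge_filt (extend_realization E L N) i \<subseteq> carrier D.X" for i
  proof -
    have "D.xv ` hodge_filt N i \<subseteq> carrier D.X" using F semilinearD(2)[OF D.xv_linear] by blast
    then show ?thesis using X.submoduleE(1)[OF X.mod_span_submodule] by (simp add: extend_realization_def Let_def)
  qed
  have c': "hodge_filt (extend_realization E' L N') i \<subseteq> carrier D'.X" for i
  proof -
    have "D'.xv ` hodge_filt N' i \<subseteq> carrier D'.X" using F' semilinearD(2)[OF D'.xv_linear] by blast
    then show ?thesis using X'.submoduleE(1)[OF X'.mod_span_submodule] by (simp add: extend_realization_def Let_def)
  qed
  have d: "derham (extend_realization E L N) = D.X" "derham (extend_realization E' L N') = D'.X"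
    by (simp_all add: extend_realization_def Let_def)
  have "{T.pt x y |x y. \<exists>i j. i + j = k \<and> x \<in> hodge_filt (extend_realization E L N) i \<and> y \<in> hodge_filt (extend_realization E' L N') j} \<subseteq> carrier T.T"
    using c c' T.pt_closed by blast
  then show ?thesis unfolding tensor_realization_def Let_def d
    using TM.mod_span_submodule by simp
qed


section \<open>The Deligne period of a tensor product\<close>

lemma frame_carrier: "frame E N J e I x \<omega> u \<Longrightarrow> i \<in> I \<Longrightarrow> \<omega> i \<in> carrier (complexify (betti N))"
  by (auto simp: frame_def spans_def)

lemma hodge_filt_carrier: "realization_with_coeffs E n N \<Longrightarrow> hodge_filt N i \<subseteq> carrier (derham N)"
  unfolding realization_with_coeffs_def by (blast dest: submodule.axioms(1)[THEN subgroup.subset, simplified])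

lemma (in ring_hom_cring) hom_unitriangular:
  assumes "unitriangular R I u"
  shows "unitriangular S I (\<lambda>i j. h (u i j))"
  using assms unfolding unitriangular_def by (metis hom_closed hom_one hom_zero)

text \<open>
  Each period comes with a class and a conjugate class, the latter in position \<open>n + 1 - i\<close>. Renumbering
  the conjugate classes by position yields one frame in each realization, serving all periods at once.
\<close>

lemma motive_frames:
  assumes E: "subfield E CC" and M: "motive_with_coeffs E n M" and p: "strict_antimono_on {1..n} p"
    and Q: "\<And>i. i \<in> {1..n} \<Longrightarrow> is_motivic_period E M n w p i (Q i)"
  obtains \<omega> \<omega>' e x u e' x' u' where
    "\<forall>i\<in>{1..n}. \<omega> i \<in> hodge (at_id M) (p i) (w - p i)"
    "\<forall>i\<in>{1..n}. \<omega>' i \<in> hodge (at_conj M) (w - p (n + 1 - i)) (p (n + 1 - i))"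
    "\<forall>i\<in>{1..n}.
      complexify_map (betti (at_conj M)) (frob M) (\<omega> i) = Q i \<odot>\<^bsub>complexify (betti (at_conj M))\<^esub> \<omega>' (n + 1 - i)"
    "frame E (at_id M) {..<n} e {1..n} x \<omega> u" "frame E (at_conj M) {..<n} e' {1..n} x' \<omega>' u'"
    "unitriangular (coeff_ring E) {1..n} u" "unitriangular (coeff_ring E) {1..n} u'"
proof -
  let ?pc = "\<lambda>j. w - p (n + 1 - j)"
  have N: "realization_with_coeffs E n (at_id M)" and N': "realization_with_coeffs E n (at_conj M)"
    using M by (auto simp: motive_with_coeffs_def)
  have pc: "strict_antimono_on {1..n} ?pc"
  proof (rule monotone_onI)
    fix i j assume ij: "i \<in> {1..n}" "j \<in> {1..n}" "i < j"
    then have "p (n + 1 - i) < p (n + 1 - j)" by (intro monotone_onD[OF p]) auto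
    then show "?pc i > ?pc j" by simp
  qed
  have "\<exists>\<omega>. \<forall>i\<in>{1..n}. \<exists>\<omega>c. rational_hodge_class (at_id M) w p i (\<omega> i) \<and>
      rational_hodge_class (at_conj M) w ?pc (n + 1 - i) \<omega>c \<and>
      complexify_map (betti (at_conj M)) (frob M) (\<omega> i) = Q i \<odot>\<^bsub>complexify (betti (at_conj M))\<^esub> \<omega>c"
    by (rule bchoice) (use Q in \<open>auto simp: is_motivic_period_def\<close>)
  then obtain \<omega> where "\<forall>i\<in>{1..n}. \<exists>\<omega>c. rational_hodge_class (at_id M) w p i (\<omega> i) \<and>
      rational_hodge_class (at_conj M) w ?pc (n + 1 - i) \<omega>c \<and>
      complexify_map (betti (at_conj M)) (frob M) (\<omega> i) = Q i \<odot>\<^bsub>complexify (betti (at_conj M))\<^esub> \<omega>c" ..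
  from bchoice[OF this] obtain \<kappa> where \<kappa>: "\<forall>i\<in>{1..n}. rational_hodge_class (at_id M) w p i (\<omega> i) \<and>
      rational_hodge_class (at_conj M) w ?pc (n + 1 - i) (\<kappa> i) \<and>
      complexify_map (betti (at_conj M)) (frob M) (\<omega> i) = Q i \<odot>\<^bsub>complexify (betti (at_conj M))\<^esub> \<kappa> i" ..
  define \<omega>' where "\<omega>' t = \<kappa> (n + 1 - t)" for t
  have r1: "rational_hodge_class (at_id M) w p i (\<omega> i)" if "i \<in> {1..n}" for i using \<kappa> that by blast
  have r2: "rational_hodge_class (at_conj M) w ?pc i (\<omega>' i)" if "i \<in> {1..n}" for i
  proof -
    have "n + 1 - i \<in> {1..n}" "n + 1 - (n + 1 - i) = i" using that by auto
    then show ?thesis using \<kappa> unfolding \<omega>'_def by metis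
  qed
  have r3: "complexify_map (betti (at_conj M)) (frob M) (\<omega> i) = Q i \<odot>\<^bsub>complexify (betti (at_conj M))\<^esub> \<omega>' (n + 1 - i)" if "i \<in> {1..n}" for i
  proof -
    have "n + 1 - (n + 1 - i) = i" using that by auto
    then show ?thesis using \<kappa> that by (simp add: \<omega>'_def)
  qed
  have h: "\<omega> i \<in> hodge (at_id M) (p i) (w - p i)" "\<omega>' i \<in> hodge (at_conj M) (w - p (n + 1 - i)) (p (n + 1 - i))"
    if "i \<in> {1..n}" for i
    using r1[OF that] r2[OF that] by (auto simp: rational_hodge_class_def)
  obtain e x u where f: "frame E (at_id M) {..<n} e {1..n} x \<omega> u"
    "unitriangular (coeff_ring E) {1..n} u"
    using frame_of_rational_classes[OF E N p r1] by blast
  obtain e' x' u' where f': "frame E (at_conj M) {..<n} e' {1..n} x' \<omega>' u'"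
    "unitriangular (coeff_ring E) {1..n} u'"
    using frame_of_rational_classes[OF E N' pc r2] by blast
  show thesis using h r3 by (intro that[OF _ _ _ f(1) f'(1) f(2) f'(2)]) blast+
qed

lemma tensor_motive_frob:
  assumes L: "subfield L CC"
    and E: "subfield E CC" "E \<subseteq> L" and M: "motive_with_coeffs E n M"
    and E': "subfield E' CC" "E' \<subseteq> L" and M': "motive_with_coeffs E' n' M'"
  defines "Mt \<equiv> tensor_motive_over L (extend_motive E L M) (extend_motive E' L M')"
  shows "split_map L (betti (at_id Mt)) (betti (at_conj Mt)) (frob Mt)"
    and "\<omega> \<in> carrier (complexify (betti (at_id M))) \<Longrightarrow> \<omega>' \<in> carrier (complexify (betti (at_id M'))) \<Longrightarrow>
      \<kappa> \<in> carrier (complexify (betti (at_conj M))) \<Longrightarrow> \<kappa>' \<in> carrier (complexify (betti (at_conj M'))) \<Longrightarrow>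
      Q \<in> carrier (coeff_ring E) \<Longrightarrow> Q' \<in> carrier (coeff_ring E') \<Longrightarrow>
      complexify_map (betti (at_conj M)) (frob M) \<omega> = Q \<odot>\<^bsub>complexify (betti (at_conj M))\<^esub> \<kappa> \<Longrightarrow>
      complexify_map (betti (at_conj M')) (frob M') \<omega>' = Q' \<odot>\<^bsub>complexify (betti (at_conj M'))\<^esub> \<kappa>' \<Longrightarrow>
      complexify_map (betti (at_conj Mt)) (frob Mt)
        (complexify_mult L (extend_module E L (betti (at_id M))) (extend_module E' L (betti (at_id M')))
          (extend_complexified E L (betti (at_id M)) \<omega>) (extend_complexified E' L (betti (at_id M')) \<omega>'))
      = (extend_coeff L Q \<otimes>\<^bsub>coeff_ring L\<^esub> extend_coeff L Q') \<odot>\<^bsub>complexify (betti (at_conj Mt))\<^esub>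
        complexify_mult L (extend_module E L (betti (at_conj M))) (extend_module E' L (betti (at_conj M')))
          (extend_complexified E L (betti (at_conj M)) \<kappa>) (extend_complexified E' L (betti (at_conj M')) \<kappa>')"
proof -
  have mV: "module (scalars E) (betti (at_id M))" "module (scalars E) (betti (at_conj M))"
    and mV': "module (scalars E') (betti (at_id M'))" "module (scalars E') (betti (at_conj M'))"
    and f: "linear_iso (scalars E) (betti (at_id M)) (betti (at_conj M)) (frob M)"
    and f': "linear_iso (scalars E') (betti (at_id M')) (betti (at_conj M')) (frob M')"
    using M M' by (simp_all add: motive_with_coeffs_def realization_with_coeffs_def)
  interpret V: extension E L "betti (at_id M)" using L E mV by (simp add: extension_def)
  interpret W: extension E L "betti (at_conj M)" using L E mV by (simp add: extension_def)
  interpret V': extension E' L "betti (at_id M')" using L E' mV' by (simp add: extension_def)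
  interpret W': extension E' L "betti (at_conj M')" using L E' mV' by (simp add: extension_def)
  interpret VV: tensor_over L L V.X V'.X using L V.X_module V'.X_module by (simp add: tensor_over_def)
  interpret WW: tensor_over L L W.X W'.X using L W.X_module W'.X_module by (simp add: tensor_over_def)
  interpret WC: module "coeff_ring L" "complexify WW.T" by (rule WW.c.VC_module)
  have s: "split_map E (betti (at_id M)) (betti (at_conj M)) (frob M)"
    unfolding split_map_def using linear_iso_inverse[OF mV(1) f] by blast
  have s': "split_map E' (betti (at_id M')) (betti (at_conj M')) (frob M')"
    unfolding split_map_def using linear_iso_inverse[OF mV'(1) f'] by blast
  have b: "betti (at_id Mt) = VV.T" "betti (at_conj Mt) = WW.T"
    by (simp_all add: Mt_def tensor_motive_over_def tensor_realization_def extend_motive_def extend_realization_def Let_def)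
  have fr: "frob Mt = tensor_lift WW.T (\<lambda>v v'. WW.pt (frob (extend_motive E L M) v) (frob (extend_motive E' L M') v'))"
    by (simp add: Mt_def tensor_motive_over_def extend_motive_def extend_realization_def Let_def)
  have fe: "frob (extend_motive E L M) = tensor_lift W.X (\<lambda>l v. pure_tensor E (scalars L) (betti (at_conj M)) l (frob M v))"
    "frob (extend_motive E' L M') = tensor_lift W'.X (\<lambda>l v. pure_tensor E' (scalars L) (betti (at_conj M')) l (frob M' v))"
    by (simp_all add: extend_motive_def)
  note e = extend_frob[OF E(1) L E(2) mV s, folded fe] and e' = extend_frob[OF E'(1) L E'(2) mV' s', folded fe]
  note t = tensor_frob[OF L V.X_module W.X_module e(1) V'.X_module W'.X_module e'(1), folded fr]
  show "split_map L (betti (at_id Mt)) (betti (at_conj Mt)) (frob Mt)" unfolding b by (rule t(1))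
  assume c: "\<omega> \<in> carrier (complexify (betti (at_id M)))" "\<omega>' \<in> carrier (complexify (betti (at_id M')))"
    "\<kappa> \<in> carrier (complexify (betti (at_conj M)))" "\<kappa>' \<in> carrier (complexify (betti (at_conj M')))"
    and Q: "Q \<in> carrier (coeff_ring E)" "Q' \<in> carrier (coeff_ring E')"
    and p: "complexify_map (betti (at_conj M)) (frob M) \<omega> = Q \<odot>\<^bsub>complexify (betti (at_conj M))\<^esub> \<kappa>"
      "complexify_map (betti (at_conj M')) (frob M') \<omega>' = Q' \<odot>\<^bsub>complexify (betti (at_conj M'))\<^esub> \<kappa>'"
  have eQ: "extend_coeff L Q \<in> carrier (coeff_ring L)" "extend_coeff L Q' \<in> carrier (coeff_ring L)"
    using extend_coeff_closed[OF E(1) L E(2) Q(1)] extend_coeff_closed[OF E'(1) L E'(2) Q(2)] by auto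
  note xc = semilinearD(2)[OF V.xc_semilinear c(1)] semilinearD(2)[OF V'.xc_semilinear c(2)]
    semilinearD(2)[OF W.xc_semilinear c(3)] semilinearD(2)[OF W'.xc_semilinear c(4)]
  note bm = complexify_mult(2)[OF WW.tensor_over_axioms]
  have bm1: "complexify_mult L W.X W'.X (r \<odot>\<^bsub>complexify W.X\<^esub> y) z = r \<odot>\<^bsub>complexify WW.T\<^esub> complexify_mult L W.X W'.X y z"
    and bm2: "complexify_mult L W.X W'.X y (r \<odot>\<^bsub>complexify W'.X\<^esub> z) = r \<odot>\<^bsub>complexify WW.T\<^esub> complexify_mult L W.X W'.X y z"
    and bm3: "complexify_mult L W.X W'.X y z \<in> carrier (complexify WW.T)"
    if "r \<in> carrier (coeff_ring L)" "y \<in> carrier (complexify W.X)" "z \<in> carrier (complexify W'.X)" for r y z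
  proof -
    have l: "linear_map (coeff_ring L) (complexify W.X) (complexify WW.T) (\<lambda>y. complexify_mult L W.X W'.X y z)"
      "linear_map (coeff_ring L) (complexify W'.X) (complexify WW.T) (complexify_mult L W.X W'.X y)"
      using bm that by (simp_all add: bilinear_map_def)
    show "complexify_mult L W.X W'.X (r \<odot>\<^bsub>complexify W.X\<^esub> y) z = r \<odot>\<^bsub>complexify WW.T\<^esub> complexify_mult L W.X W'.X y z"
      using semilinearD(4)[OF l(1)] that by simp
    show "complexify_mult L W.X W'.X y (r \<odot>\<^bsub>complexify W'.X\<^esub> z) = r \<odot>\<^bsub>complexify WW.T\<^esub> complexify_mult L W.X W'.X y z"
      using semilinearD(4)[OF l(2)] that by simp
    show "complexify_mult L W.X W'.X y z \<in> carrier (complexify WW.T)" using semilinearD(2)[OF l(2)] that by simp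
  qed
  interpret WX': module "coeff_ring L" "complexify W'.X" by (rule W'.m.W.VC_module)
  show "complexify_map (betti (at_conj Mt)) (frob Mt) (complexify_mult L V.X V'.X (V.xc \<omega>) (V'.xc \<omega>'))
      = (extend_coeff L Q \<otimes>\<^bsub>coeff_ring L\<^esub> extend_coeff L Q') \<odot>\<^bsub>complexify (betti (at_conj Mt))\<^esub>
        complexify_mult L W.X W'.X (W.xc \<kappa>) (W'.xc \<kappa>')"
    unfolding b t(2)[OF xc(1,2)] e(2)[OF c(1)] e'(2)[OF c(2)] p
      semilinearD(4)[OF W.xc_semilinear Q(1) c(3)] semilinearD(4)[OF W'.xc_semilinear Q(2) c(4)]
      bm1[OF eQ(1) xc(3) WX'.smult_closed[OF eQ(2) xc(4)]] bm2[OF eQ(2) xc(3,4)]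
    using WC.smult_assoc1[OF eQ bm3[OF eQ(1) xc(3,4)]] by simp
qed

lemma (in ring_hom_cring) hom_Units: "x \<in> Units R \<Longrightarrow> h x \<in> Units S"
  using hom_mult[of x "inv\<^bsub>R\<^esub> x"] hom_mult[of "inv\<^bsub>R\<^esub> x" x] R.Units_closed R.Units_inv_closed
  by (auto simp: Units_def[of S] intro!: bexI[of _ "h (inv\<^bsub>R\<^esub> x)"])

lemma unitriangular_product:
  assumes R: "cring R" and u: "unitriangular R I u" "unitriangular R I' u'"
    and ij: "i \<in> I" "j \<in> I" "i' \<in> I'" "j' \<in> I'"
  shows "u i i \<otimes>\<^bsub>R\<^esub> u' i' i' = \<one>\<^bsub>R\<^esub>"
    and "u i j \<otimes>\<^bsub>R\<^esub> u' i' j' \<noteq> \<zero>\<^bsub>R\<^esub> \<Longrightarrow> i \<le> j \<and> i' \<le> j'"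
proof -
  interpret cring R by fact
  show "u i i \<otimes>\<^bsub>R\<^esub> u' i' i' = \<one>\<^bsub>R\<^esub>" using u ij by (simp add: unitriangular_def)
  assume "u i j \<otimes>\<^bsub>R\<^esub> u' i' j' \<noteq> \<zero>\<^bsub>R\<^esub>"
  then have "u i j \<noteq> \<zero>\<^bsub>R\<^esub>" "u' i' j' \<noteq> \<zero>\<^bsub>R\<^esub>" using u ij by (auto simp: unitriangular_def)
  then show "i \<le> j \<and> i' \<le> j'" using u ij by (simp add: unitriangular_def)
qed

lemma strict_antimono_on_leD:
  fixes f :: "'a::linorder \<Rightarrow> 'b::preorder"
  shows "strict_antimono_on S f \<Longrightarrow> x \<in> S \<Longrightarrow> y \<in> S \<Longrightarrow> x \<le> y \<Longrightarrow> f y \<le> f x"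
  using monotone_onD[of S "(<)" "(>)" f x y] by (cases "x = y") (auto intro: less_imp_le)

text \<open>
  The entries of the comparison matrix of a tensor product are products of entries of two unitriangular
  matrices, so nonzero entries increase in both components and, off the diagonal, raise the height
  \<open>a + b\<close>. Since \<open>p\<close> and \<open>r\<close> decrease, \<open>A\<close> is closed under going down in both components; the
  conditions on the conjugate side follow as \<open>star\<close> reverses the order.
\<close>

theorem deligne_period_tensor:
  fixes n n' :: nat and w w' :: int and p r :: "nat \<Rightarrow> int"
  assumes L: "subfield L CC"
    and E: "subfield E CC" "E \<subseteq> L" and M: "motive_with_coeffs E n M" and p: "strict_antimono_on {1..n} p"
    and Q: "\<And>i. i \<in> {1..n} \<Longrightarrow> is_motivic_period E M n w p i (Q i)"
    and E': "subfield E' CC" "E' \<subseteq> L" and M': "motive_with_coeffs E' n' M'" and r: "strict_antimono_on {1..n'} r"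
    and Q': "\<And>j. j \<in> {1..n'} \<Longrightarrow> is_motivic_period E' M' n' w' r j (Q' j)"
    and mid: "\<And>a b. a \<in> {1..n} \<Longrightarrow> b \<in> {1..n'} \<Longrightarrow> 2 * (p a + r b) \<noteq> w + w'"
  defines "Mt \<equiv> tensor_motive_over L (extend_motive E L M) (extend_motive E' L M')"
    and "A \<equiv> {(a, b) \<in> {1..n} \<times> {1..n'}. 2 * (p a + r b) > w + w'}"
    and "q \<equiv> \<lambda>(t, u). extend_coeff L (Q t) \<otimes>\<^bsub>coeff_ring L\<^esub> extend_coeff L (Q' u)"
  assumes \<delta>: "is_determinant_period L (at_id Mt) \<delta>" and c: "is_deligne_period L (restrict_to_rat Mt) c"
  shows "\<exists>e\<in>L - {0}. c = ctensor (scalars L) e 1 \<otimes>\<^bsub>coeff_ring L\<^esub> (finprod (coeff_ring L) q A \<otimes>\<^bsub>coeff_ring L\<^esub> \<delta>)"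
    and "\<delta> \<in> Units (coeff_ring L)"
    and "\<And>i. i \<in> {1..n} \<times> {1..n'} \<Longrightarrow> q i \<in> Units (coeff_ring L)"
proof -
  interpret R: cring "coeff_ring L" by (rule coeff_ring_cring[OF L])
  interpret h: ring_hom_cring "coeff_ring E" "coeff_ring L" "extend_coeff L" by (rule extend_coeff_hom[OF E(1) L E(2)])
  interpret h': ring_hom_cring "coeff_ring E'" "coeff_ring L" "extend_coeff L" by (rule extend_coeff_hom[OF E'(1) L E'(2)])
  let ?I = "{1..n} \<times> {1..n'}" and ?star = "\<lambda>(a, b). (n + 1 - a, n' + 1 - b)" and ?\<rho> = "\<lambda>(a, b). int a + int b"
  have QU: "Q i \<in> Units (coeff_ring E)" if "i \<in> {1..n}" for i using Q[OF that] by (simp add: is_motivic_period_def)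
  have QU': "Q' i \<in> Units (coeff_ring E')" if "i \<in> {1..n'}" for i using Q'[OF that] by (simp add: is_motivic_period_def)
  show qU: "q i \<in> Units (coeff_ring L)" if "i \<in> ?I" for i
    using that h.hom_Units[OF QU] h'.hom_Units[OF QU'] by (auto simp: q_def)
  obtain \<omega> \<omega>c e x u ec xc uc where m0:
    "\<forall>i\<in>{1..n}. \<omega> i \<in> hodge (at_id M) (p i) (w - p i)"
    "\<forall>i\<in>{1..n}. \<omega>c i \<in> hodge (at_conj M) (w - p (n + 1 - i)) (p (n + 1 - i))"
    "\<forall>i\<in>{1..n}. complexify_map (betti (at_conj M)) (frob M) (\<omega> i) = Q i \<odot>\<^bsub>complexify (betti (at_conj M))\<^esub> \<omega>c (n + 1 - i)"
    and fr: "frame E (at_id M) {..<n} e {1..n} x \<omega> u" "frame E (at_conj M) {..<n} ec {1..n} xc \<omega>c uc"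
    and u: "unitriangular (coeff_ring E) {1..n} u" "unitriangular (coeff_ring E) {1..n} uc"
    by (rule motive_frames[OF E(1) M p]) (rule Q, assumption, rule that)
  obtain \<omega>' \<omega>c' e' x' u' ec' xc' uc' where m0':
    "\<forall>i\<in>{1..n'}. \<omega>' i \<in> hodge (at_id M') (r i) (w' - r i)"
    "\<forall>i\<in>{1..n'}. \<omega>c' i \<in> hodge (at_conj M') (w' - r (n' + 1 - i)) (r (n' + 1 - i))"
    "\<forall>i\<in>{1..n'}. complexify_map (betti (at_conj M')) (frob M') (\<omega>' i) = Q' i \<odot>\<^bsub>complexify (betti (at_conj M'))\<^esub> \<omega>c' (n' + 1 - i)"
    and fr': "frame E' (at_id M') {..<n'} e' {1..n'} x' \<omega>' u'" "frame E' (at_conj M') {..<n'} ec' {1..n'} xc' \<omega>c' uc'"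
    and u': "unitriangular (coeff_ring E') {1..n'} u'" "unitriangular (coeff_ring E') {1..n'} uc'"
    by (rule motive_frames[OF E'(1) M' r]) (rule Q', assumption, rule that)
  note m = m0[rule_format] and m' = m0'[rule_format]
  let ?V = "betti (at_id M)" and ?W = "betti (at_conj M)" and ?V' = "betti (at_id M')" and ?W' = "betti (at_conj M')"
  note simps = Mt_def tensor_motive_over_def extend_motive_def
  have N: "linear_realization E (at_id M)" "linear_realization E (at_conj M)"
    "linear_realization E' (at_id M')" "linear_realization E' (at_conj M')"
    using fr fr' by (simp_all add: frame_def)
  note C = frame_carrier[OF fr(1)] frame_carrier[OF fr(2)] frame_carrier[OF fr'(1)] frame_carrier[OF fr'(2)]
  let ?u = "\<lambda>i j. extend_coeff L (u i j)" and ?uc = "\<lambda>i j. extend_coeff L (uc i j)"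
    and ?u' = "\<lambda>i j. extend_coeff L (u' i j)" and ?uc' = "\<lambda>i j. extend_coeff L (uc' i j)"
  note eu = h.hom_unitriangular[OF u(1)] h'.hom_unitriangular[OF u'(1)]
    and euc = h.hom_unitriangular[OF u(2)] h'.hom_unitriangular[OF u'(2)]
  let ?o = "\<lambda>(i, j). complexify_mult L (extend_module E L ?V) (extend_module E' L ?V') (extend_complexified E L ?V (\<omega> i)) (extend_complexified E' L ?V' (\<omega>' j))"
    and ?oc = "\<lambda>(i, j). complexify_mult L (extend_module E L ?W) (extend_module E' L ?W') (extend_complexified E L ?W (\<omega>c i)) (extend_complexified E' L ?W' (\<omega>c' j))"
  have er: "betti (extend_realization E L X) = extend_module E L (betti X)" "derham (extend_realization E L X) = extend_module E L (derham X)"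
    for E and X :: "('x, 'y) realization"
    by (simp_all add: extend_realization_def Let_def)
  obtain eT xT ecT xcT where
    T: "frame L (at_id Mt) ({..<n} \<times> {..<n'}) eT ?I xT ?o (\<lambda>(i, i') (j, j'). ?u i j \<otimes>\<^bsub>coeff_ring L\<^esub> ?u' i' j')"
      "frame L (at_conj Mt) ({..<n} \<times> {..<n'}) ecT ?I xcT ?oc (\<lambda>(i, i') (j, j'). ?uc i j \<otimes>\<^bsub>coeff_ring L\<^esub> ?uc' i' j')"
    using tensor_frame[OF extend_frame[OF fr(1) L E(2)] extend_frame[OF fr'(1) L E'(2)]]
      tensor_frame[OF extend_frame[OF fr(2) L E(2)] extend_frame[OF fr'(2) L E'(2)]]
    unfolding er by (simp add: simps)
  have H: "?o (i, j) \<in> hodge (at_id Mt) (p i + r j) (w - p i + (w' - r j))"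
      "?oc (i, j) \<in> hodge (at_conj Mt) (w - p (n + 1 - i) + (w' - r (n' + 1 - j))) (p (n + 1 - i) + r (n' + 1 - j))"
    if "i \<in> {1..n}" "j \<in> {1..n'}" for i j
  proof -
    have a: "extend_complexified E L ?V (\<omega> i) \<in> hodge (extend_realization E L (at_id M)) (p i) (w - p i)"
      "extend_complexified E' L ?V' (\<omega>' j) \<in> hodge (extend_realization E' L (at_id M')) (r j) (w' - r j)"
      "extend_complexified E L ?W (\<omega>c i) \<in> hodge (extend_realization E L (at_conj M)) (w - p (n + 1 - i)) (p (n + 1 - i))"
      "extend_complexified E' L ?W' (\<omega>c' j) \<in> hodge (extend_realization E' L (at_conj M')) (w' - r (n' + 1 - j)) (r (n' + 1 - j))"
      by (rule extend_hodge, rule m m', rule that)+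
    show "?o (i, j) \<in> hodge (at_id Mt) (p i + r j) (w - p i + (w' - r j))"
      using tensor_hodge[OF a(1,2), of L] by (simp add: simps er)
    show "?oc (i, j) \<in> hodge (at_conj Mt) (w - p (n + 1 - i) + (w' - r (n' + 1 - j))) (p (n + 1 - i) + r (n' + 1 - j))"
      using tensor_hodge[OF a(3,4), of L] by (simp add: simps er)
  qed
  obtain g where g: "linear_map (scalars L) (betti (at_id Mt)) (betti (at_conj Mt)) (frob Mt)"
      "\<And>v. v \<in> carrier (betti (at_id Mt)) \<Longrightarrow> g (frob Mt v) = v"
    using tensor_motive_frob(1)[OF L E M E' M'] by (auto simp: split_map_def Mt_def)
  have TC: "linear_realization L (at_id Mt)" "linear_realization L (at_conj Mt)" using T by (simp_all add: frame_def)
  interpret c1: cspace L "betti (at_id Mt)" using TC by (simp add: cspace_def linear_realization_def)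
  interpret c2: cspace L "betti (at_conj Mt)" using TC by (simp add: cspace_def linear_realization_def)
  interpret m1: module "coeff_ring L" "complexify (betti (at_id Mt))" by (rule c1.VC_module)
  interpret m2: module "coeff_ring L" "complexify (betti (at_conj Mt))" by (rule c2.VC_module)
  have RM: "realization_with_coeffs E n (at_id M)" "realization_with_coeffs E n (at_conj M)"
    "realization_with_coeffs E' n' (at_id M')" "realization_with_coeffs E' n' (at_conj M')"
    using M M' by (simp_all add: motive_with_coeffs_def)
  have st: "m + 1 - a \<in> {1..m}" if "a \<in> {1..m}" for m a :: nat using that by auto
  have tri: "0 \<le> ?\<rho> i \<and> ?\<rho> i < ?\<rho> j" "p (fst j) \<le> p (fst i)" "r (snd j) \<le> r (snd i)"
    "p (n + 1 - fst i) \<le> p (n + 1 - fst j)" "r (n' + 1 - snd i) \<le> r (n' + 1 - snd j)"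
    if "i \<in> ?I" "j \<in> ?I" "i \<noteq> j" "fst i \<le> fst j \<and> snd i \<le> snd j" for i j
  proof -
    obtain a b a' b' where ij: "i = (a, b)" "j = (a', b')" by (cases i, cases j)
    have I: "a \<in> {1..n}" "b \<in> {1..n'}" "a' \<in> {1..n}" "b' \<in> {1..n'}" "a \<le> a'" "b \<le> b'"
      using that by (auto simp: ij)
    show "0 \<le> ?\<rho> i \<and> ?\<rho> i < ?\<rho> j" using that(3) I by (auto simp: ij)
    show "p (fst j) \<le> p (fst i)" "r (snd j) \<le> r (snd i)"
      using strict_antimono_on_leD[OF p I(1,3,5)] strict_antimono_on_leD[OF r I(2,4,6)] by (simp_all add: ij)
    show "p (n + 1 - fst i) \<le> p (n + 1 - fst j)" "r (n' + 1 - snd i) \<le> r (n' + 1 - snd j)"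
      using strict_antimono_on_leD[OF p st[OF I(3)] st[OF I(1)]] strict_antimono_on_leD[OF r st[OF I(4)] st[OF I(2)]] I(5,6)
      by (simp_all add: ij)
  qed
  interpret F: frobenius_frames L Mt "{..<n} \<times> {..<n'}" eT "{..<n} \<times> {..<n'}" ecT ?I xT xcT ?o ?oc
    "\<lambda>(i, i') (j, j'). ?u i j \<otimes>\<^bsub>coeff_ring L\<^esub> ?u' i' j'" "\<lambda>(i, i') (j, j'). ?uc i j \<otimes>\<^bsub>coeff_ring L\<^esub> ?uc' i' j'"
    ?star q A ?\<rho> ?\<rho> g
  proof (rule frobenius_frames.intro, goal_cases)
    case 1 then show ?case by (rule T(1))
  next
    case 2 then show ?case by (rule T(2))
  next
    case 3 then show ?case by simp
  next
    case 4 then show ?case by (rule g(1))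
  next
    case 5 then show ?case by (rule g(2))
  next
    case 6 then show ?case by auto
  next
    case 7 then show ?case by auto
  next
    case 8 then show ?case by (rule qU)
  next
    case (9 i)
    then obtain a b where i: "i = (a, b)" "a \<in> {1..n}" "b \<in> {1..n'}" by auto
    have "Q a \<in> carrier (coeff_ring E)" "Q' b \<in> carrier (coeff_ring E')" using QU[OF i(2)] QU'[OF i(3)] by (simp_all add: Units_def)
    from tensor_motive_frob(2)[OF L E M E' M' C(1)[OF i(2)] C(3)[OF i(3)] C(2)[OF st[OF i(2)]] C(4)[OF st[OF i(3)]] this
        m(3)[OF i(2)] m'(3)[OF i(3)], folded Mt_def]
    show ?case by (simp add: q_def i(1))
  next
    case 10 then show ?case by (auto simp: A_def)
  next
    case (11 i)
    then obtain a b where i: "i = (a, b)" "a \<in> {1..n}" "b \<in> {1..n'}" "2 * (p a + r b) > w + w'" by (auto simp: A_def)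
    show ?case unfolding i(1) by (rule exI, rule exI, rule conjI[OF _ H(1)[OF i(2,3)]]) (use i(4) in simp)
  next
    case (12 i)
    then obtain a b where i: "i = (a, b)" "a \<in> {1..n}" "b \<in> {1..n'}" by auto
    have "2 * (p (n + 1 - a) + r (n' + 1 - b)) < w + w'"
      using 12(2) mid[OF st[OF i(2)] st[OF i(3)]] st[OF i(2)] st[OF i(3)] by (simp add: A_def i(1))
    then have "w - p (n + 1 - a) + (w' - r (n' + 1 - b)) > p (n + 1 - a) + r (n' + 1 - b)" by simp
    then show ?case unfolding i(1) using H(2)[OF i(2,3)] by blast
  next
    case (13 a b)
    then show ?case using m1.zero_in_mod_span by (simp add: simps tensor_realization_def Let_def)
  next
    case (14 a b)
    then show ?case using m2.zero_in_mod_span by (simp add: simps tensor_realization_def Let_def)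
  next
    case (15 k)
    show ?case using tensor_hodge_filt_submodule[OF N(1,3) L E(2) E'(2) RM(1,3)[THEN hodge_filt_carrier]] by (simp add: simps)
  next
    case (16 k)
    show ?case using tensor_hodge_filt_submodule[OF N(2,4) L E(2) E'(2) RM(2,4)[THEN hodge_filt_carrier]] by (simp add: simps)
  next
    case (17 i)
    then show ?case using unitriangular_product(1)[OF R.is_cring eu, of "fst i" "fst i" "snd i" "snd i"] by (simp add: case_prod_beta mem_Times_iff)
  next
    case (18 i)
    then show ?case using unitriangular_product(1)[OF R.is_cring euc, of "fst i" "fst i" "snd i" "snd i"] by (simp add: case_prod_beta mem_Times_iff)
  next
    case (19 i j)
    then have "fst i \<le> fst j \<and> snd i \<le> snd j"
      using unitriangular_product(2)[OF R.is_cring eu, of "fst i" "fst j" "snd i" "snd j"] by (simp add: case_prod_beta mem_Times_iff)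
    from tri[OF 19(1-3) this] 19(1,2) show ?case by (auto simp: A_def)
  next
    case (20 i j)
    then have "fst i \<le> fst j \<and> snd i \<le> snd j"
      using unitriangular_product(2)[OF R.is_cring euc, of "fst i" "fst j" "snd i" "snd j"] by (simp add: case_prod_beta mem_Times_iff)
    from tri[OF 20(1-3) this] st[of "fst j" n] st[of "snd j" n'] 20(1,2) show ?case
      by (simp add: A_def case_prod_beta mem_Times_iff del: atLeastAtMost_iff)
  qed
  show "\<delta> \<in> Units (coeff_ring L)" by (rule F.deligne_determinant_ratio(2)[OF \<delta> c])
  show "\<exists>e\<in>L - {0}. c = ctensor (scalars L) e 1 \<otimes>\<^bsub>coeff_ring L\<^esub> (finprod (coeff_ring L) q A \<otimes>\<^bsub>coeff_ring L\<^esub> \<delta>)"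
    by (rule F.deligne_determinant_ratio(1)[OF \<delta> c])
qed

lemma subfield_compositum:
  "subfield (compositum E E') CC" and compositum_superset: "E \<subseteq> compositum E E'" "E' \<subseteq> compositum E E'"
  unfolding compositum_def using field.generate_field_is_subfield[OF field_CC, of "E \<union> E'"]
  by (auto simp: scalars_def intro: generate_field.incl)

lemma period_equiv_refl:
  assumes L: "subfield L CC" and B: "B \<in> Units (coeff_ring L)"
  shows "period_equiv L B B"
proof -
  interpret R: cring "coeff_ring L" by (rule coeff_ring_cring[OF L])
  interpret emb: ring_hom_cring "scalars L" "coeff_ring L" "\<lambda>e. ctensor (scalars L) e 1" by (rule emb_hom[OF L])
  have "ctensor (scalars L) 1 1 = \<one>\<^bsub>coeff_ring L\<^esub>" using emb.hom_one by simp
  then show ?thesis using B subfield_closed[OF L] unfolding period_equiv_def by (auto intro!: bexI[of _ 1])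
qed

lemma period_equiv_scalar:
  assumes L: "subfield L CC" and B: "B \<in> Units (coeff_ring L)" and e: "e \<in> L - {0}"
  shows "period_equiv L (ctensor (scalars L) e 1 \<otimes>\<^bsub>coeff_ring L\<^esub> B) B"
proof -
  interpret R: cring "coeff_ring L" by (rule coeff_ring_cring[OF L])
  interpret emb: ring_hom_cring "scalars L" "coeff_ring L" "\<lambda>e. ctensor (scalars L) e 1" by (rule emb_hom[OF L])
  have "ctensor (scalars L) e 1 \<in> carrier (coeff_ring L)" using emb.hom_closed[of e] e by simp
  then have "(ctensor (scalars L) e 1 \<otimes>\<^bsub>coeff_ring L\<^esub> B) \<otimes>\<^bsub>coeff_ring L\<^esub> inv\<^bsub>coeff_ring L\<^esub> B = ctensor (scalars L) e 1"
    using B R.Units_closed R.Units_inv_closed R.Units_r_inv by (simp add: R.m_assoc)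
  then show ?thesis unfolding period_equiv_def using B e by blast
qed

theorem proposition1p1:
  fixes K E E' :: "complex set"
    and M :: "('b, 'd) motive" and M' :: "('b2, 'd2) motive"
    and n n' :: nat and w w' :: int and p r :: "nat \<Rightarrow> int"
    and A T :: "(nat \<times> nat) set"
    and Q Q' :: "nat \<Rightarrow> (complex, complex) tensor"
    and \<delta> c :: "(complex, complex) tensor"
  defines "L \<equiv> compositum E E'"
  assumes "imaginary_quadratic_field K" and "number_field E" and "number_field E'"
    and "motive_with_coeffs E n M" and "regular E M" and "pure_of_weight M w"
    and "strict_antimono_on {1..n} p"
    and "hodge_type M = {(p i, w - p i) |i. i \<in> {1..n}}"
    and "motive_with_coeffs E' n' M'" and "regular E' M'" and "pure_of_weight M' w'"
    and "strict_antimono_on {1..n'} r"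
    and "hodge_type M' = {(r j, w' - r j) |j. j \<in> {1..n'}}"
    and "\<And>a b. a \<in> {1..n} \<Longrightarrow> b \<in> {1..n'} \<Longrightarrow>
           real_of_int (p a + r b) \<noteq> real_of_int (w + w') / 2"
    and "A = {(a, b) \<in> {1..n} \<times> {1..n'}.
           real_of_int (p a + r b) > real_of_int (w + w') / 2}"
    and "T = {(t, u) \<in> {1..n} \<times> {1..n'}.
           real_of_int (p (n + 1 - t) + r (n' + 1 - u)) < real_of_int (w + w') / 2}"
    and "\<And>i. i \<in> {1..n} \<Longrightarrow> is_motivic_period E M n w p i (Q i)"
    and "\<And>j. j \<in> {1..n'} \<Longrightarrow> is_motivic_period E' M' n' w' r j (Q' j)"
    and "is_determinant_period L (at_id (tensor_motive E E' M M')) \<delta>"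
    and "is_deligne_period L (restrict_to_rat (tensor_motive E E' M M')) c"
  shows "period_equiv L c
           (finprod (coeff_ring L) (\<lambda>(t, u).
               extend_coeff L (Q (n + 1 - t)) \<otimes>\<^bsub>coeff_ring L\<^esub> extend_coeff L (Q' (n' + 1 - u)))
               ({1..n} \<times> {1..n'} - T)
            \<otimes>\<^bsub>coeff_ring L\<^esub> \<delta>)
       \<and> period_equiv L
           (finprod (coeff_ring L) (\<lambda>(t, u).
               extend_coeff L (Q (n + 1 - t)) \<otimes>\<^bsub>coeff_ring L\<^esub> extend_coeff L (Q' (n' + 1 - u)))
               ({1..n} \<times> {1..n'} - T)
            \<otimes>\<^bsub>coeff_ring L\<^esub> \<delta>)
           (finprod (coeff_ring L) (\<lambda>(t, u).
               extend_coeff L (Q t) \<otimes>\<^bsub>coeff_ring L\<^esub> extend_coeff L (Q' u))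
               A
            \<otimes>\<^bsub>coeff_ring L\<^esub> \<delta>)"
proof -
  have E: "subfield E CC" "E \<subseteq> L" and E': "subfield E' CC" "E' \<subseteq> L" and L: "subfield L CC"
    using assms(3,4) subfield_compositum compositum_superset by (auto simp: number_field_def L_def)
  interpret R: cring "coeff_ring L" by (rule coeff_ring_cring[OF L])
  let ?I = "{1..n} \<times> {1..n'}" and ?star = "\<lambda>(t, u). (n + 1 - t, n' + 1 - u)"
  let ?q = "\<lambda>(t, u). extend_coeff L (Q t) \<otimes>\<^bsub>coeff_ring L\<^esub> extend_coeff L (Q' u)"
  have half: "real_of_int a \<noteq> real_of_int b / 2 \<longleftrightarrow> 2 * a \<noteq> b" "real_of_int a > real_of_int b / 2 \<longleftrightarrow> 2 * a > b"
    "real_of_int a < real_of_int b / 2 \<longleftrightarrow> 2 * a < b" for a b by linarith+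
  have mid: "2 * (p a + r b) \<noteq> w + w'" if "a \<in> {1..n}" "b \<in> {1..n'}" for a b
    using assms(15)[OF that] unfolding half .
  have A: "A = {(a, b) \<in> ?I. 2 * (p a + r b) > w + w'}" using assms(16) unfolding half .
  have T: "T = {(t, u) \<in> ?I. 2 * (p (n + 1 - t) + r (n' + 1 - u)) < w + w'}" using assms(17) unfolding half .
  have tm: "tensor_motive E E' M M' = tensor_motive_over L (extend_motive E L M) (extend_motive E' L M')"
    by (simp add: tensor_motive_def L_def Let_def)
  note main = deligne_period_tensor[OF L E assms(5) assms(8) assms(18) E' assms(10) assms(13) assms(19) mid
      assms(20,21)[unfolded tm], folded A]
  have qc: "?q \<in> A \<rightarrow> Units (coeff_ring L)" using main(3) by (auto simp: A)
  have inj: "inj_on ?star (?I - T)" by (auto simp: inj_on_def)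
  \<comment> \<open>As there is no middle class, pairs outside \<open>T\<close> are the mirror images of pairs in \<open>A\<close>.\<close>
  have img: "?star ` (?I - T) = A"
  proof (intro equalityI subsetI)
    fix x assume "x \<in> ?star ` (?I - T)"
    then obtain t u where x: "x = (n + 1 - t, n' + 1 - u)" and tu: "(t, u) \<in> ?I" "(t, u) \<notin> T" by auto
    have i: "n + 1 - t \<in> {1..n}" "n' + 1 - u \<in> {1..n'}" using tu(1) by auto
    show "x \<in> A" using tu i mid[OF i] by (auto simp: x A T)
  next
    fix x assume x: "x \<in> A"
    then obtain a b where ab: "x = (a, b)" "a \<in> {1..n}" "b \<in> {1..n'}" "2 * (p a + r b) > w + w'" by (auto simp: A)
    have "n + 1 - (n + 1 - a) = a" "n' + 1 - (n' + 1 - b) = b" using ab by auto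
    then have "(n + 1 - a, n' + 1 - b) \<in> ?I - T" "?star (n + 1 - a, n' + 1 - b) = x"
      using ab by (auto simp: T)
    then show "x \<in> ?star ` (?I - T)" by force
  qed
  have eq: "finprod (coeff_ring L) (\<lambda>(t, u). extend_coeff L (Q (n + 1 - t)) \<otimes>\<^bsub>coeff_ring L\<^esub> extend_coeff L (Q' (n' + 1 - u))) (?I - T)
      = finprod (coeff_ring L) ?q A"
  proof -
    have "(\<lambda>(t, u). extend_coeff L (Q (n + 1 - t)) \<otimes>\<^bsub>coeff_ring L\<^esub> extend_coeff L (Q' (n' + 1 - u))) = (\<lambda>x. ?q (?star x))"
      by (simp add: fun_eq_iff)
    moreover have "?q \<in> ?star ` (?I - T) \<rightarrow> carrier (coeff_ring L)" unfolding img using qc R.Units_closed by blast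
    ultimately show ?thesis using R.finprod_reindex[OF _ inj, of ?q] unfolding img by simp
  qed
  have "finprod (coeff_ring L) ?q A \<in> Units (coeff_ring L)"
  proof -
    have "finite A" by (rule finite_subset[of _ ?I]) (auto simp: A)
    then show ?thesis using qc
      by induction (auto simp: R.finprod_insert R.Units_closed Pi_iff)
  qed
  then have U: "finprod (coeff_ring L) ?q A \<otimes>\<^bsub>coeff_ring L\<^esub> \<delta> \<in> Units (coeff_ring L)" using main(2) by simp
  obtain e where "e \<in> L - {0}" "c = ctensor (scalars L) e 1 \<otimes>\<^bsub>coeff_ring L\<^esub> (finprod (coeff_ring L) ?q A \<otimes>\<^bsub>coeff_ring L\<^esub> \<delta>)"
    using main(1) by blast
  then show ?thesis unfolding eq using period_equiv_scalar[OF L U] period_equiv_refl[OF L U] by simp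
qed

end
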